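(* Let $i,j\in I$ and $k,l\in\mathbb Z_{>0}$. Assume $kd_i\ge ld_j$. Then $$\dim_q\mathrm{ext}^1_{\widetilde\Pi}(K^{(i)}_k,K^{(j)}_l)=q^{-kd_i}\frac{[ld_j]_q}{[d_j]_q}\sum_{u=0}^{rh^\vee}\widetilde c_{ij}(u)\,q^{-u}$$ unless the following condition holds: $(\clubsuit)$ $\mathfrak g$ is of type $\mathrm C_n$, $\mathrm F_4$ or $\mathrm G_2$, and $d_i=d_j=1$, $k=l\notin r\mathbb Z$. Even if $(\clubsuit)$ holds, the right-hand side minus the left-hand side of the displayed equation belongs to $\mathbb Z_{\ge0}[q^{\pm1}]$.
   Context: Lie data: $\mathfrak g$ is a complex finite-dimensional simple Lie algebra with Cartan matrix $C=(c_{ij})_{i,j\in I}$. Write $i\sim j$ if $i\neq j$ and $c_{ij}<0$. $r\in\{1,2,3\}$ is the lacing number ($1$ for types ADE, $2$ for B, C, F$_4$, $3$ for G$_2$). $(d_i)_{i\in I}$ is the unique tuple of mutually coprime positive integers with $d_ic_{ij}=d_jc_{ji}$ (so $d_i\in\{1,r\}$ and $c_{ij}=-\lceil d_j/d_i\rceil$ if $i\sim j$; e.g. $(d_i)=(1,\dots,1,2)$ for $\mathrm C_n$ and $(2,\dots,2,1)$ for $\mathrm B_n$). $h^\vee$ is the dual Coxeter number. Quantum Cartan matrix: $[k]_q=(q^k-q^{-k})/(q-q^{-1})$; $C(q)$ has entries $C_{ii}(q)=q^{d_i}+q^{-d_i}$, $C_{ij}(q)=[c_{ij}]_q$ for $i\neq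 j$; its inverse $\widetilde C(q)$ has entries expanded as $\widetilde C_{ij}(q)=\sum_{u\ge0}\widetilde c_{ij}(u)q^u\in\mathbb Z[\![q]\!]$. Algebra: $\Bbbk$ is an arbitrary field. $\widetilde Q$ is the quiver with vertex set $I$, arrows $\alpha_{ij}\colon j\to i$ for each $(i,j)$ with $i\sim j$, and loops $\varepsilon_i\colon i\to i$; $e_i$ is the idempotent at $i$, and $\alpha=e_{t(\alpha)}\alpha e_{s(\alpha)}$ for an arrow $\alpha$ with source $s(\alpha)$ and target $t(\alpha)$. It is graded by $\deg\alpha_{ij}=-\max(d_i,d_j)$, $\deg\varepsilon_i=2d_i$. Fix signs $\omega_{ij}=-\omega_{ji}\in\{\pm1\}$ for $i\sim j$. $\widetilde\Pi$ is the graded quotient of $\Bbbk\widetilde Q$ by (R1) $\varepsilon_i^{-c_{ij}}\alpha_{ij}=\alpha_{ij}\varepsilon_j^{-c_{ji}}$ for $i\sim j$, and (R2) $\sum_{j\sim i}\sum_{k=0}^{-c_{ij}-1}\omega_{ij}\varepsilon_i^k\alpha_{ij}\alpha_{ji}\varepsilon_i^{-c_{ij}-1-k}=0$ for each $i$. Modules: left graded modules. Shift: $(qV)_u=V_{u-1}$; $\dim_qV=\sum_u(\dim V_u)q^u$. Restricted dual: $\mathbb D(V)_u=\mathrm{Hom}_\Bbbk(V_{-u},\Bbbk)$; duals of left $\widetilde\Pi$-modules are left modules via the anti-involution $e_i\mapsto e_i$, $\alpha_{ij}\mapsto\alpha_{ji}$, $\varepsilon_i\mapsto\varepsilon_i$.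 $\mathrm{Ext}^1_{\widetilde\Pi}$ denotes the first extension group in the category of all graded $\widetilde\Pi$-modules with degree-preserving morphisms, and $\mathrm{ext}^1_{\widetilde\Pi}(M,N)_u=\mathrm{Ext}^1_{\widetilde\Pi}(q^uM,N)$. Generic kernels: for $i\in I$ and $k\in\mathbb Z_{>0}$, $K^{(i)}_k=q^{kd_i}\,\mathbb D((\widetilde\Pi/\widetilde\Pi\varepsilon_i^k)e_i)$. *)

theory Defs
  imports
    "HOL-Analysis.Cartesian_Space"
    "HOL-Computational_Algebra.Formal_Laurent_Series"
    "HOL-Algebra.QuotRing"
    "HOL-Algebra.Module"
begin

section \<open>Lie-theoretic data\<close>

text \<open>
  A simple Lie algebra enters only through its Cartan matrix, i.e. (Cartan-Killing) through one of
  the types below. The list is free of repetitions: the type \<open>B\<^sub>2 = C\<^sub>2\<close> is counted as \<open>B\<^sub>2\<close>,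
  and \<open>A\<^sub>3 = D\<^sub>3\<close> as \<open>A\<^sub>3\<close>.
\<close>

datatype dynkin_type =
  TypeA nat | TypeB nat | TypeC nat | TypeD nat | TypeE nat | TypeF4 | TypeG2

fun valid_type :: "dynkin_type \<Rightarrow> bool" where
  "valid_type (TypeA n) \<longleftrightarrow> 1 \<le> n"
| "valid_type (TypeB n) \<longleftrightarrow> 2 \<le> n"
| "valid_type (TypeC n) \<longleftrightarrow> 3 \<le> n"
| "valid_type (TypeD n) \<longleftrightarrow> 4 \<le> n"
| "valid_type (TypeE n) \<longleftrightarrow> n \<in> {6, 7, 8}"
| "valid_type TypeF4 \<longleftrightarrow> True"
| "valid_type TypeG2 \<longleftrightarrow> True"

fun type_rank :: "dynkin_type \<Rightarrow> nat" where
  "type_rank (TypeA n) = n"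
| "type_rank (TypeB n) = n"
| "type_rank (TypeC n) = n"
| "type_rank (TypeD n) = n"
| "type_rank (TypeE n) = n"
| "type_rank TypeF4 = 4"
| "type_rank TypeG2 = 2"

text \<open>Dynkin diagrams on the vertices \<open>1, \<dots>, n\<close>, in Bourbaki's numbering.\<close>

fun dynkin_edges :: "dynkin_type \<Rightarrow> (nat \<times> nat) set" where
  "dynkin_edges (TypeA n) = {(a, a + 1) |a. 1 \<le> a \<and> a < n}"
| "dynkin_edges (TypeB n) = {(a, a + 1) |a. 1 \<le> a \<and> a < n}"
| "dynkin_edges (TypeC n) = {(a, a + 1) |a. 1 \<le> a \<and> a < n}"
| "dynkin_edges (TypeD n) = {(a, a + 1) |a. 1 \<le> a \<and> a < n - 1} \<union> {(n - 2, n)}"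
| "dynkin_edges (TypeE n) = {(1, 3), (2, 4)} \<union> {(a, a + 1) |a. 3 \<le> a \<and> a < n}"
| "dynkin_edges TypeF4 = {(1, 2), (2, 3), (3, 4)}"
| "dynkin_edges TypeG2 = {(1, 2)}"

text \<open>Half the squared lengths of the simple roots, short roots having squared length 2.\<close>

fun std_symmetrizer :: "dynkin_type \<Rightarrow> nat \<Rightarrow> nat" where
  "std_symmetrizer (TypeA n) a = 1"
| "std_symmetrizer (TypeB n) a = (if a = n then 1 else 2)"
| "std_symmetrizer (TypeC n) a = (if a = n then 2 else 1)"
| "std_symmetrizer (TypeD n) a = 1"
| "std_symmetrizer (TypeE n) a = 1"
| "std_symmetrizer TypeF4 a = (if a \<le> 2 then 2 else 1)"
| "std_symmetrizer TypeG2 a = (if a = 1 then 1 else 3)"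

definition standard_cartan :: "dynkin_type \<Rightarrow> nat \<Rightarrow> nat \<Rightarrow> int" where
  "standard_cartan X a b =
     (if a = b then 2
      else if (a, b) \<in> dynkin_edges X \<or> (b, a) \<in> dynkin_edges X
        then - \<lceil>rat_of_nat (std_symmetrizer X b) / rat_of_nat (std_symmetrizer X a)\<rceil>
      else 0)"

definition cartan_matrix_of_type :: "dynkin_type \<Rightarrow> ('i::finite \<Rightarrow> 'i \<Rightarrow> int) \<Rightarrow> bool" where
  "cartan_matrix_of_type X C \<longleftrightarrow> valid_type X \<and>
     (\<exists>\<sigma>. bij_betw \<sigma> UNIV {1..type_rank X} \<and> (\<forall>i j. C i j = standard_cartan X (\<sigma> i) (\<sigma> j)))"

fun lacing_number :: "dynkin_type \<Rightarrow> nat" where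
  "lacing_number (TypeA n) = 1"
| "lacing_number (TypeB n) = 2"
| "lacing_number (TypeC n) = 2"
| "lacing_number (TypeD n) = 1"
| "lacing_number (TypeE n) = 1"
| "lacing_number TypeF4 = 2"
| "lacing_number TypeG2 = 3"

fun dual_coxeter_number :: "dynkin_type \<Rightarrow> nat" where
  "dual_coxeter_number (TypeA n) = n + 1"
| "dual_coxeter_number (TypeB n) = 2 * n - 1"
| "dual_coxeter_number (TypeC n) = n + 1"
| "dual_coxeter_number (TypeD n) = 2 * n - 2"
| "dual_coxeter_number (TypeE n) = (if n = 6 then 12 else if n = 7 then 18 else 30)"
| "dual_coxeter_number TypeF4 = 9"
| "dual_coxeter_number TypeG2 = 4"

text \<open>``Mutually coprime'' is meant for the tuple as a whole, cf. \<open>(2, \<dots>, 2, 1)\<close> in type \<open>B\<^sub>n\<close>.\<close>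

definition symmetrizer :: "('i::finite \<Rightarrow> 'i \<Rightarrow> int) \<Rightarrow> ('i \<Rightarrow> nat) \<Rightarrow> bool" where
  "symmetrizer C d \<longleftrightarrow> (\<forall>i. 0 < d i) \<and> Gcd (range d) = 1 \<and>
     (\<forall>i j. int (d i) * C i j = int (d j) * C j i)"

definition adj :: "('i \<Rightarrow> 'i \<Rightarrow> int) \<Rightarrow> 'i \<Rightarrow> 'i \<Rightarrow> bool" where
  "adj C i j \<longleftrightarrow> i \<noteq> j \<and> C i j < 0"

definition sign_choice :: "('i \<Rightarrow> 'i \<Rightarrow> int) \<Rightarrow> ('i \<Rightarrow> 'i \<Rightarrow> int) \<Rightarrow> bool" where
  "sign_choice C \<omega> \<longleftrightarrow> (\<forall>i j. adj C i j \<longrightarrow> \<omega> i j \<in> {1, -1} \<and> \<omega> i j = - \<omega> j i)"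


section \<open>The quantum Cartan matrix\<close>

abbreviation q_pow :: "int \<Rightarrow> rat fls" where
  "q_pow k \<equiv> fls_X_intpow k"

definition q_int :: "int \<Rightarrow> rat fls" where
  "q_int k = (q_pow k - q_pow (- k)) / (q_pow 1 - q_pow (- 1))"

definition quantum_cartan :: "('i::finite \<Rightarrow> 'i \<Rightarrow> int) \<Rightarrow> ('i \<Rightarrow> nat) \<Rightarrow> rat fls ^ 'i ^ 'i" where
  "quantum_cartan C d =
     (\<chi> i j. if i = j then q_pow (int (d i)) + q_pow (- int (d i)) else q_int (C i j))"

text \<open>\<open>inv_coeff C d i j u\<close> is the coefficient of \<open>q\<^sup>u\<close> in the entry \<open>(i, j)\<close> of the inverse of
  the quantum Cartan matrix, expanded at \<open>q = 0\<close>.\<close>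

definition inv_coeff :: "('i::finite \<Rightarrow> 'i \<Rightarrow> int) \<Rightarrow> ('i \<Rightarrow> nat) \<Rightarrow> 'i \<Rightarrow> 'i \<Rightarrow> nat \<Rightarrow> rat" where
  "inv_coeff C d i j u = fls_nth (matrix_inv (quantum_cartan C d) $ i $ j) (int u)"

definition nonneg_laurent_polys :: "rat fls set" where
  "nonneg_laurent_polys = {f. finite {u. fls_nth f u \<noteq> 0} \<and> (\<forall>u. fls_nth f u \<in> \<nat>)}"


section \<open>The path algebra\<close>

text \<open>\<open>Alpha i j\<close> is the arrow from \<open>j\<close> to \<open>i\<close>, and \<open>Eps i\<close> the loop at \<open>i\<close>. Paths compose like
  functions; \<open>(t, w, s)\<close> stands for the path \<open>w\<close> from \<open>s\<close> to \<open>t\<close>, so that \<open>(i, [], i)\<close> is the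
  trivial path at \<open>i\<close>.\<close>

datatype 'i arrow = Alpha 'i 'i | Eps 'i

type_synonym 'i path = "'i \<times> 'i arrow list \<times> 'i"

fun tgt :: "'i arrow \<Rightarrow> 'i" where
  "tgt (Alpha i j) = i" | "tgt (Eps i) = i"

fun src :: "'i arrow \<Rightarrow> 'i" where
  "src (Alpha i j) = j" | "src (Eps i) = i"

fun is_arrow :: "('i \<Rightarrow> 'i \<Rightarrow> int) \<Rightarrow> 'i arrow \<Rightarrow> bool" where
  "is_arrow C (Alpha i j) \<longleftrightarrow> adj C i j" | "is_arrow C (Eps i) \<longleftrightarrow> True"

fun is_path :: "('i \<Rightarrow> 'i \<Rightarrow> int) \<Rightarrow> 'i path \<Rightarrow> bool" where
  "is_path C (t, [], s) \<longleftrightarrow> t = s"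
| "is_path C (t, a # w, s) \<longleftrightarrow> is_arrow C a \<and> tgt a = t \<and> is_path C (src a, w, s)"

fun arrow_deg :: "('i \<Rightarrow> nat) \<Rightarrow> 'i arrow \<Rightarrow> int" where
  "arrow_deg d (Alpha i j) = - int (max (d i) (d j))"
| "arrow_deg d (Eps i) = 2 * int (d i)"

fun path_deg :: "('i \<Rightarrow> nat) \<Rightarrow> 'i path \<Rightarrow> int" where
  "path_deg d (t, w, s) = sum_list (map (arrow_deg d) w)"

text \<open>In the product only the \<open>v\<close> that is passed by the path \<open>(t, w, s)\<close> after cutting \<open>w\<close> at
  position \<open>m\<close> contributes.\<close>

definition path_algebra :: "('i::finite \<Rightarrow> 'i \<Rightarrow> int) \<Rightarrow> ('i path \<Rightarrow> 'k::field) ring" where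
  "path_algebra C = \<lparr>
     carrier = {f. finite {p. f p \<noteq> 0} \<and> (\<forall>p. f p \<noteq> 0 \<longrightarrow> is_path C p)},
     mult = (\<lambda>f g (t, w, s). \<Sum>m\<le>length w. \<Sum>v\<in>UNIV. f (t, take m w, v) * g (v, drop m w, s)),
     one = (\<lambda>(t, w, s). if w = [] \<and> t = s then 1 else 0),
     zero = (\<lambda>p. 0),
     add = (\<lambda>f g p. f p + g p)\<rparr>"

definition basis_path :: "'i path \<Rightarrow> 'i path \<Rightarrow> 'k::field" where
  "basis_path p = (\<lambda>p'. if p' = p then 1 else 0)"

lemma is_path_append:
  "is_path C (t, v @ w, s) \<longleftrightarrow> (\<exists>x. is_path C (t, v, x) \<and> is_path C (x, w, s))"
  by (induction v arbitrary: t) auto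

lemma path_algebra_mult_closed:
  assumes f: "f \<in> carrier (path_algebra C :: ('i::finite path \<Rightarrow> 'k::field) ring)"
    and g: "g \<in> carrier (path_algebra C)"
  shows "f \<otimes>\<^bsub>path_algebra C\<^esub> g \<in> carrier (path_algebra C)"
proof -
  let ?fg = "f \<otimes>\<^bsub>path_algebra C\<^esub> g"
  have split: "\<exists>v. f (t, take m w, v) \<noteq> 0 \<and> g (v, drop m w, s) \<noteq> 0"
    if "(\<Sum>v\<in>UNIV. f (t, take m w, v) * g (v, drop m w, s)) \<noteq> 0" for t w s m
    using that by (metis (mono_tags, lifting) mult_eq_0_iff sum.neutral)
  have nz: "\<exists>m v. f (t, take m w, v) \<noteq> 0 \<and> g (v, drop m w, s) \<noteq> 0"
    if "?fg (t, w, s) \<noteq> 0" for t w s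
  proof -
    have "(\<Sum>m\<le>length w. \<Sum>v\<in>UNIV. f (t, take m w, v) * g (v, drop m w, s)) \<noteq> 0"
      using that by (simp add: path_algebra_def)
    then obtain m where "(\<Sum>v\<in>UNIV. f (t, take m w, v) * g (v, drop m w, s)) \<noteq> 0"
      by (metis (mono_tags, lifting) sum.neutral)
    then show ?thesis using split by blast
  qed
  let ?cat = "\<lambda>(p, p'). (fst p, fst (snd p) @ fst (snd p'), snd (snd p'))"
  have "{p. ?fg p \<noteq> 0} \<subseteq> ?cat ` ({p. f p \<noteq> 0} \<times> {p. g p \<noteq> 0})"
  proof
    fix p assume "p \<in> {p. ?fg p \<noteq> 0}"
    moreover obtain t w s where p: "p = (t, w, s)" by (cases p)
    ultimately obtain m v where "f (t, take m w, v) \<noteq> 0" "g (v, drop m w, s) \<noteq> 0"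
      using nz by (metis (mono_tags, lifting) mem_Collect_eq)
    then show "p \<in> ?cat ` ({p. f p \<noteq> 0} \<times> {p. g p \<noteq> 0})"
      by (intro image_eqI[where x = "((t, take m w, v), (v, drop m w, s))"]) (auto simp: p)
  qed
  moreover have "finite ({p. f p \<noteq> 0} \<times> {p. g p \<noteq> 0})"
    using f g by (auto simp: path_algebra_def)
  ultimately have fin: "finite {p. ?fg p \<noteq> 0}"
    by (meson finite_imageI finite_subset)
  have "is_path C (t, w, s)" if fg: "?fg (t, w, s) \<noteq> 0" for t w s
  proof -
    obtain m v where "f (t, take m w, v) \<noteq> 0" "g (v, drop m w, s) \<noteq> 0"
      using nz[OF fg] by blast
    then have "is_path C (t, take m w, v)" "is_path C (v, drop m w, s)"
      using f g by (auto simp: path_algebra_def)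
    then show ?thesis
      by (metis append_take_drop_id is_path_append)
  qed
  with fin show ?thesis
    by (auto simp: path_algebra_def)
qed

lemma path_algebra_mult_assoc:
  "(f \<otimes>\<^bsub>path_algebra C\<^esub> g) \<otimes>\<^bsub>path_algebra C\<^esub> h
     = f \<otimes>\<^bsub>path_algebra C\<^esub> (g \<otimes>\<^bsub>path_algebra C\<^esub> h)"
  for f g h :: "'i::finite path \<Rightarrow> 'k::field"
proof -
  have "((f \<otimes>\<^bsub>path_algebra C\<^esub> g) \<otimes>\<^bsub>path_algebra C\<^esub> h) (t, w, s)
     = (f \<otimes>\<^bsub>path_algebra C\<^esub> (g \<otimes>\<^bsub>path_algebra C\<^esub> h)) (t, w, s)" for t w s
  proof -
    define n where "n = length w"
    define T where "T a b x v = f (t, take a w, x) * g (x, take b (drop a w), v)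
        * h (v, drop (a + b) w, s)" for a b x v
    have "((f \<otimes>\<^bsub>path_algebra C\<^esub> g) \<otimes>\<^bsub>path_algebra C\<^esub> h) (t, w, s)
      = (\<Sum>m\<le>n. \<Sum>v\<in>UNIV. \<Sum>a\<le>m. \<Sum>x\<in>UNIV. T a (m - a) x v)"
      by (auto simp: path_algebra_def n_def T_def sum_distrib_right drop_take min_def
          intro!: sum.cong)
    also have "\<dots> = (\<Sum>m\<le>n. \<Sum>a\<le>m. \<Sum>x\<in>UNIV. \<Sum>v\<in>UNIV. T a (m - a) x v)"
      by (subst sum.swap[of _ _ UNIV], subst (2) sum.swap) simp
    also have "\<dots> = (\<Sum>(m, a)\<in>(SIGMA m:{..n}. {..m}). \<Sum>x\<in>UNIV. \<Sum>v\<in>UNIV. T a (m - a) x v)"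
      by (subst sum.Sigma) auto
    also have "\<dots> = (\<Sum>(a, b)\<in>(SIGMA a:{..n}. {..n - a}). \<Sum>x\<in>UNIV. \<Sum>v\<in>UNIV. T a b x v)"
      by (rule sum.reindex_bij_witness
          [where i = "\<lambda>(a, b). (a + b, a)" and j = "\<lambda>(m, a). (a, m - a)"]) auto
    also have "\<dots> = (\<Sum>a\<le>n. \<Sum>b\<le>n - a. \<Sum>x\<in>UNIV. \<Sum>v\<in>UNIV. T a b x v)"
      by (subst sum.Sigma) auto
    also have "\<dots> = (\<Sum>a\<le>n. \<Sum>x\<in>UNIV. \<Sum>b\<le>n - a. \<Sum>v\<in>UNIV. T a b x v)"
      by (subst (2) sum.swap) simp
    also have "\<dots> = (f \<otimes>\<^bsub>path_algebra C\<^esub> (g \<otimes>\<^bsub>path_algebra C\<^esub> h)) (t, w, s)"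
      by (simp add: path_algebra_def n_def T_def sum_distrib_left mult.assoc add.commute)
    finally show ?thesis .
  qed
  then show ?thesis by auto
qed

lemma path_algebra_one:
  fixes f :: "'i::finite path \<Rightarrow> 'k::field"
  shows "\<one>\<^bsub>path_algebra C\<^esub> \<otimes>\<^bsub>path_algebra C\<^esub> f = f"
    and "f \<otimes>\<^bsub>path_algebra C\<^esub> \<one>\<^bsub>path_algebra C\<^esub> = f"
proof -
  have "(\<one>\<^bsub>path_algebra C\<^esub> \<otimes>\<^bsub>path_algebra C\<^esub> f) (t, w, s) = f (t, w, s)" for t w s
  proof -
    have "(\<one>\<^bsub>path_algebra C\<^esub> \<otimes>\<^bsub>path_algebra C\<^esub> f) (t, w, s)
      = (\<Sum>m\<le>length w. \<Sum>v\<in>UNIV. if m = 0 \<and> v = t then f (t, w, s) else 0)"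
      by (auto simp: path_algebra_def intro!: sum.cong)
    also have "\<dots> = (\<Sum>m\<le>length w. if m = 0 then f (t, w, s) else 0)"
      by (intro sum.cong refl) auto
    finally show ?thesis by simp
  qed
  then show "\<one>\<^bsub>path_algebra C\<^esub> \<otimes>\<^bsub>path_algebra C\<^esub> f = f" by auto
  have "(f \<otimes>\<^bsub>path_algebra C\<^esub> \<one>\<^bsub>path_algebra C\<^esub>) (t, w, s) = f (t, w, s)" for t w s
  proof -
    have "(f \<otimes>\<^bsub>path_algebra C\<^esub> \<one>\<^bsub>path_algebra C\<^esub>) (t, w, s)
      = (\<Sum>m\<le>length w. \<Sum>v\<in>UNIV. if m = length w \<and> v = s then f (t, w, s) else 0)"
      by (auto simp: path_algebra_def intro!: sum.cong)
    also have "\<dots> = (\<Sum>m\<le>length w. if m = length w then f (t, w, s) else 0)"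
      by (intro sum.cong refl) auto
    finally show ?thesis by simp
  qed
  then show "f \<otimes>\<^bsub>path_algebra C\<^esub> \<one>\<^bsub>path_algebra C\<^esub> = f" by auto
qed

lemma path_algebra_add_closed:
  assumes "f \<in> carrier (path_algebra C :: ('i::finite path \<Rightarrow> 'k::field) ring)"
    and "g \<in> carrier (path_algebra C)"
  shows "(\<lambda>p. f p + g p) \<in> carrier (path_algebra C)"
proof -
  have "{p. f p + g p \<noteq> 0} \<subseteq> {p. f p \<noteq> 0} \<union> {p. g p \<noteq> 0}" by auto
  then show ?thesis
    using assms by (auto simp: path_algebra_def intro: finite_subset)
qed

lemma path_algebra_ring: "ring (path_algebra C :: ('i::finite path \<Rightarrow> 'k::field) ring)"
proof (rule ringI)
  let ?P = "path_algebra C :: ('i path \<Rightarrow> 'k) ring"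
  show "abelian_group ?P"
  proof (rule abelian_groupI)
    fix f assume f: "f \<in> carrier ?P"
    have "(\<lambda>p. - f p) \<in> carrier ?P"
      using f by (simp add: path_algebra_def)
    moreover have "(\<lambda>p. - f p) \<oplus>\<^bsub>?P\<^esub> f = \<zero>\<^bsub>?P\<^esub>"
      by (simp add: path_algebra_def)
    ultimately show "\<exists>g\<in>carrier ?P. g \<oplus>\<^bsub>?P\<^esub> f = \<zero>\<^bsub>?P\<^esub>" by blast
  next
    fix f g assume "f \<in> carrier ?P" "g \<in> carrier ?P"
    then show "f \<oplus>\<^bsub>?P\<^esub> g \<in> carrier ?P"
      using path_algebra_add_closed[of f C g] by (simp add: path_algebra_def)
  qed (simp_all add: path_algebra_def ac_simps)
  show "Group.monoid ?P"
  proof (rule monoidI)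
    have "{p. \<one>\<^bsub>?P\<^esub> p \<noteq> 0} \<subseteq> (\<lambda>t. (t, [], t)) ` UNIV"
      by (auto simp: path_algebra_def split: if_splits)
    then have "finite {p. \<one>\<^bsub>?P\<^esub> p \<noteq> 0}"
      by (rule finite_subset) simp
    then show "\<one>\<^bsub>?P\<^esub> \<in> carrier ?P"
      by (auto simp: path_algebra_def split: if_splits)
  qed (simp_all add: path_algebra_mult_closed path_algebra_mult_assoc path_algebra_one)
qed (auto simp: path_algebra_def fun_eq_iff distrib_left distrib_right sum.distrib)


section \<open>Graded algebras and graded modules\<close>

text \<open>
  A graded \<open>k\<close>-algebra is a ring together with the structure map \<open>base\<close> from \<open>k\<close> and its homogeneous
  parts. The \<open>k\<close>-action on a left module is the one through \<open>base\<close>. In records of modules the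
  multiplicative fields of the underlying ring record are irrelevant.
\<close>

record ('k, 'a) graded_algebra = "'a ring" +
  base :: "'k \<Rightarrow> 'a"
  alg_part :: "int \<Rightarrow> 'a set"

record ('a, 'b) graded_module = "('a, 'b) module" +
  mod_part :: "int \<Rightarrow> 'b set"

definition shift :: "int \<Rightarrow> ('a, 'b) graded_module \<Rightarrow> ('a, 'b) graded_module" where
  "shift n M = M\<lparr>mod_part := (\<lambda>u. mod_part M (u - n))\<rparr>"

definition quot_module :: "('a, 'b, 'm) module_scheme \<Rightarrow> 'b set \<Rightarrow> ('a, 'b set) module" where
  "quot_module M N = \<lparr>
     carrier = a_rcosets\<^bsub>M\<^esub> N,
     mult = undefined,
     one = undefined,
     zero = N,
     add = (\<lambda>X Y. X <+>\<^bsub>M\<^esub> Y),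
     smult = (\<lambda>a X. \<Union>x\<in>X. N +>\<^bsub>M\<^esub> (a \<odot>\<^bsub>M\<^esub> x))\<rparr>"

definition quot_graded :: "('a, 'b) graded_module \<Rightarrow> 'b set \<Rightarrow> ('a, 'b set) graded_module" where
  "quot_graded M N = module.extend (quot_module M N)
     \<lparr>mod_part = (\<lambda>u. (\<lambda>x. N +>\<^bsub>M\<^esub> x) ` mod_part M u)\<rparr>"

definition sub_graded :: "('a, 'b) graded_module \<Rightarrow> 'b set \<Rightarrow> ('a, 'b) graded_module" where
  "sub_graded M N = M\<lparr>carrier := N, mod_part := (\<lambda>u. mod_part M u \<inter> N)\<rparr>"

definition regular_module :: "('k, 'a) graded_algebra \<Rightarrow> ('a, 'a) graded_module" where
  "regular_module A = \<lparr>
     carrier = carrier A, mult = mult A, one = one A, zero = zero A, add = add A,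
     smult = mult A, mod_part = alg_part A\<rparr>"

definition principal_left :: "('k, 'a) graded_algebra \<Rightarrow> 'a \<Rightarrow> 'a set" where
  "principal_left A x = {a \<otimes>\<^bsub>A\<^esub> x |a. a \<in> carrier A}"

text \<open>The restricted dual, with \<open>Hom(V\<^sub>-\<^sub>u, k)\<close> realised as the functionals on \<open>V\<close> that vanish on
  all the other homogeneous components; \<open>\<tau>\<close> is an anti-involution of \<open>A\<close>.\<close>

definition restricted_dual ::
  "('k::field, 'a) graded_algebra \<Rightarrow> ('a \<Rightarrow> 'a) \<Rightarrow> ('a, 'b) graded_module
     \<Rightarrow> ('a, 'b \<Rightarrow> 'k) graded_module" where
  "restricted_dual A \<tau> M =
     (let D = {\<phi> \<in> carrier M \<rightarrow>\<^sub>E UNIV.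
                 (\<forall>x\<in>carrier M. \<forall>y\<in>carrier M. \<phi> (x \<oplus>\<^bsub>M\<^esub> y) = \<phi> x + \<phi> y) \<and>
                 (\<forall>c. \<forall>x\<in>carrier M. \<phi> (base A c \<odot>\<^bsub>M\<^esub> x) = c * \<phi> x) \<and>
                 finite {u. \<exists>x\<in>mod_part M u. \<phi> x \<noteq> 0}}
      in \<lparr>carrier = D,
          mult = undefined,
          one = undefined,
          zero = (\<lambda>x\<in>carrier M. 0),
          add = (\<lambda>\<phi> \<psi>. \<lambda>x\<in>carrier M. \<phi> x + \<psi> x),
          smult = (\<lambda>a \<phi>. \<lambda>x\<in>carrier M. \<phi> (\<tau> a \<odot>\<^bsub>M\<^esub> x)),
          mod_part = (\<lambda>u. {\<phi> \<in> D. \<forall>v. v \<noteq> - u \<longrightarrow> (\<forall>x\<in>mod_part M v. \<phi> x = 0)})\<rparr>)"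


section \<open>The first extension group of graded modules\<close>

definition graded_homs ::
  "('k, 'a) graded_algebra \<Rightarrow> ('a, 'b) graded_module \<Rightarrow> ('a, 'c) graded_module \<Rightarrow> ('b \<Rightarrow> 'c) set"
  where
  "graded_homs A M N = {f \<in> carrier M \<rightarrow>\<^sub>E carrier N.
     (\<forall>x\<in>carrier M. \<forall>y\<in>carrier M. f (x \<oplus>\<^bsub>M\<^esub> y) = f x \<oplus>\<^bsub>N\<^esub> f y) \<and>
     (\<forall>a\<in>carrier A. \<forall>x\<in>carrier M. f (a \<odot>\<^bsub>M\<^esub> x) = a \<odot>\<^bsub>N\<^esub> f x) \<and>
     (\<forall>u. f ` mod_part M u \<subseteq> mod_part N u)}"

definition hom_space ::
  "('k, 'a) graded_algebra \<Rightarrow> ('a, 'b) graded_module \<Rightarrow> ('a, 'c) graded_module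
     \<Rightarrow> ('k, 'b \<Rightarrow> 'c) module" where
  "hom_space A M N = \<lparr>
     carrier = graded_homs A M N,
     mult = undefined,
     one = undefined,
     zero = (\<lambda>x\<in>carrier M. \<zero>\<^bsub>N\<^esub>),
     add = (\<lambda>f g. \<lambda>x\<in>carrier M. f x \<oplus>\<^bsub>N\<^esub> g x),
     smult = (\<lambda>c f. \<lambda>x\<in>carrier M. base A c \<odot>\<^bsub>N\<^esub> f x)\<rparr>"

text \<open>
  \<open>Ext\<^sup>1(M, N)\<close> is computed from the canonical free presentation of \<open>M\<close>: let \<open>F\<close> be the free graded
  module with one generator of degree \<open>u\<close> for every \<open>u\<close> and every \<open>x \<in> M\<^sub>u\<close>, i.e. the corresponding
  direct sum of shifts \<open>q\<^sup>u A\<close>, which maps onto \<open>M\<close> by sending the generator \<open>(u, x)\<close> to \<open>x\<close>.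
  If \<open>\<Omega>\<close> denotes the kernel, \<open>Ext\<^sup>1(M, N)\<close> is the cokernel of the restriction map
  \<open>Hom(F, N) \<rightarrow> Hom(\<Omega>, N)\<close>, all homomorphisms being degree-preserving.
\<close>

definition free_on ::
  "('k, 'a) graded_algebra \<Rightarrow> ('a, 'b) graded_module \<Rightarrow> ('a, int \<times> 'b \<Rightarrow> 'a) graded_module" where
  "free_on A M =
     (let F = {f. (\<forall>z. f z \<in> carrier A) \<and> finite {z. f z \<noteq> \<zero>\<^bsub>A\<^esub>} \<and>
                  (\<forall>u x. f (u, x) \<noteq> \<zero>\<^bsub>A\<^esub> \<longrightarrow> x \<in> mod_part M u)}
      in \<lparr>carrier = F,
          mult = undefined,
          one = undefined,
          zero = (\<lambda>z. \<zero>\<^bsub>A\<^esub>),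
          add = (\<lambda>f g z. f z \<oplus>\<^bsub>A\<^esub> g z),
          smult = (\<lambda>a f z. a \<otimes>\<^bsub>A\<^esub> f z),
          mod_part = (\<lambda>v. {f \<in> F. \<forall>u x. f (u, x) \<in> alg_part A (v - u)})\<rparr>)"

definition augmentation ::
  "('k, 'a) graded_algebra \<Rightarrow> ('a, 'b) graded_module \<Rightarrow> (int \<times> 'b \<Rightarrow> 'a) \<Rightarrow> 'b" where
  "augmentation A M f = (\<Oplus>\<^bsub>M\<^esub>z\<in>{z. f z \<noteq> \<zero>\<^bsub>A\<^esub>}. f z \<odot>\<^bsub>M\<^esub> snd z)"

definition syzygy ::
  "('k, 'a) graded_algebra \<Rightarrow> ('a, 'b) graded_module \<Rightarrow> ('a, int \<times> 'b \<Rightarrow> 'a) graded_module" where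
  "syzygy A M =
     sub_graded (free_on A M) {f \<in> carrier (free_on A M). augmentation A M f = \<zero>\<^bsub>M\<^esub>}"

definition Ext1 ::
  "('k, 'a) graded_algebra \<Rightarrow> ('a, 'b) graded_module \<Rightarrow> ('a, 'c) graded_module
     \<Rightarrow> ('k, ((int \<times> 'b \<Rightarrow> 'a) \<Rightarrow> 'c) set) module" where
  "Ext1 A M N = quot_module (hom_space A (syzygy A M) N)
     ((\<lambda>f. restrict f (carrier (syzygy A M))) ` graded_homs A (free_on A M) N)"

definition ext1 ::
  "('k, 'a) graded_algebra \<Rightarrow> ('a, 'b) graded_module \<Rightarrow> ('a, 'c) graded_module
     \<Rightarrow> int \<Rightarrow> ('k, ((int \<times> 'b \<Rightarrow> 'a) \<Rightarrow> 'c) set) module" where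
  "ext1 A M N u = Ext1 A (shift u M) N"

definition has_dim :: "('k, 'b) module \<Rightarrow> nat \<Rightarrow> bool" where
  "has_dim V n \<longleftrightarrow> (\<exists>B. finite B \<and> card B = n \<and> B \<subseteq> carrier V \<and>
     (\<forall>x\<in>carrier V. \<exists>!c. c \<in> B \<rightarrow>\<^sub>E UNIV \<and> x = (\<Oplus>\<^bsub>V\<^esub>b\<in>B. c b \<odot>\<^bsub>V\<^esub> b)))"

text \<open>\<open>has_qdim V F\<close>: all \<open>V u\<close> are finite-dimensional, and \<open>F\<close> is the sum of all \<open>dim (V u) q\<^sup>u\<close>.\<close>

definition has_qdim :: "(int \<Rightarrow> ('k, 'b) module) \<Rightarrow> rat fls \<Rightarrow> bool" where
  "has_qdim V F \<longleftrightarrow> (\<forall>u. \<exists>n. has_dim (V u) n \<and> fls_nth F u = of_nat n)"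


section \<open>The generalized preprojective algebra and the generic kernels\<close>

definition rel1 :: "('i::finite \<Rightarrow> 'i \<Rightarrow> int) \<Rightarrow> 'i \<Rightarrow> 'i \<Rightarrow> 'i path \<Rightarrow> 'k::field" where
  "rel1 C i j = (\<lambda>p.
     basis_path (i, replicate (nat (- C i j)) (Eps i) @ [Alpha i j], j) p -
     basis_path (i, Alpha i j # replicate (nat (- C j i)) (Eps j), j) p)"

definition rel2 ::
  "('i::finite \<Rightarrow> 'i \<Rightarrow> int) \<Rightarrow> ('i \<Rightarrow> 'i \<Rightarrow> int) \<Rightarrow> 'i \<Rightarrow> 'i path \<Rightarrow> 'k::field" where
  "rel2 C \<omega> i = (\<lambda>p. \<Sum>j | adj C i j. \<Sum>k<nat (- C i j). of_int (\<omega> i j) *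
     basis_path (i, replicate k (Eps i) @ [Alpha i j, Alpha j i]
                      @ replicate (nat (- C i j) - 1 - k) (Eps i), i) p)"

definition preproj_ideal ::
  "('i::finite \<Rightarrow> 'i \<Rightarrow> int) \<Rightarrow> ('i \<Rightarrow> 'i \<Rightarrow> int) \<Rightarrow> ('i path \<Rightarrow> 'k::field) set" where
  "preproj_ideal C \<omega> =
     genideal (path_algebra C) ({rel1 C i j |i j. adj C i j} \<union> range (rel2 C \<omega>))"

lemma preproj_ideal_is_ideal:
  fixes C :: "'i::finite \<Rightarrow> 'i \<Rightarrow> int"
  assumes sym: "\<And>i j. adj C i j \<Longrightarrow> adj C j i"
  shows "ideal (preproj_ideal C \<omega> :: ('i path \<Rightarrow> 'k::field) set) (path_algebra C)"
proof -
  interpret P: ring "path_algebra C :: ('i path \<Rightarrow> 'k) ring" by (rule path_algebra_ring)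
  have reps: "is_path C (t, replicate n (Eps i) @ w, s) \<longleftrightarrow> (if n = 0 then is_path C (t, w, s)
      else t = i \<and> is_path C (i, w, s))" for t n w i and s :: 'i
    by (induction n arbitrary: t) auto
  have reps': "is_path C (t, replicate n (Eps i), s) \<longleftrightarrow> (if n = 0 then t = s
      else t = i \<and> s = i)" for t n i and s :: 'i
    by (induction n arbitrary: t) auto
  have "rel1 C i j \<in> carrier (path_algebra C :: ('i path \<Rightarrow> 'k) ring)" if "adj C i j" for i j
  proof -
    let ?p = "(i, replicate (nat (- C i j)) (Eps i) @ [Alpha i j], j)"
    let ?q = "(i, Alpha i j # replicate (nat (- C j i)) (Eps j), j)"
    have *: "rel1 C i j p \<noteq> (0::'k) \<Longrightarrow> p \<in> {?p, ?q}" for p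
      by (auto simp: rel1_def basis_path_def split: if_splits)
    have "finite {p. rel1 C i j p \<noteq> (0::'k)}"
      by (rule finite_subset[of _ "{?p, ?q}"]) (use * in blast, simp)
    moreover have "is_path C ?p" "is_path C ?q"
      using that by (auto simp: reps reps')
    ultimately show ?thesis
      using * by (fastforce simp: path_algebra_def)
  qed
  moreover have "rel2 C \<omega> i \<in> carrier (path_algebra C :: ('i path \<Rightarrow> 'k) ring)" for i
  proof -
    let ?p = "\<lambda>j k. (i, replicate k (Eps i) @ [Alpha i j, Alpha j i]
                      @ replicate (nat (- C i j) - 1 - k) (Eps i), i)"
    let ?S = "\<Union>j\<in>{j. adj C i j}. ?p j ` {..<nat (- C i j)}"
    have *: "p \<in> ?S" if "rel2 C \<omega> i p \<noteq> (0::'k)" for p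
    proof (rule ccontr)
      assume p: "p \<notin> ?S"
      have "rel2 C \<omega> i p = (0::'k)"
        unfolding rel2_def basis_path_def
        by (intro sum.neutral ballI) (use p in auto)
      with that show False by simp
    qed
    have "finite {p. rel2 C \<omega> i p \<noteq> (0::'k)}"
      by (rule finite_subset[of _ ?S]) (use * in blast, simp)
    moreover have "\<forall>p\<in>?S. is_path C p"
      using sym by (auto simp: reps reps')
    then have "\<forall>p. rel2 C \<omega> i p \<noteq> (0::'k) \<longrightarrow> is_path C p"
      using * by blast
    ultimately show ?thesis
      by (simp add: path_algebra_def)
  qed
  ultimately show ?thesis
    unfolding preproj_ideal_def by (intro P.genideal_ideal) auto
qed

type_synonym ('i, 'k) preproj_elt = "('i path \<Rightarrow> 'k) set"

definition preproj_class ::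
  "('i::finite \<Rightarrow> 'i \<Rightarrow> int) \<Rightarrow> ('i \<Rightarrow> 'i \<Rightarrow> int) \<Rightarrow> ('i path \<Rightarrow> 'k::field) \<Rightarrow> ('i, 'k) preproj_elt"
  where
  "preproj_class C \<omega> f = preproj_ideal C \<omega> +>\<^bsub>path_algebra C\<^esub> f"

definition preproj_algebra ::
  "('i::finite \<Rightarrow> 'i \<Rightarrow> int) \<Rightarrow> ('i \<Rightarrow> nat) \<Rightarrow> ('i \<Rightarrow> 'i \<Rightarrow> int)
     \<Rightarrow> ('k::field, ('i, 'k) preproj_elt) graded_algebra" where
  "preproj_algebra C d \<omega> = ring.extend (path_algebra C Quot preproj_ideal C \<omega>)
     \<lparr>base = (\<lambda>c. preproj_class C \<omega> (\<lambda>p. c * one (path_algebra C) p)),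
      alg_part = (\<lambda>u. preproj_class C \<omega> `
        {f \<in> carrier (path_algebra C). \<forall>p. f p \<noteq> 0 \<longrightarrow> path_deg d p = u})\<rparr>"

fun flip_arrow :: "'i arrow \<Rightarrow> 'i arrow" where
  "flip_arrow (Alpha i j) = Alpha j i" | "flip_arrow (Eps i) = Eps i"

fun flip_path :: "'i path \<Rightarrow> 'i path" where
  "flip_path (t, w, s) = (s, rev (map flip_arrow w), t)"

definition anti_involution :: "('i, 'k) preproj_elt \<Rightarrow> ('i, 'k) preproj_elt" where
  "anti_involution X = (\<lambda>f. f \<circ> flip_path) ` X"

text \<open>The left ideal generated by \<open>\<epsilon>\<^sub>i\<^sup>k = \<epsilon>\<^sub>i\<^sup>k e\<^sub>i\<close> lies in the one generated by \<open>e\<^sub>i\<close>, so that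
  \<open>(\<Pi> / \<Pi> \<epsilon>\<^sub>i\<^sup>k) e\<^sub>i = \<Pi> e\<^sub>i / \<Pi> \<epsilon>\<^sub>i\<^sup>k\<close>.\<close>

definition truncated_projective ::
  "('i::finite \<Rightarrow> 'i \<Rightarrow> int) \<Rightarrow> ('i \<Rightarrow> nat) \<Rightarrow> ('i \<Rightarrow> 'i \<Rightarrow> int) \<Rightarrow> 'i \<Rightarrow> nat
     \<Rightarrow> (('i, 'k::field) preproj_elt, ('i, 'k) preproj_elt set) graded_module" where
  "truncated_projective C d \<omega> i k =
     (let A = preproj_algebra C d \<omega>;
          e = preproj_class C \<omega> (basis_path (i, [], i));
          \<epsilon> = preproj_class C \<omega> (basis_path (i, [Eps i], i))
      in quot_graded (sub_graded (regular_module A) (principal_left A e))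
           (principal_left A (\<epsilon> [^]\<^bsub>A\<^esub> k)))"

definition generic_kernel ::
  "('i::finite \<Rightarrow> 'i \<Rightarrow> int) \<Rightarrow> ('i \<Rightarrow> nat) \<Rightarrow> ('i \<Rightarrow> 'i \<Rightarrow> int) \<Rightarrow> 'i \<Rightarrow> nat
     \<Rightarrow> (('i, 'k::field) preproj_elt, ('i, 'k) preproj_elt set \<Rightarrow> 'k) graded_module" where
  "generic_kernel C d \<omega> i k = shift (int (k * d i))
     (restricted_dual (preproj_algebra C d \<omega>) anti_involution (truncated_projective C d \<omega> i k))"


section \<open>The dimension formula\<close>

text \<open>Since \<open>B\<^sub>2 = C\<^sub>2\<close> counts as \<open>B\<^sub>2\<close>, it is not covered by the exceptional condition.\<close>

definition clubsuit ::
  "dynkin_type \<Rightarrow> ('i \<Rightarrow> nat) \<Rightarrow> 'i \<Rightarrow> 'i \<Rightarrow> nat \<Rightarrow> nat \<Rightarrow> bool" where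
  "clubsuit X d i j k l \<longleftrightarrow>
     ((\<exists>n. X = TypeC n) \<or> X = TypeF4 \<or> X = TypeG2) \<and>
     d i = 1 \<and> d j = 1 \<and> k = l \<and> \<not> lacing_number X dvd k"

definition ext_formula ::
  "dynkin_type \<Rightarrow> ('i::finite \<Rightarrow> 'i \<Rightarrow> int) \<Rightarrow> ('i \<Rightarrow> nat) \<Rightarrow> 'i \<Rightarrow> 'i \<Rightarrow> nat \<Rightarrow> nat \<Rightarrow> rat fls"
  where
  "ext_formula X C d i j k l =
     q_pow (- int (k * d i)) * (q_int (int (l * d j)) / q_int (int (d j))) *
     (\<Sum>u = 0..lacing_number X * dual_coxeter_number X.
        fls_const (inv_coeff C d i j u) * q_pow (- int u))"

end

theory Submission
  imports Defs "HOL-Library.Function_Algebras"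
begin

text \<open>
  The algebra is replaced by its dual \<open>D\<close>: the functions on paths that are annihilated by the relations,
  on which arrows act by removing letters. Let \<open>B i n\<close> be the part of \<open>D\<close> that is killed by
  \<open>\<epsilon>\<^sub>i\<close> on the right and lives on paths with \<open>n\<close> letters \<open>\<alpha>\<close>. Relation (R2) says
  that \<open>B i (n + 1)\<close> is the kernel of the transposed mesh maps from \<open>B i n\<close> to \<open>B i (n - 1)\<close>. By
  induction on \<open>n\<close>, compatible endomorphisms of two consecutive slices are scalars; so the mesh maps are
  onto as long as \<open>B i n\<close> is nonzero, since otherwise there would be an endomorphism of rank one. Hence
  the graded dimensions of the slices obey a recursion, which is solved type by type; summation over \<open>n\<close>
  gives the truncated inverse of the quantum Cartan matrix.

  Homomorphisms into \<open>K\<close> are functionals, and \<open>Ext\<^sup>1\<close> is dual to the part of \<open>D\<close> from \<open>i\<close> to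
  \<open>j\<close> that is killed by \<open>\<epsilon>\<^sub>j\<^sup>l\<close> on the left and by \<open>\<epsilon>\<^sub>i\<^sup>k\<close> on the
  right. The first condition alone yields the formula; it implies the second one outside the exceptional
  cases because \<open>\<Sum>\<^sub>i \<epsilon>\<^sub>i\<^bsup>r/d\<^esup>\<close> is central, or else by comparing degrees.
\<close>

text \<open>In the algebra itself the slices would be cokernels of maps between spaces of words
  modulo (R1) and (R2); in the dual they are kernels, and a function can be glued from prescribed
  components. So all counts take place among functions on words, over any field. That the mesh maps
  are onto is not formal. The induction closes because, where they are onto, they present a slice as
  a cokernel, so that an endomorphism passes from slice \<open>n\<close> to slice
  \<open>n - 1\<close>; and because the loops act nilpotently on \<open>B i n\<close>, which by a
  Nakayama argument yields an endomorphism of rank one of slice \<open>n - 1\<close> compatible with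
  0 on slice \<open>n\<close>. That the slices do not vanish too early is read off from explicit
  solutions. These also explain the bound of the sum: their last row is a single monomial, so that
  the quantum Cartan matrix times the table sums is 1 plus a term of order \<open>T\<close>, the
  product of lacing number and dual Coxeter number. Inverse and table agree up to that order.
  Surjectivity also gives torsion freeness: loops are cancellable. This enters twice, in counting
  kernels of powers of loops and in constructing extensions.\<close>

abbreviation eps :: "nat => 'i => 'i arrow list" where
 "eps n i \<equiv> replicate n (Eps i)"

section \<open>Linear algebra in spaces of functions over an arbitrary field\<close>

definition sc :: "'k::field => ('z => 'k) => 'z => 'k" where
 "sc c f = (\<lambda>z. c * f z)"

lemma sc_apply: "sc c f z = c * f z"
 by (simp add: sc_def)

interpretation fv: vector_space "sc :: 'k::field => ('z => 'k) => 'z => 'k"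
 by unfold_locales (auto simp: fun_eq_iff sc_apply algebra_simps)

interpretation fk: vector_space "(*) :: 'k::field => 'k => 'k"
 by unfold_locales (auto simp: algebra_simps)

interpretation fvk: vector_space_pair "sc :: 'k::field => ('z => 'k) => 'z => 'k" "(*) :: 'k => 'k => 'k"
 by unfold_locales

interpretation fvv: vector_space_pair "sc :: 'k::field => ('z => 'k) => 'z => 'k" "sc :: 'k => ('y => 'k) => 'y => 'k"
 by unfold_locales

abbreviation fun_linear :: "(('z => 'k::field) => ('y => 'k)) => bool" where
 "fun_linear \<equiv> Vector_Spaces.linear sc sc"

abbreviation functional :: "(('z => 'k::field) => 'k) => bool" where
 "functional \<equiv> Vector_Spaces.linear sc (*)"

lemma fun_linearI:
 assumes "\<And>x y. L (x + y) = L x + L y" "\<And>c x. L (sc c x) = sc c (L x)"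
 shows "fun_linear L"
 unfolding Vector_Spaces.linear_iff by (intro conjI allI fv.vector_space_axioms assms)

text \<open>A functional can be prescribed on a basis of \<open>U\<close>, and linearity of
  \<open>g\<close> on \<open>U\<close> does the rest. Later \<open>g\<close> is an expression that
  is additive only on genuine elements of \<open>U\<close>, such as lifts of module
  elements.\<close>

lemma functional_extend:
 fixes g :: "('z => 'k::field) => 'k"
 assumes U: "fv.subspace U"
  and add: "\<And>x y. x \<in> U ==> y \<in> U ==> g (x + y) = g x + g y"
  and scale: "\<And>c x. x \<in> U ==> g (sc c x) = c * g x"
 obtains L where "functional L" "\<And>x. x \<in> U ==> L x = g x"
proof -
 obtain B where B: "B \<subseteq> U" "fv.independent B" "U \<subseteq> fv.span B"
  using fv.maximal_independent_subset by blast
 obtain L where L: "functional L" "\<And>x. x \<in> B ==> L x = g x"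
  using fvk.linear_independent_extend[OF B(2), of g] by blast
 interpret L: Vector_Spaces.linear sc "(*)" L by (rule L(1))
 have "L x = g x \<and> x \<in> U" if "x \<in> fv.span B" for x
  using that
 proof (induction rule: fv.span_induct_alt)
  case base
  have "g 0 = 0" using scale[of 0 0] fv.subspace_0[OF U] by (metis fv.scale_zero_left mult_zero_left)
  thus "L 0 = g 0 \<and> 0 \<in> U" using fv.subspace_0[OF U] by (simp add: L.zero)
 next
  case (step c x y)
  hence "x \<in> U" using B by auto
  thus "L (sc c x + y) = g (sc c x + y) \<and> sc c x + y \<in> U"
   using step L(2) add scale fv.subspace_scale[OF U] fv.subspace_add[OF U]
   by (simp add: L.add L.scale)
 qed
 with B L show ?thesis by (intro that[of L]) auto
qed

lemma functional_separate:
 fixes y :: "'z => 'k::field"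
 assumes U: "fv.subspace U" and y: "y \<notin> U"
 obtains L where "functional L" "\<And>x. x \<in> U ==> L x = 0" "L y = 1"
proof -
 obtain B where B: "B \<subseteq> U" "fv.independent B" "U \<subseteq> fv.span B"
  using fv.maximal_independent_subset by blast
 have "fv.span B = U"
  using B U by (metis fv.span_eq_iff fv.span_mono subset_antisym)
 hence "fv.independent (insert y B)"
  using B y by (metis fv.independent_insertI)
 then obtain L where L: "functional L" "\<And>x. x \<in> insert y B ==> L x = (if x = y then 1 else 0)"
  using fvk.linear_independent_extend[of "insert y B" "\<lambda>x. if x = y then 1 else 0"] by blast
 interpret L: Vector_Spaces.linear sc "(*)" L by (rule L(1))
 have "L x = 0" if "x \<in> fv.span B" for x
  using that
 proof (induction rule: fv.span_induct_alt)
  case base show "L 0 = 0" by (rule L.zero)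
 next
  case (step c x z)
  hence "x ~= y" using B y by auto
  with step L(2) show "L (sc c x + z) = 0" by (simp add: L.add L.scale)
 qed
 with L B show ?thesis by (intro that[of L]) auto
qed

definition fin_dim :: "('z => 'k::field) set => bool" where
 "fin_dim U \<longleftrightarrow> (\<exists>B. finite B \<and> U \<subseteq> fv.span B)"

lemma fin_dim_subset: "fin_dim U ==> V \<subseteq> U ==> fin_dim V"
 unfolding fin_dim_def by blast

lemma fin_dim_independent:
 assumes "fin_dim U" "B \<subseteq> U" "fv.independent B"
 shows "finite B"
proof -
 obtain S where "finite S" "U \<subseteq> fv.span S" using assms by (auto simp: fin_dim_def)
 thus ?thesis using fv.independent_span_bound[of S B] assms by auto
qed

lemma fin_dim_basis:
 assumes "fin_dim U" "fv.subspace U"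
 obtains B where "finite B" "B \<subseteq> U" "fv.independent B" "fv.span B = U" "card B = fv.dim U"
proof -
 obtain B where B: "B \<subseteq> U" "fv.independent B" "U \<subseteq> fv.span B" "card B = fv.dim U"
  using fv.basis_exists[of U] by metis
 have "fv.span B = U" using B assms(2) by (metis fv.span_eq_iff fv.span_mono subset_antisym)
 with B fin_dim_independent[OF assms(1)] show ?thesis by (intro that[of B]) auto
qed

text \<open>Coordinates over \<open>A \<union> B\<close> are unique: those of \<open>x\<close> are
  supported in \<open>A\<close> and in \<open>B\<close>, hence nowhere.\<close>

lemma indep_cap:
 assumes "fv.independent (A \<union> B)" "A \<inter> B = {}" "x \<in> fv.span A" "x \<in> fv.span B"
 shows "x = 0"
proof -
 let ?r = "fv.representation (A \<union> B) x"
 have A: "x = (\<Sum>b | fv.representation A x b ~= 0. sc (fv.representation A x b) b)"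
  by (rule fv.sum_nonzero_representation_eq[symmetric]) (use assms fv.independent_mono in \<open>blast+\<close>)
 have "fv.representation (A \<union> B) x = fv.representation A x" "fv.representation (A \<union> B) x = fv.representation B x"
  by (rule fv.representation_extend; use assms in blast)+
 hence "fv.representation A x b = 0" for b
  using fv.representation_ne_zero[of A x b] fv.representation_ne_zero[of B x b] assms(2) by auto
 with A show ?thesis by (metis (mono_tags, lifting) empty_Collect_eq sum.empty)
qed

text \<open>A basis \<open>B0\<close> of the kernel is extended to a basis \<open>B\<close> of
  \<open>U\<close>. On the span of \<open>B - B0\<close> the map is injective, and it has its full
  image there.\<close>

lemma rank_nullity:
 fixes L :: "('z => 'k::field) => ('y => 'k)"
 assumes L: "fun_linear L" and fd: "fin_dim U" and U: "fv.subspace U"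
 shows "fin_dim (L ` U)" and "fv.dim U = fv.dim {x \<in> U. L x = 0} + fv.dim (L ` U)"
proof -
 interpret L: Vector_Spaces.linear sc sc L by (rule L)
 show "fin_dim (L ` U)"
 proof -
  obtain S where "finite S" "U \<subseteq> fv.span S" using fd by (auto simp: fin_dim_def)
  hence "L ` U \<subseteq> fv.span (L ` S)" using L.span_image[of S] by auto
  with \<open>finite S\<close> show ?thesis unfolding fin_dim_def by blast
 qed
 let ?K = "{x \<in> U. L x = 0}"
 have K: "fv.subspace ?K"
  using U by (auto simp: fv.subspace_def L.zero L.add L.scale)
 obtain B0 where B0: "finite B0" "B0 \<subseteq> ?K" "fv.independent B0" "fv.span B0 = ?K" "card B0 = fv.dim ?K"
  using fin_dim_basis[OF fin_dim_subset[OF fd] K] by auto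
 obtain B where B: "B0 \<subseteq> B" "B \<subseteq> U" "fv.independent B" "U \<subseteq> fv.span B"
  using fv.maximal_independent_subset_extend[of B0 U] B0 by auto
 have fB: "finite B" using fin_dim_independent[OF fd B(2,3)] .
 have dU: "fv.dim U = card B" using fv.dim_unique[OF B(2,4,3)] by simp
 let ?B1 = "B - B0"
 have indep1: "fv.independent ?B1" using B(3) fv.independent_mono by blast
 have cap: "x = 0" if x: "x \<in> fv.span ?B1" and "L x = 0" for x
 proof -
  have "fv.span ?B1 \<subseteq> U" using B(2) U by (meson Diff_subset fv.span_minimal subset_trans)
  hence "x \<in> fv.span B0" using that B0(4) by auto
  moreover have "B = B0 \<union> ?B1" using B(1) by auto
  ultimately show ?thesis using x B(3) indep_cap[of B0 ?B1 x] by auto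
 qed
 have inj: "inj_on L (fv.span ?B1)"
  unfolding L.inj_on_iff_eq_0[OF fv.subspace_span] using cap by blast
 have i2: "fv.independent (L ` ?B1)"
  by (rule L.independent_injective_image[OF indep1 inj])
 have "L ` U \<subseteq> fv.span (L ` ?B1)"
 proof
  fix z assume "z \<in> L ` U"
  then obtain x where "x \<in> U" "z = L x" by auto
  hence "z \<in> L ` fv.span B" using B(4) by auto
  hence "z \<in> fv.span (L ` B)" by (simp add: L.span_image)
  moreover have "L ` B \<subseteq> fv.span (L ` ?B1)"
  proof
   fix z assume "z \<in> L ` B"
   then obtain b where "b \<in> B" "z = L b" by auto
   thus "z \<in> fv.span (L ` ?B1)"
    using B0(2) by (cases "b \<in> B0") (auto simp: fv.span_zero intro: fv.span_base)
  qed
  ultimately show "z \<in> fv.span (L ` ?B1)"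
   by (meson fv.span_minimal fv.subspace_span subsetD)
 qed
 hence "fv.dim (L ` U) = card (L ` ?B1)"
  by (intro fv.dim_unique[of "L ` ?B1"]) (use i2 B(2) in auto)
 also have "... = card ?B1"
  by (rule card_image) (rule inj_on_subset[OF inj fv.span_superset])
 finally show "fv.dim U = fv.dim {x \<in> U. L x = 0} + fv.dim (L ` U)"
  using dU B0(5) B(1) fB card_Diff_subset[OF B0(1) B(1)] card_mono[OF fB B(1)] by simp
qed

text \<open>Here finite dimension is a conclusion, whereas \<open>rank_nullity\<close> presupposes
  it: the spaces of interest are shown to be finite-dimensional by mapping them to known
  ones.\<close>

lemma fin_dim_of_kernel_image:
 fixes L :: "('z => 'k::field) => ('y => 'k)"
 assumes L: "fun_linear L" and U: "fv.subspace U"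
  and k: "fin_dim {x \<in> U. L x = 0}" and im: "fin_dim (L ` U)"
 shows "fin_dim U"
proof -
 interpret L: Vector_Spaces.linear sc sc L by (rule L)
 have "fv.subspace (L ` U)" using L.subspace_image[OF U] .
 then obtain B where B: "finite B" "B \<subseteq> L ` U" "fv.span B = L ` U"
  using fin_dim_basis[OF im] by metis
 obtain B' where B': "finite B'" "B' \<subseteq> U" "B = L ` B'"
  using B(1,2) by (meson finite_subset_image)
 obtain S where S: "finite S" "{x \<in> U. L x = 0} \<subseteq> fv.span S" using k by (auto simp: fin_dim_def)
 have "U \<subseteq> fv.span (S \<union> B')"
 proof
  fix x assume x: "x \<in> U"
  hence "L x \<in> L ` fv.span B'" using B B' by (auto simp: L.span_image)
  then obtain y where y: "y \<in> fv.span B'" "L x = L y" by auto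
  have "y \<in> U" using y(1) B'(2) U by (meson fv.span_minimal subsetD)
  hence "x - y \<in> {x \<in> U. L x = 0}" using x y U by (simp add: fv.subspace_diff L.diff)
  hence "x - y \<in> fv.span (S \<union> B')" using S(2) by (meson fv.span_mono Un_upper1 subsetD)
  moreover have "y \<in> fv.span (S \<union> B')" using y(1) by (meson fv.span_mono Un_upper2 subsetD)
  ultimately have "(x - y) + y \<in> fv.span (S \<union> B')" by (rule fv.span_add)
  thus "x \<in> fv.span (S \<union> B')" by simp
 qed
 with S B' show ?thesis unfolding fin_dim_def by (meson finite_UnI)
qed

lemma dim_zero: "fv.dim {0} = 0"
 by (rule fv.dim_unique[of "{}"]) (simp_all add: fv.span_empty fv.independent_empty)

lemma dim_injective_image:
 fixes L :: "('z => 'k::field) => ('y => 'k)"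
 assumes L: "fun_linear L" and fd: "fin_dim U" and U: "fv.subspace U"
  and inj: "\<And>x. x \<in> U ==> L x = 0 ==> x = 0"
 shows "fv.dim (L ` U) = fv.dim U"
proof -
 interpret L: Vector_Spaces.linear sc sc L by (rule L)
 have "{x \<in> U. L x = 0} = {0}" using inj fv.subspace_0[OF U] L.zero by auto
 thus ?thesis using rank_nullity(2)[OF L fd U] by (simp add: dim_zero)
qed

lemma dim_eq_0:
 assumes "fin_dim U" "fv.subspace U"
 shows "fv.dim U = 0 \<longleftrightarrow> U = {0}"
proof
 assume 0: "fv.dim U = 0"
 obtain B where "finite B" "B \<subseteq> U" "fv.span B = U" "card B = fv.dim U"
  using fin_dim_basis[OF assms] by metis
 with 0 show "U = {0}" by (auto simp: fv.span_empty)
qed (simp add: dim_zero)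

text \<open>The coordinates \<open>h s\<close> are functionals on the whole ambient space, not only
  on \<open>U\<close>; in the construction of extensions they are applied to augmentations that need
  not lie in \<open>U\<close>.\<close>

lemma fin_dim_coordinates:
 fixes U :: "('z => 'k::field) set"
 assumes "fin_dim U" "fv.subspace U"
 obtains b :: "nat => 'z => 'k" and h :: "nat => ('z => 'k) => 'k" where
  "\<And>s. s < fv.dim U ==> b s \<in> U" "\<And>s. functional (h s)"
  "\<And>s t. s < fv.dim U ==> t < fv.dim U ==> h s (b t) = (if s = t then 1 else 0)"
  "U = fv.span (b ` {..<fv.dim U})"
proof -
 obtain B where B: "finite B" "B \<subseteq> U" "fv.independent B" "fv.span B = U" "card B = fv.dim U"
  using fin_dim_basis[OF assms] .
 obtain b where b: "bij_betw b {0..<card B} B" using ex_bij_betw_nat_finite[OF B(1)] by blast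
 have "\<exists>L. functional L \<and> (\<forall>x\<in>B. L x = (if x = b s then 1 else 0))" for s
  using fvk.linear_independent_extend[OF B(3), of "\<lambda>x. if x = b s then 1 else 0"] by blast
 then obtain h where h: "\<And>s. functional (h s)" "\<And>s x. x \<in> B ==> h s x = (if x = b s then 1 else 0)"
  by metis
 have img: "b ` {..<fv.dim U} = B" using b B(5) by (simp add: bij_betw_def atLeast0LessThan)
 show ?thesis
 proof (rule that[of b h])
  show "b s \<in> U" if "s < fv.dim U" for s using img that B(2) by blast
  show "h s (b t) = (if s = t then 1 else 0)" if "s < fv.dim U" "t < fv.dim U" for s t
  proof -
   have "b t \<in> B" using img that by blast
   moreover have "b t = b s \<longleftrightarrow> t = s"
    using b that B(5) by (auto simp: bij_betw_def inj_on_eq_iff)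
   ultimately show ?thesis using h by auto
  qed
 qed (use h img B in auto)
qed

text \<open>A product of function spaces is again encoded as a function space, on pairs of an index
  and a point, so that \<open>rank_nullity\<close> applies to it. The value 0 outside
  \<open>J\<close> makes the encoding unique.\<close>

definition fun_prod :: "'j set => ('j => ('z => 'k::field) set) => ('j \<times> 'z => 'k) set" where
 "fun_prod J U = {f. (\<forall>\<iota>\<in>J. (\<lambda>z. f (\<iota>, z)) \<in> U \<iota>) \<and> (\<forall>\<iota> z. \<iota> \<notin> J --> f (\<iota>, z) = 0)}"

lemma fun_prod_subspace:
 fixes U :: "'j => ('z => 'k::field) set"
 assumes "\<And>\<iota>. \<iota> \<in> J ==> fv.subspace (U \<iota>)"
 shows "fv.subspace (fun_prod J U)"
proof (rule fv.subspaceI)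
 have e: "(\<lambda>z. (0 :: 'j \<times> 'z => 'k) (\<iota>, z)) = 0" "(\<lambda>z. (f + g) (\<iota>, z)) = (\<lambda>z. f (\<iota>, z)) + (\<lambda>z. g (\<iota>, z))"
  "(\<lambda>z. sc c f (\<iota>, z)) = sc c (\<lambda>z. f (\<iota>, z))" for f g :: "'j \<times> 'z => 'k" and c \<iota>
  by (auto simp: fun_eq_iff sc_apply)
 show "0 \<in> fun_prod J U"
  unfolding fun_prod_def mem_Collect_eq e using fv.subspace_0[OF assms] by simp
 show "f + g \<in> fun_prod J U" if "f \<in> fun_prod J U" "g \<in> fun_prod J U" for f g
  using that fv.subspace_add[OF assms] unfolding fun_prod_def mem_Collect_eq e by simp
 show "sc c f \<in> fun_prod J U" if "f \<in> fun_prod J U" for c f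
  using that fv.subspace_scale[OF assms] unfolding fun_prod_def mem_Collect_eq e by (simp add: sc_apply)
qed

text \<open>Projection to the new factor has the product over the remaining indices as its
  kernel.\<close>

lemma fun_prod_dim:
 fixes U :: "'j => ('z => 'k::field) set"
 assumes "finite J" and sub: "\<And>\<iota>. \<iota> \<in> J ==> fv.subspace (U \<iota>)" and fd: "\<And>\<iota>. \<iota> \<in> J ==> fin_dim (U \<iota>)"
 shows "fin_dim (fun_prod J U) \<and> fv.dim (fun_prod J U) = (\<Sum>\<iota>\<in>J. fv.dim (U \<iota>))"
 using assms
proof (induction J rule: finite_induct)
 case empty
 have e: "fun_prod {} U = {0}" by (auto simp: fun_prod_def)
 have "fin_dim {0::'j \<times> 'z => 'k}" unfolding fin_dim_def by (metis finite.emptyI fv.span_empty order_refl)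
 thus "fin_dim (fun_prod {} U) \<and> fv.dim (fun_prod {} U) = (\<Sum>\<iota>\<in>{}. fv.dim (U \<iota>))"
  unfolding e by (simp add: dim_zero)
next
 case (insert \<iota> J)
 define L :: "('j \<times> 'z => 'k) => 'z => 'k" where "L f = (\<lambda>z. f (\<iota>, z))" for f
 have L: "fun_linear L" by (rule fun_linearI) (auto simp: L_def sc_apply fun_eq_iff)
 let ?P = "fun_prod (insert \<iota> J) U"
 have P: "fv.subspace ?P" by (rule fun_prod_subspace) (use insert in auto)
 have ker: "{f \<in> ?P. L f = 0} = fun_prod J U"
 proof -
  have "f \<in> fun_prod J U \<longleftrightarrow> f \<in> ?P \<and> L f = 0" for f
  proof
   assume f: "f \<in> fun_prod J U"
   hence "L f = 0" using insert(2) by (auto simp: fun_prod_def L_def fun_eq_iff)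
   with f show "f \<in> ?P \<and> L f = 0" using fv.subspace_0[OF insert(4)[of \<iota>]]
    by (auto simp: fun_prod_def L_def)
  next
   assume f: "f \<in> ?P \<and> L f = 0"
   hence "f (\<iota>, z) = 0" for z by (auto simp: L_def fun_eq_iff)
   hence "f (\<kappa>, z) = 0" if "\<kappa> \<notin> J" for \<kappa> z
    using f that by (cases "\<kappa> = \<iota>") (auto simp: fun_prod_def)
   with f show "f \<in> fun_prod J U" by (simp add: fun_prod_def)
  qed
  thus ?thesis by blast
 qed
 have im: "L ` ?P = U \<iota>"
 proof
  show "L ` ?P \<subseteq> U \<iota>" by (auto simp: fun_prod_def L_def)
  show "U \<iota> \<subseteq> L ` ?P"
  proof
   fix u assume u: "u \<in> U \<iota>"
   let ?f = "\<lambda>(\<kappa>, z). if \<kappa> = \<iota> then u z else 0"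
   have "(\<lambda>z. ?f (\<kappa>, z)) \<in> U \<kappa>" if "\<kappa> \<in> insert \<iota> J" for \<kappa>
   proof (cases "\<kappa> = \<iota>")
    case True thus ?thesis using u by simp
   next
    case False
    hence "(\<lambda>z. ?f (\<kappa>, z)) = 0" by (auto simp: fun_eq_iff)
    thus ?thesis using fv.subspace_0[OF insert(4)[OF that]] by (simp only:)
   qed
   hence f: "?f \<in> ?P" unfolding fun_prod_def by (intro CollectI conjI ballI allI impI) auto
   have "L ?f = u" by (auto simp: L_def)
   thus "u \<in> L ` ?P" using f image_eqI[of u L ?f ?P] by (simp only: refl)
  qed
 qed
 have "fin_dim ?P"
  by (rule fin_dim_of_kernel_image[OF L P]) (use ker im insert in auto)
 moreover from rank_nullity(2)[OF L this P] have "fv.dim ?P = (\<Sum>\<iota>\<in>insert \<iota> J. fv.dim (U \<iota>))"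
  unfolding ker im using insert by (simp add: add.commute)
 ultimately show "fin_dim ?P \<and> fv.dim ?P = (\<Sum>\<iota>\<in>insert \<iota> J. fv.dim (U \<iota>))" by blast
qed

declare plus_fun_apply [simp del] zero_fun_apply [simp del]
lemmas fun_app = plus_fun_apply zero_fun_apply sc_apply

section \<open>The annihilator of the defining relations\<close>

definition cnt :: "'i arrow list => int" where
 "cnt w = int (length (filter (\<lambda>a. \<exists>i j. a = Alpha i j) w))"

definition wdeg :: "('i => nat) => 'i arrow list => int" where
 "wdeg d w = sum_list (map (arrow_deg d) w)"

lemma cnt_simps [simp]:
 "cnt [] = 0" "cnt (Alpha i j # w) = cnt w + 1" "cnt (Eps i # w) = cnt w"
 "cnt (u @ w) = cnt u + cnt w" "cnt (eps n i) = 0"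
 by (auto simp: cnt_def)

lemma cnt_nonneg [simp]: "cnt w >= 0"
 by (simp add: cnt_def)

lemma wdeg_simps [simp]:
 "wdeg d [] = 0" "wdeg d (a # w) = arrow_deg d a + wdeg d w" "wdeg d (u @ w) = wdeg d u + wdeg d w"
 by (auto simp: wdeg_def)

lemma wdeg_replicate [simp]: "wdeg d (eps n i) = 2 * int n * int (d i)"
 by (simp add: wdeg_def sum_list_replicate)

lemma path_deg_eq_wdeg: "path_deg d (t, w, s) = wdeg d w"
 by (simp add: wdeg_def)

lemma cnt_0_path:
 assumes "is_path C (t, w, s)" "cnt w = 0"
 shows "t = s \<and> w = eps (length w) s"
 using assms
proof (induction w arbitrary: t)
 case (Cons a w)
 thus ?case using cnt_nonneg[of w] by (cases a) auto
qed auto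

lemma cnt_pos_split:
 assumes "is_path C (t, w, s)" "cnt w ~= 0"
 obtains a k w' where "w = eps a t @ Alpha t k # w'" "adj C t k" "is_path C (k, w', s)"
 using assms
proof (induction w arbitrary: t thesis)
 case (Cons x w)
 show ?case
 proof (cases x)
  case (Alpha p q)
  thus ?thesis using Cons(2)[of 0 q w] Cons(3) by auto
 next
  case (Eps p)
  hence p: "p = t" "is_path C (t, w, s)" "cnt w ~= 0" using Cons(3,4) by auto
  from Cons(1)[OF _ p(2,3)] obtain a k w' where
   "w = eps a t @ Alpha t k # w'" "adj C t k" "is_path C (k, w', s)" by blast
  thus ?thesis using Cons(2)[of "Suc a" k w'] Eps p(1) by auto
 qed
qed simp

text \<open>The transpose of left multiplication by the arrow \<open>a\<close>; likewise
  \<open>right_op i\<close> is the transpose of right multiplication by the loop at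
  \<open>i\<close>.\<close>

definition left_op :: "'i arrow => ('i path => 'k::field) => 'i path => 'k" where
 "left_op a l = (\<lambda>(t, w, s). if t = src a then l (tgt a, a # w, s) else 0)"

definition right_op :: "'i => ('i path => 'k::field) => 'i path => 'k" where
 "right_op i l = (\<lambda>(t, w, s). if s = i then l (t, w @ [Eps i], i) else 0)"

text \<open>The predicate \<open>Q\<close> refers to target, number of arrows \<open>Alpha\<close>, degree, and source of a path.\<close>

definition restr :: "('i => nat) => ('i => int => int => 'i => bool) => ('i path => 'k::field) => 'i path => 'k"
 where "restr d Q l = (\<lambda>(t, w, s). if Q t (cnt w) (wdeg d w) s then l (t, w, s) else 0)"

lemma left_op_linear: "fun_linear (left_op a)"
 by (rule fun_linearI) (auto simp: left_op_def fun_app fun_eq_iff)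

lemma right_op_linear: "fun_linear (right_op a)"
 by (rule fun_linearI) (auto simp: right_op_def fun_app fun_eq_iff)

lemma restr_linear: "fun_linear (restr d Q)"
 by (rule fun_linearI) (auto simp: restr_def fun_app fun_eq_iff)

lemma funpow_linear:
 assumes "fun_linear (L :: ('z => 'k::field) => ('z => 'k))"
 shows "fun_linear (L ^^ n)"
proof -
 interpret L: Vector_Spaces.linear sc sc L by (rule assms)
 show ?thesis
 proof (rule fun_linearI)
  show "(L ^^ n) (x + y) = (L ^^ n) x + (L ^^ n) y" for x y
   by (induction n) (simp_all add: L.add)
  show "(L ^^ n) (sc c x) = sc c ((L ^^ n) x)" for c x
   by (induction n) (simp_all add: L.scale)
 qed
qed

abbreviation leps :: "'i => nat => ('i path => 'k::field) => 'i path => 'k" where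
 "leps i n \<equiv> left_op (Eps i) ^^ n"

abbreviation reps :: "'i => nat => ('i path => 'k::field) => 'i path => 'k" where
 "reps i n \<equiv> right_op i ^^ n"

lemma left_op_pow_at: "leps j m l (j, w, s) = l (j, eps m j @ w, s)"
 by (induction m arbitrary: w) (auto simp: left_op_def replicate_app_Cons_same)

lemma left_op_pow_off: "t ~= j ==> m > 0 ==> leps j m l (t, w, s) = 0"
 by (cases m) (auto simp: left_op_def)

lemma right_op_pow_at: "reps i m l (t, w, i) = l (t, w @ eps m i, i)"
 by (induction m arbitrary: w) (auto simp: right_op_def replicate_append_same)

definition eps_mult :: "('i => 'i => int) => 'i => 'i => nat" where
 "eps_mult C i j = nat (- C i j)"

abbreviation mesh_sum ::
 "('i::finite => 'i => int) => ('i => 'i => int) => ('i path => 'k::field) => 'i => 'i => 'i arrow list => 'i arrow list => 'i => 'k" where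
 "mesh_sum C \<omega> l i t u w s \<equiv> \<Sum>j | adj C i j. \<Sum>k<eps_mult C i j. of_int (\<omega> i j) *
   l (t, u @ eps k i @ Alpha i j # Alpha j i # eps (eps_mult C i j - 1 - k) i @ w, s)"

text \<open>The ideal is spanned by the products of a relation with a path \<open>u\<close> on its
  left and a path \<open>w\<close> on its right, so a function kills the ideal iff it satisfies (R1)
  and (R2) in every such context. The proof of this is \<open>II_iff\<close> and the lemmas before
  it.\<close>

definition rel_dual :: "('i::finite => 'i => int) => ('i => 'i => int) => ('i path => 'k::field) set" where
 "rel_dual C \<omega> = {l. (\<forall>p. \<not> is_path C p --> l p = 0) \<and>
   (\<forall>i j u w t s. adj C i j -->
    l (t, u @ eps (eps_mult C i j) i @ Alpha i j # w, s)
     = l (t, u @ Alpha i j # eps (eps_mult C j i) j @ w, s)) \<and>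
   (\<forall>i u w t s. mesh_sum C \<omega> l i t u w s = 0)}"

lemma rel_dual_path: "l \<in> rel_dual C \<omega> ==> l p ~= 0 ==> is_path C p"
 unfolding rel_dual_def by blast

lemma rel_dual_R1:
 "l \<in> rel_dual C \<omega> ==> adj C i j ==>
  l (t, u @ eps (eps_mult C i j) i @ Alpha i j # w, s)
     = l (t, u @ Alpha i j # eps (eps_mult C j i) j @ w, s)"
 by (auto simp: rel_dual_def)

lemma rel_dual_R2:
 "l \<in> rel_dual C \<omega> ==> mesh_sum C \<omega> l i t u w s = 0"
 by (auto simp: rel_dual_def)

lemma rel_dualI:
 assumes "\<And>p. l p ~= 0 ==> is_path C p"
  and "\<And>i j u w t s. adj C i j ==>
    l (t, u @ eps (eps_mult C i j) i @ Alpha i j # w, s)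
     = l (t, u @ Alpha i j # eps (eps_mult C j i) j @ w, s)"
  and "\<And>i u w t s. mesh_sum C \<omega> l i t u w s = 0"
 shows "l \<in> rel_dual C \<omega>"
 using assms by (auto simp: rel_dual_def)

lemma rel_dual_subspace:
 fixes C :: "'i::finite => 'i => int"
 shows "fv.subspace (rel_dual C \<omega> :: ('i path => 'k::field) set)"
proof (rule fv.subspaceI)
 show "(0 :: 'i path => 'k) \<in> rel_dual C \<omega>" by (rule rel_dualI) (auto simp: fun_app)
 show "f + g \<in> rel_dual C \<omega>" if "f \<in> rel_dual C \<omega>" "g \<in> rel_dual C \<omega>" for f g :: "'i path => 'k"
 proof (rule rel_dualI)
  show "is_path C p" if "(f + g) p ~= 0" for p
   using that rel_dual_path[OF \<open>f \<in> _\<close>, of p] rel_dual_path[OF \<open>g \<in> _\<close>, of p] by (fastforce simp: fun_app)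
  show "(f + g) (t, u @ eps (eps_mult C i j) i @ Alpha i j # w, s)
     = (f + g) (t, u @ Alpha i j # eps (eps_mult C j i) j @ w, s)"
   if "adj C i j" for i j u w t s
   using that \<open>f \<in> _\<close> \<open>g \<in> _\<close> by (simp add: fun_app rel_dual_R1)
  show "mesh_sum C \<omega> (f + g) i t u w s = 0" for i u w t s
   using rel_dual_R2[OF \<open>f \<in> _\<close>, of i t u w s] rel_dual_R2[OF \<open>g \<in> _\<close>, of i t u w s]
   by (simp add: fun_app distrib_left sum.distrib)
 qed
 show "sc c f \<in> rel_dual C \<omega>" if "f \<in> rel_dual C \<omega>" for c and f :: "'i path => 'k"
 proof (rule rel_dualI)
  show "is_path C p" if "sc c f p ~= 0" for p
   using that rel_dual_path[OF \<open>f \<in> _\<close>, of p] by (auto simp: sc_apply)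
  fix i u w t s
  show "mesh_sum C \<omega> (sc c f) i t u w s = 0"
   using rel_dual_R2[OF that, where i = i and u = u and w = w and t = t and s = s, THEN arg_cong, of "\<lambda>x. c * x"]
   by (simp add: sc_apply sum_distrib_left mult.left_commute)
  show "sc c f (t, u @ eps (eps_mult C i j) i @ Alpha i j # w, s)
     = sc c f (t, u @ Alpha i j # eps (eps_mult C j i) j @ w, s)"
   if "adj C i j" for i j u w t s
   unfolding sc_apply rel_dual_R1[OF \<open>f \<in> _\<close> that] ..
 qed
qed

lemma left_op_rel_dual:
 assumes "l \<in> rel_dual C \<omega>" shows "left_op a l \<in> rel_dual C \<omega>"
proof (rule rel_dualI)
 show "is_path C p" if "left_op a l p ~= 0" for p
  using that rel_dual_path[OF assms, of "(tgt a, a # fst (snd p), snd (snd p))"]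
  by (cases p) (auto simp: left_op_def split: if_splits)
 show "left_op a l (t, u @ eps (eps_mult C i j) i @ Alpha i j # w, s)
     = left_op a l (t, u @ Alpha i j # eps (eps_mult C j i) j @ w, s)"
  if "adj C i j" for i j u w t s
  using rel_dual_R1[OF assms that, where u = "a # u"] by (simp add: left_op_def)
 show "mesh_sum C \<omega> (left_op a l) i t u w s = 0" for i u w t s
  using rel_dual_R2[OF assms, where u = "a # u"] by (cases "t = src a") (simp_all add: left_op_def)
qed

lemma right_op_rel_dual:
 assumes "l \<in> rel_dual C \<omega>" shows "right_op b l \<in> rel_dual C \<omega>"
proof (rule rel_dualI)
 show "is_path C p" if "right_op b l p ~= 0" for p
  using that rel_dual_path[OF assms, of "(fst p, fst (snd p) @ [Eps b], b)"]
  by (cases p) (auto simp: right_op_def is_path_append split: if_splits)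
 show "right_op b l (t, u @ eps (eps_mult C i j) i @ Alpha i j # w, s)
     = right_op b l (t, u @ Alpha i j # eps (eps_mult C j i) j @ w, s)"
  if "adj C i j" for i j u w t s
  using rel_dual_R1[OF assms that, where w = "w @ [Eps b]"] by (simp add: right_op_def)
 show "mesh_sum C \<omega> (right_op b l) i t u w s = 0" for i u w t s
  using rel_dual_R2[OF assms, where w = "w @ [Eps b]"] by (cases "s = b") (simp_all add: right_op_def)
qed

text \<open>A left context can be peeled off letter by letter, and peeling off \<open>a\<close>
  turns \<open>l\<close> into \<open>left_op a l\<close>. In a family stable under this, the
  relations only have to be tested at the left end of a word. The alternative in \<open>step\<close>
  serves letters after which the function is already known to satisfy all relations.\<close>

lemma rel_dual_coinduct:
 fixes S :: "('i::finite path => 'k::field) set"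
 assumes S: "l \<in> S"
  and path: "\<And>l p. l \<in> S ==> l p ~= 0 ==> is_path C p"
  and R1: "\<And>l i j w s. l \<in> S ==> adj C i j ==>
    l (i, eps (eps_mult C i j) i @ Alpha i j # w, s)
     = l (i, Alpha i j # eps (eps_mult C j i) j @ w, s)"
  and R2: "\<And>l i w s. l \<in> S ==> (\<Sum>j | adj C i j. \<Sum>k<eps_mult C i j. of_int (\<omega> i j) *
    l (i, eps k i @ Alpha i j # Alpha j i #
       eps (eps_mult C i j - 1 - k) i @ w, s)) = 0"
  and step: "\<And>l a. l \<in> S ==> left_op a l \<in> S \<or> left_op a l \<in> rel_dual C \<omega>"
  and pos: "\<And>i j. adj C i j ==> eps_mult C i j > 0"
 shows "l \<in> rel_dual C \<omega>"
proof (rule rel_dualI)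
 show "is_path C p" if "l p ~= 0" for p using path[OF S that] .
 have z: "l (t, w, s) = 0" if "l \<in> S" "\<not> is_path C (t, w, s)" for l t w s
  using path that by blast
 show "l (t, u @ eps (eps_mult C i j) i @ Alpha i j # w, s)
     = l (t, u @ Alpha i j # eps (eps_mult C j i) j @ w, s)"
  if adj: "adj C i j" for i j u w t s
  using S
 proof (induction u arbitrary: l t)
  case Nil
  show ?case
  proof (cases "t = i")
   case True thus ?thesis using R1[OF Nil adj] by simp
  next
   case False
   have "eps (eps_mult C i j) i = Eps i # eps (eps_mult C i j - 1) i"
    using pos[OF adj] by (cases "eps_mult C i j") auto
   thus ?thesis using False by (simp add: z[OF Nil])
  qed
 next
  case (Cons a u)
  show ?case
  proof (cases "t = tgt a")
   case True
   have e: "l (t, a # w, s) = left_op a l (src a, w, s)" for w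
    by (simp add: left_op_def True)
   from step[OF Cons(2), of a] show ?thesis
   proof
    assume "left_op a l \<in> S" thus ?thesis using Cons(1) by (simp add: e)
   next
    assume "left_op a l \<in> rel_dual C \<omega>"
    thus ?thesis by (simp add: e rel_dual_R1 adj)
   qed
  qed (simp add: z[OF Cons(2)])
 qed
 show "mesh_sum C \<omega> l i t u w s = 0" for i u w t s
  using S
 proof (induction u arbitrary: l t)
  case Nil
  show ?case
  proof (cases "t = i")
   case True thus ?thesis using R2[OF Nil] by simp
  next
   case False
   have "l (t, eps k i @ Alpha i j # w, s) = 0" for k j w
    by (rule z[OF Nil]) (use False in \<open>cases k; auto\<close>)
   thus ?thesis by simp
  qed
 next
  case (Cons a u)
  show ?case
  proof (cases "t = tgt a")
   case True
   have e: "l (t, a # w, s) = left_op a l (src a, w, s)" for w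
    by (simp add: left_op_def True)
   from step[OF Cons(2), of a] show ?thesis
   proof
    assume "left_op a l \<in> S" thus ?thesis using Cons(1) by (simp add: e)
   next
    assume "left_op a l \<in> rel_dual C \<omega>"
    thus ?thesis using rel_dual_R2[of "left_op a l" C \<omega>] by (simp add: e)
   qed
  qed (simp add: z[OF Cons(2)])
 qed
qed

text \<open>The part of the Cartan datum that governs the slices. \<open>eps_mult_d\<close>
  expresses the entries \<open>- C i j\<close> through the symmetrizer in the form in which degrees
  use it; finite type enters only later, through the existence of tables.\<close>

locale gpa =
 fixes C :: "'i::finite => 'i => int" and \<omega> :: "'i => 'i => int" and d :: "'i => nat" and r :: nat
 assumes adj_sym: "adj C i j ==> adj C j i"
  and d_pos: "d i > 0"
  and eps_mult_d: "adj C i j ==> eps_mult C i j * d i = max (d i) (d j)"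
  and sign: "adj C i j ==> \<omega> i j \<in> {1, -1}"
  and d_dvd: "d i dvd r" and r_pos: "r > 0"
begin

abbreviation "E i j \<equiv> eps_mult C i j"
abbreviation D :: "('i path => 'k::field) set" where "D \<equiv> rel_dual C \<omega>"

lemma E_pos: "adj C i j ==> E i j > 0"
 by (auto simp: adj_def eps_mult_def)

lemma deg_rel1: "adj C i j ==> int (E i j) * int (d i) = int (E j i) * int (d j)"
 using eps_mult_d[of i j] eps_mult_d[of j i] adj_sym[of i j] by (metis max.commute of_nat_mult)

text \<open>Every summand of (R2) at \<open>i\<close> has degree \<open>- 2 * d i\<close>, whatever
  the neighbour and the exponent are. This is the origin of the shift by \<open>2 * d j\<close> in
  the dimension recursion.\<close>

lemma deg_rel2: 
 assumes "adj C i j" "k < E i j"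
 shows "2 * int k * int (d i) - int (max (d i) (d j)) - int (max (d j) (d i)) + 2 * int (E i j - 1 - k) * int (d i) = - 2 * int (d i)"
proof -
 have "2 * int k * int (d i) + 2 * int (E i j - 1 - k) * int (d i) = 2 * (int k + int (E i j - 1 - k)) * int (d i)"
  by (simp add: algebra_simps)
 also have "int k + int (E i j - 1 - k) = int (E i j) - 1" using assms by simp
 also have "2 * (int (E i j) - 1) * int (d i) = 2 * int (max (d i) (d j)) - 2 * int (d i)"
  using eps_mult_d[OF assms(1)] by (simp add: left_diff_distrib flip: of_nat_mult)
 finally show ?thesis by (simp add: max.commute)
qed

text \<open>Each relation only compares words with the same ends, the same number of letters
  \<open>Alpha\<close> and the same degree, so cutting a function down along these invariants
  preserves the relations.\<close>

lemma restr_D: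
 assumes l: "l \<in> D"
 shows "restr d Q l \<in> D"
proof (rule rel_dualI)
 show "is_path C p" if "restr d Q l p ~= 0" for p
  using that rel_dual_path[OF l] by (cases p) (auto simp: restr_def split: if_splits)
 show "restr d Q l (t, u @ eps (E i j) i @ Alpha i j # w, s)
     = restr d Q l (t, u @ Alpha i j # eps (E j i) j @ w, s)"
  if "adj C i j" for i j u w t s
 proof -
  have "wdeg d (u @ eps (E i j) i @ Alpha i j # w)
    = wdeg d (u @ Alpha i j # eps (E j i) j @ w)"
   "cnt (u @ eps (E i j) i @ Alpha i j # w)
    = cnt (u @ Alpha i j # eps (E j i) j @ w)"
   using deg_rel1[OF that] by simp_all
  thus ?thesis
   unfolding restr_def prod.case rel_dual_R1[OF l that] by (simp only:)
 qed
 fix i u w t s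
 have "cnt (u @ eps k i @ Alpha i j # Alpha j i # eps (E i j - 1 - k) i @ w)
   = cnt u + cnt w + 2 \<and>
   wdeg d (u @ eps k i @ Alpha i j # Alpha j i # eps (E i j - 1 - k) i @ w)
   = wdeg d u + wdeg d w - 2 * int (d i)" if "adj C i j" "k < E i j" for j k
  using deg_rel2[OF that] by (simp add: algebra_simps)
 hence "mesh_sum C \<omega> (restr d Q l) i t u w s
   = (\<Sum>j | adj C i j. \<Sum>k<E i j. of_int (\<omega> i j) *
    (if Q t (cnt u + cnt w + 2) (wdeg d u + wdeg d w - 2 * int (d i)) s then
     l (t, u @ eps k i @ Alpha i j # Alpha j i #
       eps (E i j - 1 - k) i @ w, s) else 0))"
  unfolding restr_def by (intro sum.cong refl) (simp del: cnt_simps wdeg_simps)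
 also have "... = 0"
  using rel_dual_R2[OF l] by (cases "Q t (cnt u + cnt w + 2) (wdeg d u + wdeg d w - 2 * int (d i)) s") simp_all
 finally show "mesh_sum C \<omega> (restr d Q l) i t u w s = 0" .
qed

lemma D_subspace: "fv.subspace D"
 by (rule rel_dual_subspace)

lemma left_op_D: "l \<in> D ==> left_op a l \<in> D"
 by (rule left_op_rel_dual)

lemma left_op_pow_D: "l \<in> D ==> (left_op a ^^ n) l \<in> D"
 by (induction n) (auto intro: left_op_D)

lemma right_op_D: "l \<in> D ==> right_op i l \<in> D"
 by (rule right_op_rel_dual)

definition tgt_part :: "'i => ('i path => 'k::field) => 'i path => 'k" where
 "tgt_part j = restr d (\<lambda>t n v s. t = j)"

lemma tgt_part_apply: "tgt_part j l (t, w, s) = (if t = j then l (t, w, s) else 0)"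
 by (simp add: tgt_part_def restr_def)

lemma tgt_part_linear: "fun_linear (tgt_part j)"
 unfolding tgt_part_def by (rule restr_linear)

lemma tgt_part_D: "l \<in> D ==> tgt_part j l \<in> D"
 unfolding tgt_part_def by (rule restr_D)

section \<open>Components of functions on paths, gluing, and a central element\<close>

abbreviation branch :: "'i => 'i => nat => ('i path => 'k::field) => 'i path => 'k" where
 "branch j k m l \<equiv> left_op (Alpha j k) (leps j m l)"

text \<open>Relation (R1) with empty left context, as an identity of operators.\<close>

lemma left_op_eps_mult:
 assumes l: "l \<in> D" and adj: "adj C j k"
 shows "leps j (E j k) (left_op (Alpha k j) l) = branch k j (E k j) l"
proof (rule ext, clarify)
 fix t w s
 show "leps j (E j k) (left_op (Alpha k j) l) (t, w, s)
   = branch k j (E k j) l (t, w, s)"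
 proof (cases "t = j")
  case True
  have "l (k, Alpha k j # eps (E j k) j @ w, s) = l (k, eps (E k j) k @ Alpha k j # w, s)"
   using rel_dual_R1[OF l adj_sym[OF adj], where u = "[]"] by simp
  thus ?thesis by (simp add: True left_op_pow_at) (simp add: left_op_def left_op_pow_at)
 next
  case False
  thus ?thesis using E_pos[OF adj] by (simp add: left_op_pow_off) (simp add: left_op_def)
 qed
qed

text \<open>The transpose of the map from the generalized mesh relation.\<close>

definition mesh :: "'i => ('i => nat => 'i path => 'k::field) => 'i path => 'k" where
 "mesh j x = (\<Sum>k | adj C j k. \<Sum>m<E j k.
   sc (of_int (\<omega> j k)) (leps j (E j k - 1 - m) (left_op (Alpha k j) (x k m))))"

lemma sum_fun_apply: "(\<Sum>x\<in>S. (f x :: 'z => 'k::field)) z = (\<Sum>x\<in>S. f x z)"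
 by (induction S rule: infinite_finite_induct) (auto simp: fun_app)

lemma mesh_at:
 "mesh j x (j, w, s) = (\<Sum>k | adj C j k. \<Sum>m<E j k. of_int (\<omega> j k) *
   x k m (k, Alpha k j # eps (E j k - 1 - m) j @ w, s))"
 unfolding mesh_def by (simp add: sum_fun_apply sc_apply left_op_pow_at left_op_def)

lemma mesh_off:
 fixes x :: "'i => nat => 'i path => 'k::field"
 assumes t: "t ~= j"
 shows "mesh j x (t, w, s) = 0"
proof -
 have "leps j n (left_op (Alpha k j) y) (t, w, s) = 0" for n k and y :: "'i path => 'k"
  using t by (cases "n = 0") (auto simp: left_op_pow_off left_op_def)
 thus ?thesis unfolding mesh_def by (simp add: sum_fun_apply sc_apply)
qed

text \<open>This is (R2) with empty left context; \<open>prescribe_components\<close> gives the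
  converse.\<close>

lemma mesh_components:
 assumes l: "l \<in> D"
 shows "mesh j (\<lambda>k m. branch j k m l) = 0"
proof (rule ext, clarify)
 fix t w s
 show "mesh j (\<lambda>k m. branch j k m l) (t, w, s) = 0 (t, w, s)"
  using rel_dual_R2[OF l, of j j "[]" w s]
  by (cases "t = j") (simp_all add: fun_app mesh_off mesh_at left_op_def left_op_pow_at)
qed

text \<open>A path with a letter \<open>Alpha\<close> starts with \<open>eps a j\<close> and some
  \<open>Alpha j k\<close>. If \<open>a\<close> is at least \<open>E j k\<close>, relation (R1)
  moves \<open>E j k\<close> of these loops across the arrow; so the components with
  \<open>m < E j k\<close> determine all values.\<close>

lemma components_determine:
 assumes l: "l \<in> D" and comp: "\<And>k m. adj C j k ==> m < E j k ==> branch j k m l = 0"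
  and w: "cnt w ~= 0"
 shows "l (j, w, s) = 0"
proof (rule ccontr)
 assume nz: "l (j, w, s) ~= 0"
 hence "is_path C (j, w, s)" using rel_dual_path[OF l] by blast
 from cnt_pos_split[OF this w] obtain a k w' where w': "w = eps a j @ Alpha j k # w'" and k: "adj C j k"
  by blast
 have "l (j, eps a j @ Alpha j k # w', s) = 0" for a w'
 proof (induction a arbitrary: w' rule: less_induct)
  case (less a)
  show ?case
  proof (cases "a < E j k")
   case True
   have "branch j k a l (k, w', s) = 0"
    by (simp add: comp[OF k True] fun_app)
   thus ?thesis by (simp add: left_op_def left_op_pow_at)
  next
   case False
   hence "eps a j = eps (a - E j k) j @ eps (E j k) j"
    by (simp flip: replicate_add)
   hence "l (j, eps a j @ Alpha j k # w', s)
     = l (j, eps (a - E j k) j @ Alpha j k # eps (E k j) k @ w', s)"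
    using rel_dual_R1[OF l k, where u = "eps (a - E j k) j"] by simp
   also have "... = 0" using less[of "a - E j k"] False E_pos[OF k] by simp
   finally show ?thesis .
  qed
 qed
 with nz w' show False by blast
qed

text \<open>Conversely, the components can be prescribed, as long as the mesh relation holds. The
 family \<open>y k a\<close> prescribes the values on the paths that start with \<open>Eps j\<close> repeated \<open>a\<close> times
 and \<open>Alpha j k\<close>.\<close>

primrec glue :: "'i => 'i arrow list => ('i => nat => 'i path => 'k) => 'i => 'k::field" where
 "glue j [] y s = 0"
| "glue j (a # w) y s = (case a of Alpha i k => if i = j \<and> adj C j k then y k 0 (k, w, s) else 0
   | Eps i => if i = j then glue j w (\<lambda>k m. y k (Suc m)) s else 0)"

lemma glue_replicate:
 "adj C j k ==> glue j (eps a j @ Alpha j k # w) y s = y k a (k, w, s)"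
 by (induction a arbitrary: y) auto

text \<open>Coinduction over all families with these three properties: stripping
  \<open>Eps j\<close> shifts the family by one, and stripping \<open>Alpha j k\<close> leaves a
  part of \<open>y k 0\<close>, which satisfies the relations already. At the left end,
  \<open>per\<close> is (R1) and \<open>mesh0\<close> is (R2).\<close>

lemma glue_D:
 fixes y :: "'i => nat => 'i path => 'k::field"
 assumes y: "\<And>k a. adj C j k ==> y k a \<in> D"
  and per: "\<And>k a. adj C j k ==> y k (a + E j k) = leps k (E k j) (y k a)"
  and mesh0: "\<And>a. mesh j (\<lambda>k m. y k (a + m)) = 0"
 shows "(\<lambda>(t, w, s). if t = j then glue j w y s else 0) \<in> D"
proof -
 define Y where "Y = {y. (\<forall>k a. adj C j k --> y k a \<in> D) \<and> (\<forall>k a. adj C j k --> y k (a + E j k) = leps k (E k j) (y k a)) \<and>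
  (\<forall>a. mesh j (\<lambda>k m. (y k (a + m) :: 'i path => 'k)) = 0)}"
 define G where "G y = (\<lambda>(t, w, s). if t = j then glue j w y s else (0::'k))" for y
 have "G y \<in> D"
 proof (rule rel_dual_coinduct[where S = "G ` Y"])
  show "G y \<in> G ` Y" using assms by (auto simp: Y_def)
 next
  fix l p assume l: "l \<in> G ` Y" "l p ~= 0"
  obtain t w s where p: "p = (t, w, s)" by (cases p)
  from l obtain y where y: "y \<in> Y" "l = G y" by auto
  with l p have "t = j" "glue j w y s ~= 0" by (auto simp: G_def split: if_splits)
  have "is_path C (j, w, s)" using \<open>glue j w y s ~= 0\<close> y(1)
  proof (induction w arbitrary: y)
   case (Cons a w)
   show ?case
   proof (cases a)
    case (Alpha i k)
    with Cons show ?thesis using rel_dual_path[of "y k 0" C \<omega> "(k, w, s)"]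
     by (auto simp: Y_def split: if_splits)
   next
    case (Eps i)
    have "(\<lambda>k m. y k (Suc m)) \<in> Y" using Cons(3) by (auto simp: Y_def simp flip: add_Suc)
    with Cons Eps show ?thesis by (auto split: if_splits)
   qed
  qed auto
  with p \<open>t = j\<close> show "is_path C p" by simp
 next
  fix l i k w s assume "l \<in> G ` Y" and adj: "adj C i k"
  then obtain y where y: "y \<in> Y" "l = G y" by auto
  show "l (i, eps (E i k) i @ Alpha i k # w, s) = l (i, Alpha i k # eps (E k i) k @ w, s)"
  proof (cases "i = j")
   case True
   have "y k (0 + E j k) = leps k (E k j) (y k 0)"
    using y(1) adj True unfolding Y_def by blast
   thus ?thesis using adj True by (simp add: y(2) G_def glue_replicate left_op_pow_at)
  qed (simp add: y(2) G_def)
 next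
  fix l i w s assume "l \<in> G ` Y"
  then obtain y where y: "y \<in> Y" "l = G y" by auto
  show "(\<Sum>k | adj C i k. \<Sum>m<E i k. of_int (\<omega> i k) *
    l (i, eps m i @ Alpha i k # Alpha k i #
       eps (E i k - 1 - m) i @ w, s)) = 0"
  proof (cases "i = j")
   case True
   have "mesh j (\<lambda>k m. y k (0 + m)) = 0" using y(1) unfolding Y_def by blast
   hence "mesh j y (j, w, s) = 0" by (simp add: fun_app)
   thus ?thesis by (simp add: True y(2) G_def glue_replicate mesh_at)
  qed (simp add: y(2) G_def)
 next
  fix l a assume "l \<in> G ` Y"
  then obtain y where y: "y \<in> Y" "l = G y" by auto
  show "left_op a l \<in> G ` Y \<or> left_op a l \<in> D"
  proof (cases a)
   case (Alpha i k)
   show ?thesis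
   proof (cases "i = j \<and> adj C j k")
    case True
    hence "left_op a l = tgt_part k (y k 0)"
     by (auto simp: Alpha y(2) G_def left_op_def tgt_part_apply fun_eq_iff)
    with True y(1) show ?thesis by (auto simp: Y_def intro: tgt_part_D)
   next
    case False
    hence "left_op a l = 0" by (auto simp: Alpha y(2) G_def left_op_def fun_eq_iff fun_app)
    thus ?thesis by (simp add: fv.subspace_0[OF D_subspace])
   qed
  next
   case (Eps i)
   show ?thesis
   proof (cases "i = j")
    case True
    hence "left_op a l = G (\<lambda>k m. y k (Suc m))"
     by (auto simp: Eps y(2) G_def left_op_def fun_eq_iff)
    moreover have "(\<lambda>k m. y k (Suc m)) \<in> Y" using y(1) by (auto simp: Y_def simp flip: add_Suc)
    ultimately show ?thesis by auto
   next
    case False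
    hence "left_op a l = 0" by (auto simp: Eps y(2) G_def left_op_def fun_eq_iff fun_app)
    thus ?thesis by (simp add: fv.subspace_0[OF D_subspace])
   qed
  qed
 qed (auto intro: E_pos)
 thus ?thesis by (simp add: G_def)
qed

text \<open>The action of \<open>Eps j\<close> on the source of the transposed mesh map.\<close>

definition mesh_shift :: "'i => ('i => nat => 'i path => 'k::field) => 'i => nat => 'i path => 'k" where
 "mesh_shift j x k m = (if Suc m < E j k then x k (Suc m) else (leps k (E k j)) (x k 0))"

lemma mesh_cong: "(\<And>k m. adj C j k ==> m < E j k ==> x k m = y k m) ==> mesh j x = mesh j y"
 unfolding mesh_def by (intro sum.cong refl) auto

text \<open>One more loop raises each exponent \<open>E j k - 1 - m\<close> by one, which amounts to
  a shift of \<open>m\<close>. The term at \<open>m = 0\<close> then carries \<open>E j k\<close>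
  loops and re-enters at the other end by (R1), in the form \<open>left_op_eps_mult\<close>.\<close>

lemma mesh_mesh_shift:
 fixes x :: "'i => nat => 'i path => 'k::field"
 assumes x: "\<And>k m. x k m \<in> D"
 shows "mesh j (mesh_shift j x) = left_op (Eps j) (mesh j x)"
proof -
 interpret Lj: Vector_Spaces.linear sc sc "left_op (Eps j) :: ('i path => 'k) => _" by (rule left_op_linear)
 let ?t = "\<lambda>k b y. leps j b (left_op (Alpha k j) y)"
 have "(\<Sum>m<E j k. ?t k (E j k - 1 - m) (mesh_shift j x k m)) = (\<Sum>m<E j k. left_op (Eps j) (?t k (E j k - 1 - m) (x k m)))"
  if k: "adj C j k" for k
 proof -
  obtain f where f: "E j k = Suc f" using E_pos[OF k] by (cases "E j k") auto
  have "(\<Sum>m<E j k. ?t k (E j k - 1 - m) (mesh_shift j x k m))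
    = (\<Sum>m<f. ?t k (f - m) (x k (Suc m))) + ?t k 0 (leps k (E k j) (x k 0))"
   by (simp add: f mesh_shift_def)
  also have "?t k 0 (leps k (E k j) (x k 0)) = ?t k (Suc f) (x k 0)"
   using left_op_eps_mult[OF x k, of k 0] f by (simp del: funpow.simps)
  also have "(\<Sum>m<f. ?t k (f - m) (x k (Suc m))) + ?t k (Suc f) (x k 0) = (\<Sum>m<Suc f. ?t k (Suc f - m) (x k m))"
   by (simp add: sum.lessThan_Suc_shift add.commute del: funpow.simps sum.lessThan_Suc)
  also have "... = (\<Sum>m<E j k. left_op (Eps j) (?t k (E j k - 1 - m) (x k m)))"
   unfolding f by (intro sum.cong refl) (simp add: Suc_diff_le)
  finally show ?thesis .
 qed
 thus ?thesis
  unfolding mesh_def fv.scale_sum_right[symmetric] Lj.sum Lj.scale by (intro sum.cong refl) simp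
qed

text \<open>(R1) dictates how the components with \<open>m < E j k\<close> continue to all
  exponents. The mesh relation, assumed at exponent 0, then holds at all exponents since the
  transposed mesh map commutes with \<open>Eps j\<close>.\<close>

lemma prescribe_components:
 fixes x :: "'i => nat => 'i path => 'k::field"
 assumes x: "\<And>k m. x k m \<in> D" and mesh0: "mesh j x = 0"
 obtains l where "l \<in> D" "\<And>k m. adj C j k ==> m < E j k ==> branch j k m l = tgt_part k (x k m)"
  "tgt_part j l = l"
proof -
 \<comment> \<open>Division with remainder: each full block of \<open>E j k\<close> loops at
   \<open>j\<close> becomes a block of \<open>E k j\<close> loops at \<open>k\<close>.\<close>
 define y where "y k a = leps k ((E k j * (a div E j k))) (x k (a mod E j k))" for k a
 have yD: "y k a \<in> D" for k a unfolding y_def by (intro left_op_pow_D x)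
 have per: "y k (a + E j k) = leps k (E k j) (y k a)" if "adj C j k" for k a
  using E_pos[OF that] by (simp add: y_def funpow_add)
 have y0: "y k m = x k m" if "m < E j k" for k m using that by (simp add: y_def)
 interpret Lj: Vector_Spaces.linear sc sc "left_op (Eps j) :: ('i path => 'k) => _" by (rule left_op_linear)
 have mesh_y: "mesh j (\<lambda>k m. y k (a + m)) = 0" for a
 proof (induction a)
  case 0
  have "mesh j (\<lambda>k m. y k (0 + m)) = mesh j x" by (rule mesh_cong) (simp add: y0)
  thus "mesh j (\<lambda>k m. y k (0 + m)) = 0" using mesh0 by simp
 next
  case (Suc a)
  have "mesh j (\<lambda>k m. y k (Suc a + m)) = mesh j (mesh_shift j (\<lambda>k m. y k (a + m)))"
  proof (rule mesh_cong)
   fix k m assume k: "adj C j k" "m < E j k"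
   have "y k (Suc a + m) = y k (a + E j k)" if "\<not> Suc m < E j k"
   proof -
    have "E j k = Suc m" using that k(2) by simp
    thus ?thesis by simp
   qed
   thus "y k (Suc a + m) = mesh_shift j (\<lambda>k m. y k (a + m)) k m"
    unfolding mesh_shift_def using per[OF k(1), of a] by simp
  qed
  also have "... = left_op (Eps j) 0" unfolding mesh_mesh_shift[OF yD] Suc ..
  finally show "mesh j (\<lambda>k m. y k (Suc a + m)) = 0" unfolding Lj.zero .
 qed
 define l where "l = (\<lambda>(t, w, s). if t = j then glue j w y s else 0)"
 show ?thesis
 proof (rule that[of l])
  show "l \<in> D" unfolding l_def by (rule glue_D[OF yD per mesh_y])
  show "branch j k m l = tgt_part k (x k m)" if "adj C j k" "m < E j k" for k m
  proof (rule ext, clarify)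
   fix t w s show "branch j k m l (t, w, s) = tgt_part k (x k m) (t, w, s)"
    using that by (simp add: left_op_def tgt_part_apply left_op_pow_at l_def glue_replicate y0)
  qed
  show "tgt_part j l = l" by (auto simp: fun_eq_iff tgt_part_apply l_def)
 qed
qed

text \<open>The sum of the powers \<open>r div d i\<close> of the loops is central: for an edge
  between \<open>t\<close> and \<open>k\<close>, the two powers are obtained from those in (R1) by
  the common factor \<open>r div max (d t) (d k)\<close>, so (R1) is applied that many
  times.\<close>

lemma centrality:
 assumes l: "l \<in> D" and "is_path C (t, w, s)"
 shows "l (t, eps (r div d t) t @ w, s) = l (t, w @ eps (r div d s) s, s)"
 using assms
proof (induction w arbitrary: t l)
 case Nil
 thus ?case by simp
next
 case (Cons a w)
 have IH: "l (tgt a, a # eps (r div d (src a)) (src a) @ w, s) = l (tgt a, a # w @ eps (r div d s) s, s)"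
  using Cons.IH[of "left_op a l" "src a"] Cons.prems by (simp add: left_op_def left_op_D[unfolded left_op_def])
 show ?case
 proof (cases a)
  case (Eps i)
  thus ?thesis using IH Cons.prems by (simp add: replicate_app_Cons_same)
 next
  case (Alpha i k)
  with Cons.prems have adj: "adj C t k" and i: "i = t" by auto
  define m where "m = r div max (d t) (d k)"
  have "max (d t) (d k) dvd r" using d_dvd by (simp add: max_def)
  hence r: "r = max (d t) (d k) * m" by (simp add: m_def)
  have c: "r div d t = E t k * m" "r div d k = E k t * m"
  proof -
   have "r = d t * (E t k * m)" "r = d k * (E k t * m)"
    using eps_mult_d[OF adj] eps_mult_d[OF adj_sym[OF adj]]
    by (simp_all add: r max.commute mult.commute flip: mult.assoc)
   thus "r div d t = E t k * m" "r div d k = E k t * m"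
    by (metis d_pos less_not_refl3 nonzero_mult_div_cancel_left)+
  qed
  have "l (t, eps (E t k * m) t @ Alpha t k # w, s) = l (t, Alpha t k # eps (E k t * m) k @ w, s)" for w
  proof (induction m arbitrary: w)
   case (Suc m)
   have "eps (E t k * Suc m) t = eps (E t k * m) t @ eps (E t k) t"
    "eps (E k t * Suc m) k = eps (E k t * m) k @ eps (E k t) k"
    by (simp_all add: add.commute flip: replicate_add)
   thus ?case
    using Suc.IH[of "eps (E k t) k @ w"] rel_dual_R1[OF l adj, where u = "eps (E t k * m) t" and w = w]
    Cons.prems(1)
    by (simp add: rel_dual_R1[OF Cons.prems(1) adj])
  qed simp
  thus ?thesis using IH Alpha i by (simp add: c)
 qed
qed

section \<open>Slices: fixed source and fixed number of letters \<open>Alpha\<close>\<close>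

definition pieces :: "'i => int => ('i path => 'k::field) set" where
 "pieces i n = {l \<in> D. \<forall>t w s. l (t, w, s) ~= 0 --> s = i \<and> cnt w = n}"

definition bar_pieces :: "'i => int => ('i path => 'k::field) set" where
 "bar_pieces i n = {l \<in> pieces i n. right_op i l = 0}"

lemma pieces_D: "l \<in> pieces i n ==> l \<in> D"
 by (simp add: pieces_def)

lemma pieces_supp: "l \<in> pieces i n ==> s ~= i \<or> cnt w ~= n ==> l (t, w, s) = 0"
 by (auto simp: pieces_def)

lemma piecesI: "l \<in> D ==> (\<And>t w s. s ~= i \<or> cnt w ~= n ==> l (t, w, s) = 0) ==> l \<in> pieces i n"
 unfolding pieces_def by blast

lemma bar_pieces_pieces: "l \<in> bar_pieces i n ==> l \<in> pieces i n"
 by (simp add: bar_pieces_def)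

lemma bar_pieces_D: "l \<in> bar_pieces i n ==> l \<in> D"
 by (rule pieces_D[OF bar_pieces_pieces])

lemma bar_pieces_right:
 assumes "l \<in> bar_pieces i n" shows "l (t, w @ [Eps i], i) = 0"
proof -
 have "right_op i l (t, w, i) = 0" using assms by (simp add: bar_pieces_def fun_app)
 thus ?thesis by (simp add: right_op_def)
qed

lemma pieces_subspace: "fv.subspace (pieces i n :: ('i path => 'k::field) set)"
proof (rule fv.subspaceI)
 show "0 \<in> pieces i n" by (rule piecesI) (auto simp: fv.subspace_0[OF D_subspace] fun_app)
 show "x + y \<in> pieces i n" if "x \<in> pieces i n" "y \<in> pieces i n" for x y :: "'i path => 'k"
  by (rule piecesI) (use that in \<open>auto intro: fv.subspace_add[OF D_subspace] pieces_D simp: fun_app pieces_supp\<close>)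
 show "sc c x \<in> pieces i n" if "x \<in> pieces i n" for c and x :: "'i path => 'k"
  by (rule piecesI) (use that in \<open>auto intro: fv.subspace_scale[OF D_subspace] pieces_D simp: fun_app pieces_supp\<close>)
qed

lemma bar_pieces_subspace: "fv.subspace (bar_pieces i n :: ('i path => 'k::field) set)"
proof -
 interpret L: Vector_Spaces.linear sc sc "right_op i :: ('i path => 'k) => _" by (rule right_op_linear)
 show ?thesis
  by (rule fv.subspaceI)
    (auto simp: bar_pieces_def L.zero L.add L.scale
     intro: fv.subspace_0 fv.subspace_add fv.subspace_scale pieces_subspace)
qed

lemma left_eps_pieces: "l \<in> pieces i n ==> left_op (Eps j) l \<in> pieces i n"
 by (rule piecesI, erule left_op_D[OF pieces_D], auto simp: left_op_def pieces_supp)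

lemma left_alpha_pieces: "l \<in> pieces i n ==> left_op (Alpha k j) l \<in> pieces i (n - 1)"
 by (rule piecesI, erule left_op_D[OF pieces_D], auto simp: left_op_def pieces_supp)

lemma tgt_part_pieces: "l \<in> pieces i n ==> tgt_part j l \<in> pieces i n"
 by (rule piecesI, erule tgt_part_D[OF pieces_D], auto simp: tgt_part_apply pieces_supp)

lemma right_left_op: "right_op i (left_op a l) = left_op a (right_op i l)"
 by (auto simp: right_op_def left_op_def fun_eq_iff)

lemma right_tgt_part: "right_op i (tgt_part j l) = tgt_part j (right_op i l)"
 by (auto simp: right_op_def tgt_part_apply fun_eq_iff)

lemma right_pieces: "l \<in> pieces i n ==> right_op i l \<in> pieces i n"
 by (rule piecesI, erule right_op_D[OF pieces_D], auto simp: right_op_def pieces_supp)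

lemma left_op_zero [simp]: "left_op a 0 = 0" and right_op_zero [simp]: "right_op i 0 = 0"
 and tgt_part_zero [simp]: "tgt_part j 0 = 0"
 by (auto simp: fun_eq_iff left_op_def right_op_def tgt_part_apply fun_app)

lemma left_eps_bar: "l \<in> bar_pieces i n ==> left_op (Eps j) l \<in> bar_pieces i n"
 by (simp add: bar_pieces_def left_eps_pieces right_left_op)

lemma left_alpha_bar: "l \<in> bar_pieces i n ==> left_op (Alpha k j) l \<in> bar_pieces i (n - 1)"
 by (simp add: bar_pieces_def left_alpha_pieces right_left_op)

lemma tgt_part_bar: "l \<in> bar_pieces i n ==> tgt_part j l \<in> bar_pieces i n"
 by (simp add: bar_pieces_def tgt_part_pieces right_tgt_part)

lemma left_eps_pow_bar: "l \<in> bar_pieces i n ==> leps j m l \<in> bar_pieces i n"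
 by (induction m) (auto intro: left_eps_bar)

lemma left_eps_pow_pieces: "l \<in> pieces i n ==> leps j m l \<in> pieces i n"
 by (induction m) (auto intro: left_eps_pieces)

lemma mesh_pieces: "(\<And>k m. x k m \<in> pieces i n) ==> mesh j x \<in> pieces i (n - 1)"
 unfolding mesh_def
 by (intro fv.subspace_sum fv.subspace_scale pieces_subspace left_eps_pow_pieces left_alpha_pieces) auto

lemma mesh_bar: "(\<And>k m. x k m \<in> bar_pieces i n) ==> mesh j x \<in> bar_pieces i (n - 1)"
 unfolding mesh_def
 by (intro fv.subspace_sum fv.subspace_scale bar_pieces_subspace left_eps_pow_bar left_alpha_bar) auto

lemma pieces_negative:
 assumes n: "n < 0"
 shows "pieces i n = {0 :: 'i path => 'k::field}"
proof -
 have "l = 0" if "l \<in> pieces i n" for l :: "'i path => 'k"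
 proof (rule ext, clarify)
  fix t w s show "l (t, w, s) = 0 (t, w, s)"
   using pieces_supp[OF that, of s w t] n cnt_nonneg[of w] by (auto simp: fun_app)
 qed
 thus ?thesis using fv.subspace_0[OF pieces_subspace] by blast
qed

lemma pieces_determine:
 assumes l: "l \<in> pieces i n" and n: "n >= 1"
  and comp: "\<And>k m. adj C j k ==> m < E j k ==> branch j k m l = 0"
 shows "tgt_part j l = 0"
proof (rule ext, clarify)
 fix t w s
 have "l (j, w, s) = 0"
 proof (cases "cnt w = 0")
  case True
  thus ?thesis using pieces_supp[OF l] n by auto
 next
  case False
  show ?thesis by (rule components_determine[OF pieces_D[OF l] comp False])
 qed
 thus "tgt_part j l (t, w, s) = 0 (t, w, s)" by (simp add: tgt_part_apply fun_app)
qed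

lemma prescribe_pieces:
 fixes x :: "'i => nat => 'i path => 'k::field"
 assumes x: "\<And>k m. x k m \<in> pieces i n" and n: "n >= 0" and mesh0: "mesh j x = 0"
 obtains l where "l \<in> pieces i (n + 1)" "tgt_part j l = l"
  "\<And>k m. adj C j k ==> m < E j k ==> branch j k m l = tgt_part k (x k m)"
proof -
 obtain l where l: "l \<in> D" "\<And>k m. adj C j k ==> m < E j k ==> branch j k m l = tgt_part k (x k m)"
  "tgt_part j l = l"
  using prescribe_components[OF pieces_D[OF x] mesh0] by blast
 define l' where "l' = restr d (\<lambda>t c v s. c = n + 1 \<and> s = i) l"
 have l'_apply: "l' (t, w, s) = (if cnt w = n + 1 \<and> s = i then l (t, w, s) else 0)" for t w s
  by (simp add: l'_def restr_def)
 show ?thesis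
 proof (rule that[of l'])
  show "l' \<in> pieces i (n + 1)"
   using restr_D[OF l(1)] by (auto simp: pieces_def l'_apply) (simp add: l'_def)
  have "l (t, w, s) = 0" if "t ~= j" for t w s
   using fun_cong[OF l(3), of "(t, w, s)"] that by (simp add: tgt_part_apply)
  thus "tgt_part j l' = l'" by (auto simp: fun_eq_iff tgt_part_apply l'_apply)
  show "branch j k m l' = tgt_part k (x k m)" if "adj C j k" "m < E j k" for k m
  proof (rule ext, clarify)
   fix t w s
   show "branch j k m l' (t, w, s) = tgt_part k (x k m) (t, w, s)"
    using fun_cong[OF l(2)[OF that], of "(t, w, s)"] pieces_supp[OF x, of s w k m t]
    by (auto simp: left_op_def left_op_pow_at tgt_part_apply l'_apply)
  qed
 qed
qed

text \<open>Taking components commutes with \<open>right_op i\<close>. So if \<open>l\<close> is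
  glued from functions killed by \<open>right_op i\<close>, then \<open>right_op i l\<close> has
  zero components; it lives on paths with at least one letter \<open>Alpha\<close>, hence
  vanishes.\<close>

lemma prescribe_bar:
 fixes x :: "'i => nat => 'i path => 'k::field"
 assumes x: "\<And>k m. x k m \<in> bar_pieces i n" and n: "n >= 0" and mesh0: "mesh j x = 0"
 obtains l where "l \<in> bar_pieces i (n + 1)" "tgt_part j l = l"
  "\<And>k m. adj C j k ==> m < E j k ==> branch j k m l = tgt_part k (x k m)"
proof -
 obtain l where l: "l \<in> pieces i (n + 1)" "tgt_part j l = l"
  "\<And>k m. adj C j k ==> m < E j k ==> branch j k m l = tgt_part k (x k m)"
  using prescribe_pieces[OF bar_pieces_pieces[OF x] n mesh0] by metis
 have r: "right_op i (leps j m l) = leps j m (right_op i l)" for m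
  by (induction m) (simp_all add: right_left_op)
 have "tgt_part j (right_op i l) = 0"
 proof (rule pieces_determine[OF right_pieces[OF l(1)]])
  fix k m assume k: "adj C j k" "m < E j k"
  have "branch j k m (right_op i l) = right_op i (tgt_part k (x k m))"
   unfolding l(3)[OF k, symmetric] right_left_op r ..
  also have "... = 0" using x[of k m] by (simp add: right_tgt_part bar_pieces_def)
  finally show "branch j k m (right_op i l) = 0" .
 qed (use n in simp)
 hence "l \<in> bar_pieces i (n + 1)" using l(1,2) by (simp add: bar_pieces_def flip: right_tgt_part)
 with l show ?thesis using that by blast
qed

text \<open>Centrality moves the loops to the right end of the word, where a single
  \<open>Eps i\<close> kills \<open>l\<close>.\<close>

lemma left_eps_nilpotent:
 assumes l: "l \<in> bar_pieces i n"
 shows "leps j (r div d j) l = 0"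
proof (rule ext, clarify)
 have pos: "r div d t > 0" for t using d_dvd[of t] d_pos[of t] r_pos by (simp add: dvd_imp_le div_greater_zero_iff)
 fix t w s
 show "leps j (r div d j) l (t, w, s) = 0 (t, w, s)"
 proof (cases "t = j \<and> is_path C (j, w, s) \<and> s = i")
  case False
  moreover have "is_path C (j, w, s)" if "is_path C (j, eps m j @ w, s)" for m
   using that by (induction m) auto
  ultimately show ?thesis
   using pos[of j] rel_dual_path[OF bar_pieces_D[OF l], of "(j, eps (r div d j) j @ w, s)"]
    pieces_supp[OF bar_pieces_pieces[OF l], of s]
   by (cases "t = j") (auto simp: left_op_pow_off left_op_pow_at fun_app)
 next
  case True
  have "w @ eps (r div d i) i = (w @ eps (r div d i - 1) i) @ [Eps i]"
   using pos[of i] by (cases "r div d i") (simp_all add: replicate_append_same flip: replicate_Suc)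
  hence "l (j, w @ eps (r div d i) i, i) = 0"
   using bar_pieces_right[OF l] by metis
  thus ?thesis using True centrality[OF bar_pieces_D[OF l], of j w s] by (auto simp: left_op_pow_at fun_app)
 qed
qed

end

section \<open>Endomorphisms of slices and surjectivity of the mesh maps\<close>

locale gpa_over = gpa C \<omega> d r for C :: "'i::finite => 'i => int" and \<omega> d r +
 fixes K :: "'k::field itself"
begin

abbreviation B :: "'i => int => ('i path => 'k) set" where "B \<equiv> bar_pieces"

text \<open>Endomorphisms over the subalgebra generated by the idempotents, which act by
  \<open>tgt_part\<close>, and the loops. All conditions are confined to \<open>B i n\<close>
  because \<open>f\<close> is a total function.\<close>

definition equivariant :: "'i => int => (('i path => 'k) => ('i path => 'k)) => bool" where
 "equivariant i n f \<longleftrightarrow> (\<forall>x\<in>B i n. f x \<in> B i n) \<and>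
   (\<forall>x\<in>B i n. \<forall>y\<in>B i n. f (x + y) = f x + f y) \<and> (\<forall>c. \<forall>x\<in>B i n. f (sc c x) = sc c (f x)) \<and>
   (\<forall>j. \<forall>x\<in>B i n. f (tgt_part j x) = tgt_part j (f x)) \<and>
   (\<forall>j. \<forall>x\<in>B i n. f (left_op (Eps j) x) = left_op (Eps j) (f x))"

text \<open>An endomorphism of the subquotient of the dual module that consists of the slices
  \<open>n - 1\<close> and \<open>n\<close>; the letters \<open>Alpha\<close> lead from slice
  \<open>n\<close> to slice \<open>n - 1\<close>.\<close>

definition slice_endo :: "'i => int => (('i path => 'k) => ('i path => 'k)) => (('i path => 'k) => ('i path => 'k)) => bool" where
 "slice_endo i n f g \<longleftrightarrow> equivariant i (n - 1) f \<and> equivariant i n g \<and>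
   (\<forall>j k. adj C k j --> (\<forall>x\<in>B i n. left_op (Alpha k j) (g x) = f (left_op (Alpha k j) x)))"

definition brick :: "'i => int => bool" where
 "brick i n \<longleftrightarrow> (\<forall>f g. slice_endo i n f g -->
   (\<exists>c. (\<forall>x\<in>B i (n - 1). f x = sc c x) \<and> (\<forall>x\<in>B i n. g x = sc c x)))"

definition onto :: "'i => int => bool" where
 "onto i n \<longleftrightarrow> (\<forall>j. \<forall>y\<in>B i (n - 1). tgt_part j y = y -->
   (\<exists>x. (\<forall>k m. x k m \<in> B i n) \<and> mesh j x = y))"

lemma equivariantD:
 assumes "equivariant i n f" "x \<in> B i n"
 shows "f x \<in> B i n" "y \<in> B i n ==> f (x + y) = f x + f y" "f (sc c x) = sc c (f x)"
  "f (tgt_part j x) = tgt_part j (f x)" "f (left_op (Eps j) x) = left_op (Eps j) (f x)"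
 using assms by (auto simp: equivariant_def)

lemma equivariant_zero: "equivariant i n f ==> f 0 = 0"
 using equivariantD(3)[of i n f 0 0, OF _ fv.subspace_0[OF bar_pieces_subspace]] by (simp add: fv.scale_zero_left)

lemma equivariant_pow:
 assumes "equivariant i n f" "x \<in> B i n"
 shows "f (leps j m x) = leps j m (f x)"
 using assms by (induction m) (simp_all add: equivariantD(5) left_eps_pow_bar)

lemmas B_simps [simp] = fv.subspace_0[OF bar_pieces_subspace] fv.subspace_add[OF bar_pieces_subspace]
 fv.subspace_scale[OF bar_pieces_subspace] fv.subspace_diff[OF bar_pieces_subspace]
 fv.subspace_neg[OF bar_pieces_subspace]

lemmas left_op_add = fvv.linear_add[OF left_op_linear]
 and left_op_scale = fvv.linear_scale[OF left_op_linear]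
 and left_op_diff = fvv.linear_diff[OF left_op_linear]
 and left_pow_add = fvv.linear_add[OF funpow_linear[OF left_op_linear]]
 and left_pow_scale = fvv.linear_scale[OF funpow_linear[OF left_op_linear]]
 and left_pow_diff = fvv.linear_diff[OF funpow_linear[OF left_op_linear]]
 and left_pow_zero = fvv.linear_0[OF funpow_linear[OF left_op_linear]]
 and tgt_part_add = fvv.linear_add[OF tgt_part_linear]
 and tgt_part_scale = fvv.linear_scale[OF tgt_part_linear]
 and tgt_part_diff = fvv.linear_diff[OF tgt_part_linear]
 and tgt_part_sum = fvv.linear_sum[OF tgt_part_linear]

lemma mesh_add: "mesh j (\<lambda>k m. x k m + y k m) = mesh j x + mesh j (y :: 'i => nat => 'i path => 'k)"
 by (simp add: mesh_def left_op_add left_pow_add fv.scale_right_distrib sum.distrib)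

lemma mesh_diff: "mesh j (\<lambda>k m. x k m - y k m) = mesh j x - mesh j (y :: 'i => nat => 'i path => 'k)"
 by (simp add: mesh_def left_op_diff left_pow_diff fv.scale_right_diff_distrib sum_subtractf)

lemma mesh_scale: "mesh j (\<lambda>k m. sc c (x k m)) = sc c (mesh j (x :: 'i => nat => 'i path => 'k))"
 by (simp add: mesh_def left_op_scale left_pow_scale fv.scale_sum_right mult.commute)

lemma mesh_zero: "mesh j (\<lambda>k m. 0) = (0 :: 'i path => 'k)"
 by (simp add: mesh_def left_pow_zero)

lemma mesh_tgt_part: "mesh j (\<lambda>k m. tgt_part k (x k m)) = mesh j (x :: 'i => nat => 'i path => 'k)"
proof -
 have "left_op (Alpha k j) (tgt_part k y) = left_op (Alpha k j) y" for k and y :: "'i path => 'k"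
  by (auto simp: fun_eq_iff left_op_def tgt_part_apply)
 thus ?thesis by (simp add: mesh_def)
qed

lemma tgt_part_mesh: "tgt_part j (mesh k x) = (if j = k then mesh k x else (0 :: 'i path => 'k))"
 by (auto simp: fun_eq_iff tgt_part_apply mesh_off fun_app)

lemma tgt_part_idem: "tgt_part j (tgt_part k x) = (if j = k then tgt_part j x else (0 :: 'i path => 'k))"
 by (auto simp: fun_eq_iff tgt_part_apply fun_app)

lemma tgt_part_total: "(\<Sum>j\<in>UNIV. tgt_part j x) = (x :: 'i path => 'k)"
proof (rule ext, clarify)
 fix t w s show "(\<Sum>j\<in>UNIV. tgt_part j x) (t, w, s) = x (t, w, s)"
  by (simp add: sum_fun_apply tgt_part_apply)
qed

lemma tgt_part_eps: "tgt_part j (left_op (Eps k) x) = (if j = k then left_op (Eps k) x else (0 :: 'i path => 'k))"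
 "left_op (Eps k) (tgt_part j x) = (if j = k then left_op (Eps k) x else 0)"
 by (auto simp: fun_eq_iff tgt_part_apply fun_app left_op_def)

lemma tgt_part_alpha: "tgt_part j (left_op (Alpha l k) x) = (if j = k then left_op (Alpha l k) x else (0 :: 'i path => 'k))"
 "left_op (Alpha l k) (tgt_part j x) = (if j = l then left_op (Alpha l k) x else 0)"
 by (auto simp: fun_eq_iff tgt_part_apply fun_app left_op_def)

lemma sign_square: "adj C j k ==> (of_int (\<omega> j k) :: 'k) * of_int (\<omega> j k) = 1"
 using sign[of j k] by auto

text \<open>For \<open>m = E j k - 1\<close> no loops are left in the mesh map, and the sign squares
  to 1. Hence the image of a slice under \<open>left_op (Alpha k j)\<close> is contained in the
  image of the mesh map at \<open>j\<close>.\<close>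

lemma mesh_single:
 assumes k: "adj C j k"
 shows "mesh j (\<lambda>k' m. if k' = k \<and> m = E j k - 1 then sc (of_int (\<omega> j k)) x else 0)
   = left_op (Alpha k j) (x :: 'i path => 'k)"
proof -
 have "mesh j (\<lambda>k' m. if k' = k \<and> m = E j k - 1 then sc (of_int (\<omega> j k)) x else 0)
   = (\<Sum>k' | adj C j k'. \<Sum>m<E j k'. if k' = k then (if m = E j k - 1 then left_op (Alpha k j) x else 0) else 0)"
  unfolding mesh_def
  by (intro sum.cong refl) (auto simp: left_pow_zero left_op_scale fv.scale_scale sign_square[OF k])
 also have "... = (\<Sum>k' | adj C j k'. if k' = k then (\<Sum>m<E j k. if m = E j k - 1 then left_op (Alpha k j) x else 0) else 0)"
  by (intro sum.cong refl) auto
 also have "... = left_op (Alpha k j) x"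
  using k E_pos[OF k] by simp
 finally show ?thesis .
qed

lemma bar_determine:
 assumes "x \<in> B i n" "n >= 1"
  and "\<And>j k m. adj C j k ==> m < E j k ==> branch j k m x = 0"
 shows "x = 0"
proof -
 have "tgt_part j x = 0" for j
  by (rule pieces_determine[OF bar_pieces_pieces[OF assms(1)] assms(2,3)])
 thus ?thesis using tgt_part_total[of x] by simp
qed

text \<open>An endomorphism of a slice induces one of the preceding slice, as the transposed mesh maps
 are cokernels of the maps into the following slice.\<close>

lemma brick_step:
 assumes n: "n >= 0" and brick: "brick i n" and onto: "onto i n"
 shows "brick i (n + 1)"
 unfolding brick_def
proof (intro allI impI)
 fix g h assume "slice_endo i (n + 1) g h"
 hence g: "equivariant i n g" and h: "equivariant i (n + 1) h"
  and gh: "\<And>j k x. adj C k j ==> x \<in> B i (n + 1) ==> left_op (Alpha k j) (h x) = g (left_op (Alpha k j) x)"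
  by (auto simp: slice_endo_def)
 note gD = equivariantD[OF g] and hD = equivariantD[OF h]
 have comp_h: "branch j k m (h l) = g (branch j k m l)"
  if "adj C j k" "l \<in> B i (n + 1)" for j k m l
  using that by (simp add: gh left_eps_pow_bar equivariant_pow[OF h, symmetric])
 \<comment> \<open>A family in the kernel of the mesh map consists, up to \<open>tgt_part\<close>,
   of the components of some \<open>l\<close> in slice \<open>n + 1\<close>. As \<open>h\<close> is
   compatible with \<open>g\<close>, the image family belongs in the same way to \<open>h l\<close>,
   so it satisfies the mesh relation too.\<close>
 have ker: "mesh j (\<lambda>k m. g (x k m)) = 0" if x: "\<And>k m. x k m \<in> B i n" and "mesh j x = 0" for j x
 proof -
  obtain l where l: "l \<in> B i (n + 1)" "tgt_part j l = l"
   "\<And>k m. adj C j k ==> m < E j k ==> branch j k m l = tgt_part k (x k m)"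
   by (rule prescribe_bar[OF x n \<open>mesh j x = 0\<close>], rule that)
  have "0 = mesh j (\<lambda>k m. branch j k m (h l))"
   by (rule mesh_components[OF bar_pieces_D[OF hD(1)[OF l(1)]], symmetric])
  also have "... = mesh j (\<lambda>k m. tgt_part k (g (x k m)))"
   by (rule mesh_cong) (simp add: comp_h l gD(4) x)
  finally show ?thesis by (simp add: mesh_tgt_part)
 qed
 have wd: "mesh j (\<lambda>k m. g (x k m)) = mesh j (\<lambda>k m. g (x' k m))"
  if x: "\<And>k m. x k m \<in> B i n" and x': "\<And>k m. x' k m \<in> B i n" and "mesh j x = mesh j x'" for j x x'
 proof -
  have "g (x k m - x' k m) = g (x k m) - g (x' k m)" for k m
   using gD(2)[of "x k m - x' k m" "x' k m"] x x' by simp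
  thus ?thesis using ker[of "\<lambda>k m. x k m - x' k m" j] that by (simp add: mesh_diff)
 qed
 have ex_X: "\<exists>x. (\<forall>k m. x k m \<in> B i n) \<and> mesh j x = tgt_part j y" if "y \<in> B i (n - 1)" for j y
  using onto that unfolding onto_def by (simp add: tgt_part_bar tgt_part_idem)
 define X where "X j y = (SOME x. (\<forall>k m. x k m \<in> B i n) \<and> mesh j x = tgt_part j y)" for j y
 have "(\<forall>k m. X j y k m \<in> B i n) \<and> mesh j (X j y) = tgt_part j y" if "y \<in> B i (n - 1)" for j y
  using someI_ex[OF ex_X[OF that, of j]] unfolding X_def .
 hence X: "\<And>j y k m. y \<in> B i (n - 1) ==> X j y k m \<in> B i n"
  and mesh_X: "\<And>j y. y \<in> B i (n - 1) ==> mesh j (X j y) = tgt_part j y"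
  by blast+
 \<comment> \<open>The induced map sends \<open>mesh j x\<close> to the mesh image of the family of
   all \<open>g (x k m)\<close>; by \<open>wd\<close> this is independent of the chosen preimage
   \<open>X j y\<close>.\<close>
 define M where "M j y = mesh j (\<lambda>k m. g (X j y k m))" for j y
 have M: "M j y = mesh j (\<lambda>k m. g (x k m))"
  if "y \<in> B i (n - 1)" "\<And>k m. x k m \<in> B i n" "mesh j x = tgt_part j y" for j y x
  unfolding M_def by (rule wd) (use that X mesh_X in auto)
 define f where "f y = (\<Sum>j\<in>UNIV. M j y)" for y
 have M_zero: "M k y = 0" if "y \<in> B i (n - 1)" "tgt_part k y = 0" for k y
  using M[of y "\<lambda>k m. 0" k] that by (simp add: equivariant_zero[OF g] mesh_zero)
 have M_tgt: "M j (tgt_part j y) = M j y" if "y \<in> B i (n - 1)" for j y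
  using M[of "tgt_part j y" "X j y" j] that by (simp add: tgt_part_bar mesh_X X tgt_part_idem M_def)
 have f_tgt: "f y = M j y" if "y \<in> B i (n - 1)" "tgt_part j y = y" for j y
 proof -
  have "M k y = (if k = j then M j y else 0)" for k
   using M_zero[of y k] tgt_part_idem[of k j y] that by auto
  hence "f y = (\<Sum>k\<in>UNIV. if k = j then M j y else 0)" unfolding f_def by (intro sum.cong refl)
  also have "... = M j y" by simp
  finally show ?thesis .
 qed
 have "slice_endo i n f g"
  unfolding slice_endo_def
 proof (intro conjI allI impI ballI)
  show "equivariant i (n - 1) f"
   unfolding equivariant_def
  proof (intro conjI allI impI ballI)
   fix x assume x: "x \<in> B i (n - 1)"
   show "f x \<in> B i (n - 1)"
    unfolding f_def M_def by (intro fv.subspace_sum bar_pieces_subspace mesh_bar gD X x)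
   show "f (x + y) = f x + f y" if y: "y \<in> B i (n - 1)" for y
   proof -
    have "M j (x + y) = M j x + M j y" for j
     using M[of "x + y" "\<lambda>k m. X j x k m + X j y k m" j] x y
     by (simp add: X mesh_X mesh_add tgt_part_add gD M_def)
    thus ?thesis by (simp add: f_def sum.distrib)
   qed
   show "f (sc c x) = sc c (f x)" for c
   proof -
    have "M j (sc c x) = sc c (M j x)" for j
     using M[of "sc c x" "\<lambda>k m. sc c (X j x k m)" j] x
     by (simp add: X mesh_X mesh_scale tgt_part_scale gD M_def)
    thus ?thesis by (simp add: f_def fv.scale_sum_right)
   qed
   show "f (tgt_part j x) = tgt_part j (f x)" for j
   proof -
    have "tgt_part j (f x) = (\<Sum>k\<in>UNIV. if k = j then M j x else 0)"
     unfolding f_def tgt_part_sum by (intro sum.cong refl) (auto simp: M_def tgt_part_mesh)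
    also have "... = M j x" by simp
    finally show ?thesis using f_tgt[of "tgt_part j x" j] x by (simp add: tgt_part_bar tgt_part_idem M_tgt)
   qed
   show "f (left_op (Eps j) x) = left_op (Eps j) (f x)" for j
   proof -
    have XD: "X j x k m \<in> D" "g (X j x k m) \<in> D" for k m
     by (auto intro!: bar_pieces_D gD X x)
    have "left_op (Eps j) (f x) = left_op (Eps j) (M j x)"
    proof -
     have "left_op (Eps j) (f x) = (\<Sum>k\<in>UNIV. left_op (Eps j) (M k x))"
      unfolding f_def by (rule fvv.linear_sum[OF left_op_linear])
     also have "... = (\<Sum>k\<in>UNIV. if k = j then left_op (Eps j) (M j x) else 0)"
     proof (intro sum.cong refl)
      fix k show "left_op (Eps j) (M k x) = (if k = j then left_op (Eps j) (M j x) else 0)"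
       using tgt_part_eps(2)[of j k "M k x"] by (auto simp: M_def tgt_part_mesh)
     qed
     finally show ?thesis by simp
    qed
    also have "... = mesh j (mesh_shift j (\<lambda>k m. g (X j x k m)))"
     unfolding M_def by (rule mesh_mesh_shift[symmetric]) (rule XD)
    also have "... = mesh j (\<lambda>k m. g (mesh_shift j (X j x) k m))"
     by (rule mesh_cong) (simp add: mesh_shift_def equivariant_pow[OF g] X x)
    also have "... = M j (left_op (Eps j) x)"
    proof (rule M[symmetric])
     show "mesh j (mesh_shift j (X j x)) = tgt_part j (left_op (Eps j) x)"
      using x by (simp add: mesh_mesh_shift XD mesh_X tgt_part_eps)
    qed (use x in \<open>auto simp: left_eps_bar mesh_shift_def X left_eps_pow_bar\<close>)
    also have "... = f (left_op (Eps j) x)"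
     by (rule f_tgt[symmetric]) (use x in \<open>auto simp: left_eps_bar tgt_part_eps\<close>)
    finally show ?thesis by simp
   qed
  qed
  \<comment> \<open>\<open>left_op (Alpha k j) x\<close> is the mesh image of a family whose only
    non-zero entry is a multiple of \<open>x\<close>, so \<open>f\<close> may be computed with this
    family.\<close>
  show "left_op (Alpha k j) (g x) = f (left_op (Alpha k j) x)" if "adj C k j" "x \<in> B i n" for j k x
  proof -
   have k: "adj C j k" using adj_sym that by blast
   have "f (left_op (Alpha k j) x) = M j (left_op (Alpha k j) x)"
    by (rule f_tgt) (use that in \<open>auto simp: left_alpha_bar tgt_part_alpha\<close>)
   also have "... = mesh j (\<lambda>k' m. g (if k' = k \<and> m = E j k - 1 then sc (of_int (\<omega> j k)) x else 0))"
    by (rule M) (use that k mesh_single[OF k, of x] in \<open>auto simp: left_alpha_bar tgt_part_alpha\<close>)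
   also have "... = mesh j (\<lambda>k' m. if k' = k \<and> m = E j k - 1 then sc (of_int (\<omega> j k)) (g x) else 0)"
    by (rule mesh_cong) (use that in \<open>auto simp: gD equivariant_zero[OF g]\<close>)
   also have "... = left_op (Alpha k j) (g x)" by (rule mesh_single[OF k])
   finally show ?thesis by simp
  qed
 qed (use g in auto)
 then obtain c where c: "\<And>x. x \<in> B i n ==> g x = sc c x"
  using brick unfolding brick_def by blast
 \<comment> \<open>Elements of slice \<open>n + 1\<close> are determined by their components in
   slice \<open>n\<close>, on which \<open>g\<close> is the scalar \<open>c\<close>.\<close>
 have "h x = sc c x" if x: "x \<in> B i (n + 1)" for x
 proof -
  have "h x - sc c x = 0"
  proof (rule bar_determine[of _ i "n + 1"])
   fix j k m assume k: "adj C j k" "m < E j k"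
   have "branch j k m x \<in> B i n"
    using left_alpha_bar[OF left_eps_pow_bar[OF x]] by simp
   thus "branch j k m (h x - sc c x) = 0"
    using x k by (simp add: left_pow_diff left_op_diff comp_h c left_pow_scale left_op_scale)
  qed (use n x hD in auto)
  thus ?thesis by simp
 qed
 with c show "\<exists>c. (\<forall>x\<in>B i (n + 1 - 1). g x = sc c x) \<and> (\<forall>x\<in>B i (n + 1). h x = sc c x)"
  by auto
qed

text \<open>If a transposed mesh map is not onto, then a slice has an endomorphism of rank one.\<close>

lemma brick_dichotomy:
 assumes brick: "brick i n" and not_onto: "\<not> onto i n"
 shows "B i n = {0}"
proof -
 obtain j y0 where y0: "y0 \<in> B i (n - 1)" "tgt_part j y0 = y0"
  and no: "\<And>x. (\<And>k m. x k m \<in> B i n) ==> mesh j x ~= y0"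
  using not_onto unfolding onto_def by blast
 define Z where "Z = {mesh j x | x. \<forall>k m. x k m \<in> B i n}"
 define Bj where "Bj = {u \<in> B i (n - 1). tgt_part j u = u}"
 have Z: "fv.subspace Z"
 proof (rule fv.subspaceI)
  show "0 \<in> Z" unfolding Z_def using mesh_zero[of j] by (intro CollectI exI[of _ "\<lambda>k m. 0"]) simp
  show "x + y \<in> Z" if "x \<in> Z" "y \<in> Z" for x y
  proof -
   obtain u where "x = mesh j u" "\<forall>k m. u k m \<in> B i n"
    using \<open>x \<in> Z\<close> unfolding Z_def by blast
   moreover obtain v where "y = mesh j v" "\<forall>k m. v k m \<in> B i n"
    using \<open>y \<in> Z\<close> unfolding Z_def by blast
   ultimately show ?thesis unfolding Z_def
    by (intro CollectI exI[of _ "\<lambda>k m. u k m + v k m"]) (simp add: mesh_add)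
  qed
  show "sc c x \<in> Z" if "x \<in> Z" for c x
  proof -
   obtain u where "x = mesh j u" "\<forall>k m. u k m \<in> B i n" using \<open>x \<in> Z\<close> unfolding Z_def by blast
   thus ?thesis unfolding Z_def
    by (intro CollectI exI[of _ "\<lambda>k m. sc c (u k m)"]) (simp add: mesh_scale)
  qed
 qed
 have Z_eps: "left_op (Eps j) z \<in> Z" if "z \<in> Z" for z
 proof -
  obtain x where x: "z = mesh j x" "\<And>k m. x k m \<in> B i n" using \<open>z \<in> Z\<close> unfolding Z_def by blast
  have "left_op (Eps j) z = mesh j (mesh_shift j x)"
   unfolding x(1) by (rule mesh_mesh_shift[symmetric]) (rule bar_pieces_D[OF x(2)])
  thus ?thesis unfolding Z_def using x(2) by (intro CollectI exI[of _ "mesh_shift j x"]) (simp add: mesh_shift_def left_eps_pow_bar)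
 qed
 have y0_Bj: "y0 \<in> Bj"
  using y0 by (simp add: Bj_def)
 have y0_Z: "y0 \<notin> Z" using no unfolding Z_def by blast
 have Bj: "fv.subspace Bj" by (rule fv.subspaceI) (auto simp: Bj_def tgt_part_add tgt_part_scale)
 have Bj_eps: "left_op (Eps j) u \<in> Bj" if "u \<in> Bj" for u
  using that by (auto simp: Bj_def left_eps_bar tgt_part_eps)
 \<comment> \<open>\<open>y0\<close> lies outside the image \<open>Z\<close> of the mesh map. The
   functional to be constructed must also kill the image of the loop, so an element outside
   \<open>Z2\<close> is required.\<close>
 define Z2 where "Z2 = {z + left_op (Eps j) u | z u. z \<in> Z \<and> u \<in> Bj}"
 have Z2: "fv.subspace Z2"
 proof -
  have "Z2 = {x + y | x y. x \<in> Z \<and> y \<in> left_op (Eps j) ` Bj}" by (auto simp: Z2_def)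
  thus ?thesis
   using fv.subspace_sums[OF Z fvv.linear_subspace_image[OF left_op_linear Bj]] by simp
 qed
 \<comment> \<open>Nakayama: if every element of \<open>Bj\<close> were a sum of one in
   \<open>Z\<close> and one in the image of the loop, iteration would allow any power of the loop in
   place of the loop. A power vanishes, so \<open>y0\<close> would be in \<open>Z\<close>.\<close>
 obtain y1 where y1: "y1 \<in> Bj" "y1 \<notin> Z2"
 proof (rule ccontr)
  assume "\<not> thesis"
  hence sub: "Bj \<subseteq> Z2" using that by blast
  have "\<exists>z u. x = z + leps j s u \<and> z \<in> Z \<and> u \<in> Bj" if "x \<in> Bj" for x s
  proof (induction s)
   case 0 thus ?case using that fv.subspace_0[OF Z] by (intro exI[of _ 0] exI[of _ x]) simp
  next
   case (Suc s)
   then obtain z u where zu: "x = z + leps j s u" "z \<in> Z" "u \<in> Bj" by blast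
   then obtain z' u' where zu': "u = z' + left_op (Eps j) u'" "z' \<in> Z" "u' \<in> Bj"
    using sub by (auto simp: Z2_def)
   have "leps j s z' \<in> Z" using zu'(2) by (induction s) (auto intro: Z_eps)
   thus ?case using zu zu'
    by (intro exI[of _ "z + leps j s z'"] exI[of _ u'])
      (simp add: left_pow_add funpow_swap1 fv.subspace_add[OF Z] add.assoc)
  qed
  from this[OF y0_Bj, of "r div d j"] obtain z u where
   "y0 = z + leps j (r div d j) u" "z \<in> Z" "u \<in> Bj" by blast
  thus False using y0_Z left_eps_nilpotent[of u i "n - 1" j] by (auto simp: Bj_def)
 qed
 \<comment> \<open>An element of the socle for the loop: the last non-zero power of the loop applied
   to \<open>y0\<close>.\<close>
 obtain y2 where y2: "y2 \<in> Bj" "y2 ~= 0" "left_op (Eps j) y2 = 0"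
 proof -
  have nz: "y0 ~= 0" using y0_Z fv.subspace_0[OF Z] by auto
  have "leps j (r div d j) y0 = 0" using left_eps_nilpotent[OF y0(1)] .
  then obtain s where s: "leps j s y0 = 0" "\<And>s'. s' < s ==> leps j s' y0 ~= 0"
   using exists_least_iff[of "\<lambda>s. leps j s y0 = 0"] by blast
  then obtain s' where s': "s = Suc s'" using nz by (cases s) auto
  have "leps j s' y0 \<in> Bj" by (induction s') (auto intro: Bj_eps y0_Bj)
  thus ?thesis using that s s' by auto
 qed
 obtain \<phi> where \<phi>: "functional \<phi>" "\<And>x. x \<in> Z2 ==> \<phi> x = 0" "\<phi> y1 = 1"
  by (rule functional_separate[OF Z2 y1(2)], rule that)
 note \<phi>_lin = fvk.linear_add[OF \<phi>(1)] fvk.linear_scale[OF \<phi>(1)] fvk.linear_0[OF \<phi>(1)]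
 \<comment> \<open>The endomorphism of rank one. \<open>\<phi>\<close> kills the images of the loop
   and of all arrows from slice \<open>n\<close>, and the loop kills \<open>y2\<close>; so
   \<open>f\<close> commutes with the loops and is compatible with 0 on slice
   \<open>n\<close>.\<close>
 define f where "f x = sc (\<phi> (tgt_part j x)) y2" for x
 have ZZ2: "z \<in> Z2" if "z \<in> Z" for z
  using that fv.subspace_0[OF Bj] unfolding Z2_def by (intro CollectI exI[of _ z] exI[of _ 0]) simp
 have epsZ2: "left_op (Eps j) u \<in> Z2" if "u \<in> B i (n - 1)" for u
 proof -
  have "tgt_part j u \<in> Bj" using that by (simp add: Bj_def tgt_part_bar tgt_part_idem)
  thus ?thesis using fv.subspace_0[OF Z] unfolding Z2_def
   by (intro CollectI exI[of _ 0] exI[of _ "tgt_part j u"]) (simp add: tgt_part_eps)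
 qed
 have tgt_y2: "tgt_part k y2 = (if k = j then y2 else 0)" for k
  using y2(1) tgt_part_idem[of k j y2] by (auto simp: Bj_def)
 have eps_y2: "left_op (Eps k) y2 = 0" for k
  using y2(3) tgt_y2[of j] tgt_part_eps(2)[of k j y2] by (cases "k = j") auto
 have "slice_endo i n f (\<lambda>x. 0)"
  unfolding slice_endo_def equivariant_def
 proof (intro conjI allI impI ballI)
  fix x assume x: "x \<in> B i (n - 1)"
  show "f x \<in> B i (n - 1)" using y2(1) by (simp add: f_def Bj_def)
  show "f (x + y) = f x + f y" for y by (simp add: f_def tgt_part_add \<phi>_lin fv.scale_left_distrib)
  show "f (sc c x) = sc c (f x)" for c by (simp add: f_def tgt_part_scale \<phi>_lin fv.scale_scale)
  show "f (tgt_part k x) = tgt_part k (f x)" for k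
   by (auto simp: f_def tgt_part_idem tgt_part_scale tgt_y2 \<phi>_lin)
  show "f (left_op (Eps k) x) = left_op (Eps k) (f x)" for k
   using \<phi>(2)[OF epsZ2[OF x]] by (auto simp: f_def tgt_part_eps left_op_scale eps_y2 \<phi>_lin)
 next
  fix k j' x assume k: "adj C j' k" and x: "x \<in> B i n"
  have "\<phi> (left_op (Alpha j' j) x) = 0" if "k = j"
  proof -
   have "adj C j j'" using k that adj_sym by blast
   from mesh_single[OF this, of x] have "left_op (Alpha j' j) x \<in> Z"
    unfolding Z_def using x
    by (intro CollectI exI[of _ "\<lambda>k' m. if k' = j' \<and> m = E j j' - 1 then sc (of_int (\<omega> j j')) x else 0"]) simp
   thus ?thesis using ZZ2 \<phi>(2) by blast
  qed
  thus "left_op (Alpha j' k) 0 = f (left_op (Alpha j' k) x)"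
   by (auto simp: f_def tgt_part_alpha \<phi>_lin)
 qed (auto simp: fv.scale_zero_right)
 then obtain c where c: "\<And>x. x \<in> B i (n - 1) ==> f x = sc c x" "\<And>x. x \<in> B i n ==> 0 = sc c x"
  using brick unfolding brick_def by blast
 \<comment> \<open>The scalar is non-zero because \<open>f\<close> is, and yet it acts as 0 on slice
   \<open>n\<close>.\<close>
 have "f y1 = y2" using y1(1) \<phi>(3) by (simp add: f_def Bj_def)
 hence "c ~= 0" using c(1)[of y1] y1(1) y2(2) by (auto simp: Bj_def)
 thus ?thesis using c(2) by (auto simp: fv.scale_eq_0_iff)
qed

lemma bar_0_apply:
 assumes "x \<in> B i 0" "(t, w, s) ~= (i, [], i)"
 shows "x (t, w, s) = 0"
proof (rule ccontr)
 assume nz: "x (t, w, s) ~= 0"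
 hence "s = i" "cnt w = 0" using pieces_supp[OF bar_pieces_pieces[OF assms(1)], of s w t] by auto
 hence "t = i \<and> w = eps (length w) i"
  using cnt_0_path[OF rel_dual_path[OF bar_pieces_D[OF assms(1)] nz]] by simp
 hence t: "t = i" and w: "w = eps (length w) i" by auto
 have "w ~= []" using assms(2) t \<open>s = i\<close> by auto
 hence "w = eps (length w - 1) i @ [Eps i]"
  using w by (metis Suc_pred' length_greater_0_conv replicate_Suc replicate_append_same)
 thus False using nz bar_pieces_right[OF assms(1)] \<open>s = i\<close> by metis
qed

text \<open>A function in slice 0 can be non-zero only at the trivial path, so this slice is at most
  a line, and slice \<open>- 1\<close> is zero.\<close>

lemma brick_0: "brick i 0"
 unfolding brick_def
proof (intro allI impI)
 fix f g assume "slice_endo i 0 f g"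
 hence f: "equivariant i (- 1) f" and g: "equivariant i 0 g" by (auto simp: slice_endo_def)
 have neg: "B i (- 1) = {0}"
  using pieces_negative[of "-1" i] fv.subspace_0[OF bar_pieces_subspace] by (auto dest: bar_pieces_pieces)
 have "\<exists>c. \<forall>x\<in>B i 0. g x = sc c x"
 proof (cases "\<exists>x\<in>B i 0. x (i, [], i) ~= 0")
  case True
  then obtain x where x: "x \<in> B i 0" "x (i, [], i) ~= 0" by blast
  have mult: "y = sc (y (i, [], i) / x (i, [], i)) x" if y: "y \<in> B i 0" for y
  proof (rule ext, clarify)
   fix t w s show "y (t, w, s) = sc (y (i, [], i) / x (i, [], i)) x (t, w, s)"
    using bar_0_apply[OF x(1), of t w s] bar_0_apply[OF y, of t w s] x(2)
    by (cases "(t, w, s) = (i, [], i)") (auto simp: sc_apply)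
  qed
  obtain c where c: "g x = sc c x" using mult[of "g x"] equivariantD(1)[OF g x(1)] by blast
  have "g y = sc c y" if "y \<in> B i 0" for y
  proof -
   obtain a where "y = sc a x" using mult[OF \<open>y \<in> B i 0\<close>] by blast
   thus ?thesis using equivariantD(3)[OF g x(1)] c by (simp add: fv.scale_left_commute)
  qed
  thus ?thesis by blast
 next
  case False
  have "y = 0" if "y \<in> B i 0" for y
  proof (rule ext, clarify)
   fix t w s show "y (t, w, s) = 0 (t, w, s)"
    using bar_0_apply[OF that, of t w s] False that by (cases "(t, w, s) = (i, [], i)") (auto simp: fun_app)
  qed
  thus ?thesis using equivariant_zero[OF g] by (intro exI[of _ 0]) (auto simp: fv.scale_zero_right)
 qed
 thus "\<exists>c. (\<forall>x\<in>B i (0 - 1). f x = sc c x) \<and> (\<forall>x\<in>B i 0. g x = sc c x)"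
  using equivariant_zero[OF f] by (auto simp: neg fv.scale_zero_right)
qed

text \<open>\<open>brick_dichotomy\<close> and \<open>brick_step\<close> alternate: a brick with
  non-zero slice is onto, and then the next one is a brick.\<close>

lemma onto_before_end:
 assumes "\<And>m. 0 <= m ==> m < n ==> B i m ~= {0}" "0 <= m" "m < n"
 shows "onto i m"
proof -
 have "brick i (int p) \<and> onto i (int p)" if "int p < n" for p
  using that
 proof (induction p)
  case 0
  thus ?case using brick_0 brick_dichotomy[of i 0] assms(1)[of 0] by auto
 next
  case (Suc p)
  hence "brick i (int p + 1)" using brick_step[of "int p" i] by auto
  thus ?case using brick_dichotomy[of i "int p + 1"] assms(1)[of "int p + 1"] Suc by (auto simp: add.commute)
 qed
 from this[of "nat m"] assms(2,3) show ?thesis by simp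
qed

end

section \<open>Graded dimensions of the slices\<close>

lemma fls_nth_q_pow_mult: "fls_nth (q_pow a * f) v = fls_nth f (v - a)"
 by (simp add: fls_X_intpow_times_conv_shift)

context gpa_over
begin

lemma bar_piecesI:
 fixes l :: "'i path => 'k"
 assumes "l \<in> pieces i n" "\<And>t w. l (t, w @ [Eps i], i) = 0"
 shows "l \<in> B i n"
 using assms by (auto simp: bar_pieces_def right_op_def fun_eq_iff fun_app)

lemma fin_dim_trivial: "U \<subseteq> {0} ==> fin_dim U"
 unfolding fin_dim_def by (intro exI[of _ "{}"]) (simp add: fv.span_empty)

lemma d_le_r: "d j <= r"
 using d_dvd r_pos by (simp add: dvd_imp_le)

text \<open>Only the letters \<open>Alpha\<close> have negative degree, at least \<open>- r\<close>
  each. Degrees are therefore bounded below on a slice, which ends all iterations of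
  \<open>right_op\<close>.\<close>

lemma wdeg_lower: "wdeg d w >= - int r * cnt w"
proof (induction w)
 case (Cons a w)
 show ?case
 proof (cases a)
  case (Alpha p q)
  have "max (d p) (d q) <= r" using d_le_r by simp
  hence "int (max (d p) (d q)) <= int r" unfolding of_nat_le_iff .
  moreover have "wdeg d (a # w) = wdeg d w - int (max (d p) (d q))" by (simp add: Alpha)
  moreover have "- int r * cnt (a # w) = - int r * cnt w - int r" by (simp add: Alpha algebra_simps)
  ultimately show ?thesis using Cons by linarith
 next
  case (Eps p)
  thus ?thesis using Cons by simp
 qed
qed simp

lemma restr_apply: "restr d Q l (t, w, s) = (if Q t (cnt w) (wdeg d w) s then l (t, w, s) else 0)"
 by (simp add: restr_def)

lemma restr_pieces: "l \<in> pieces i n ==> restr d Q l \<in> pieces i n"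
 by (rule piecesI, erule restr_D[OF pieces_D], auto simp: restr_apply pieces_supp)

lemma restr_bar: "l \<in> B i n ==> restr d Q l \<in> B i n"
 by (rule bar_piecesI, erule restr_pieces[OF bar_pieces_pieces]) (auto simp: restr_apply bar_pieces_right)

definition hom_bar :: "'i => 'i => int => int => ('i path => 'k) set" where
 "hom_bar i j n v = {l \<in> B i n. restr d (\<lambda>t c u s. t = j \<and> u = v) l = l}"

lemma hom_bar_supp: "l \<in> hom_bar i j n v ==> t ~= j \<or> wdeg d w ~= v ==> l (t, w, s) = 0"
 unfolding hom_bar_def by (metis (mono_tags, lifting) mem_Collect_eq restr_apply)

lemma hom_barI: "l \<in> B i n ==> (\<And>t w s. t ~= j \<or> wdeg d w ~= v ==> l (t, w, s) = 0) ==> l \<in> hom_bar i j n v"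
 unfolding hom_bar_def by (auto simp: fun_eq_iff restr_apply)

lemma hom_bar_B: "l \<in> hom_bar i j n v ==> l \<in> B i n"
 by (simp add: hom_bar_def)

lemma hom_bar_subspace: "fv.subspace (hom_bar i j n v)"
 by (rule fv.subspaceI)
   (auto simp: hom_bar_def fvv.linear_add[OF restr_linear] fvv.linear_scale[OF restr_linear] fvv.linear_0[OF restr_linear])

lemma restr_hom_bar: "l \<in> B i n ==> restr d (\<lambda>t c u s. t = j \<and> u = v) l \<in> hom_bar i j n v"
 by (rule hom_barI, erule restr_bar) (auto simp: restr_apply)

lemma hom_bar_0:
 "fin_dim (hom_bar i j 0 v)" "fv.dim (hom_bar i j 0 v) = (if j = i \<and> v = 0 then 1 else 0)"
proof -
 define e :: "'i path => 'k" where "e = (\<lambda>p. if p = (i, [], i) then 1 else 0)"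
 have eD: "e \<in> D" by (rule rel_dualI) (auto simp: e_def split: if_splits)
 have eB: "e \<in> B i 0" by (intro bar_piecesI piecesI eD) (auto simp: e_def)
 have single: "x = sc (x (i, [], i)) e" if "x \<in> B i 0" for x
 proof (rule ext, clarify)
  fix t w s show "x (t, w, s) = sc (x (i, [], i)) e (t, w, s)"
   using bar_0_apply[OF that, of t w s] by (cases "(t, w, s) = (i, [], i)") (auto simp: sc_apply e_def)
 qed
 have "fin_dim (hom_bar i j 0 v) \<and> fv.dim (hom_bar i j 0 v) = (if j = i \<and> v = 0 then 1 else 0)"
 proof (cases "j = i \<and> v = 0")
  case True
  have e: "e \<in> hom_bar i j 0 v" by (rule hom_barI[OF eB]) (use True in \<open>auto simp: e_def\<close>)
  have sp: "hom_bar i j 0 v \<subseteq> fv.span {e}"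
  proof
   fix x assume "x \<in> hom_bar i j 0 v"
   hence "x = sc (x (i, [], i)) e" by (intro single hom_bar_B)
   thus "x \<in> fv.span {e}" by (metis fv.span_base fv.span_scale insertI1)
  qed
  have "e ~= 0" by (auto simp: e_def fun_eq_iff fun_app)
  hence "fv.independent {e}" by (simp add: fv.dependent_single)
  hence "fv.dim (hom_bar i j 0 v) = card {e}"
   by (intro fv.dim_unique[of "{e}"]) (use e sp in auto)
  thus ?thesis using True sp by (auto simp: fin_dim_def)
 next
  case False
  have "x = 0" if "x \<in> hom_bar i j 0 v" for x
  proof -
   have "x (i, [], i) = 0" using hom_bar_supp[OF that, of i "[]" i] False by auto
   thus ?thesis using single[OF hom_bar_B[OF that]] by (simp add: fv.scale_zero_left)
  qed
  hence "hom_bar i j 0 v = {0}" using fv.subspace_0[OF hom_bar_subspace] by auto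
  thus ?thesis using False by (auto simp: dim_zero fin_dim_trivial)
 qed
 thus "fin_dim (hom_bar i j 0 v)" "fv.dim (hom_bar i j 0 v) = (if j = i \<and> v = 0 then 1 else 0)"
  by auto
qed

text \<open>The degree that remains of \<open>v\<close> after the removal of
  \<open>eps m j @ [Alpha j k]\<close>.\<close>

abbreviation branch_deg :: "int => 'i => 'i => nat => int" where
 "branch_deg v j k m \<equiv> v + int (max (d j) (d k)) - 2 * int m * int (d j)"

lemma mesh_word_deg:
 assumes "adj C j k" "m < E j k"
 shows "wdeg d (Alpha k j # eps (E j k - 1 - m) j @ w) = branch_deg v j k m
  \<longleftrightarrow> wdeg d w = v + 2 * int (d j)"
proof -
 have "int (E j k - 1 - m) = int (E j k) - 1 - int m" using assms by simp
 moreover have "int (E j k) * int (d j) = int (max (d j) (d k))" using eps_mult_d[OF assms(1)] by (metis of_nat_mult)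
 ultimately show ?thesis by (auto simp: algebra_simps max.commute)
qed

lemma component_word_deg:
 assumes "adj C j k"
 shows "wdeg d (eps m j @ Alpha j k # w) = v \<longleftrightarrow> wdeg d w = branch_deg v j k m"
 by auto

text \<open>A short exact sequence: from the part of slice \<open>n + 1\<close> at \<open>j\<close>
  to the sum of its components in slice \<open>n\<close>, and on to slice \<open>n - 1\<close> by
  the transposed mesh map. Components determine a function, \<open>prescribe_bar\<close> is
  exactness in the middle, and \<open>onto\<close> is exactness on the right. The last term sits in
  degree \<open>v + 2 * d j\<close> because (R2) has degree \<open>- 2 * d j\<close>.\<close>

lemma hom_bar_dim_step:
 assumes n: "n >= 0" and onto: "onto i n" and fd: "\<And>k u. fin_dim (hom_bar i k n u)"
 shows "fin_dim (hom_bar i j (n + 1) v)"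
  and "fv.dim (hom_bar i j (n + 1) v) + fv.dim (hom_bar i j (n - 1) (v + 2 * int (d j)))
   = (\<Sum>k | adj C j k. \<Sum>m<E j k. fv.dim (hom_bar i k n (branch_deg v j k m)))"
proof -
 define J where "J = (SIGMA k:{k. adj C j k}. {..<E j k})"
 define U where "U = (\<lambda>(k, m). hom_bar i k n (branch_deg v j k m))"
 define P where "P = fun_prod J U"
 have finJ: "finite J" by (simp add: J_def)
 have subU: "fv.subspace (U \<iota>)" for \<iota> by (cases \<iota>) (simp add: U_def hom_bar_subspace)
 have fdU: "fin_dim (U \<iota>)" for \<iota> by (cases \<iota>) (simp add: U_def fd)
 have P: "fin_dim P" "fv.dim P = (\<Sum>\<iota>\<in>J. fv.dim (U \<iota>))" "fv.subspace P"
  using fun_prod_dim[OF finJ subU fdU] fun_prod_subspace[OF subU] by (auto simp: P_def)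
 define M :: "(('i \<times> nat) \<times> 'i path => 'k) => 'i path => 'k" where
  "M f = mesh j (\<lambda>k m p. f ((k, m), p))" for f
 have M: "fun_linear M"
 proof (rule fun_linearI)
  show "M (f + g) = M f + M g" for f g
  proof -
   have "(\<lambda>k m p. (f + g) ((k, m), p)) = (\<lambda>k m. (\<lambda>p. f ((k, m), p)) + (\<lambda>p. g ((k, m), p)))"
    by (auto simp: fun_eq_iff fun_app)
   thus ?thesis unfolding M_def by (simp only: mesh_add)
  qed
  show "M (sc c f) = sc c (M f)" for c f
  proof -
   have "(\<lambda>k m p. (sc c f) ((k, m), p)) = (\<lambda>k m. sc c (\<lambda>p. f ((k, m), p)))"
    by (auto simp: fun_eq_iff fun_app)
   thus ?thesis unfolding M_def by (simp only: mesh_scale)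
  qed
 qed
 have comp_P: "(\<lambda>p. f ((k, m), p)) \<in> hom_bar i k n (branch_deg v j k m)"
  if "f \<in> P" "adj C j k" "m < E j k" for f k m
  using that by (auto simp: P_def fun_prod_def J_def U_def)
 have zero_P: "(\<lambda>p. f ((k, m), p)) = 0" if "f \<in> P" "\<not> (adj C j k \<and> m < E j k)" for f k m
  using that by (auto simp: P_def fun_prod_def J_def fun_eq_iff fun_app)
 have comp_B: "(\<lambda>p. f ((k, m), p)) \<in> B i n" if "f \<in> P" for f k m
  using comp_P[OF that, of k m] zero_P[OF that, of k m] hom_bar_B by (cases "adj C j k \<and> m < E j k") auto
 have im: "M ` P = hom_bar i j (n - 1) (v + 2 * int (d j))"
 proof (intro equalityI subsetI)
  fix y assume "y \<in> M ` P"
  then obtain f where f: "f \<in> P" "y = M f" by auto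
  show "y \<in> hom_bar i j (n - 1) (v + 2 * int (d j))"
  proof (rule hom_barI)
   show "y \<in> B i (n - 1)" unfolding f(2) M_def by (rule mesh_bar) (rule comp_B[OF f(1)])
   fix t w s assume "t ~= j \<or> wdeg d w ~= v + 2 * int (d j)"
   moreover have "f ((k, m), (k, Alpha k j # eps (E j k - 1 - m) j @ w, s)) = 0"
    if "wdeg d w ~= v + 2 * int (d j)" "adj C j k" "m < E j k" for k m
    using hom_bar_supp[OF comp_P[OF f(1) that(2,3)]] mesh_word_deg[OF that(2,3)] that(1) by blast
   ultimately show "y (t, w, s) = 0" unfolding f(2) M_def
    by (cases "t = j") (simp_all add: mesh_off mesh_at)
  qed
 next
  fix y assume y: "y \<in> hom_bar i j (n - 1) (v + 2 * int (d j))"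
  have "tgt_part j y = y" using hom_bar_supp[OF y] by (auto simp: fun_eq_iff tgt_part_apply)
  then obtain x where x: "\<And>k m. x k m \<in> B i n" "mesh j x = y"
   using onto hom_bar_B[OF y] unfolding onto_def by blast
  define f where "f = (\<lambda>((k, m), p). if (k, m) \<in> J then
   restr d (\<lambda>t c u s. t = k \<and> u = branch_deg v j k m) (x k m) p else 0)"
  have "f \<in> P"
   unfolding P_def fun_prod_def using restr_hom_bar[OF x(1)] by (auto simp: f_def U_def)
  moreover have "M f = y"
  proof (rule ext, clarify)
   fix t w s
   show "M f (t, w, s) = y (t, w, s)"
   proof (cases "t = j")
    case False
    thus ?thesis using hom_bar_supp[OF y, of t w s] by (simp add: M_def mesh_off)
   next
    case True
    have "f ((k, m), k, Alpha k j # eps (E j k - 1 - m) j @ w, s)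
     = (if wdeg d w = v + 2 * int (d j) then x k m (k, Alpha k j # eps (E j k - 1 - m) j @ w, s) else 0)"
     if "adj C j k" "m < E j k" for k m
     using mesh_word_deg[OF that, of w v] that by (simp add: f_def J_def restr_apply del: wdeg_simps)
    hence "M f (j, w, s) = (if wdeg d w = v + 2 * int (d j) then mesh j x (j, w, s) else 0)"
     by (auto simp: M_def mesh_at)
    thus ?thesis using True x(2) hom_bar_supp[OF y, of j w s] by auto
   qed
  qed
  ultimately show "y \<in> M ` P" by blast
 qed
 define L :: "('i path => 'k) => (('i \<times> nat) \<times> 'i path => 'k)" where
  "L l = (\<lambda>((k, m), p). if (k, m) \<in> J then branch j k m l p else 0)" for l
 have L: "fun_linear L"
  by (rule fun_linearI) (auto simp: L_def fun_eq_iff left_op_add left_pow_add left_op_scale left_pow_scale fun_app)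
 have L_comp: "(\<lambda>p. L l ((k, m), p)) = branch j k m l" if "adj C j k" "m < E j k" for k m l
  using that by (simp add: L_def J_def)
 have inj: "l = 0" if l: "l \<in> hom_bar i j (n + 1) v" and "L l = 0" for l
 proof -
  have "branch j k m l = 0" if "adj C j k" "m < E j k" for k m
   using L_comp[OF that, of l] \<open>L l = 0\<close> by (simp add: fun_eq_iff fun_app)
  hence "tgt_part j l = 0"
   using pieces_determine[OF bar_pieces_pieces[OF hom_bar_B[OF l]]] n by simp
  moreover have "tgt_part j l = l" using hom_bar_supp[OF l] by (auto simp: fun_eq_iff tgt_part_apply)
  ultimately show ?thesis by simp
 qed
 have ker: "L ` hom_bar i j (n + 1) v = {f \<in> P. M f = 0}"
 proof (intro equalityI subsetI)
  fix f assume "f \<in> L ` hom_bar i j (n + 1) v"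
  then obtain l where l: "l \<in> hom_bar i j (n + 1) v" "f = L l" by auto
  have "L l \<in> P"
   unfolding P_def fun_prod_def
  proof (intro CollectI conjI ballI allI impI)
   fix \<iota> assume "\<iota> \<in> J"
   then obtain k m where \<iota>: "\<iota> = (k, m)" and k: "adj C j k" "m < E j k" by (auto simp: J_def)
   have "branch j k m l \<in> U (k, m)"
    unfolding U_def prod.case
   proof (rule hom_barI)
    show "branch j k m l \<in> B i n"
     using left_alpha_bar[OF left_eps_pow_bar[OF hom_bar_B[OF l(1)]]] by simp
    fix t w s assume "t ~= k \<or> wdeg d w ~= branch_deg v j k m"
    thus "branch j k m l (t, w, s) = 0"
     using hom_bar_supp[OF l(1), of j "eps m j @ Alpha j k # w" s] component_word_deg[OF k(1), of m w v]
     by (auto simp: left_op_def left_op_pow_at simp del: wdeg_simps)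
   qed
   thus "(\<lambda>z. L l (\<iota>, z)) \<in> U \<iota>" unfolding \<iota> L_comp[OF k] .
  qed (auto simp: L_def)
  moreover have "M (L l) = 0"
  proof -
   have "M (L l) = mesh j (\<lambda>k m. branch j k m l)"
    unfolding M_def by (rule mesh_cong) (rule L_comp)
   thus ?thesis using mesh_components[OF bar_pieces_D[OF hom_bar_B[OF l(1)]]] by simp
  qed
  ultimately show "f \<in> {f \<in> P. M f = 0}" by (simp add: l(2))
 next
  fix f assume "f \<in> {f \<in> P. M f = 0}"
  hence f: "f \<in> P" "M f = 0" by auto
  obtain l where l: "l \<in> B i (n + 1)" "tgt_part j l = l"
   "\<And>k m. adj C j k ==> m < E j k ==> branch j k m l = tgt_part k (\<lambda>p. f ((k, m), p))"
   by (rule prescribe_bar[OF comp_B[OF f(1)] n f(2)[unfolded M_def]], rule that)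
  define l' where "l' = restr d (\<lambda>t c u s. t = j \<and> u = v) l"
  have "l' \<in> hom_bar i j (n + 1) v" unfolding l'_def by (rule restr_hom_bar[OF l(1)])
  moreover have "L l' = f"
  proof (rule ext, clarify)
   fix k m t w s
   show "L l' ((k, m), (t, w, s)) = f ((k, m), (t, w, s))"
   proof (cases "adj C j k \<and> m < E j k")
    case False
    thus ?thesis using fun_cong[OF zero_P[OF f(1) False], of "(t, w, s)"] by (auto simp: L_def J_def fun_app)
   next
    case True
    have "L l' ((k, m), (t, w, s)) = branch j k m l' (t, w, s)"
     using True by (simp add: L_def J_def)
    also have "... = (if t = k \<and> wdeg d w = branch_deg v j k m then f ((k, m), (t, w, s)) else 0)"
     using component_word_deg[of j k m w v] True fun_cong[OF l(3), of k m "(t, w, s)"]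
     by (auto simp: left_op_def left_op_pow_at l'_def restr_apply tgt_part_apply simp del: wdeg_simps)
    also have "... = f ((k, m), (t, w, s))"
     using hom_bar_supp[OF comp_P[OF f(1)], of k m t w s] True by auto
    finally show ?thesis .
   qed
  qed
  ultimately show "f \<in> L ` hom_bar i j (n + 1) v" by blast
 qed
 show fdn: "fin_dim (hom_bar i j (n + 1) v)"
 proof (rule fin_dim_of_kernel_image[OF L hom_bar_subspace])
  have "{x \<in> hom_bar i j (n + 1) v. L x = 0} \<subseteq> {0}" using inj by blast
  thus "fin_dim {x \<in> hom_bar i j (n + 1) v. L x = 0}"
   by (rule fin_dim_trivial)
  show "fin_dim (L ` hom_bar i j (n + 1) v)" unfolding ker by (rule fin_dim_subset[OF P(1)]) auto
 qed
 have "fv.dim (hom_bar i j (n + 1) v) = fv.dim {f \<in> P. M f = 0}"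
  using dim_injective_image[OF L fdn hom_bar_subspace inj] by (simp add: ker)
 moreover have "fv.dim P = fv.dim {f \<in> P. M f = 0} + fv.dim (hom_bar i j (n - 1) (v + 2 * int (d j)))"
  using rank_nullity(2)[OF M P(1,3)] by (simp add: im)
 moreover have "(\<Sum>\<iota>\<in>J. fv.dim (U \<iota>)) = (\<Sum>k | adj C j k. \<Sum>m<E j k. fv.dim (hom_bar i k n (branch_deg v j k m)))"
 proof -
  have "(\<Sum>\<iota>\<in>J. fv.dim (U \<iota>)) = (\<Sum>(k, m)\<in>J. fv.dim (hom_bar i k n (branch_deg v j k m)))"
   by (intro sum.cong refl) (auto simp: U_def)
  also have "... = (\<Sum>k | adj C j k. \<Sum>m<E j k. fv.dim (hom_bar i k n (branch_deg v j k m)))"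
   unfolding J_def by (rule sum.Sigma[symmetric]) auto
  finally show ?thesis .
 qed
 ultimately show "fv.dim (hom_bar i j (n + 1) v) + fv.dim (hom_bar i j (n - 1) (v + 2 * int (d j)))
   = (\<Sum>k | adj C j k. \<Sum>m<E j k. fv.dim (hom_bar i k n (branch_deg v j k m)))"
  using P(2) by simp
qed

lemma bar_zero_Suc: "B i n = {0} ==> n >= 0 ==> B i (n + 1) = {0}"
proof -
 assume 0: "B i n = {0}" "n >= 0"
 have "x = 0" if "x \<in> B i (n + 1)" for x
 proof (rule bar_determine[OF that])
  fix j k m show "branch j k m x = 0"
   using left_alpha_bar[OF left_eps_pow_bar[OF that]] 0 by simp
 qed (use 0 in simp)
 thus ?thesis using fv.subspace_0[OF bar_pieces_subspace] by blast
qed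

text \<open>The dimensions are governed by any solution of the mesh recursion. In \<open>P\<close> the exponent of
 \<open>q\<close> is the negative of the degree.\<close>

definition mesh_table :: "'i => nat => ('i => nat => rat fls) => bool" where
 "mesh_table i N P \<longleftrightarrow> N > 0 \<and> (\<forall>j. P j 0 = (if j = i then 1 else 0)) \<and>
   (\<forall>n<N. \<forall>j. q_pow (- int (d j)) * P j (Suc n) + (if n = 0 then 0 else q_pow (int (d j)) * P j (n - 1))
    = (\<Sum>k | adj C j k. (\<Sum>m<E j k. q_pow (int (d j) * (int (E j k) - 1 - 2 * int m))) * P k n)) \<and>
   (\<forall>n<N. \<exists>j. P j n ~= 0) \<and> (\<forall>j. P j N = 0)"

text \<open>Row by row: non-zero rows of the table mean non-zero slices, these make the mesh maps
  onto, and the exact sequence then computes the next slice by the recursion that \<open>P\<close>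
  satisfies. Row \<open>N\<close> vanishes, and with it all later slices.\<close>

lemma mesh_table_dims:
 assumes P: "mesh_table i N P"
 shows "n <= N ==> fin_dim (hom_bar i j (int n) v)"
  and "n <= N ==> of_nat (fv.dim (hom_bar i j (int n) v)) = fls_nth (P j n) (- v)"
  and "n < N ==> onto i (int n)"
  and "n >= N ==> B i (int n) = {0}"
proof -
 have rec: "q_pow (- int (d j)) * P j (Suc n) + (if n = 0 then 0 else q_pow (int (d j)) * P j (n - 1))
    = (\<Sum>k | adj C j k. (\<Sum>m<E j k. q_pow (int (d j) * (int (E j k) - 1 - 2 * int m))) * P k n)" if "n < N" for n j
  using P that unfolding mesh_table_def by blast
 \<comment> \<open>The recursion at the exponent \<open>- v - d j\<close>; the two factors on its
   left-hand side turn this into \<open>- v\<close> and \<open>- (v + 2 * d j)\<close>.\<close>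
 have rec_nth: "fls_nth (P j (Suc n)) (- v) + (if n = 0 then 0 else fls_nth (P j (n - 1)) (- (v + 2 * int (d j))))
  = (\<Sum>k | adj C j k. \<Sum>m<E j k. fls_nth (P k n) (- (branch_deg v j k m)))"
  if "n < N" for n j v
 proof -
  have "fls_nth ((\<Sum>m<E j k. q_pow (int (d j) * (int (E j k) - 1 - 2 * int m))) * P k n) (- v - int (d j))
   = (\<Sum>m<E j k. fls_nth (P k n) (- (branch_deg v j k m)))" if "adj C j k" for k
  proof -
   have e: "int (max (d j) (d k)) = int (E j k) * int (d j)" using eps_mult_d[OF that] by (metis of_nat_mult)
   show ?thesis unfolding e sum_distrib_right fls_nth_sum fls_nth_q_pow_mult
    by (intro sum.cong refl arg_cong[of _ _ "fls_nth (P k n)"]) (simp add: algebra_simps)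
  qed
  hence "fls_nth (q_pow (- int (d j)) * P j (Suc n) + (if n = 0 then 0 else q_pow (int (d j)) * P j (n - 1))) (- v - int (d j))
   = (\<Sum>k | adj C j k. \<Sum>m<E j k. fls_nth (P k n) (- (branch_deg v j k m)))"
   unfolding rec[OF that] fls_nth_sum by (intro sum.cong refl) blast
  moreover have "- v - int (d j) - - int (d j) = - v" "- v - int (d j) - int (d j) = - (v + 2 * int (d j))" by simp_all
  ultimately show ?thesis
   by (cases "n = 0") (simp_all only: fls_plus_nth fls_nth_q_pow_mult fls_zero_nth if_True if_False simp_thms)
 qed
 have B_zero_iff: "B i n = {0} \<longleftrightarrow> (\<forall>j v. hom_bar i j n v = {0})" for n
 proof
  assume "B i n = {0}"
  thus "\<forall>j v. hom_bar i j n v = {0}"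
   using hom_bar_B fv.subspace_0[OF hom_bar_subspace] by blast
 next
  assume 0: "\<forall>j v. hom_bar i j n v = {0}"
  have "x = 0" if x: "x \<in> B i n" for x
  proof (rule ext, clarify)
   fix t w s
   have "restr d (\<lambda>t' c u s. t' = t \<and> u = wdeg d w) x = 0"
    using restr_hom_bar[OF x, of t "wdeg d w"] 0 by blast
   from fun_cong[OF this, of "(t, w, s)"] show "x (t, w, s) = 0 (t, w, s)" by (simp add: restr_apply fun_app)
  qed
  thus "B i n = {0}" using fv.subspace_0[OF bar_pieces_subspace] by blast
 qed
 have main: "(\<forall>j v. fin_dim (hom_bar i j (int n) v) \<and> of_nat (fv.dim (hom_bar i j (int n) v)) = fls_nth (P j n) (- v))
   \<and> (\<forall>m<n. onto i (int m))" if "n <= N" for n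
  using that
 proof (induction n rule: less_induct)
  case (less n)
  show ?case
  proof (cases n)
   case 0
   have "P j 0 = (if j = i then 1 else 0)" for j using P by (auto simp: mesh_table_def)
   thus ?thesis using 0 hom_bar_0 by auto
  next
   case (Suc n')
   have nz: "B i (int m) ~= {0}" if "m <= n'" for m
   proof -
    have m: "m < n" "m < N" using that Suc less.prems by auto
    then obtain j where "P j m ~= 0" using P by (auto simp: mesh_table_def)
    then obtain v where "fls_nth (P j m) v ~= 0" by (metis fls_eq_iff fls_zero_nth)
    hence "fv.dim (hom_bar i j (int m) (- v)) ~= 0"
     using less.IH[OF m(1)] m(2) by (metis less_imp_le minus_minus of_nat_0)
    thus ?thesis using B_zero_iff dim_zero by metis
   qed
   have onto: "onto i (int m)" if "m < n" for m
   proof (rule onto_before_end[where n = "int n"])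
    fix p assume "0 <= p" "p < int n"
    thus "B i p ~= {0}" using nz[of "nat p"] Suc by auto
   qed (use that in auto)
   have IH: "fin_dim (hom_bar i j (int n') v)" "of_nat (fv.dim (hom_bar i j (int n') v)) = fls_nth (P j n') (- v)" for j v
    using less.IH[of n'] less.prems Suc by auto
   have prev: "of_nat (fv.dim (hom_bar i j (int n' - 1) v)) = (if n' = 0 then 0 else fls_nth (P j (n' - 1)) (- v))" for j v
   proof (cases "n' = 0")
    case True
    have "B i (int n' - 1) \<subseteq> {0}" using pieces_negative[of "int n' - 1" i] True bar_pieces_pieces by auto
    hence "hom_bar i j (int n' - 1) v = {0}" using hom_bar_B fv.subspace_0[OF hom_bar_subspace] by blast
    thus ?thesis using True by (simp add: dim_zero)
   next
    case False
    hence "int n' - 1 = int (n' - 1)" by simp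
    thus ?thesis using less.IH[of "n' - 1"] less.prems Suc False by simp
   qed
   have n: "int n = int n' + 1" using Suc by simp
   note step = hom_bar_dim_step[OF _ onto[of n'] IH(1)]
   have "of_nat (fv.dim (hom_bar i j (int n) v)) = fls_nth (P j n) (- v)" for j v
   proof -
    have "of_nat (fv.dim (hom_bar i j (int n) v)) + of_nat (fv.dim (hom_bar i j (int n' - 1) (v + 2 * int (d j))))
     = (\<Sum>k | adj C j k. \<Sum>m<E j k. (of_nat (fv.dim (hom_bar i k (int n') (branch_deg v j k m))) :: rat))"
     using arg_cong[OF step(2), of "of_nat :: nat => rat" j v] Suc unfolding n
     by (simp only: of_nat_add of_nat_sum of_nat_0_le_iff lessI)
    thus ?thesis using rec_nth[of n' j v] less.prems Suc by (simp add: IH(2) prev split: if_splits)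
   qed
   moreover have "fin_dim (hom_bar i j (int n) v)" for j v unfolding n by (rule step(1)) (simp_all add: Suc)
   ultimately show ?thesis using onto by blast
  qed
 qed
 show "n <= N ==> fin_dim (hom_bar i j (int n) v)" "n <= N ==> of_nat (fv.dim (hom_bar i j (int n) v)) = fls_nth (P j n) (- v)"
  using main by auto
 show "n < N ==> onto i (int n)" using main[of N] by auto
 have "P j N = 0" for j using P by (simp add: mesh_table_def)
 hence "hom_bar i j (int N) v = {0}" for j v
  using main[of N] dim_eq_0[of "hom_bar i j (int N) v"] hom_bar_subspace by simp
 hence N: "B i (int N) = {0}" using B_zero_iff by blast
 show "n >= N ==> B i (int n) = {0}"
 proof (induction n rule: dec_induct)
  case (step n) thus ?case using bar_zero_Suc[of i "int n"] by (simp add: add.commute)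
 qed (rule N)
qed

text \<open>The transpose of torsion freeness.\<close>

lemma right_op_onto_0:
 assumes y: "y \<in> (pieces i 0 :: ('i path => 'k) set)"
 shows "\<exists>x\<in>pieces i 0. right_op i x = y"
proof -
 \<comment> \<open>Slice 0 lives on words of loops. The preimage reads off the value of
   \<open>y\<close> after deleting the last loop; as no letter \<open>Alpha\<close> occurs, it
   satisfies the relations trivially.\<close>
 define x where "x = (\<lambda>(t, w, s). if s = i \<and> w ~= [] \<and> last w = Eps i then y (t, butlast w, i) else 0)"
 have zero: "x (t, w, s) = 0" if "cnt w ~= 0" for t w s
 proof (cases "w ~= [] \<and> last w = Eps i")
  case True
  hence "cnt (butlast w) = cnt w" by (metis append_butlast_last_id cnt_simps(1,3,4) add.right_neutral)
  thus ?thesis using pieces_supp[OF y] that by (auto simp: x_def)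
 qed (auto simp: x_def)
 have zero': "x (t, u @ Alpha a b # w, s) = 0" "x (t, u @ eps k c @ Alpha a b # w, s) = 0" for t u k c a b w s
 proof -
  have "cnt u + (cnt w + 1) ~= 0" using cnt_nonneg[of u] cnt_nonneg[of w] by linarith
  thus "x (t, u @ Alpha a b # w, s) = 0" "x (t, u @ eps k c @ Alpha a b # w, s) = 0"
   by (auto intro!: zero)
 qed
 have "x \<in> D"
 proof (rule rel_dualI)
  fix p assume "x p ~= 0"
  then obtain t w where p: "p = (t, w, i)" "w ~= []" "last w = Eps i" "y (t, butlast w, i) ~= 0"
   by (cases p) (auto simp: x_def split: if_splits)
  hence "is_path C (t, butlast w, i)" using rel_dual_path[OF pieces_D[OF y]] by blast
  hence "is_path C (t, butlast w @ [Eps i], i)" by (auto simp: is_path_append)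
  thus "is_path C p" using p by (metis append_butlast_last_id)
 qed (simp_all add: zero')
 moreover have "right_op i x = y"
  using pieces_supp[OF y] by (auto simp: fun_eq_iff right_op_def x_def)
 moreover have "x (t, w, s) = 0" if "s ~= i \<or> cnt w ~= 0" for t w s
  using zero[of w t s] that by (cases "cnt w = 0") (auto simp: x_def)
 ultimately show ?thesis by (intro bexI[of _ x] piecesI)
qed

text \<open>A diagram chase. The components of \<open>y\<close> are lifted through
  \<open>right_op i\<close> by \<open>IH\<close>. The mesh image of the lifts is killed by
  \<open>right_op i\<close>, so it lies in \<open>B i (n - 1)\<close> and by \<open>onto\<close> is
  also the mesh image of a family in \<open>B i n\<close>. After subtracting this family the lifts
  satisfy the mesh relation and can be glued.\<close>

lemma right_op_onto_Suc:
 assumes n: "n >= 0" and onto: "onto i n"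
  and IH: "\<And>y. y \<in> (pieces i n :: ('i path => 'k) set) ==> \<exists>x\<in>pieces i n. right_op i x = y"
  and y: "y \<in> (pieces i (n + 1) :: ('i path => 'k) set)"
 shows "\<exists>x\<in>pieces i (n + 1). right_op i x = y"
proof -
 note right_lin = fvv.linear_diff[OF right_op_linear] fvv.linear_sum[OF right_op_linear]
 have r: "right_op i (leps j m l) = leps j m (right_op i l)" for j m and l :: "'i path => 'k"
  by (induction m) (simp_all add: right_left_op)
 have r_mesh: "right_op i (mesh j x) = mesh j (\<lambda>k m. right_op i (x k m))" for j and x :: "'i => nat => 'i path => 'k"
  unfolding mesh_def by (simp add: right_lin fvv.linear_scale[OF right_op_linear] r right_left_op)
 have "\<exists>l\<in>pieces i (n + 1). right_op i l = tgt_part j y" for j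
 proof -
  define c where "c k m = branch j k m y" for k m
  have c: "c k m \<in> pieces i n" for k m
   using left_alpha_pieces[OF left_eps_pow_pieces[OF y]] by (simp add: c_def)
  define z where "z k m = (SOME x. x \<in> pieces i n \<and> right_op i x = c k m)" for k m
  have z: "z k m \<in> pieces i n" "right_op i (z k m) = c k m" for k m
   using someI_ex[of "\<lambda>x. x \<in> pieces i n \<and> right_op i x = c k m"] IH[OF c, of k m] unfolding z_def by blast+
  have "mesh j z \<in> B i (n - 1)"
   using mesh_components[OF pieces_D[OF y], of j] mesh_pieces[of z i n j] z
   by (simp add: bar_pieces_def r_mesh c_def)
  then obtain x' where x': "\<And>k m. x' k m \<in> B i n" "mesh j x' = mesh j z"
   using onto unfolding onto_def by (metis tgt_part_mesh)
  have zx: "z k m - x' k m \<in> pieces i n" for k m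
   by (intro fv.subspace_diff[OF pieces_subspace] z bar_pieces_pieces x')
  have mesh0: "mesh j (\<lambda>k m. z k m - x' k m) = 0" by (simp add: mesh_diff x')
  obtain l where l: "l \<in> pieces i (n + 1)" "tgt_part j l = l"
   "\<And>k m. adj C j k ==> m < E j k ==> branch j k m l = tgt_part k (z k m - x' k m)"
   by (rule prescribe_pieces[OF zx n mesh0], rule that)
  have "tgt_part j (right_op i l - y) = 0"
  proof (rule pieces_determine)
   show "right_op i l - y \<in> pieces i (n + 1)"
    by (intro fv.subspace_diff[OF pieces_subspace] right_pieces l y)
   fix k m assume k: "adj C j k" "m < E j k"
   have "branch j k m (right_op i l) = tgt_part k (right_op i (z k m) - right_op i (x' k m))"
    unfolding r[symmetric] right_left_op[symmetric] l(3)[OF k] right_tgt_part right_lin ..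
   also have "... = tgt_part k (c k m)" using x'(1)[of k m] by (simp add: z bar_pieces_def)
   also have "... = c k m" by (simp add: c_def tgt_part_alpha)
   finally show "branch j k m (right_op i l - y) = 0"
    by (simp add: left_pow_diff left_op_diff c_def)
  qed (use n in simp)
  hence "right_op i l = tgt_part j y"
   using l(2) by (simp add: tgt_part_diff flip: right_tgt_part)
  with l(1) show ?thesis by blast
 qed
 then obtain X where X: "\<And>j. X j \<in> pieces i (n + 1)" "\<And>j. right_op i (X j) = tgt_part j y" by metis
 have "right_op i (\<Sum>j\<in>UNIV. X j) = y" by (simp add: right_lin X tgt_part_total)
 moreover have "(\<Sum>j\<in>UNIV. X j) \<in> pieces i (n + 1)" by (intro fv.subspace_sum pieces_subspace X)
 ultimately show ?thesis by blast
qed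

text \<open>\<open>B i n\<close> is the kernel of \<open>right_op i\<close> on the slice. If it is
  zero, all powers of \<open>right_op i\<close> keep a homogeneous non-zero function non-zero, while
  its degree drops each time; this contradicts \<open>wdeg_lower\<close>.\<close>

lemma pieces_zero:
 assumes B0: "B i n = {0}"
 shows "(pieces i n :: ('i path => 'k) set) = {0}"
proof -
 have "l (t, w, i) = 0" if l: "l \<in> pieces i n" for l :: "'i path => 'k" and t w
 proof (rule ccontr)
  assume nz: "l (t, w, i) ~= 0"
  define l' where "l' = restr d (\<lambda>t c u s. u = wdeg d w) l"
  have l': "l' \<in> pieces i n" "l' ~= 0"
   using nz restr_pieces[OF l] by (auto simp: l'_def restr_apply fun_eq_iff fun_app)
  have "reps i m l' \<in> pieces i n \<and> reps i m l' ~= 0" for m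
  proof (induction m)
   case (Suc m)
   hence "reps i m l' \<notin> B i n" using B0 by auto
   thus ?case using Suc right_pieces by (auto simp: bar_pieces_def)
  qed (use l' in simp)
  then obtain m where m: "m = nat (wdeg d w + int r * n) + 1" "reps i m l' \<in> pieces i n" "reps i m l' ~= 0"
   by blast
  then obtain t' w' s' where p: "reps i m l' (t', w', s') ~= 0" by (auto simp: fun_eq_iff fun_app)
  hence s: "s' = i" "cnt w' = n" using pieces_supp[OF m(2)] by blast+
  hence "l' (t', w' @ eps m i, i) ~= 0" using p by (simp add: right_op_pow_at)
  hence "wdeg d w' + 2 * int m * int (d i) = wdeg d w" by (auto simp: l'_def restr_apply split: if_splits)
  moreover have "wdeg d w' >= - int r * n" using wdeg_lower[of w'] s by simp
  moreover have "int m * int (d i) >= int m" using mult_left_mono[of 1 "int (d i)" "int m"] d_pos[of i] by simp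
  moreover have "int m > wdeg d w + int r * n" using m(1) by linarith
  ultimately show False by (simp add: algebra_simps)
 qed
 hence "l = 0" if "l \<in> pieces i n" for l :: "'i path => 'k"
  using pieces_supp[OF that] that by (auto simp: fun_eq_iff fun_app) metis
 thus ?thesis using fv.subspace_0[OF pieces_subspace] by blast
qed

lemma right_op_onto_pieces:
 assumes P: "mesh_table i N P" and "n >= 0"
  and y: "y \<in> (pieces i n :: ('i path => 'k) set)"
 shows "\<exists>x\<in>pieces i n. right_op i x = y"
proof -
 have "\<forall>y\<in>(pieces i (int n) :: ('i path => 'k) set). \<exists>x\<in>pieces i (int n). right_op i x = y" for n
 proof (induction n)
  case 0 thus ?case using right_op_onto_0 by simp
 next
  case (Suc n)
  show ?case
  proof (cases "n < N")
   case True
   thus ?thesis using right_op_onto_Suc[of "int n" i] Suc mesh_table_dims(3)[OF P] by (simp add: add.commute)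
  next
   case False
   hence "B i (int (Suc n)) = {0}" using mesh_table_dims(4)[OF P, of "Suc n"] by simp
   from pieces_zero[OF this] show ?thesis by (auto intro: bexI[of _ 0])
  qed
 qed
 from this[of "nat n"] y \<open>n >= 0\<close> show ?thesis by simp
qed

end

section \<open>The anti-involution on functions, and homogeneous parts\<close>

definition flip_fun :: "('i path => 'k::field) => 'i path => 'k" where
 "flip_fun l = l \<circ> flip_path"

lemma flip_arrow_flip [simp]: "flip_arrow (flip_arrow a) = a" by (cases a) auto
lemma flip_arrow_comp [simp]: "flip_arrow \<circ> flip_arrow = id" by auto
lemma flip_path_flip [simp]: "flip_path (flip_path p) = p" by (cases p) (simp add: rev_map)
lemma flip_fun_flip [simp]: "flip_fun (flip_fun l) = l" by (auto simp: flip_fun_def fun_eq_iff)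
lemma flip_fun_apply: "flip_fun l (t, w, s) = l (s, rev (map flip_arrow w), t)" by (simp add: flip_fun_def)
lemma flip_fun_linear: "fun_linear flip_fun"
 by (rule fun_linearI) (auto simp: flip_fun_def fun_eq_iff fun_app)
lemma cnt_flip [simp]: "cnt (rev (map flip_arrow w)) = cnt w"
proof (induction w)
 case (Cons a w) thus ?case by (cases a) auto
qed simp
lemma wdeg_flip [simp]: "wdeg d (rev (map flip_arrow w)) = wdeg d w"
proof (induction w)
 case (Cons a w) thus ?case by (cases a) (auto simp: max.commute)
qed simp
lemma flip_eq_0_iff: "flip_fun l = 0 \<longleftrightarrow> l = 0"
 by (metis flip_fun_flip fvv.linear_0[OF flip_fun_linear])
lemma right_op_flip: "right_op i (flip_fun l) = flip_fun (left_op (Eps i) l)"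
 by (auto simp: fun_eq_iff right_op_def left_op_def flip_fun_apply)
lemma right_pow_flip: "reps i n (flip_fun l) = flip_fun (leps i n l)"
 by (induction n) (auto simp: right_op_flip)
lemma left_pow_flip: "leps i n (flip_fun l) = flip_fun (reps i n l)"
 using right_pow_flip[of n i "flip_fun l"] by (metis flip_fun_flip)

context gpa
begin

lemma is_path_flip: "is_path C (t, w, s) ==> is_path C (flip_path (t, w, s))"
proof (induction w arbitrary: t)
 case (Cons a w)
 hence "is_path C (flip_path (src a, w, s))" by auto
 moreover have "is_path C (src a, [flip_arrow a], t)" using Cons(2) adj_sym by (cases a) auto
 ultimately show ?case by (auto simp: is_path_append)
qed auto

lemma is_path_flip_iff: "is_path C (flip_path p) \<longleftrightarrow> is_path C p"
 using is_path_flip by (metis flip_path_flip prod_cases3)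

text \<open>Reversal of words exchanges the relations (R1) for \<open>(i, j)\<close> and
  \<open>(j, i)\<close>, and sends the summand of (R2) with index \<open>k\<close> to the one with
  index \<open>E i j - 1 - k\<close>.\<close>

lemma flip_fun_D:
 assumes l: "l \<in> D" shows "flip_fun l \<in> D"
proof (rule rel_dualI)
 show "is_path C p" if "flip_fun l p ~= 0" for p
  using that rel_dual_path[OF l, of "flip_path p"] is_path_flip_iff[of p] by (simp add: flip_fun_def)
 show "flip_fun l (t, u @ eps (E i j) i @ Alpha i j # w, s)
     = flip_fun l (t, u @ Alpha i j # eps (E j i) j @ w, s)"
  if "adj C i j" for i j u w t s
  using rel_dual_R1[OF l adj_sym[OF that], where u = "rev (map flip_arrow w)" and w = "rev (map flip_arrow u)"]
  by (simp add: flip_fun_apply)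
 fix i u w t s
 have "mesh_sum C \<omega> (flip_fun l) i t u w s
  = (\<Sum>j | adj C i j. \<Sum>k<E i j. of_int (\<omega> i j) *
    l (s, rev (map flip_arrow w) @ eps k i @ Alpha i j # Alpha j i #
       eps (E i j - 1 - k) i @ rev (map flip_arrow u), t))"
 proof (rule sum.cong[OF refl])
  fix j
  show "(\<Sum>k<E i j. of_int (\<omega> i j) *
    flip_fun l (t, u @ eps k i @ Alpha i j # Alpha j i #
       eps (E i j - 1 - k) i @ w, s))
   = (\<Sum>k<E i j. of_int (\<omega> i j) *
    l (s, rev (map flip_arrow w) @ eps k i @ Alpha i j # Alpha j i #
       eps (E i j - 1 - k) i @ rev (map flip_arrow u), t))"
   by (rule sum.reindex_bij_witness[where i = "\<lambda>k. E i j - 1 - k" and j = "\<lambda>k. E i j - 1 - k"])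
     (auto simp: flip_fun_apply)
 qed
 also have "... = 0" by (rule rel_dual_R2[OF l])
 finally show "mesh_sum C \<omega> (flip_fun l) i t u w s = 0" .
qed

definition homog :: "'i => 'i => int => ('i path => 'k::field) set" where
 "homog i j v = {l \<in> D. \<forall>t w s. l (t, w, s) ~= 0 --> t = j \<and> s = i \<and> wdeg d w = v}"

lemma homog_D: "l \<in> homog i j v ==> l \<in> D"
 by (simp add: homog_def)

lemma homog_supp: "l \<in> homog i j v ==> t ~= j \<or> s ~= i \<or> wdeg d w ~= v ==> l (t, w, s) = 0"
 by (auto simp: homog_def)

lemma homogI: "l \<in> D ==> (\<And>t w s. t ~= j \<or> s ~= i \<or> wdeg d w ~= v ==> l (t, w, s) = 0) ==> l \<in> homog i j v"
 unfolding homog_def by blast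

lemma homog_subspace: "fv.subspace (homog i j v :: ('i path => 'k::field) set)"
proof (rule fv.subspaceI)
 show "0 \<in> homog i j v" by (rule homogI) (auto simp: fv.subspace_0[OF D_subspace] fun_app)
 show "x + y \<in> homog i j v" if "x \<in> homog i j v" "y \<in> homog i j v" for x y :: "'i path => 'k"
  by (rule homogI) (use that in \<open>auto intro: fv.subspace_add[OF D_subspace] homog_D simp: fun_app homog_supp\<close>)
 show "sc c x \<in> homog i j v" if "x \<in> homog i j v" for c and x :: "'i path => 'k"
  by (rule homogI) (use that in \<open>auto intro: fv.subspace_scale[OF D_subspace] homog_D simp: fun_app homog_supp\<close>)
qed

lemma right_homog: "l \<in> homog i j v ==> right_op i l \<in> homog i j (v - 2 * int (d i))"
 by (rule homogI, erule right_op_D[OF homog_D], auto simp: right_op_def homog_supp)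

lemma left_homog: "l \<in> homog i j v ==> left_op (Eps j) l \<in> homog i j (v - 2 * int (d j))"
 by (rule homogI, erule left_op_D[OF homog_D], auto simp: left_op_def homog_supp)

lemma right_pow_homog: "l \<in> homog i j v ==> reps i n l \<in> homog i j (v - 2 * int n * int (d i))"
proof (induction n)
 case (Suc n) thus ?case using right_homog[of "reps i n l" i j "v - 2 * int n * int (d i)"] by (simp add: algebra_simps)
qed simp

lemma left_pow_homog: "l \<in> homog i j v ==> leps j n l \<in> homog i j (v - 2 * int n * int (d j))"
proof (induction n)
 case (Suc n) thus ?case using left_homog[of "leps j n l" i j "v - 2 * int n * int (d j)"] by (simp add: algebra_simps)
qed simp

lemma flip_homog: "l \<in> homog i j v ==> flip_fun l \<in> homog j i v"
 by (rule homogI, erule flip_fun_D[OF homog_D]) (auto simp: flip_fun_apply homog_supp)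

lemma restr_homog: "l \<in> homog i j v ==> restr d Q l \<in> homog i j v"
 by (rule homogI, erule restr_D[OF homog_D]) (auto simp: restr_def homog_supp)

lemma central_homog:
 assumes l: "l \<in> homog i j v"
 shows "leps j (r div d j) l = reps i (r div d i) l"
proof (rule ext, clarify)
 have pos: "r div d t > 0" for t using d_dvd[of t] d_pos[of t] r_pos by (simp add: dvd_imp_le div_greater_zero_iff)
 fix t w s
 have l1: "leps j (r div d j) l \<in> homog i j (v - 2 * int (r div d j) * int (d j))"
  by (rule left_pow_homog[OF l])
 have l2: "reps i (r div d i) l \<in> homog i j (v - 2 * int (r div d i) * int (d i))"
  by (rule right_pow_homog[OF l])
 show "leps j (r div d j) l (t, w, s) = reps i (r div d i) l (t, w, s)"
 proof (cases "t = j \<and> s = i")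
  case False
  thus ?thesis using homog_supp[OF l1] homog_supp[OF l2] by metis
 next
  case True
  show ?thesis
  proof (cases "is_path C (j, w, i)")
   case True
   thus ?thesis using \<open>t = j \<and> s = i\<close> centrality[OF homog_D[OF l] True]
    by (simp add: left_op_pow_at right_op_pow_at)
  next
   case False
   thus ?thesis using True rel_dual_path[OF homog_D[OF l1]] rel_dual_path[OF homog_D[OF l2]] by metis
  qed
 qed
qed

end

section \<open>Kernels of powers of the loops\<close>

context gpa_over
begin

abbreviation Hom :: "'i => 'i => int => ('i path => 'k) set" where "Hom \<equiv> homog"

lemma restr_count_zero:
 assumes P: "mesh_table i N P" and x: "x \<in> Hom i j v" and w: "cnt w >= int N"
 shows "x (t, w, s) = 0"
proof -
 have "restr d (\<lambda>t' c u s. c = cnt w) x \<in> pieces i (cnt w)"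
  by (rule piecesI, rule restr_D[OF homog_D[OF x]]) (auto simp: restr_apply homog_supp[OF x])
 moreover have "B i (int (nat (cnt w))) = {0}" by (rule mesh_table_dims(4)[OF P]) (use w in simp)
 hence "B i (cnt w) = {0}" by simp
 ultimately have "restr d (\<lambda>t' c u s. c = cnt w) x = 0" using pieces_zero by blast
 from fun_cong[OF this, of "(t, w, s)"] show ?thesis by (simp add: restr_apply fun_app)
qed

text \<open>Only slices below \<open>N\<close> occur, so preimages on the slices can be added up;
  the sum is then cut back to the required ends and degree.\<close>

lemma right_op_onto:
 assumes P: "mesh_table i N P" and y: "y \<in> Hom i j v"
 obtains x where "x \<in> Hom i j (v + 2 * int (d i))" "right_op i x = y"
proof -
 define yn where "yn n = restr d (\<lambda>t c u s. c = int n) y" for n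
 have yn: "yn n \<in> pieces i (int n)" for n
  unfolding yn_def by (rule piecesI, rule restr_D[OF homog_D[OF y]]) (auto simp: restr_apply homog_supp[OF y])
 obtain X where X: "\<And>n. X n \<in> pieces i (int n)" "\<And>n. right_op i (X n) = yn n"
  using right_op_onto_pieces[OF P _ yn] by (metis of_nat_0_le_iff)
 have sum: "(\<Sum>n<N. yn n) = y"
 proof (rule ext, clarify)
  fix t w s
  have "(\<Sum>n<N. yn n) (t, w, s) = (\<Sum>n<N. if n = nat (cnt w) then y (t, w, s) else 0)"
   unfolding sum_fun_apply yn_def restr_apply by (intro sum.cong refl) auto
  also have "... = y (t, w, s)" using restr_count_zero[OF P y, of w t s]
   by (cases "int N <= cnt w") (auto simp: nat_less_iff)
  finally show "(\<Sum>n<N. yn n) (t, w, s) = y (t, w, s)" .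
 qed
 define x0 where "x0 = (\<Sum>n<N. X n)"
 have r0: "right_op i x0 = y"
  unfolding x0_def fvv.linear_sum[OF right_op_linear] X(2) by (rule sum)
 have x0D: "x0 \<in> D" unfolding x0_def by (intro fv.subspace_sum D_subspace pieces_D[OF X(1)])
 define x where "x = restr d (\<lambda>t c u s. t = j \<and> s = i \<and> u = v + 2 * int (d i)) x0"
 have "x \<in> Hom i j (v + 2 * int (d i))"
  unfolding x_def by (rule homogI, rule restr_D[OF x0D]) (auto simp: restr_apply)
 moreover have "right_op i x = y"
 proof (rule ext, clarify)
  fix t w s
  show "right_op i x (t, w, s) = y (t, w, s)"
   using fun_cong[OF r0, of "(t, w, s)"] homog_supp[OF y, of t s w]
   by (auto simp: right_op_def x_def restr_apply split: if_splits)
 qed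
 ultimately show ?thesis by (rule that)
qed

lemma right_pow_onto:
 assumes P: "mesh_table i N P" and y: "y \<in> Hom i j v"
 shows "\<exists>x \<in> Hom i j (v + 2 * int n * int (d i)). reps i n x = y"
proof (induction n)
 case 0 thus ?case using y by auto
next
 case (Suc n)
 then obtain x where x: "x \<in> Hom i j (v + 2 * int n * int (d i))" "reps i n x = y" by blast
 obtain x' where "x' \<in> Hom i j (v + 2 * int n * int (d i) + 2 * int (d i))" "right_op i x' = x"
  by (rule right_op_onto[OF P x(1)])
 thus ?case using x(2) by (intro bexI[of _ x']) (auto simp: funpow_swap1 algebra_simps simp del: funpow.simps simp: funpow_Suc_right)
qed

lemma left_pow_onto:
 assumes P: "mesh_table j N P" and y: "y \<in> Hom i j v"
 shows "\<exists>x \<in> Hom i j (v + 2 * int n * int (d j)). leps j n x = y"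
proof -
 obtain x where x: "x \<in> Hom j i (v + 2 * int n * int (d j))" "reps j n x = flip_fun y"
  using right_pow_onto[OF P flip_homog[OF y]] by blast
 thus ?thesis using flip_homog[OF x(1)] by (intro bexI[of _ "flip_fun x"]) (simp_all add: left_pow_flip)
qed

lemma funpow_eq_0:
 assumes L: "fun_linear (L :: ('z => 'k) => ('z => 'k))" and x: "(L ^^ l) x = 0" and "l <= m"
 shows "(L ^^ m) x = 0"
proof -
 have "m = (m - l) + l" using \<open>l <= m\<close> by simp
 hence "(L ^^ m) x = (L ^^ (m - l)) ((L ^^ l) x)" by (metis comp_apply funpow_add)
 thus ?thesis by (simp add: x fvv.linear_0[OF funpow_linear[OF L]])
qed

definition right_ker :: "'i => 'i => int => nat => ('i path => 'k) set" where
 "right_ker i j v l = {x \<in> Hom i j v. reps i l x = 0}"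

definition left_ker :: "'i => 'i => int => nat => ('i path => 'k) set" where
 "left_ker i j v l = {x \<in> Hom i j v. leps j l x = 0}"

lemma right_ker_subspace: "fv.subspace (right_ker i j v l)"
 unfolding right_ker_def
 by (rule fv.subspaceI)
   (auto simp: fvv.linear_add[OF funpow_linear[OF right_op_linear]] fvv.linear_scale[OF funpow_linear[OF right_op_linear]]
    fvv.linear_0[OF funpow_linear[OF right_op_linear]] intro: fv.subspace_0 fv.subspace_add fv.subspace_scale homog_subspace)

lemma left_ker_subspace: "fv.subspace (left_ker i j v l)"
 unfolding left_ker_def
 by (rule fv.subspaceI)
   (auto simp: left_pow_add left_pow_scale left_pow_zero intro: fv.subspace_0 fv.subspace_add fv.subspace_scale homog_subspace)

text \<open>The kernel is filtered by the number of letters \<open>Alpha\<close>, and the successive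
  quotients are the \<open>hom_bar\<close>.\<close>

lemma right_ker_1_dim:
 assumes P: "mesh_table i N P"
 shows "fin_dim (right_ker i j v 1) \<and> fv.dim (right_ker i j v 1) = (\<Sum>n<N. fv.dim (hom_bar i j (int n) v))"
proof -
 define Km where "Km m = {x \<in> right_ker i j v 1. \<forall>t w s. cnt w >= int m --> x (t, w, s) = 0}" for m
 have sub: "fv.subspace (Km m)" for m
  unfolding Km_def by (rule fv.subspaceI)
   (auto simp: fun_app intro: fv.subspace_0 fv.subspace_add fv.subspace_scale right_ker_subspace)
 have "fin_dim (Km m) \<and> fv.dim (Km m) = (\<Sum>n<m. fv.dim (hom_bar i j (int n) v))" if "m <= N" for m
  using that
 proof (induction m)
  case 0
  have "x = 0" if "x \<in> Km 0" for x using that by (auto simp: Km_def fun_eq_iff fun_app)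
  hence "Km 0 = {0}" using fv.subspace_0[OF sub] by blast
  thus ?case by (simp add: dim_zero fin_dim_trivial)
 next
  case (Suc m)
  let ?L = "restr d (\<lambda>t c u s. c = int m) :: ('i path => 'k) => _"
  have ker: "{x \<in> Km (Suc m). ?L x = 0} = Km m"
  proof -
   have "x \<in> Km (Suc m) \<and> ?L x = 0 \<longleftrightarrow> x \<in> Km m" for x
   proof
    assume x: "x \<in> Km (Suc m) \<and> ?L x = 0"
    have "x (t, w, s) = 0" if "cnt w >= int m" for t w s
    proof (cases "cnt w = int m")
     case True
     have "?L x (t, w, s) = 0" using x by (simp add: fun_app)
     thus ?thesis using True by (simp add: restr_apply)
    next
     case False
     thus ?thesis using x that by (auto simp: Km_def)
    qed
    thus "x \<in> Km m" using x by (auto simp: Km_def)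
   next
    assume "x \<in> Km m"
    thus "x \<in> Km (Suc m) \<and> ?L x = 0" by (auto simp: Km_def fun_eq_iff restr_apply fun_app)
   qed
   thus ?thesis by blast
  qed
  have im: "?L ` Km (Suc m) = hom_bar i j (int m) v"
  proof (intro equalityI subsetI)
   fix y assume "y \<in> ?L ` Km (Suc m)"
   then obtain x where x: "x \<in> Km (Suc m)" "y = ?L x" by auto
   hence xH: "x \<in> Hom i j v" and r0: "right_op i x = 0" by (auto simp: Km_def right_ker_def)
   have 0: "x (t, w @ [Eps i], i) = 0" for t w
    using fun_cong[OF r0, of "(t, w, i)"] by (simp add: right_op_def fun_app)
   show "y \<in> hom_bar i j (int m) v" unfolding x(2)
    by (intro hom_barI bar_piecesI piecesI restr_D homog_D[OF xH]) (auto simp: restr_apply homog_supp[OF xH] 0)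
  next
   fix y assume y: "y \<in> hom_bar i j (int m) v"
   note yB = hom_bar_B[OF y]
   note yp = pieces_supp[OF bar_pieces_pieces[OF yB]]
   have "y \<in> Hom i j v"
    by (rule homogI[OF bar_pieces_D[OF yB]]) (use hom_bar_supp[OF y] yp in blast)
   moreover have "right_op i y = 0" using yB by (simp add: bar_pieces_def)
   moreover have "y (t, w, s) = 0" if "cnt w >= int (Suc m)" for t w s by (rule yp) (use that in simp)
   ultimately have "y \<in> Km (Suc m)" by (simp add: Km_def right_ker_def)
   moreover have "?L y = y" using yp by (auto simp: fun_eq_iff restr_apply)
   ultimately show "y \<in> ?L ` Km (Suc m)" by (metis imageI)
  qed
  have fd: "fin_dim (Km (Suc m))"
   by (rule fin_dim_of_kernel_image[where L = ?L, OF restr_linear sub]) (use ker im Suc mesh_table_dims(1)[OF P] in \<open>simp_all\<close>)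
  show ?case using fd rank_nullity(2)[OF restr_linear fd sub, of d "\<lambda>t c u s. c = int m"] Suc by (simp add: ker im)
 qed
 moreover have "Km N = right_ker i j v 1"
  using restr_count_zero[OF P] by (auto simp: Km_def right_ker_def)
 ultimately show ?thesis by (metis order_refl)
qed

text \<open>As \<open>right_op i\<close> is onto, it maps the kernel of its power
  \<open>l + 1\<close> onto the kernel of its power \<open>l\<close>, lowering degrees by
  \<open>2 * d i\<close>; what it kills is the kernel of the first power.\<close>

lemma right_ker_dim:
 assumes P: "mesh_table i N P"
 shows "fin_dim (right_ker i j v l) \<and>
  fv.dim (right_ker i j v l) = (\<Sum>s<l. \<Sum>n<N. fv.dim (hom_bar i j (int n) (v - 2 * int s * int (d i))))"
proof (induction l arbitrary: v)
 case 0
 have "right_ker i j v 0 = {0}" using fv.subspace_0[OF homog_subspace] by (auto simp: right_ker_def)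
 thus ?case by (simp add: dim_zero fin_dim_trivial)
next
 case (Suc l)
 let ?v = "v - 2 * int (d i)"
 have ker: "{x \<in> right_ker i j v (Suc l). right_op i x = 0} = right_ker i j v 1"
 proof -
  have "reps i (Suc l) x = 0" if "right_op i x = 0" for x :: "'i path => 'k"
   using that by (induction l) (simp_all add: funpow_swap1)
  thus ?thesis by (auto simp: right_ker_def)
 qed
 have im: "right_op i ` right_ker i j v (Suc l) = right_ker i j ?v l"
 proof (intro equalityI subsetI)
  fix y assume "y \<in> right_op i ` right_ker i j v (Suc l)"
  thus "y \<in> right_ker i j ?v l" by (auto simp: right_ker_def right_homog funpow_swap1)
 next
  fix y assume y: "y \<in> right_ker i j ?v l"
  hence yH: "y \<in> Hom i j ?v" by (simp add: right_ker_def)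
  obtain x where x: "x \<in> Hom i j (?v + 2 * int (d i))" "right_op i x = y"
   by (rule right_op_onto[OF P yH])
  hence "x \<in> right_ker i j v (Suc l)" using y by (auto simp: right_ker_def funpow_swap1)
  with x show "y \<in> right_op i ` right_ker i j v (Suc l)" by blast
 qed
 have fd: "fin_dim (right_ker i j v (Suc l))"
  by (rule fin_dim_of_kernel_image[where L = "right_op i", OF right_op_linear right_ker_subspace])
    (use ker im Suc[of ?v] right_ker_1_dim[OF P, of j v] in simp_all)
 have "fv.dim (right_ker i j v (Suc l)) = (\<Sum>n<N. fv.dim (hom_bar i j (int n) v))
   + (\<Sum>s<l. \<Sum>n<N. fv.dim (hom_bar i j (int n) (?v - 2 * int s * int (d i))))"
  using rank_nullity(2)[OF right_op_linear fd right_ker_subspace, of i] right_ker_1_dim[OF P, of j v] Suc[of ?v]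
  by (simp add: ker im)
 also have "... = (\<Sum>s<Suc l. \<Sum>n<N. fv.dim (hom_bar i j (int n) (v - 2 * int s * int (d i))))"
  by (subst sum.lessThan_Suc_shift) (simp add: algebra_simps)
 finally show ?case using fd by simp
qed

text \<open>The anti-involution turns loops on the left into loops on the right and exchanges source
  and target. So the table is the one started at \<open>j\<close>, evaluated at
  \<open>i\<close>.\<close>

lemma left_ker_dim:
 assumes P: "mesh_table j N P"
 shows "fin_dim (left_ker i j v l)"
  and "of_nat (fv.dim (left_ker i j v l)) = (\<Sum>s<l. \<Sum>n<N. fls_nth (P i n) (2 * int s * int (d j) - v))"
proof -
 have img: "left_ker i j v l = flip_fun ` right_ker j i v l"
 proof (intro equalityI subsetI)
  fix x assume x: "x \<in> left_ker i j v l"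
  hence "flip_fun x \<in> right_ker j i v l"
   by (simp add: left_ker_def right_ker_def flip_homog right_pow_flip flip_eq_0_iff)
  thus "x \<in> flip_fun ` right_ker j i v l" by (metis flip_fun_flip imageI)
 next
  fix x assume "x \<in> flip_fun ` right_ker j i v l"
  thus "x \<in> left_ker i j v l"
   by (auto simp: left_ker_def right_ker_def flip_homog left_pow_flip flip_eq_0_iff)
 qed
 have fd: "fin_dim (right_ker j i v l)" using right_ker_dim[OF P] by blast
 show "fin_dim (left_ker i j v l)" unfolding img by (rule rank_nullity(1)[OF flip_fun_linear fd right_ker_subspace])
 have "fv.dim (left_ker i j v l) = fv.dim (right_ker j i v l)"
  unfolding img by (rule dim_injective_image[OF flip_fun_linear fd right_ker_subspace]) (simp add: flip_eq_0_iff)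
 hence "of_nat (fv.dim (left_ker i j v l))
   = (\<Sum>s<l. \<Sum>n<N. of_nat (fv.dim (hom_bar j i (int n) (v - 2 * int s * int (d j)))) :: rat)"
  using right_ker_dim[OF P, of i v l] by simp
 also have "... = (\<Sum>s<l. \<Sum>n<N. fls_nth (P i n) (2 * int s * int (d j) - v))"
  by (intro sum.cong refl) (simp add: mesh_table_dims(2)[OF P])
 finally show "of_nat (fv.dim (left_ker i j v l)) = (\<Sum>s<l. \<Sum>n<N. fls_nth (P i n) (2 * int s * int (d j) - v))" .
qed

text \<open>By centrality, \<open>a * (r div d j)\<close> loops on the left amount to
  \<open>a * (r div d i)\<close> loops on the right. The first number is at least \<open>l\<close>
  and the second at most \<open>k\<close>.\<close>

lemma left_ker_central:
 assumes k: "a * (r div d i) <= k" and l: "l <= a * (r div d j)"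
 shows "left_ker i j v l \<subseteq> right_ker i j v k"
proof
 fix x assume "x \<in> left_ker i j v l"
 hence x: "x \<in> Hom i j v" "leps j l x = 0" by (auto simp: left_ker_def)
 have "leps j ((b * (r div d j))) x = reps i ((b * (r div d i))) x" for b
 proof (induction b)
  case (Suc b)
  have "leps j (r div d j) (leps j ((b * (r div d j))) x)
   = reps i (r div d i) (leps j ((b * (r div d j))) x)"
   by (rule central_homog[OF left_pow_homog[OF x(1)]])
  thus ?case using Suc by (simp add: funpow_add)
 qed simp
 moreover have "leps j ((a * (r div d j))) x = 0"
  by (rule funpow_eq_0[OF left_op_linear x(2) l])
 ultimately have "reps i ((a * (r div d i))) x = 0" by metis
 hence "reps i k x = 0"
  by (rule funpow_eq_0[OF right_op_linear]) (rule k)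
 thus "x \<in> right_ker i j v k" using x by (simp add: right_ker_def)
qed

text \<open>A criterion that only refers to degrees: a power of \<open>left_op (Eps i)\<close> and one of
 \<open>right_op i\<close> take an element to the respective kernels.\<close>

lemma left_ker_spread:
 assumes P: "mesh_table i N P" and "l <= k"
  and spread: "\<And>n e e'. n < N ==> fls_nth (P i n) e ~= 0 ==> fls_nth (P i n) e' ~= 0 ==> e' - e < 2 * int (d i) * (int k - int l + 1)"
 shows "left_ker i i v l \<subseteq> right_ker i i v k"
proof
 fix x assume "x \<in> left_ker i i v l"
 hence x: "x \<in> Hom i i v" "leps i l x = 0" by (auto simp: left_ker_def)
 have "reps i k x = 0"
 proof (rule ccontr)
  assume "reps i k x ~= 0"
  then obtain t w s where nz: "reps i k x (t, w, s) ~= 0" by (auto simp: fun_eq_iff fun_app)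
  define n where "n = cnt w"
  have "s = i" using homog_supp[OF right_pow_homog[OF x(1), of k]] nz by metis
  \<comment> \<open>A slice on which \<open>reps i k x\<close> survives: the part \<open>y\<close>
    of \<open>x\<close> there is still killed by \<open>leps i l\<close>, but not by
    \<open>reps i k\<close>.\<close>
  define y where "y = restr d (\<lambda>t c u s. c = n) x"
  have y: "y \<in> Hom i i v" unfolding y_def by (rule restr_homog[OF x(1)])
  have yn: "y (t, w, s) = 0" if "cnt w ~= n" for t w s using that by (simp add: y_def restr_apply)
  have nN: "n < int N" "n >= 0"
   using restr_count_zero[OF P right_pow_homog[OF x(1), of k], of w t s] nz by (auto simp: n_def not_le[symmetric])
  have ry: "reps i m z (t, w, s) = 0" if "z \<in> Hom i i u" "\<And>t w s. cnt w ~= n ==> z (t, w, s) = 0" "cnt w ~= n"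
   for m t w s u and z :: "'i path => 'k"
   using that homog_supp[OF right_pow_homog[OF that(1), of m], of t s w]
   by (cases "s = i") (auto simp: right_op_pow_at)
  have ly: "leps i m z (t, w, s) = 0" if "z \<in> Hom i i u" "\<And>t w s. cnt w ~= n ==> z (t, w, s) = 0" "cnt w ~= n"
   for m t w s u and z :: "'i path => 'k"
   using that homog_supp[OF left_pow_homog[OF that(1), of m], of t s w]
   by (cases "t = i") (auto simp: left_op_pow_at)
  have yk: "reps i k y ~= 0"
  proof -
   have "reps i k y (t, w, s) = reps i k x (t, w, s)"
    using \<open>s = i\<close> by (simp add: right_op_pow_at y_def restr_apply n_def)
   thus ?thesis using nz by (metis zero_fun_apply)
  qed
  have yl: "leps i l y = 0"
  proof (rule ext, clarify)
   fix t w s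
   show "leps i l y (t, w, s) = 0 (t, w, s)"
   proof (cases "t = i")
    case True
    thus ?thesis using fun_cong[OF x(2), of "(t, w, s)"]
     by (simp add: left_op_pow_at y_def restr_apply fun_app)
   next
    case False
    thus ?thesis using homog_supp[OF left_pow_homog[OF y, of l], of t s w] by (simp add: fun_app)
   qed
  qed
  \<comment> \<open>Such a \<open>z\<close> is a non-zero element of a \<open>hom_bar\<close>, so
    the negative of its degree occurs as an exponent in the table.\<close>
  have exp: "fls_nth (P i (nat n)) (- u) ~= 0"
   if "z \<in> Hom i i u" "z ~= 0" "right_op i z = 0" "\<And>t w s. cnt w ~= n ==> z (t, w, s) = 0" for z u
  proof -
   have "z \<in> hom_bar i i (int (nat n)) u"
    using that nN homog_supp[OF that(1)]
    by (intro hom_barI bar_piecesI piecesI homog_D[OF that(1)])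
      (auto simp: right_op_def fun_eq_iff fun_app split: if_splits)
   hence "hom_bar i i (int (nat n)) u ~= {0}" using that(2) by blast
   thus ?thesis
    using dim_eq_0[OF mesh_table_dims(1)[OF P] hom_bar_subspace, of "nat n" i u] mesh_table_dims(2)[OF P, of "nat n" i u] nN
    by (metis nat_less_iff less_imp_le of_nat_eq_0_iff)
  qed
  \<comment> \<open>The last non-zero power from the left. After the anti-involution it is killed by
    \<open>right_op i\<close>, so \<open>exp\<close> applies to it.\<close>
  obtain s1 where s1: "leps i s1 y ~= 0" "left_op (Eps i) (leps i s1 y) = 0" "s1 < l"
  proof -
   obtain s1 where s1: "leps i s1 y = 0" "\<And>s'. s' < s1 ==> leps i s' y ~= 0" "s1 <= l"
    using exists_least_iff[of "\<lambda>s. leps i s y = 0"] yl by (metis not_le)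
   have "y ~= 0" using yk fvv.linear_0[OF funpow_linear[OF right_op_linear]] by metis
   then obtain s2 where "s1 = Suc s2" using s1(1) by (cases s1) auto
   with s1 show ?thesis by (intro that[of s2]) auto
  qed
  have e1: "fls_nth (P i (nat n)) (- (v - 2 * int s1 * int (d i))) ~= 0"
  proof (rule exp[of "flip_fun (leps i s1 y)"])
   show "flip_fun (leps i s1 y) \<in> Hom i i (v - 2 * int s1 * int (d i))"
    by (rule flip_homog[OF left_pow_homog[OF y]])
  qed (use s1 ly[OF y yn] in \<open>auto simp: flip_eq_0_iff right_op_flip flip_fun_apply\<close>)
  \<comment> \<open>The last non-zero power from the right. It exists because degrees on a slice are
    bounded below, and it is at least \<open>k\<close> by the choice of \<open>y\<close>.\<close>
  obtain m where m: "reps i m y ~= 0" "right_op i (reps i m y) = 0" "k <= m"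
  proof -
   have "reps i m y = 0" if m: "int m > v + int r * n" for m
   proof (rule ext, clarify)
    fix t w s
    have H: "reps i m y \<in> Hom i i (v - 2 * int m * int (d i))" by (rule right_pow_homog[OF y])
    show "reps i m y (t, w, s) = 0 (t, w, s)"
    proof (rule ccontr)
     assume nz: "reps i m y (t, w, s) ~= 0 (t, w, s)"
     hence "wdeg d w = v - 2 * int m * int (d i)" "cnt w = n"
      using homog_supp[OF H, of t s w] ry[OF y yn, of w m t s] by (auto simp: fun_app)
     moreover have "int m * int (d i) >= int m" using mult_left_mono[of 1 "int (d i)" "int m"] d_pos[of i] by simp
     ultimately show False using wdeg_lower[of w] m by (simp add: algebra_simps)
    qed
   qed
   moreover have "int (nat (v + int r * n) + 1) > v + int r * n" by linarith
   ultimately have "\<exists>m. reps i m y = 0" by blast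
   then obtain m where m: "reps i m y = 0" "\<And>s'. s' < m ==> reps i s' y ~= 0"
    using exists_least_iff[of "\<lambda>s. reps i s y = 0"] by blast
   have "k < m"
   proof (rule ccontr)
    assume "\<not> k < m"
    thus False using funpow_eq_0[OF right_op_linear m(1), of k] yk by simp
   qed
   then obtain m' where "m = Suc m'" by (cases m) auto
   with m \<open>k < m\<close> show ?thesis by (intro that[of m']) auto
  qed
  have e2: "fls_nth (P i (nat n)) (- (v - 2 * int m * int (d i))) ~= 0"
   by (rule exp[OF right_pow_homog[OF y]]) (use m ry[OF y yn] in auto)
  \<comment> \<open>The two exponents differ by \<open>2 * d i * (m - s1)\<close>, and
    \<open>s1 < l\<close> together with \<open>k <= m\<close> exceeds the allowed spread.\<close>
  have "2 * int (d i) * (int m - int s1) < 2 * int (d i) * (int k - int l + 1)"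
   using spread[OF _ e1 e2] nN by (simp add: algebra_simps)
  hence "int m - int s1 < int k - int l + 1" using d_pos[of i] by simp
  thus False using s1(3) m(3) by simp
 qed
 thus "x \<in> right_ker i i v k" using x by (simp add: right_ker_def)
qed

end

section \<open>Pairing the path algebra with functions on paths\<close>

text \<open>Only the second argument has finite support. Thus an arbitrary function on paths is a
  functional on the path algebra, and every functional arises so.\<close>

definition pair :: "('z => 'k::field) => ('z => 'k) => 'k" where
 "pair l x = (\<Sum>p | x p ~= 0. x p * l p)"

definition fin_supp :: "('z => 'k::field) set" where
 "fin_supp = {x. finite {p. x p ~= 0}}"

lemma fin_supp_add: "x \<in> fin_supp ==> y \<in> fin_supp ==> x + y \<in> fin_supp"
 unfolding fin_supp_def by (auto simp: fun_app intro: finite_subset[of _ "{p. x p ~= 0} \<union> {p. y p ~= 0}"])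

lemma fin_supp_scale: "x \<in> fin_supp ==> sc c x \<in> fin_supp"
 unfolding fin_supp_def by (auto simp: fun_app intro: finite_subset[of _ "{p. x p ~= 0}"])

lemma fin_supp_zero: "0 \<in> fin_supp"
 by (simp add: fin_supp_def fun_app)

lemma pair_superset:
 assumes "finite S" "{p. x p ~= 0} \<subseteq> S"
 shows "pair l x = (\<Sum>p\<in>S. x p * l p)"
 unfolding pair_def by (rule sum.mono_neutral_left) (use assms in auto)

lemma pair_add:
 assumes "x \<in> fin_supp" "y \<in> fin_supp"
 shows "pair l (x + y) = pair l x + pair l y"
proof -
 let ?S = "{p. x p ~= 0} \<union> {p. y p ~= 0}"
 have "finite ?S" using assms by (simp add: fin_supp_def)
 thus ?thesis
  by (subst (1 2 3) pair_superset[of ?S]) (auto simp: fun_app distrib_right sum.distrib)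
qed

lemma pair_scale: "pair l (sc c x) = c * pair l x"
proof (cases "c = 0")
 case False
 thus ?thesis by (simp add: pair_def sc_apply sum_distrib_left mult.assoc)
qed (simp add: pair_def fun_app)

lemma pair_zero: "pair l 0 = 0"
 by (simp add: pair_def fun_app)

lemma pair_diff:
 assumes "x \<in> fin_supp" "y \<in> fin_supp"
 shows "pair l (x - y) = pair l x - pair l y"
proof -
 have e: "x - y = x + sc (-1) y" by (auto simp: fun_eq_iff fun_app)
 show ?thesis using pair_add[OF assms(1) fin_supp_scale[OF assms(2)], of l "-1"] unfolding e pair_scale by simp
qed

lemma pair_zero_left: "pair 0 x = 0"
 by (simp add: pair_def fun_app)

lemma pair_sum:
 assumes "finite S" "\<And>i. i \<in> S ==> x i \<in> fin_supp"
 shows "(\<Sum>i\<in>S. x i) \<in> fin_supp \<and> pair l (\<Sum>i\<in>S. x i) = (\<Sum>i\<in>S. pair l (x i))"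
 using assms by (induction S rule: finite_induct) (simp_all add: fin_supp_zero pair_zero fin_supp_add pair_add)

lemma pair_basis:
 fixes l :: "'i path => 'k::field"
 shows "pair l (basis_path p) = l p"
proof -
 have "{q. basis_path p q ~= (0::'k)} = {p}" by (auto simp: basis_path_def)
 thus ?thesis by (simp add: pair_def) (simp add: basis_path_def)
qed

lemma basis_fin_supp: "(basis_path p :: 'i path => 'k::field) \<in> fin_supp"
proof -
 have "{q. basis_path p q ~= (0::'k)} = {p}" by (auto simp: basis_path_def)
 thus ?thesis by (simp add: fin_supp_def)
qed

text \<open>The support of the rest stays inside that of \<open>x\<close>, so conditions on
  supports, such as a fixed source, survive the induction.\<close>

lemma fin_supp_induct [consumes 1, case_names zero add]:
 assumes x: "x \<in> fin_supp" and 0: "P 0"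
  and add: "\<And>c p y. x p ~= 0 ==> y \<in> fin_supp ==> {q. y q ~= 0} \<subseteq> {q. x q ~= 0} ==> P y ==> P (sc c (\<lambda>q. if q = p then 1 else 0) + y)"
 shows "P (x :: 'z => 'k::field)"
proof -
 have "P y" if "finite S" "S \<subseteq> {p. x p ~= 0}" "{p. y p ~= 0} \<subseteq> S" for S y
  using that
 proof (induction S arbitrary: y rule: finite_induct)
  case empty
  hence "y = 0" by (auto simp: fun_eq_iff fun_app)
  thus ?case using 0 by simp
 next
  case (insert p S)
  define y' where "y' = (\<lambda>q. if q = p then 0 else y q)"
  have y: "y = sc (y p) (\<lambda>q. if q = p then 1 else 0) + y'" by (auto simp: fun_eq_iff fun_app y'_def)
  have s: "{q. y' q ~= 0} \<subseteq> S" using insert by (auto simp: y'_def)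
  have "P (sc (y p) (\<lambda>q. if q = p then 1 else 0) + y')"
  proof (rule add)
   show "y' \<in> fin_supp" using finite_subset[OF s insert(1)] by (simp add: fin_supp_def)
   show "P y'" by (rule insert.IH) (use insert s in auto)
  qed (use insert s in auto)
  thus ?case by (subst y)
 qed
 from this[of "{p. x p ~= 0}" x] x show ?thesis by (simp add: fin_supp_def)
qed

lemma functional_eq_pair:
 fixes L :: "('z => 'k::field) => 'k"
 assumes L: "functional L" and x: "x \<in> fin_supp"
 shows "L x = pair (\<lambda>p. L (\<lambda>q. if q = p then 1 else 0)) x"
 using x
proof (induction rule: fin_supp_induct)
 case zero
 show "L 0 = pair (\<lambda>p. L (\<lambda>q. if q = p then 1 else 0)) 0" by (simp add: fvk.linear_0[OF L] pair_zero)
next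
 case (add c p y)
 let ?e = "\<lambda>q. if q = p then 1 else (0::'k)"
 have e: "?e \<in> fin_supp" "pair l ?e = l p" for l
  by (simp_all add: fin_supp_def pair_def)
 show "L (sc c ?e + y) = pair (\<lambda>p. L (\<lambda>q. if q = p then 1 else 0)) (sc c ?e + y)"
  using add by (simp add: fvk.linear_add[OF L] fvk.linear_scale[OF L] pair_add fin_supp_scale e pair_scale)
qed

section \<open>The path algebra\<close>

definition path_times :: "'i path => ('i path => 'k::field) => 'i path => 'k" where
 "path_times q x = (\<lambda>(t, w, s). if t = fst q \<and> length (fst (snd q)) <= length w \<and> take (length (fst (snd q))) w = fst (snd q)
   then x (snd (snd q), drop (length (fst (snd q))) w, s) else 0)"

text \<open>The transpose of left multiplication by a whole path, cf. \<open>pair_left_mult\<close>;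
  \<open>right_path\<close> is its counterpart on the right.\<close>

definition left_path :: "'i path => ('i path => 'k::field) => 'i path => 'k" where
 "left_path q l = (\<lambda>(t, w, s). if t = snd (snd q) then l (fst q, fst (snd q) @ w, s) else 0)"

definition right_path :: "'i path => ('i path => 'k::field) => 'i path => 'k" where
 "right_path q l = (\<lambda>(t, w, s). if s = fst q then l (t, w @ fst (snd q), snd (snd q)) else 0)"

lemma is_path_src_unique: "is_path C (t, w, s) ==> is_path C (t, w, s') ==> s = s'"
 by (induction w arbitrary: t) auto

lemma is_path_tgt_unique: "is_path C (t, w, s) ==> is_path C (t', w, s) ==> t = t'"
 by (cases w) auto

lemma is_path_replicate: "is_path C (t, eps n i, s) \<longleftrightarrow> (if n = 0 then t = s else t = i \<and> s = i)"
 by (induction n arbitrary: t) auto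

context gpa_over
begin

abbreviation PA :: "('i path => 'k) ring" where "PA \<equiv> path_algebra C"

abbreviation pmult (infixl "\<cdot>" 70) where "x \<cdot> y \<equiv> x \<otimes>\<^bsub>PA\<^esub> y"

lemma PA_simps:
 "x \<oplus>\<^bsub>PA\<^esub> y = x + y" "\<zero>\<^bsub>PA\<^esub> = 0"
 by (simp_all add: path_algebra_def plus_fun_def zero_fun_def)

lemma PA_carrier: "x \<in> carrier PA \<longleftrightarrow> x \<in> fin_supp \<and> (\<forall>p. x p ~= 0 --> is_path C p)"
 unfolding path_algebra_def fin_supp_def by simp

lemma PA_fin_supp: "x \<in> carrier PA ==> x \<in> fin_supp"
 unfolding PA_carrier by blast

interpretation PA: ring PA by (rule path_algebra_ring)

lemma PA_zero: "0 \<in> carrier PA"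
 using PA.zero_closed by (simp only: PA_simps)

lemma PA_add: "x \<in> carrier PA ==> y \<in> carrier PA ==> x + y \<in> carrier PA"
 using PA.add.m_closed[of x y] by (simp only: PA_simps)

lemma PA_scale: "x \<in> carrier PA ==> sc c x \<in> carrier PA"
 unfolding PA_carrier by (auto simp: fin_supp_scale sc_apply)

lemma PA_subspace: "fv.subspace (carrier PA)"
 by (rule fv.subspaceI) (auto intro: PA_zero PA_add PA_scale)

lemma PA_uminus:
 assumes y: "y \<in> carrier PA" shows "\<ominus>\<^bsub>PA\<^esub> y = - y" "- y \<in> carrier PA"
proof -
 show n: "- y \<in> carrier PA" using PA_scale[OF y, of "-1"] by simp
 show "\<ominus>\<^bsub>PA\<^esub> y = - y"
  by (rule PA.minus_equality) (use n y in \<open>simp_all only: PA_simps left_minus\<close>)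
qed

lemma PA_minus: "y \<in> carrier PA ==> x \<ominus>\<^bsub>PA\<^esub> y = x - y"
 by (simp add: a_minus_def PA_simps PA_uminus)

lemma PA_diff: "x \<in> carrier PA ==> y \<in> carrier PA ==> x - y \<in> carrier PA"
 by (rule fv.subspace_diff[OF PA_subspace])

lemma basis_PA: "is_path C p ==> basis_path p \<in> carrier PA"
 unfolding PA_carrier by (auto simp: basis_fin_supp) (auto simp: basis_path_def split: if_splits)

lemma PA_mult_add: "x \<cdot> (y + z) = x \<cdot> y + x \<cdot> z" "(x + y) \<cdot> z = x \<cdot> z + y \<cdot> z"
 by (auto simp: path_algebra_def fun_eq_iff fun_app distrib_left distrib_right sum.distrib)

lemma PA_mult_scale: "sc c x \<cdot> y = sc c (x \<cdot> y)" "x \<cdot> sc c y = sc c (x \<cdot> y)"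
 by (auto simp: path_algebra_def fun_eq_iff fun_app sum_distrib_left mult_ac)

lemma PA_mult_diff: "x \<cdot> (y - z) = x \<cdot> y - x \<cdot> z" "(x - y) \<cdot> z = x \<cdot> z - y \<cdot> z"
 by (auto simp: path_algebra_def fun_eq_iff fun_app left_diff_distrib right_diff_distrib sum_subtractf)

lemma PA_mult_zero: "0 \<cdot> x = 0" "x \<cdot> 0 = 0"
 by (auto simp: path_algebra_def fun_eq_iff fun_app)

lemma PA_mult_sum: "finite S ==> x \<cdot> (\<Sum>i\<in>S. y i) = (\<Sum>i\<in>S. x \<cdot> y i)"
 "finite S ==> (\<Sum>i\<in>S. y i) \<cdot> x = (\<Sum>i\<in>S. y i \<cdot> x)"
 by (induction S rule: finite_induct; simp add: PA_mult_zero PA_mult_add)+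

lemma PA_induct [consumes 1, case_names zero scale_basis]:
 assumes x: "x \<in> carrier PA" and 0: "P 0"
  and add: "\<And>c p y. is_path C p ==> x p ~= 0 ==> y \<in> carrier PA ==> {q. y q ~= 0} \<subseteq> {q. x q ~= 0} ==> P y ==> P (sc c (basis_path p) + y)"
 shows "P x"
proof (rule fin_supp_induct[of x P, OF PA_fin_supp[OF x] 0])
 fix c p and y :: "'i path => 'k"
 assume p: "x p ~= 0" and y: "y \<in> fin_supp" "{q. y q ~= 0} \<subseteq> {q. x q ~= 0}" "P y"
 have "P (sc c (basis_path p) + y)"
 proof (rule add)
  show "is_path C p" using x p unfolding PA_carrier by blast
  show "y \<in> carrier PA" using x y unfolding PA_carrier by blast
 qed (use p y in auto)
 thus "P (sc c (\<lambda>q. if q = p then 1 else 0) + y)" by (simp add: basis_path_def)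
qed

lemma basis_mult_basis:
 "basis_path (a, u, b) \<cdot> basis_path (t, w, s) = (if b = t then basis_path (a, u @ w, s) else 0)"
proof (rule ext, clarify)
 fix a' x s'
 have "(basis_path (a, u, b) \<cdot> basis_path (t, w, s)) (a', x, s')
   = (\<Sum>m\<le>length x. \<Sum>v\<in>UNIV. if v = b then (if m = length u then (if b = t \<and> a' = a \<and> s' = s \<and> x = u @ w then 1 else 0) else 0) else (0 :: 'k))"
 proof -
  have iff: "(take m x = u \<and> drop m x = w) = (m = length u \<and> x = u @ w)" if "m <= length x" for m
   using that append_take_drop_id[of m x] by (auto simp: min_def)
  have prd: "basis_path (a, u, b) (a', take m x, v) * basis_path (t, w, s) (v, drop m x, s')
   = (if (take m x = u \<and> drop m x = w) \<and> v = b \<and> b = t \<and> a' = a \<and> s' = s then 1 else (0 :: 'k))" for m v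
   by (auto simp: basis_path_def)
  have "basis_path (a, u, b) (a', take m x, v) * basis_path (t, w, s) (v, drop m x, s')
   = (if v = b then (if m = length u then (if b = t \<and> a' = a \<and> s' = s \<and> x = u @ w then 1 else 0) else 0) else (0 :: 'k))"
   if "m <= length x" for m v
   unfolding prd iff[OF that] by auto
  thus ?thesis by (simp add: path_algebra_def)
 qed
 also have "... = (\<Sum>m\<le>length x. if m = length u then (if b = t \<and> a' = a \<and> s' = s \<and> x = u @ w then 1 else 0) else (0 :: 'k))"
  by simp
 also have "... = (if b = t then basis_path (a, u @ w, s) else 0) (a', x, s')"
  by (auto simp: basis_path_def fun_app)
 finally show "(basis_path (a, u, b) \<cdot> basis_path (t, w, s)) (a', x, s')
  = (if b = t then basis_path (a, u @ w, s) else 0 :: 'i path => 'k) (a', x, s')" .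
qed

lemma left_path_D:
 assumes l: "l \<in> D" and q: "is_path C q"
 shows "left_path q l \<in> D"
proof -
 obtain a u b where q': "q = (a, u, b)" by (cases q)
 show ?thesis
 proof (rule rel_dualI)
  show "is_path C p" if "left_path q l p ~= 0" for p
  proof -
   obtain t w s where p: "p = (t, w, s)" by (cases p)
   hence "t = b" "is_path C (a, u @ w, s)"
    using that rel_dual_path[OF l] by (auto simp: left_path_def q' split: if_splits)
   then obtain x where "is_path C (a, u, x)" "is_path C (x, w, s)" by (auto simp: is_path_append)
   moreover have "x = b" using is_path_src_unique[OF \<open>is_path C (a, u, x)\<close>] q q' by simp
   ultimately show ?thesis using p \<open>t = b\<close> by simp
  qed
  show "left_path q l (t, u' @ eps (E i j) i @ Alpha i j # w, s)
     = left_path q l (t, u' @ Alpha i j # eps (E j i) j @ w, s)"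
   if "adj C i j" for i j u' w t s
   using rel_dual_R1[OF l that, where u = "u @ u'"] by (simp add: left_path_def q')
  show "mesh_sum C \<omega> (left_path q l) i t u' w s = 0" for i u' w t s
   using rel_dual_R2[OF l, where u = "u @ u'"] by (cases "t = b") (simp_all add: left_path_def q')
 qed
qed

lemma right_path_D:
 assumes l: "l \<in> D" and q: "is_path C q"
 shows "right_path q l \<in> D"
proof -
 obtain a u b where q': "q = (a, u, b)" by (cases q)
 show ?thesis
 proof (rule rel_dualI)
  show "is_path C p" if "right_path q l p ~= 0" for p
  proof -
   obtain t w s where p: "p = (t, w, s)" by (cases p)
   hence "s = a" "is_path C (t, w @ u, b)"
    using that rel_dual_path[OF l] by (auto simp: right_path_def q' split: if_splits)
   then obtain x where "is_path C (t, w, x)" "is_path C (x, u, b)" by (auto simp: is_path_append)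
   moreover have "x = a" using is_path_tgt_unique[OF \<open>is_path C (x, u, b)\<close>] q q' by simp
   ultimately show ?thesis using p \<open>s = a\<close> by simp
  qed
  show "right_path q l (t, u' @ eps (E i j) i @ Alpha i j # w, s)
     = right_path q l (t, u' @ Alpha i j # eps (E j i) j @ w, s)"
   if "adj C i j" for i j u' w t s
   using rel_dual_R1[OF l that, where u = u' and w = "w @ u"] by (simp add: right_path_def q')
  show "mesh_sum C \<omega> (right_path q l) i t u' w s = 0" for i u' w t s
   using rel_dual_R2[OF l, where u = u' and w = "w @ u"] by (cases "s = a") (simp_all add: right_path_def q')
 qed
qed

lemma pair_left_mult:
 assumes x: "x \<in> carrier PA" and q: "is_path C q"
 shows "pair l (basis_path q \<cdot> x) = pair (left_path q l) x"
 using x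
proof (induction rule: PA_induct)
 case zero
 show "pair l (basis_path q \<cdot> 0) = pair (left_path q l) 0"
  by (simp add: PA_mult_zero pair_zero)
next
 case (scale_basis c p y)
 have f: "basis_path q \<cdot> z \<in> fin_supp" if "z \<in> carrier PA" for z
  by (intro PA_fin_supp PA.m_closed basis_PA that q)
 obtain a u b t w s where "q = (a, u, b)" "p = (t, w, s)" by (cases q, cases p)
 hence "pair l (basis_path q \<cdot> basis_path p) = pair (left_path q l) (basis_path p)"
  by (simp add: basis_mult_basis pair_basis pair_zero) (simp add: left_path_def)
 thus "pair l (basis_path q \<cdot> (sc c (basis_path p) + y)) = pair (left_path q l) (sc c (basis_path p) + y)"
  using scale_basis
  by (simp add: PA_mult_add PA_mult_scale pair_add f basis_PA fin_supp_scale basis_fin_supp PA_fin_supp pair_scale)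
qed

lemma pair_right_mult:
 assumes x: "x \<in> carrier PA" and q: "is_path C q"
 shows "pair l (x \<cdot> basis_path q) = pair (right_path q l) x"
 using x
proof (induction rule: PA_induct)
 case zero
 show "pair l (0 \<cdot> basis_path q) = pair (right_path q l) 0"
  by (simp add: PA_mult_zero pair_zero)
next
 case (scale_basis c p y)
 have f: "z \<cdot> basis_path q \<in> fin_supp" if "z \<in> carrier PA" for z
  by (intro PA_fin_supp PA.m_closed basis_PA that q)
 obtain a u b t w s where "q = (a, u, b)" "p = (t, w, s)" by (cases q, cases p)
 hence "pair l (basis_path p \<cdot> basis_path q) = pair (right_path q l) (basis_path p)"
  by (simp add: basis_mult_basis pair_basis pair_zero) (simp add: right_path_def)
 thus "pair l ((sc c (basis_path p) + y) \<cdot> basis_path q) = pair (right_path q l) (sc c (basis_path p) + y)"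
  using scale_basis
  by (simp add: PA_mult_add PA_mult_scale pair_add f basis_PA fin_supp_scale basis_fin_supp PA_fin_supp pair_scale)
qed

section \<open>The preprojective algebra\<close>

abbreviation II :: "('i path => 'k) set" where "II \<equiv> preproj_ideal C \<omega>"

lemma II_ideal: "ideal II PA"
 by (rule preproj_ideal_is_ideal) (rule adj_sym)

interpretation II: ideal II PA by (rule II_ideal)

lemma II_PA: "x \<in> II ==> x \<in> carrier PA"
 by (rule II.Icarr)

lemma rel1_eq: "rel1 C i j = basis_path (i, eps (E i j) i @ [Alpha i j], j)
   - (basis_path (i, Alpha i j # eps (E j i) j, j) :: 'i path => 'k)"
 by (auto simp: rel1_def eps_mult_def fun_eq_iff)

lemma rel2_eq: "rel2 C \<omega> i = (\<Sum>j | adj C i j. \<Sum>k<E i j. sc (of_int (\<omega> i j))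
   (basis_path (i, eps k i @ [Alpha i j, Alpha j i] @ eps (E i j - 1 - k) i, i) :: 'i path => 'k))"
 by (rule ext) (simp add: rel2_def eps_mult_def sum_fun_apply sc_apply)

lemma rel1_path: "adj C i j ==> is_path C (t, u @ eps n i @ Alpha i j # w, s) \<longleftrightarrow> is_path C (t, u, i) \<and> is_path C (j, w, s)"
 "adj C i j ==> is_path C (t, u @ Alpha i j # eps n j @ w, s) \<longleftrightarrow> is_path C (t, u, i) \<and> is_path C (j, w, s)"
 by (auto simp: is_path_append is_path_replicate split: if_splits)

lemma rel2_path: "adj C i j ==> is_path C (t, u @ eps k i @ Alpha i j # Alpha j i # eps n i @ w, s)
  \<longleftrightarrow> is_path C (t, u, i) \<and> is_path C (i, w, s)"
 using adj_sym by (auto simp: is_path_append is_path_replicate split: if_splits)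

lemma rels_PA: "adj C i j ==> rel1 C i j \<in> carrier PA" "rel2 C \<omega> i \<in> carrier PA"
proof -
 show "rel1 C i j \<in> carrier PA" if "adj C i j"
  unfolding rel1_eq
  by (intro PA_diff basis_PA) (use that rel1_path[OF that, of i "[]" _ "[]" j] in auto)
 show "rel2 C \<omega> i \<in> carrier PA"
  unfolding rel2_eq
 proof (intro fv.subspace_sum[OF PA_subspace] PA_scale basis_PA)
  fix j k assume "j \<in> {j. adj C i j}"
  thus "is_path C (i, eps k i @ [Alpha i j, Alpha j i] @ eps (E i j - 1 - k) i, i)"
   using rel2_path[of i j i "[]" k _ "[]" i] by simp
 qed
qed

lemma II_subspace: "fv.subspace II"
proof (rule fv.subspaceI)
 show "0 \<in> II" using II.zero_closed by (simp only: PA_simps)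
 show "x + y \<in> II" if "x \<in> II" "y \<in> II" for x y using II.a_closed[OF that] by (simp only: PA_simps)
 show "sc c x \<in> II" if "x \<in> II" for c x
 proof -
  have "sc c \<one>\<^bsub>PA\<^esub> \<cdot> x \<in> II" by (rule II.I_l_closed[OF that]) (rule PA_scale[OF PA.one_closed])
  thus ?thesis using II_PA[OF that] by (simp add: PA_mult_scale)
 qed
qed

lemma II_mult: "x \<in> II ==> y \<in> carrier PA ==> y \<cdot> x \<in> II" "x \<in> II ==> y \<in> carrier PA ==> x \<cdot> y \<in> II"
 by (auto intro: II.I_l_closed II.I_r_closed)

text \<open>The elements killed by all of \<open>D\<close> form a two-sided ideal, because
  \<open>D\<close> is stable under the transposes of left and right multiplication by paths; this
  ideal contains the relations.\<close>

lemma D_annihilates_II: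
 assumes l: "l \<in> D" and x: "x \<in> II"
 shows "pair l x = 0"
proof -
 define Z where "Z = {x \<in> carrier PA. \<forall>l\<in>D. pair l x = 0}"
 have "ideal Z PA"
 proof (rule idealI[OF path_algebra_ring])
  show "subgroup Z (add_monoid PA)"
  proof (rule subgroup.intro)
   show "Z \<subseteq> carrier (add_monoid PA)" by (auto simp: Z_def)
   show "x \<otimes>\<^bsub>add_monoid PA\<^esub> y \<in> Z" if "x \<in> Z" "y \<in> Z" for x y
    using that by (auto simp: Z_def PA_simps PA_add pair_add PA_fin_supp)
   show "\<one>\<^bsub>add_monoid PA\<^esub> \<in> Z" by (auto simp: Z_def PA_simps PA_zero pair_zero)
   show "inv\<^bsub>add_monoid PA\<^esub> x \<in> Z" if "x \<in> Z" for x
   proof -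
    have "inv\<^bsub>add_monoid PA\<^esub> x = - x" using that PA_uminus(1)[of x] by (simp add: Z_def a_inv_def)
    moreover have "pair l (- x) = - pair l x" for l using pair_scale[of l "-1" x] by simp
    ultimately show ?thesis using that by (auto simp: Z_def PA_uminus)
   qed
  qed
  show "y \<cdot> x \<in> Z" if x: "x \<in> Z" and y: "y \<in> carrier PA" for x y
   using y
  proof (induction rule: PA_induct)
   case zero
   show "0 \<cdot> x \<in> Z" by (simp add: Z_def PA_mult_zero PA_zero pair_zero)
  next
   case (scale_basis c p y)
   have "basis_path p \<cdot> x \<in> Z"
    using x scale_basis by (auto simp: Z_def basis_PA pair_left_mult left_path_D)
   thus "(sc c (basis_path p) + y) \<cdot> x \<in> Z"
    using scale_basis by (auto simp: Z_def PA_mult_add PA_mult_scale PA_add PA_scale pair_add pair_scale PA_fin_supp fin_supp_scale)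
  qed
  show "x \<cdot> y \<in> Z" if x: "x \<in> Z" and y: "y \<in> carrier PA" for x y
   using y
  proof (induction rule: PA_induct)
   case zero
   show "x \<cdot> 0 \<in> Z" by (simp add: Z_def PA_mult_zero PA_zero pair_zero)
  next
   case (scale_basis c p y)
   have "x \<cdot> basis_path p \<in> Z"
    using x scale_basis by (auto simp: Z_def basis_PA pair_right_mult right_path_D)
   thus "x \<cdot> (sc c (basis_path p) + y) \<in> Z"
    using scale_basis by (auto simp: Z_def PA_mult_add PA_mult_scale PA_add PA_scale pair_add pair_scale PA_fin_supp fin_supp_scale)
  qed
 qed
 moreover have "{rel1 C i j |i j. adj C i j} \<union> range (rel2 C \<omega>) \<subseteq> Z"
 proof -
  have "pair l (rel1 C i j) = 0" if l: "l \<in> D" and "adj C i j" for l :: "'i path => 'k" and i j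
   using rel_dual_R1[OF l \<open>adj C i j\<close>, of i "[]" "[]" j]
   by (simp add: rel1_eq pair_diff basis_fin_supp pair_basis)
  moreover have "pair l (rel2 C \<omega> i) = 0" if l: "l \<in> D" for l :: "'i path => 'k" and i
   using rel_dual_R2[OF l, of i i "[]" "[]" i]
   unfolding rel2_eq by (simp add: pair_sum fin_supp_scale basis_fin_supp pair_scale pair_basis)
  ultimately show ?thesis using rels_PA by (auto simp: Z_def)
 qed
 ultimately have "II \<subseteq> Z" unfolding preproj_ideal_def by (rule PA.genideal_minimal)
 with l x show ?thesis by (auto simp: Z_def)
qed

lemma annihilator_in_D:
 assumes path: "\<And>p. \<not> is_path C p ==> l p = 0" and ann: "\<And>x. x \<in> II ==> pair l x = 0"
 shows "l \<in> D"
proof (rule rel_dualI)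
 show "is_path C p" if "l p ~= 0" for p using that path by blast
 have gen: "{rel1 C i j |i j. adj C i j} \<union> range (rel2 C \<omega>) \<subseteq> II"
  unfolding preproj_ideal_def by (rule PA.genideal_self) (use rels_PA in auto)
 show "l (t, u @ eps (E i j) i @ Alpha i j # w, s)
     = l (t, u @ Alpha i j # eps (E j i) j @ w, s)" if adj: "adj C i j" for i j u w t s
 proof (cases "is_path C (t, u, i) \<and> is_path C (j, w, s)")
  case True
  have "basis_path (t, u, i) \<cdot> rel1 C i j \<cdot> basis_path (j, w, s) \<in> II"
   using gen adj True by (intro II_mult basis_PA) auto
  hence "pair l (basis_path (t, u @ eps (E i j) i @ Alpha i j # w, s)
   - basis_path (t, u @ Alpha i j # eps (E j i) j @ w, s)) = 0"
   using ann by (fastforce simp: rel1_eq PA_mult_diff basis_mult_basis)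
  thus ?thesis by (simp add: pair_diff basis_fin_supp pair_basis)
 next
  case False
  thus ?thesis by (subst (1 2) path) (auto simp: rel1_path[OF adj])
 qed
 show "mesh_sum C \<omega> l i t u w s = 0" for i u w t s
 proof (cases "is_path C (t, u, i) \<and> is_path C (i, w, s)")
  case True
  have "basis_path (t, u, i) \<cdot> rel2 C \<omega> i \<cdot> basis_path (i, w, s) \<in> II"
   using gen True by (intro II_mult basis_PA) auto
  hence "pair l (basis_path (t, u, i) \<cdot> rel2 C \<omega> i \<cdot> basis_path (i, w, s)) = 0" by (rule ann)
  thus ?thesis
   by (simp add: rel2_eq PA_mult_sum PA_mult_scale basis_mult_basis pair_sum fin_supp_scale basis_fin_supp pair_scale pair_basis)
 next
  case False
  have "l (t, u @ eps k i @ Alpha i j # Alpha j i #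
       eps (E i j - 1 - k) i @ w, s) = 0" if "adj C i j" for j k
   by (rule path) (use False rel2_path[OF that] in blast)
  thus ?thesis by simp
 qed
qed

text \<open>An element outside the ideal is separated from it by a functional. On the path algebra
  this functional is the pairing with its own values on paths, and the function of these values lies
  in \<open>D\<close>.\<close>

lemma II_iff:
 assumes x: "x \<in> carrier PA"
 shows "x \<in> II \<longleftrightarrow> (\<forall>l\<in>D. pair l x = 0)"
proof
 assume "\<forall>l\<in>D. pair l x = 0"
 show "x \<in> II"
 proof (rule ccontr)
  assume "x \<notin> II"
  obtain L where L: "functional L" "\<And>y. y \<in> II ==> L y = 0" "L x = 1"
   by (rule functional_separate[OF II_subspace \<open>x \<notin> II\<close>], rule that)
  define l where "l p = (if is_path C p then L (\<lambda>q. if q = p then 1 else 0) else 0)" for p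
  have pl: "pair l y = L y" if "y \<in> carrier PA" for y
  proof -
   have "pair l y = pair (\<lambda>p. L (\<lambda>q. if q = p then 1 else 0)) y"
    unfolding pair_def by (intro sum.cong refl) (use that in \<open>auto simp: l_def PA_carrier\<close>)
   thus ?thesis using functional_eq_pair[OF L(1) PA_fin_supp[OF that]] by simp
  qed
  have "l \<in> D" by (rule annihilator_in_D) (auto simp: l_def pl II_PA L(2))
  thus False using \<open>\<forall>l\<in>D. pair l x = 0\<close> pl[OF x] L(3) by simp
 qed
qed (use D_annihilates_II in blast)

end

lemma pair_add_left: "pair (l + l') x = pair l x + pair l' x"
 by (simp add: pair_def fun_app distrib_left sum.distrib)

lemma pair_scale_left: "pair (sc c l) x = c * pair l x"
 by (simp add: pair_def fun_app sum_distrib_left mult.left_commute)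

lemma pair_sum_left: "pair (\<Sum>i\<in>S. l i) x = (\<Sum>i\<in>S. pair (l i) x)"
 by (induction S rule: infinite_finite_induct) (simp_all add: pair_zero_left pair_add_left)

lemma flip_path_inj: "inj flip_path"
 by (rule injI) (metis flip_path_flip)

lemma flip_supp: "{p. flip_fun x p ~= 0} = flip_path ` {p. x p ~= 0}"
proof (intro equalityI subsetI)
 fix p assume "p \<in> {p. flip_fun x p ~= 0}"
 hence "flip_path p \<in> {p. x p ~= 0}" by (simp only: flip_fun_def comp_def mem_Collect_eq not_False_eq_True)
 thus "p \<in> flip_path ` {p. x p ~= 0}" by (rule image_eqI[rotated]) simp
qed (auto simp only: flip_fun_def comp_def mem_Collect_eq flip_path_flip)

lemma pair_flip: "pair l (flip_fun x) = pair (flip_fun l) x"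
proof -
 show ?thesis unfolding pair_def flip_supp
  by (subst sum.reindex[OF inj_on_subset[OF flip_path_inj subset_UNIV]]) (simp add: flip_fun_def)
qed

lemma flip_basis: "flip_fun (basis_path (p :: 'a path)) = basis_path (flip_path p)"
proof
 fix q :: "'a path"
 have "flip_path q = p \<longleftrightarrow> q = flip_path p" by (metis flip_path_flip)
 thus "flip_fun (basis_path p) q = basis_path (flip_path p) q" by (simp add: flip_fun_def basis_path_def)
qed

lemma flip_fin_supp: "x \<in> fin_supp ==> flip_fun x \<in> fin_supp"
 by (simp add: fin_supp_def flip_supp)

section \<open>The action on the dual, and the generic kernels as spaces of functions\<close>

definition path_act :: "'i path => ('i path => 'k::field) => 'i path => 'k" where
 "path_act p = left_path (flip_path p)"

definition act :: "('i path => 'k::field) => ('i path => 'k) => 'i path => 'k" where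
 "act x l = (\<Sum>p | x p ~= 0. sc (x p) (path_act p l))"

lemma left_path_linear: "fun_linear (left_path q)"
 by (rule fun_linearI) (auto simp: left_path_def fun_eq_iff fun_app)

lemma act_superset:
 assumes "finite S" "{p. x p ~= 0} \<subseteq> S"
 shows "act x l = (\<Sum>p\<in>S. sc (x p) (path_act p l))"
 unfolding act_def by (rule sum.mono_neutral_left) (use assms in \<open>auto simp: fv.scale_zero_left\<close>)

lemma act_add:
 assumes "x \<in> fin_supp" "y \<in> fin_supp"
 shows "act (x + y) l = act x l + act y l"
proof -
 let ?S = "{p. x p ~= 0} \<union> {p. y p ~= 0}"
 have "finite ?S" using assms by (simp add: fin_supp_def)
 thus ?thesis
  by (subst (1 2 3) act_superset[of ?S]) (auto simp: fun_app fv.scale_left_distrib sum.distrib)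
qed

lemma act_scale: "act (sc c x) l = sc c (act x l)"
proof (cases "c = 0")
 case True
 thus ?thesis by (simp add: act_def fun_app fv.scale_zero_left)
next
 case False
 thus ?thesis by (simp add: act_def sc_apply fv.scale_sum_right fv.scale_scale)
qed

lemma act_zero: "act 0 l = 0"
 by (simp add: act_def fun_app)

lemma act_basis: "act (basis_path p) l = path_act p (l :: 'i path => 'k::field)"
proof -
 have "{q. basis_path p q ~= (0::'k)} = {p}" by (auto simp: basis_path_def)
 thus ?thesis by (simp add: act_def) (simp add: basis_path_def)
qed

lemma act_right_linear: "fun_linear (act x)"
 unfolding path_act_def act_def
 by (rule fun_linearI)
   (simp_all add: fvv.linear_add[OF left_path_linear] fvv.linear_scale[OF left_path_linear]
    fv.scale_right_distrib sum.distrib fv.scale_sum_right mult.commute)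

context gpa_over
begin

interpretation PA: ring PA by (rule path_algebra_ring)
interpretation II: ideal II PA by (rule II_ideal)

abbreviation cls :: "('i path => 'k) => ('i, 'k) preproj_elt" where "cls \<equiv> preproj_class C \<omega>"
abbreviation AA :: "('k, ('i, 'k) preproj_elt) graded_algebra" where "AA \<equiv> preproj_algebra C d \<omega>"

lemma cls_eq: "x \<in> carrier PA ==> y \<in> carrier PA ==> cls x = cls y \<longleftrightarrow> x - y \<in> II"
 unfolding preproj_class_def by (metis PA.quotient_eq_iff_same_a_r_cos II_ideal PA_minus)

lemma cls_II: "x \<in> II ==> cls x = cls 0"
 using cls_eq[of x 0] II_PA PA_zero by simp

lemma cls_pair: "x \<in> carrier PA ==> y \<in> carrier PA ==> cls x = cls y ==> l \<in> D ==> pair l x = pair l y"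
 using cls_eq[of x y] D_annihilates_II[of l "x - y"] by (simp add: pair_diff PA_fin_supp)

lemma AA_add: "x \<in> carrier PA ==> y \<in> carrier PA ==> cls x \<oplus>\<^bsub>AA\<^esub> cls y = cls (x + y)"
 using ring_hom_add[OF II.rcos_ring_hom, of x y]
 by (simp add: preproj_algebra_def ring.defs preproj_class_def PA_simps)

lemma AA_mult: "x \<in> carrier PA ==> y \<in> carrier PA ==> cls x \<otimes>\<^bsub>AA\<^esub> cls y = cls (x \<cdot> y)"
 using ring_hom_mult[OF II.rcos_ring_hom, of x y]
 by (simp add: preproj_algebra_def ring.defs preproj_class_def)

lemma AA_one: "\<one>\<^bsub>AA\<^esub> = cls \<one>\<^bsub>PA\<^esub>"
 using ring_hom_one[OF II.rcos_ring_hom]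
 by (simp add: preproj_algebra_def ring.defs preproj_class_def)

lemma AA_zero: "\<zero>\<^bsub>AA\<^esub> = cls 0"
proof -
 have "II +>\<^bsub>PA\<^esub> 0 = II" using II.a_rcos_const[of 0] fv.subspace_0[OF II_subspace] by simp
 thus ?thesis by (simp add: preproj_algebra_def ring.defs preproj_class_def FactRing_def)
qed

lemma AA_carrier: "carrier AA = cls ` carrier PA"
 by (auto simp: preproj_algebra_def ring.defs preproj_class_def FactRing_def A_RCOSETS_def')

lemma AA_base: "base AA c = cls (sc c \<one>\<^bsub>PA\<^esub>)"
 by (simp add: preproj_algebra_def ring.defs sc_def)

abbreviation of_deg :: "int => ('i path => 'k::field) => bool" where
 "of_deg u x \<equiv> \<forall>p. x p ~= 0 --> path_deg d p = u"

lemma AA_part: "alg_part AA u = cls ` {x \<in> carrier PA. of_deg u x}"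
 by (simp add: preproj_algebra_def ring.defs)

lemma PA_one_mult: "x \<in> carrier PA ==> sc c \<one>\<^bsub>PA\<^esub> \<cdot> x = sc c x"
 by (simp add: PA_mult_scale)

lemma flip_PA: "x \<in> carrier PA ==> flip_fun x \<in> carrier PA"
 unfolding PA_carrier
proof (intro conjI allI impI)
 assume x: "x \<in> fin_supp \<and> (\<forall>p. x p ~= 0 --> is_path C p)"
 thus "flip_fun x \<in> fin_supp" by (simp add: flip_fin_supp)
 fix p assume "flip_fun x p ~= 0"
 hence "x (flip_path p) ~= 0" by (simp only: flip_fun_def comp_def not_False_eq_True)
 hence "is_path C (flip_path p)" using x by blast
 thus "is_path C p" by (simp only: is_path_flip_iff)
qed

lemma flip_II: "x \<in> II ==> flip_fun x \<in> II"
 using II_iff[OF II_PA] II_iff[OF flip_PA[OF II_PA]] by (auto simp: pair_flip flip_fun_D)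

lemma anti_involution_cls:
 assumes x: "x \<in> carrier PA" shows "anti_involution (cls x) = cls (flip_fun x)"
proof -
 have e: "cls y = {h + y | h. h \<in> II}" for y
  by (auto simp: preproj_class_def a_r_coset_def' PA_simps)
 have f: "flip_fun (h + y) = flip_fun h + flip_fun y" for h y :: "'i path => 'k"
  by (rule fvv.linear_add[OF flip_fun_linear])
 have "anti_involution (cls x) = flip_fun ` {h + x | h. h \<in> II}"
  unfolding anti_involution_def e flip_fun_def ..
 also have "... = {h + flip_fun x | h. h \<in> II}"
 proof (intro equalityI subsetI)
  fix z assume "z \<in> flip_fun ` {h + x | h. h \<in> II}"
  thus "z \<in> {h + flip_fun x | h. h \<in> II}" using f flip_II by auto
 next
  fix z assume "z \<in> {h + flip_fun x | h. h \<in> II}"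
  then obtain h where h: "z = h + flip_fun x" "h \<in> II" by auto
  hence "z = flip_fun (flip_fun h + x)" by (simp add: f)
  thus "z \<in> flip_fun ` {h + x | h. h \<in> II}" using flip_II[OF h(2)] by blast
 qed
 finally show ?thesis unfolding e .
qed

definition src_part :: "'i => ('i path => 'k) set" where
 "src_part i = {x \<in> carrier PA. \<forall>p. x p ~= 0 --> snd (snd p) = i}"

lemma src_part_PA: "x \<in> src_part i ==> x \<in> carrier PA"
 by (simp add: src_part_def)

lemma src_part_subspace: "fv.subspace (src_part i)"
proof (rule fv.subspaceI)
 show "0 \<in> src_part i" by (simp add: src_part_def PA_zero fun_app)
 show "x + y \<in> src_part i" if "x \<in> src_part i" "y \<in> src_part i" for x y
  unfolding src_part_def
 proof (intro CollectI conjI allI impI)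
  show "x + y \<in> carrier PA" using that by (simp add: src_part_def PA_add)
  fix p assume "(x + y) p ~= 0"
  hence "x p ~= 0 \<or> y p ~= 0" by (auto simp: fun_app)
  thus "snd (snd p) = i" using that unfolding src_part_def by blast
 qed
 show "sc c x \<in> src_part i" if "x \<in> src_part i" for c x
  using that unfolding src_part_def by (auto simp: PA_scale fun_app)
qed

lemma mult_src_part: "x \<in> carrier PA ==> y \<in> src_part i ==> x \<cdot> y \<in> src_part i"
proof -
 assume x: "x \<in> carrier PA" and y: "y \<in> src_part i"
 have "s = i" if nz: "(x \<cdot> y) (t, w, s) ~= 0" for t w s
 proof (rule ccontr)
  assume "s ~= i"
  hence "y (v, u, s) = 0" for v u using y by (auto simp: src_part_def)
  thus False using nz by (simp add: path_algebra_def)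
 qed
 thus ?thesis using PA.m_closed[OF x src_part_PA[OF y]] by (auto simp: src_part_def)
qed

lemma mult_idem: "(x \<cdot> basis_path (i, [], i)) (t, w, s) = (if s = i then x (t, w, s) else (0 :: 'k))"
proof -
 have "x (t, take m w, v) * basis_path (i, [], i) (v, drop m w, s)
  = (if v = i then (if m = length w then (if s = i then x (t, w, s) else 0) else 0) else 0)" if "m <= length w" for m v
  using that by (auto simp: basis_path_def)
 hence "(x \<cdot> basis_path (i, [], i)) (t, w, s)
   = (\<Sum>m\<le>length w. \<Sum>v\<in>UNIV. if v = i then (if m = length w then (if s = i then x (t, w, s) else 0) else 0) else 0)"
  by (simp add: path_algebra_def)
 thus ?thesis by simp
qed

lemma idem_src_part: "x \<in> carrier PA ==> x \<cdot> basis_path (i, [], i) \<in> src_part i"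
 by (rule mult_src_part) (auto simp: src_part_def basis_PA, auto simp: basis_path_def split: if_splits)

lemma mult_idem_src: "x \<in> src_part i ==> x \<cdot> basis_path (i, [], i) = x"
proof (rule ext, clarify)
 assume x: "x \<in> src_part i"
 fix t w s
 have "x (t, w, s) = 0" if "s ~= i" using x that unfolding src_part_def by fastforce
 thus "(x \<cdot> basis_path (i, [], i)) (t, w, s) = x (t, w, s)" by (auto simp: mult_idem)
qed

definition eps_path :: "'i => nat => 'i path" where
 "eps_path i k = (i, eps k i, i)"

lemma eps_path_path: "is_path C (eps_path i k)"
 by (simp add: eps_path_def is_path_replicate)

lemma AA_eps_pow: "k > 0 ==> cls (basis_path (i, [Eps i], i)) [^]\<^bsub>AA\<^esub> k = cls (basis_path (eps_path i k))"
proof (induction k rule: nat_induct_non_zero)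
 case 1
 have "is_path C (i, [Eps i], i)" by simp
 from basis_PA[OF this] show ?case
  by (simp add: nat_pow_def AA_one AA_mult eps_path_def)
next
 case (Suc n)
 have "is_path C (i, [Eps i], i)" by simp
 from basis_PA[OF this] show ?case using Suc basis_PA[OF eps_path_path[of i n]]
  by (simp add: nat_pow_def AA_mult) (simp add: eps_path_def basis_mult_basis replicate_append_same)
qed

text \<open>An element of the truncated projective at \<open>i\<close>: the class of
  \<open>x\<close> modulo the ideal and modulo the left multiples of the \<open>k\<close>-th power
  of the loop. It is a set of classes since the module is a quotient of a quotient.\<close>

definition coset :: "'i => nat => ('i path => 'k) => ('i, 'k) preproj_elt set" where
 "coset i k x = {cls (y \<cdot> basis_path (eps_path i k) + x) | y. y \<in> carrier PA}"

lemma mult_eps: "y \<in> carrier PA ==> y \<cdot> basis_path (eps_path i k) \<in> carrier PA"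
 by (intro PA.m_closed basis_PA eps_path_path)

lemma coset_translate:
 assumes x: "x \<in> carrier PA" and y: "y \<in> carrier PA"
 shows "coset i k (y \<cdot> basis_path (eps_path i k) + x) = coset i k x"
proof (intro equalityI subsetI)
 fix z assume "z \<in> coset i k (y \<cdot> basis_path (eps_path i k) + x)"
 then obtain u where u: "u \<in> carrier PA" "z = cls (u \<cdot> basis_path (eps_path i k) + (y \<cdot> basis_path (eps_path i k) + x))"
  by (auto simp: coset_def)
 hence "z = cls ((u + y) \<cdot> basis_path (eps_path i k) + x)" by (simp add: PA_mult_add add.assoc)
 thus "z \<in> coset i k x" unfolding coset_def using PA_add[OF u(1) y] by blast
next
 fix z assume "z \<in> coset i k x"
 then obtain u where u: "u \<in> carrier PA" "z = cls (u \<cdot> basis_path (eps_path i k) + x)"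
  by (auto simp: coset_def)
 hence "z = cls ((u - y) \<cdot> basis_path (eps_path i k) + (y \<cdot> basis_path (eps_path i k) + x))"
  by (simp add: PA_mult_diff)
 thus "z \<in> coset i k (y \<cdot> basis_path (eps_path i k) + x)"
  unfolding coset_def using PA_diff[OF u(1) y] by blast
qed

lemma coset_cls:
 assumes x: "x \<in> carrier PA" and y: "y \<in> carrier PA" and "cls x = cls y"
 shows "coset i k x = coset i k y"
proof -
 have "cls (u \<cdot> basis_path (eps_path i k) + x) = cls (u \<cdot> basis_path (eps_path i k) + y)"
  if "u \<in> carrier PA" for u
  using that assms by (simp add: mult_eps flip: AA_add)
 thus ?thesis unfolding coset_def by (intro Collect_cong iff_exI) auto
qed

lemma coset_mem: "x \<in> carrier PA ==> cls x \<in> coset i k x"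
 unfolding coset_def using PA_zero by (intro CollectI exI[of _ 0]) (simp add: PA_mult_zero)

text \<open>Right multiplication by the power of the loop is transposed to \<open>reps i k\<close>,
  so functions killed by \<open>reps i k\<close> are well defined on cosets.\<close>

lemma coset_pair:
 assumes x: "x \<in> carrier PA" and y: "y \<in> carrier PA" and eq: "coset i k x = coset i k y"
  and l: "l \<in> D" and lk: "reps i k l = 0" and src: "\<And>t w s. l (t, w, s) ~= 0 ==> s = i"
 shows "pair l x = pair l y"
proof -
 have "cls x \<in> coset i k y" using coset_mem[OF x, of i k] unfolding eq .
 then obtain u where u: "u \<in> carrier PA" "cls x = cls (u \<cdot> basis_path (eps_path i k) + y)"
  by (auto simp: coset_def)
 have "right_path (eps_path i k) l = 0"
 proof (rule ext, clarify)
  fix t w s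
  show "right_path (eps_path i k) l (t, w, s) = 0 (t, w, s)"
   using fun_cong[OF lk, of "(t, w, i)"] by (simp add: right_path_def eps_path_def right_op_pow_at fun_app)
 qed
 hence "pair l (u \<cdot> basis_path (eps_path i k)) = 0"
  by (simp add: pair_right_mult[OF u(1) eps_path_path] pair_zero_left)
 moreover have "pair l x = pair l (u \<cdot> basis_path (eps_path i k) + y)"
  by (rule cls_pair[OF x _ u(2) l]) (intro PA_add mult_eps u y)
 ultimately show ?thesis by (simp add: pair_add PA_fin_supp mult_eps u y)
qed

abbreviation TT :: "'i => nat => (('i, 'k) preproj_elt, ('i, 'k) preproj_elt set) graded_module" where
 "TT \<equiv> truncated_projective C d \<omega>"

lemma principal_idem: "principal_left AA (cls (basis_path (i, [], i))) = cls ` src_part i"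
proof -
 have p: "basis_path (i, [], i) \<in> carrier PA" by (rule basis_PA) simp
 have "principal_left AA (cls (basis_path (i, [], i))) = {cls (x \<cdot> basis_path (i, [], i)) | x. x \<in> carrier PA}"
  unfolding principal_left_def AA_carrier using p by (auto simp: AA_mult) (metis AA_mult imageI)
 also have "... = cls ` src_part i"
  using idem_src_part mult_idem_src src_part_PA by (auto simp: image_iff) metis
 finally show ?thesis .
qed

lemma principal_eps: "principal_left AA (cls (basis_path (eps_path i k))) = {cls (y \<cdot> basis_path (eps_path i k)) | y. y \<in> carrier PA}"
 unfolding principal_left_def AA_carrier using basis_PA[OF eps_path_path[of i k]]
 by (auto simp: AA_mult) (metis AA_mult imageI)

lemma TT_structure:
 assumes k: "k > 0"
 shows "carrier (TT i k) = coset i k ` src_part i"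
  and "x \<in> src_part i ==> y \<in> src_part i ==> coset i k x \<oplus>\<^bsub>TT i k\<^esub> coset i k y = coset i k (x + y)"
  and "z \<in> carrier PA ==> x \<in> src_part i ==> cls z \<odot>\<^bsub>TT i k\<^esub> coset i k x = coset i k (z \<cdot> x)"
  and "mod_part (TT i k) u = coset i k ` {x \<in> src_part i. of_deg u x}"
proof -
 define Q where "Q = sub_graded (regular_module AA) (principal_left AA (cls (basis_path (i, [], i))))"
 define N where "N = principal_left AA (cls (basis_path (eps_path i k)))"
 have T: "TT i k = quot_graded Q N"
  by (simp add: truncated_projective_def Let_def Q_def N_def AA_eps_pow[OF k])
 have Q: "carrier Q = cls ` src_part i" "add Q = add AA" "smult Q = mult AA"
  "mod_part Q u = alg_part AA u \<inter> cls ` src_part i" for u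
  by (simp_all add: Q_def sub_graded_def regular_module_def principal_idem)
 have N: "N = {cls (y \<cdot> basis_path (eps_path i k)) | y. y \<in> carrier PA}"
  unfolding N_def by (rule principal_eps)
 have co: "N +>\<^bsub>Q\<^esub> cls x = coset i k x" if "x \<in> carrier PA" for x
 proof -
  have "N +>\<^bsub>Q\<^esub> cls x = {cls (y \<cdot> basis_path (eps_path i k)) \<oplus>\<^bsub>AA\<^esub> cls x | y. y \<in> carrier PA}"
   unfolding a_r_coset_def' N Q by auto
  also have "... = coset i k x" unfolding coset_def using that by (auto simp: AA_add mult_eps) (metis AA_add mult_eps that)
  finally show ?thesis .
 qed
 show "carrier (TT i k) = coset i k ` src_part i"
  using co src_part_PA by (auto simp: T quot_graded_def quot_module_def module.defs A_RCOSETS_def' Q image_iff)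
 show "coset i k x \<oplus>\<^bsub>TT i k\<^esub> coset i k y = coset i k (x + y)" if x: "x \<in> src_part i" and y: "y \<in> src_part i"
 proof -
  note xy = src_part_PA[OF x] src_part_PA[OF y]
  have "coset i k x \<oplus>\<^bsub>TT i k\<^esub> coset i k y = {a \<oplus>\<^bsub>AA\<^esub> b | a b. a \<in> coset i k x \<and> b \<in> coset i k y}"
   by (auto simp: T quot_graded_def quot_module_def module.defs set_add_def' Q)
  also have "... = coset i k (x + y)"
  proof (intro equalityI subsetI)
   fix z assume "z \<in> {a \<oplus>\<^bsub>AA\<^esub> b | a b. a \<in> coset i k x \<and> b \<in> coset i k y}"
   then obtain u v where uv: "u \<in> carrier PA" "v \<in> carrier PA"
    "z = cls (u \<cdot> basis_path (eps_path i k) + x) \<oplus>\<^bsub>AA\<^esub> cls (v \<cdot> basis_path (eps_path i k) + y)"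
    by (auto simp: coset_def)
   hence "z = cls ((u + v) \<cdot> basis_path (eps_path i k) + (x + y))"
    using xy by (simp add: AA_add PA_add mult_eps PA_mult_add algebra_simps)
   thus "z \<in> coset i k (x + y)" unfolding coset_def using PA_add[OF uv(1,2)] by blast
  next
   fix z assume "z \<in> coset i k (x + y)"
   then obtain u where u: "u \<in> carrier PA" "z = cls (u \<cdot> basis_path (eps_path i k) + (x + y))"
    by (auto simp: coset_def)
   hence "z = cls (u \<cdot> basis_path (eps_path i k) + x) \<oplus>\<^bsub>AA\<^esub> cls y"
    using xy by (simp add: AA_add PA_add mult_eps add.assoc)
   moreover have "cls (u \<cdot> basis_path (eps_path i k) + x) \<in> coset i k x" using u(1) by (auto simp: coset_def)
   ultimately show "z \<in> {a \<oplus>\<^bsub>AA\<^esub> b | a b. a \<in> coset i k x \<and> b \<in> coset i k y}"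
    using coset_mem[OF xy(2)] by blast
  qed
  finally show ?thesis .
 qed
 show "cls z \<odot>\<^bsub>TT i k\<^esub> coset i k x = coset i k (z \<cdot> x)" if z: "z \<in> carrier PA" and x: "x \<in> src_part i"
 proof -
  note xP = src_part_PA[OF x]
  have "cls z \<odot>\<^bsub>TT i k\<^esub> coset i k x = (\<Union>a\<in>coset i k x. N +>\<^bsub>Q\<^esub> (cls z \<otimes>\<^bsub>AA\<^esub> a))"
   by (simp add: T quot_graded_def quot_module_def module.defs Q)
  also have "N +>\<^bsub>Q\<^esub> (cls z \<otimes>\<^bsub>AA\<^esub> a) = coset i k (z \<cdot> x)" if "a \<in> coset i k x" for a
  proof -
   obtain u where u: "u \<in> carrier PA" "a = cls (u \<cdot> basis_path (eps_path i k) + x)"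
    using \<open>a \<in> coset i k x\<close> by (auto simp: coset_def)
   have "cls z \<otimes>\<^bsub>AA\<^esub> a = cls ((z \<cdot> u) \<cdot> basis_path (eps_path i k) + z \<cdot> x)"
    using u z xP basis_PA[OF eps_path_path]
    by (simp add: AA_mult PA_add mult_eps PA_mult_add PA.m_assoc)
   thus ?thesis using co coset_translate z u xP by (simp add: PA_add mult_eps)
  qed
  hence "(\<Union>a\<in>coset i k x. N +>\<^bsub>Q\<^esub> (cls z \<otimes>\<^bsub>AA\<^esub> a)) = coset i k (z \<cdot> x)"
   using coset_mem[OF xP, of i k] by blast
  finally show ?thesis .
 qed
 \<comment> \<open>A homogeneous class in the left ideal of the idempotent has a homogeneous
   representative and one with source \<open>i\<close>; multiplying the former by the idempotent
   gives one with both properties.\<close>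
 have "alg_part AA u \<inter> cls ` src_part i = cls ` {x \<in> src_part i. of_deg u x}"
 proof (intro equalityI subsetI)
  fix a assume "a \<in> alg_part AA u \<inter> cls ` src_part i"
  hence "a \<in> cls ` {x \<in> carrier PA. of_deg u x}" "a \<in> cls ` src_part i"
   unfolding AA_part by blast+
  then obtain x y where x: "x \<in> carrier PA" "\<And>p. x p ~= 0 ==> path_deg d p = u" "a = cls x"
   and y: "y \<in> src_part i" "a = cls y"
   by blast
  have p: "basis_path (i, [], i) \<in> carrier PA" by (rule basis_PA) simp
  have "a = cls (x \<cdot> basis_path (i, [], i))"
  proof -
   have "cls (x \<cdot> basis_path (i, [], i)) = cls (y \<cdot> basis_path (i, [], i))"
    using x y p src_part_PA[OF y(1)] by (metis AA_mult)
   thus ?thesis using mult_idem_src[OF y(1)] y(2) by simp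
  qed
  moreover have "path_deg d p = u" if "(x \<cdot> basis_path (i, [], i)) p ~= 0" for p
   using that x(2) by (cases p) (auto simp: mult_idem split: if_splits)
  ultimately show "a \<in> cls ` {x \<in> src_part i. of_deg u x}"
   using idem_src_part[OF x(1)] by blast
 qed (auto simp: AA_part src_part_def)
 thus "mod_part (TT i k) u = coset i k ` {x \<in> src_part i. of_deg u x}"
  using co src_part_PA by (auto simp: T quot_graded_def quot_module_def module.defs Q image_iff) (metis (mono_tags, lifting) mem_Collect_eq)
qed

abbreviation KK :: "'i => nat => (('i, 'k) preproj_elt, ('i, 'k) preproj_elt set => 'k) graded_module" where
 "KK \<equiv> generic_kernel C d \<omega>"

text \<open>The generic kernel, realised as a space of functions on paths.\<close>

abbreviation degs :: "('i path => 'k::field) => int set" where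
 "degs l \<equiv> {u. \<exists>t w s. l (t, w, s) ~= 0 \<and> wdeg d w = u}"

definition ker_fun :: "'i => nat => ('i path => 'k) set" where
 "ker_fun i k = {l \<in> D. (\<forall>t w s. l (t, w, s) ~= 0 --> s = i) \<and> reps i k l = 0 \<and>
   finite (degs l)}"

text \<open>\<open>to_fun\<close> and \<open>from_fun\<close> are mutually inverse identifications
  of the restricted dual with \<open>ker_fun\<close>: a functional is determined by its values on
  paths.\<close>

definition to_fun :: "'i => nat => (('i, 'k) preproj_elt set => 'k) => 'i path => 'k" where
 "to_fun i k \<phi> = (\<lambda>(t, w, s). if is_path C (t, w, s) \<and> s = i then \<phi> (coset i k (basis_path (t, w, s))) else 0)"

definition from_fun :: "'i => nat => ('i path => 'k) => ('i, 'k) preproj_elt set => 'k" where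
 "from_fun i k l = (\<lambda>X\<in>carrier (TT i k). pair l (SOME x. x \<in> src_part i \<and> coset i k x = X))"

lemma ker_funD:
 assumes "l \<in> ker_fun i k"
 shows "l \<in> D" "l (t, w, s) ~= 0 ==> s = i" "reps i k l = 0"
  "finite (degs l)"
 using assms by (auto simp: ker_fun_def)

lemma from_fun_coset:
 assumes l: "l \<in> ker_fun i k" and k: "k > 0" and x: "x \<in> src_part i"
 shows "from_fun i k l (coset i k x) = pair l x"
proof -
 define y where "y = (SOME y. y \<in> src_part i \<and> coset i k y = coset i k x)"
 have y: "y \<in> src_part i" "coset i k y = coset i k x"
  using someI_ex[of "\<lambda>y. y \<in> src_part i \<and> coset i k y = coset i k x"] x unfolding y_def by blast+
 have "from_fun i k l (coset i k x) = pair l y"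
  using x by (simp add: from_fun_def TT_structure(1)[OF k] y_def)
 also have "... = pair l x"
  by (rule coset_pair[OF src_part_PA[OF y(1)] src_part_PA[OF x] y(2) ker_funD(1)[OF l] ker_funD(3)[OF l]])
    (rule ker_funD(2)[OF l])
 finally show ?thesis .
qed

lemma basis_src_part: "is_path C (t, w, i) ==> basis_path (t, w, i) \<in> src_part i"
 using basis_PA[of "(t, w, i)"] by (auto simp: src_part_def) (auto simp: basis_path_def split: if_splits)

lemma KK_carrier:
 assumes k: "k > 0"
 shows "\<phi> \<in> carrier (KK i k) \<longleftrightarrow> \<phi> \<in> extensional (coset i k ` src_part i) \<and>
   (\<forall>x\<in>src_part i. \<forall>y\<in>src_part i. \<phi> (coset i k (x + y)) = \<phi> (coset i k x) + \<phi> (coset i k y)) \<and>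
   (\<forall>c. \<forall>x\<in>src_part i. \<phi> (coset i k (sc c x)) = c * \<phi> (coset i k x)) \<and>
   finite {u. \<exists>x\<in>src_part i. of_deg u x \<and> \<phi> (coset i k x) ~= 0}"
proof -
 have base: "base AA c \<odot>\<^bsub>TT i k\<^esub> coset i k x = coset i k (sc c x)" if "x \<in> src_part i" for c x
  using TT_structure(3)[OF k PA_scale[OF PA.one_closed] that] by (simp add: AA_base PA_one_mult[OF src_part_PA[OF that]])
 have "{u. \<exists>x\<in>mod_part (TT i k) u. \<phi> x ~= 0} = {u. \<exists>x\<in>src_part i. of_deg u x \<and> \<phi> (coset i k x) ~= 0}"
  by (auto simp: TT_structure(4)[OF k])
 thus ?thesis
  by (simp add: generic_kernel_def shift_def restricted_dual_def Let_def PiE_iff TT_structure(1,2)[OF k] base)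
qed

lemma KK_eval:
 assumes k: "k > 0" and \<phi>: "\<phi> \<in> carrier (KK i k)" and x: "x \<in> src_part i"
 shows "\<phi> (coset i k x) = pair (to_fun i k \<phi>) x"
proof -
 note \<phi>' = \<phi>[unfolded KK_carrier[OF k]]
 have "x \<in> src_part i --> \<phi> (coset i k x) = pair (to_fun i k \<phi>) x"
  using src_part_PA[OF x]
 proof (induction rule: PA_induct)
  case zero
  have "\<phi> (coset i k (sc 0 0)) = 0 * \<phi> (coset i k 0)" using \<phi>' fv.subspace_0[OF src_part_subspace] by blast
  thus "(0 :: 'i path => 'k) \<in> src_part i --> \<phi> (coset i k 0) = pair (to_fun i k \<phi>) 0"
   by (simp add: pair_zero)
 next
  case (scale_basis c p y)
  have p: "snd (snd p) = i" using x scale_basis(2) unfolding src_part_def by blast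
  have y: "y \<in> src_part i"
   using scale_basis x unfolding src_part_def by blast
  obtain t w where p': "p = (t, w, i)" using p by (cases p) auto
  have b: "basis_path p \<in> src_part i" using scale_basis(1) p' basis_src_part by simp
  have "\<phi> (coset i k (sc c (basis_path p) + y)) = c * \<phi> (coset i k (basis_path p)) + \<phi> (coset i k y)"
  proof -
   have "sc c (basis_path p) \<in> src_part i" by (rule fv.subspace_scale[OF src_part_subspace b])
   hence "\<phi> (coset i k (sc c (basis_path p) + y)) = \<phi> (coset i k (sc c (basis_path p))) + \<phi> (coset i k y)"
    using \<phi>' y by blast
   moreover have "\<phi> (coset i k (sc c (basis_path p))) = c * \<phi> (coset i k (basis_path p))"
    using \<phi>' b by blast
   ultimately show ?thesis by simp
  qed
  also have "\<phi> (coset i k (basis_path p)) = to_fun i k \<phi> p"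
   using scale_basis(1) p' by (simp add: to_fun_def)
  finally show "sc c (basis_path p) + y \<in> src_part i -->
    \<phi> (coset i k (sc c (basis_path p) + y)) = pair (to_fun i k \<phi>) (sc c (basis_path p) + y)"
   using scale_basis y
   by (simp add: pair_add fin_supp_scale basis_fin_supp PA_fin_supp pair_scale pair_basis)
 qed
 with x show ?thesis by blast
qed

text \<open>Elements of the ideal have the coset of 0, which puts the function into
  \<open>D\<close>; so do left multiples of the power of the loop, which gives the vanishing of
  \<open>reps i k\<close>.\<close>

lemma to_fun_ker_fun:
 assumes k: "k > 0" and \<phi>: "\<phi> \<in> carrier (KK i k)"
 shows "to_fun i k \<phi> \<in> ker_fun i k"
proof -
 let ?l = "to_fun i k \<phi>"
 have p0: "\<phi> (coset i k 0) = 0"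
  using KK_eval[OF k \<phi> fv.subspace_0[OF src_part_subspace]] by (simp add: pair_zero)
 have D: "?l \<in> D"
 proof (rule annihilator_in_D)
  show "?l p = 0" if "\<not> is_path C p" for p using that by (cases p) (simp add: to_fun_def)
  show "pair ?l x = 0" if x: "x \<in> II" for x
  proof -
   let ?e = "basis_path (i, [], i)"
   have e: "?e \<in> carrier PA" by (rule basis_PA) simp
   have I: "x \<cdot> ?e \<in> II" by (rule II_mult(2)[OF x e])
   have "right_path (i, [], i) ?l = ?l" by (auto simp: right_path_def to_fun_def fun_eq_iff)
   hence "pair ?l x = pair ?l (x \<cdot> ?e)"
    using pair_right_mult[OF II_PA[OF x], of "(i, [], i)" ?l] by simp
   also have "... = \<phi> (coset i k (x \<cdot> ?e))"
    by (rule KK_eval[OF k \<phi> idem_src_part[OF II_PA[OF x]], symmetric])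
   also have "coset i k (x \<cdot> ?e) = coset i k 0"
    by (rule coset_cls[OF II_PA[OF I] PA_zero cls_II[OF I]])
   finally show ?thesis using p0 by simp
  qed
 qed
 have right: "reps i k ?l = 0"
 proof (rule ext, clarify)
  fix t w s
  show "reps i k ?l (t, w, s) = 0 (t, w, s)"
  proof (cases "s = i \<and> is_path C (t, w, i)")
   case True
   hence b: "basis_path (t, w, i) \<in> carrier PA" by (auto intro: basis_PA)
   have "coset i k (basis_path (t, w, i) \<cdot> basis_path (eps_path i k) + 0) = coset i k 0"
    by (rule coset_translate[OF PA_zero b])
   hence "coset i k (basis_path (t, w @ eps k i, i)) = coset i k 0"
    by (simp add: eps_path_def basis_mult_basis)
   thus ?thesis using True p0 by (simp add: right_op_pow_at to_fun_def fun_app)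
  next
   case False
   show ?thesis
   proof (cases "s = i")
    case True
    hence "\<not> is_path C (t, w @ eps k i, i)"
     using False by (auto simp: is_path_append is_path_replicate split: if_splits)
    thus ?thesis using True by (simp add: right_op_pow_at to_fun_def fun_app)
   next
    case False
    thus ?thesis using k by (cases k) (simp_all add: right_op_def fun_app)
   qed
  qed
 qed
 have "degs ?l
   \<subseteq> {u. \<exists>x\<in>src_part i. of_deg u x \<and> \<phi> (coset i k x) ~= 0}"
 proof
  fix u assume "u \<in> degs ?l"
  then obtain t w where w: "is_path C (t, w, i)" "\<phi> (coset i k (basis_path (t, w, i))) ~= 0" "wdeg d w = u"
   by (auto simp: to_fun_def split: if_splits)
  have "\<forall>p. basis_path (t, w, i) p ~= (0 :: 'k) --> path_deg d p = u"
   using w(3) by (auto simp: basis_path_def wdeg_def)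
  thus "u \<in> {u. \<exists>x\<in>src_part i. of_deg u x \<and> \<phi> (coset i k x) ~= 0}"
   using w basis_src_part by blast
 qed
 hence "finite (degs ?l)"
  using \<phi>[unfolded KK_carrier[OF k]] finite_subset by blast
 with D right show ?thesis by (auto simp: ker_fun_def to_fun_def split: if_splits)
qed

lemma from_fun_carrier:
 assumes k: "k > 0" and l: "l \<in> ker_fun i k"
 shows "from_fun i k l \<in> carrier (KK i k)"
 unfolding KK_carrier[OF k]
proof (intro conjI ballI allI)
 show "from_fun i k l \<in> extensional (coset i k ` src_part i)"
  by (simp add: from_fun_def TT_structure(1)[OF k])
 note ev = from_fun_coset[OF l k]
 show "from_fun i k l (coset i k (x + y)) = from_fun i k l (coset i k x) + from_fun i k l (coset i k y)"
  if "x \<in> src_part i" "y \<in> src_part i" for x y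
  using that by (simp add: ev fv.subspace_add[OF src_part_subspace] pair_add PA_fin_supp src_part_PA)
 show "from_fun i k l (coset i k (sc c x)) = c * from_fun i k l (coset i k x)" if "x \<in> src_part i" for c x
  using that by (simp add: ev fv.subspace_scale[OF src_part_subspace] pair_scale)
 have "{u. \<exists>x\<in>src_part i. of_deg u x \<and> from_fun i k l (coset i k x) ~= 0}
   \<subseteq> degs l"
 proof
  fix u assume "u \<in> {u. \<exists>x\<in>src_part i. of_deg u x \<and> from_fun i k l (coset i k x) ~= 0}"
  then obtain x where x: "x \<in> src_part i" "\<And>p. x p ~= 0 ==> path_deg d p = u" "from_fun i k l (coset i k x) ~= 0"
   by blast
  hence "pair l x ~= 0" by (simp add: ev)
  then obtain p where "x p * l p ~= 0" unfolding pair_def by (meson sum.neutral)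
  hence "x p ~= 0" "l p ~= 0" by auto
  thus "u \<in> degs l"
   using x(2)[of p] by (cases p) (auto simp: wdeg_def)
 qed
 thus "finite {u. \<exists>x\<in>src_part i. of_deg u x \<and> from_fun i k l (coset i k x) ~= 0}"
  using ker_funD(4)[OF l] finite_subset by blast
qed

lemma to_from_fun:
 assumes k: "k > 0" and l: "l \<in> ker_fun i k"
 shows "to_fun i k (from_fun i k l) = l"
proof (rule ext, clarify)
 fix t w s
 show "to_fun i k (from_fun i k l) (t, w, s) = l (t, w, s)"
  using ker_funD(2)[OF l, of t w s] rel_dual_path[OF ker_funD(1)[OF l], of "(t, w, s)"]
  by (auto simp: to_fun_def from_fun_coset[OF l k] basis_src_part pair_basis)
qed

lemma from_fun_unique:
 assumes k: "k > 0" and l: "l \<in> ker_fun i k" and "\<phi> \<in> extensional (coset i k ` src_part i)"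
  and "\<And>x. x \<in> src_part i ==> \<phi> (coset i k x) = pair l x"
 shows "\<phi> = from_fun i k l"
proof (rule extensionalityI[OF assms(3)])
 show "from_fun i k l \<in> extensional (coset i k ` src_part i)"
  by (simp add: from_fun_def TT_structure(1)[OF k])
qed (auto simp: assms(4) from_fun_coset[OF l k])

lemma from_to_fun:
 assumes k: "k > 0" and \<phi>: "\<phi> \<in> carrier (KK i k)"
 shows "from_fun i k (to_fun i k \<phi>) = \<phi>"
 by (rule from_fun_unique[OF k to_fun_ker_fun[OF k \<phi>], symmetric])
   (use \<phi> KK_eval[OF k \<phi>] in \<open>auto simp: KK_carrier[OF k]\<close>)

lemma to_fun_inj: "k > 0 ==> \<phi> \<in> carrier (KK i k) ==> \<psi> \<in> carrier (KK i k) ==> to_fun i k \<phi> = to_fun i k \<psi> ==> \<phi> = \<psi>"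
 by (metis from_to_fun)

lemma ker_fun_subspace: "fv.subspace (ker_fun i k)"
proof (rule fv.subspaceI)
 have lin: "fun_linear (reps i k)" by (rule funpow_linear[OF right_op_linear])
 note lin' = fvv.linear_add[OF lin] fvv.linear_scale[OF lin] fvv.linear_0[OF lin]
 show "0 \<in> ker_fun i k" by (simp add: ker_fun_def fv.subspace_0[OF D_subspace] lin' fun_app)
 show "x + y \<in> ker_fun i k" if "x \<in> ker_fun i k" "y \<in> ker_fun i k" for x y
 proof -
  have nz: "x (t, w, s) ~= 0 \<or> y (t, w, s) ~= 0" if "(x + y) (t, w, s) ~= 0" for t w s
   using that by (auto simp: fun_app)
  have "degs (x + y) \<subseteq>
   degs x \<union> degs y"
   using nz by blast
  hence "finite (degs (x + y))"
   using ker_funD(4)[OF that(1)] ker_funD(4)[OF that(2)] by (meson finite_UnI finite_subset)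
  moreover have "s = i" if "(x + y) (t, w, s) ~= 0" for t w s
   using nz[OF that] ker_funD(2)[OF \<open>x \<in> _\<close>] ker_funD(2)[OF \<open>y \<in> _\<close>] by blast
  moreover have "x + y \<in> D" by (intro fv.subspace_add[OF D_subspace] ker_funD(1)[OF that(1)] ker_funD(1)[OF that(2)])
  moreover have "reps i k (x + y) = 0" by (simp add: lin' ker_funD(3)[OF that(1)] ker_funD(3)[OF that(2)])
  ultimately show ?thesis unfolding ker_fun_def by blast
 qed
 show "sc c x \<in> ker_fun i k" if x: "x \<in> ker_fun i k" for c x
 proof -
  have "degs (sc c x) \<subseteq> degs x"
   by (auto simp: fun_app)
  hence "finite (degs (sc c x))"
   using ker_funD(4)[OF x] finite_subset by blast
  thus ?thesis using x by (auto simp: ker_fun_def fv.subspace_scale[OF D_subspace] lin' fun_app)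
 qed
qed

lemma path_act_apply: "path_act (a, u, b) l (t, w, s) = (if t = a then l (b, rev (map flip_arrow u) @ w, s) else 0)"
 by (simp add: path_act_def left_path_def)

lemma path_act_ker_fun:
 assumes l: "l \<in> ker_fun i k" and p: "is_path C p"
 shows "path_act p l \<in> ker_fun i k"
proof -
 obtain a u b where p': "p = (a, u, b)" by (cases p)
 let ?m = "path_act p l"
 have "?m \<in> D" unfolding path_act_def by (rule left_path_D[OF ker_funD(1)[OF l]]) (use p in \<open>simp only: is_path_flip_iff\<close>)
 moreover have "s = i" if "?m (t, w, s) ~= 0" for t w s
  using that ker_funD(2)[OF l] by (auto simp: p' path_act_apply split: if_splits)
 moreover have "reps i k ?m = path_act p (reps i k l)"
 proof -
  have "right_op i (path_act p m) = path_act p (right_op i m)" for m :: "'i path => 'k"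
   by (auto simp: fun_eq_iff right_op_def path_act_apply p')
  thus ?thesis by (induction k) auto
 qed
 hence "reps i k ?m = 0"
  by (simp add: ker_funD(3)[OF l] path_act_def fvv.linear_0[OF left_path_linear])
 moreover have "degs ?m
   \<subseteq> (\<lambda>v. v - wdeg d u) ` degs l"
 proof
  fix v assume "v \<in> degs ?m"
  then obtain w s where "l (b, rev (map flip_arrow u) @ w, s) ~= 0" "wdeg d w = v"
   by (auto simp: p' path_act_apply split: if_splits)
  hence "v = (v + wdeg d u) - wdeg d u"
   "l (b, rev (map flip_arrow u) @ w, s) ~= 0 \<and> wdeg d (rev (map flip_arrow u) @ w) = v + wdeg d u"
   by auto
  hence "v = (v + wdeg d u) - wdeg d u" "v + wdeg d u \<in> degs l"
   by blast+
  thus "v \<in> (\<lambda>v. v - wdeg d u) ` degs l" by (rule image_eqI)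
 qed
 hence "finite (degs ?m)"
  using ker_funD(4)[OF l] finite_subset by blast
 ultimately show ?thesis unfolding ker_fun_def by blast
qed

lemma act_ker_fun:
 assumes l: "l \<in> ker_fun i k" and x: "x \<in> carrier PA"
 shows "act x l \<in> ker_fun i k"
 unfolding act_def
 by (intro fv.subspace_sum fv.subspace_scale ker_fun_subspace path_act_ker_fun[OF l])
   (use x in \<open>auto simp: PA_carrier\<close>)

text \<open>The action on functions is adjoint to left multiplication by the flipped element. On
  single paths this is \<open>pair_left_mult\<close>.\<close>

lemma act_mult:
 assumes x: "x \<in> carrier PA" and y: "y \<in> carrier PA" and q: "q \<in> carrier PA"
 shows "pair l (flip_fun x \<cdot> q) = pair (act x l) q"
 using x
proof (induction rule: PA_induct)
 case zero
 show "pair l (flip_fun 0 \<cdot> q) = pair (act 0 l) q"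
  by (simp add: fvv.linear_0[OF flip_fun_linear] PA_mult_zero act_zero pair_zero pair_zero_left)
next
 case (scale_basis c p z)
 have "is_path C (flip_path p)" using scale_basis(1) by (simp only: is_path_flip_iff)
 hence "pair l (basis_path (flip_path p) \<cdot> q) = pair (path_act p l) q"
  unfolding path_act_def by (rule pair_left_mult[OF q])
 moreover have "basis_path (flip_path p) \<cdot> q \<in> fin_supp" "flip_fun z \<cdot> q \<in> fin_supp"
  using \<open>is_path C (flip_path p)\<close> scale_basis(3) q by (auto intro!: PA_fin_supp PA.m_closed basis_PA flip_PA)
 ultimately show "pair l (flip_fun (sc c (basis_path p) + z) \<cdot> q) = pair (act (sc c (basis_path p) + z) l) q"
  using scale_basis
  by (simp add: fvv.linear_add[OF flip_fun_linear] fvv.linear_scale[OF flip_fun_linear] flip_basis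
   PA_mult_add PA_mult_scale pair_add fin_supp_scale pair_scale act_add act_scale act_basis basis_fin_supp PA_fin_supp
   pair_add_left pair_scale_left)
qed

text \<open>The module structure of the generic kernel in terms of functions on paths. Dualizing
  changes the sign of degrees and the shift adds \<open>k * d i\<close>, so degree \<open>u\<close>
  corresponds to path degree \<open>k * d i - u\<close>.\<close>

lemma KK_ops:
 assumes k: "k > 0" and \<phi>: "\<phi> \<in> carrier (KK i k)"
 shows "\<psi> \<in> carrier (KK i k) ==> \<phi> \<oplus>\<^bsub>KK i k\<^esub> \<psi> = from_fun i k (to_fun i k \<phi> + to_fun i k \<psi>)"
  and "x \<in> carrier PA ==> cls x \<odot>\<^bsub>KK i k\<^esub> \<phi> = from_fun i k (act x (to_fun i k \<phi>))"
  and "\<zero>\<^bsub>KK i k\<^esub> = from_fun i k 0"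
  and "\<phi> \<in> mod_part (KK i k) u \<longleftrightarrow> (\<forall>t w s. to_fun i k \<phi> (t, w, s) ~= 0 --> wdeg d w = int (k * d i) - u)"
proof -
 have add: "add (KK i k) \<phi> \<psi> = (\<lambda>x\<in>coset i k ` src_part i. \<phi> x + \<psi> x)"
  and smult: "smult (KK i k) a \<phi> = (\<lambda>x\<in>coset i k ` src_part i. \<phi> (anti_involution a \<odot>\<^bsub>TT i k\<^esub> x))"
  and zero: "zero (KK i k) = (\<lambda>x\<in>coset i k ` src_part i. 0)" for \<phi> \<psi> a
  by (simp_all add: generic_kernel_def shift_def restricted_dual_def Let_def TT_structure(1)[OF k])
 note l = to_fun_ker_fun[OF k]
 show "\<phi> \<oplus>\<^bsub>KK i k\<^esub> \<psi> = from_fun i k (to_fun i k \<phi> + to_fun i k \<psi>)" if \<psi>: "\<psi> \<in> carrier (KK i k)"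
  by (rule from_fun_unique[OF k])
    (auto simp: add fv.subspace_add[OF ker_fun_subspace l[OF \<phi>] l[OF \<psi>]] pair_add_left KK_eval[OF k \<phi>] KK_eval[OF k \<psi>])
 show "cls x \<odot>\<^bsub>KK i k\<^esub> \<phi> = from_fun i k (act x (to_fun i k \<phi>))" if x: "x \<in> carrier PA"
 proof (rule from_fun_unique[OF k act_ker_fun[OF l[OF \<phi>] x]])
  show "cls x \<odot>\<^bsub>KK i k\<^esub> \<phi> \<in> extensional (coset i k ` src_part i)" by (simp add: smult)
  fix y assume y: "y \<in> src_part i"
  have "(cls x \<odot>\<^bsub>KK i k\<^esub> \<phi>) (coset i k y) = \<phi> (coset i k (flip_fun x \<cdot> y))"
   using y by (simp add: smult anti_involution_cls[OF x] TT_structure(3)[OF k flip_PA[OF x] y])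
  also have "... = pair (to_fun i k \<phi>) (flip_fun x \<cdot> y)"
   by (rule KK_eval[OF k \<phi> mult_src_part[OF flip_PA[OF x] y]])
  also have "... = pair (act x (to_fun i k \<phi>)) y" by (rule act_mult[OF x x src_part_PA[OF y]])
  finally show "(cls x \<odot>\<^bsub>KK i k\<^esub> \<phi>) (coset i k y) = pair (act x (to_fun i k \<phi>)) y" .
 qed
 show "\<zero>\<^bsub>KK i k\<^esub> = from_fun i k 0"
  by (rule from_fun_unique[OF k fv.subspace_0[OF ker_fun_subspace]]) (auto simp: zero pair_zero_left)
 have "\<phi> \<in> mod_part (KK i k) u \<longleftrightarrow> (\<forall>v. v ~= - (u - int (k * d i)) -->
   (\<forall>x\<in>src_part i. of_deg v x --> \<phi> (coset i k x) = 0))"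
  using \<phi> by (auto simp: generic_kernel_def shift_def restricted_dual_def Let_def TT_structure(4)[OF k])
 also have "... \<longleftrightarrow> (\<forall>t w s. to_fun i k \<phi> (t, w, s) ~= 0 --> wdeg d w = int (k * d i) - u)"
 proof
  assume L: "\<forall>v. v ~= - (u - int (k * d i)) -->
   (\<forall>x\<in>src_part i. of_deg v x --> \<phi> (coset i k x) = 0)"
  show "\<forall>t w s. to_fun i k \<phi> (t, w, s) ~= 0 --> wdeg d w = int (k * d i) - u"
  proof (intro allI impI, rule ccontr)
   fix t w s assume nz: "to_fun i k \<phi> (t, w, s) ~= 0" and "wdeg d w ~= int (k * d i) - u"
   hence p: "is_path C (t, w, i)" "s = i" by (auto simp: to_fun_def split: if_splits)
   have hom: "\<forall>p. basis_path (t, w, i) p ~= (0 :: 'k) --> path_deg d p = wdeg d w"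
    by (auto simp: basis_path_def wdeg_def)
   have "\<phi> (coset i k (basis_path (t, w, i))) = 0"
   proof -
    have "wdeg d w ~= - (u - int (k * d i))" using \<open>wdeg d w ~= _\<close> by simp
    with L basis_src_part[OF p(1)] hom show ?thesis by blast
   qed
   thus False using nz p by (simp add: to_fun_def)
  qed
 next
  assume R: "\<forall>t w s. to_fun i k \<phi> (t, w, s) ~= 0 --> wdeg d w = int (k * d i) - u"
  show "\<forall>v. v ~= - (u - int (k * d i)) -->
   (\<forall>x\<in>src_part i. of_deg v x --> \<phi> (coset i k x) = 0)"
  proof (intro allI impI ballI)
   fix v x assume v: "v ~= - (u - int (k * d i))" and x: "x \<in> src_part i" "of_deg v x"
   have "x p * to_fun i k \<phi> p = 0" for p
   proof -
    obtain t w s where p: "p = (t, w, s)" by (cases p)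
    have "x p = 0" if "to_fun i k \<phi> p ~= 0"
    proof (rule ccontr)
     assume "x p ~= 0"
     hence "path_deg d p = v" using x(2) by blast
     moreover have "wdeg d w = int (k * d i) - u" using R that unfolding p by blast
     ultimately show False using v unfolding p path_deg_eq_wdeg by simp
    qed
    thus ?thesis by auto
   qed
   hence "pair (to_fun i k \<phi>) x = 0" unfolding pair_def by (intro sum.neutral ballI)
   thus "\<phi> (coset i k x) = 0" by (simp add: KK_eval[OF k \<phi> x(1)])
  qed
 qed
 finally show "\<phi> \<in> mod_part (KK i k) u \<longleftrightarrow> (\<forall>t w s. to_fun i k \<phi> (t, w, s) ~= 0 --> wdeg d w = int (k * d i) - u)" .
qed

lemma KK_part_carrier: "mod_part (KK i k) u \<subseteq> carrier (KK i k)"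
 by (auto simp: generic_kernel_def shift_def restricted_dual_def Let_def)

end

section \<open>Lifts of the free module\<close>

definition lin_ext :: "('q => ('z => 'k::field)) => ('q => 'k) => 'z => 'k" where
 "lin_ext G y = (\<Sum>q | y q ~= 0. sc (y q) (G q))"

lemma lin_ext_superset:
 assumes "finite S" "{p. x p ~= 0} \<subseteq> S"
 shows "lin_ext G x = (\<Sum>p\<in>S. sc (x p) (G p))"
 unfolding lin_ext_def by (rule sum.mono_neutral_left) (use assms in \<open>auto simp: fv.scale_zero_left\<close>)

lemma lin_ext_add:
 assumes "x \<in> fin_supp" "y \<in> fin_supp"
 shows "lin_ext G (x + y) = lin_ext G x + lin_ext G y"
proof -
 let ?S = "{p. x p ~= 0} \<union> {p. y p ~= 0}"
 have "finite ?S" using assms by (simp add: fin_supp_def)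
 thus ?thesis
  by (subst (1 2 3) lin_ext_superset[of ?S]) (auto simp: fun_app fv.scale_left_distrib sum.distrib)
qed

lemma lin_ext_scale: "lin_ext G (sc c x) = sc c (lin_ext G x)"
proof (cases "c = 0")
 case True
 thus ?thesis by (simp add: lin_ext_def fun_app fv.scale_zero_left)
next
 case False
 thus ?thesis by (simp add: lin_ext_def sc_apply fv.scale_sum_right fv.scale_scale)
qed

lemma lin_ext_zero: "lin_ext G 0 = 0"
 by (simp add: lin_ext_def fun_app)

lemma lin_ext_diff:
 assumes "x \<in> fin_supp" "y \<in> fin_supp"
 shows "lin_ext G (x - y) = lin_ext G x - lin_ext G y"
proof -
 have e: "x - y = x + sc (-1) y" by (auto simp: fun_eq_iff fun_app)
 show ?thesis unfolding e lin_ext_add[OF assms(1) fin_supp_scale[OF assms(2)]] lin_ext_scale by simp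
qed

lemma lin_ext_single: "lin_ext G (\<lambda>q. if q = p then 1 else 0) = G p"
 by (simp add: lin_ext_def)

lemma single_fin_supp: "(\<lambda>q. if q = p then 1 else 0) \<in> fin_supp"
 by (simp add: fin_supp_def)

definition slice :: "('z \<times> 'p => 'k) => 'z => 'p => 'k" where
 "slice y z = (\<lambda>p. y (z, p))"

lemma slice_add: "slice (x + y) z = slice x z + slice y z"
 by (auto simp: slice_def fun_eq_iff fun_app)

lemma slice_scale: "slice (sc c x) z = sc c (slice x z)"
 by (auto simp: slice_def fun_eq_iff fun_app)

lemma slice_zero: "slice 0 z = 0"
 by (auto simp: slice_def fun_eq_iff fun_app)

lemma slice_diff: "slice (x - y) z = slice x z - slice y z"
 by (auto simp: slice_def fun_eq_iff)

lemma slice_eq_iff: "x = y \<longleftrightarrow> (\<forall>z. slice x z = slice y z)"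
 by (auto simp: slice_def fun_eq_iff)

context gpa_over
begin

interpretation PA: ring PA by (rule path_algebra_ring)

lemma KK_th:
 assumes k: "k > 0" and \<phi>: "\<phi> \<in> carrier (KK i k)"
 shows "\<psi> \<in> carrier (KK i k) ==> \<phi> \<oplus>\<^bsub>KK i k\<^esub> \<psi> \<in> carrier (KK i k)"
  and "\<psi> \<in> carrier (KK i k) ==> to_fun i k (\<phi> \<oplus>\<^bsub>KK i k\<^esub> \<psi>) = to_fun i k \<phi> + to_fun i k \<psi>"
  and "x \<in> carrier PA ==> cls x \<odot>\<^bsub>KK i k\<^esub> \<phi> \<in> carrier (KK i k)"
  and "x \<in> carrier PA ==> to_fun i k (cls x \<odot>\<^bsub>KK i k\<^esub> \<phi>) = act x (to_fun i k \<phi>)"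
 using KK_ops(1,2)[OF k \<phi>] from_fun_carrier[OF k] to_from_fun[OF k] to_fun_ker_fun[OF k]
  fv.subspace_add[OF ker_fun_subspace] act_ker_fun \<phi> by auto

lemma KK_zero:
 assumes k: "k > 0"
 shows "\<zero>\<^bsub>KK i k\<^esub> \<in> carrier (KK i k)" "to_fun i k \<zero>\<^bsub>KK i k\<^esub> = 0"
proof -
 have z: "from_fun i k 0 \<in> carrier (KK i k)" by (rule from_fun_carrier[OF k fv.subspace_0[OF ker_fun_subspace]])
 have e: "\<zero>\<^bsub>KK i k\<^esub> = from_fun i k 0" by (rule KK_ops(3)[OF k z])
 show "\<zero>\<^bsub>KK i k\<^esub> \<in> carrier (KK i k)" "to_fun i k \<zero>\<^bsub>KK i k\<^esub> = 0"
  unfolding e using z by (auto simp: to_from_fun[OF k fv.subspace_0[OF ker_fun_subspace]])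
qed

lemma KK_abelian_group:
 assumes k: "k > 0"
 shows "abelian_group (KK i k)"
proof (rule abelian_groupI)
 note inj = to_fun_inj[OF k, of _ i]
 note th = KK_th(1,2)[OF k] KK_zero[OF k]
 show "x \<oplus>\<^bsub>KK i k\<^esub> y \<oplus>\<^bsub>KK i k\<^esub> z = x \<oplus>\<^bsub>KK i k\<^esub> (y \<oplus>\<^bsub>KK i k\<^esub> z)"
  if "x \<in> carrier (KK i k)" "y \<in> carrier (KK i k)" "z \<in> carrier (KK i k)" for x y z
  by (rule inj) (use that in \<open>simp_all add: th add.assoc\<close>)
 show "x \<oplus>\<^bsub>KK i k\<^esub> y = y \<oplus>\<^bsub>KK i k\<^esub> x" if "x \<in> carrier (KK i k)" "y \<in> carrier (KK i k)" for x y
  by (rule inj) (use that in \<open>simp_all add: th add.commute\<close>)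
 show "\<zero>\<^bsub>KK i k\<^esub> \<oplus>\<^bsub>KK i k\<^esub> x = x" if "x \<in> carrier (KK i k)" for x
  by (rule inj) (use that in \<open>simp_all add: th\<close>)
 show "\<exists>y\<in>carrier (KK i k). y \<oplus>\<^bsub>KK i k\<^esub> x = \<zero>\<^bsub>KK i k\<^esub>" if x: "x \<in> carrier (KK i k)" for x
 proof -
  have m: "- to_fun i k x \<in> ker_fun i k" by (rule fv.subspace_neg[OF ker_fun_subspace to_fun_ker_fun[OF k x]])
  hence "from_fun i k (- to_fun i k x) \<in> carrier (KK i k)" by (rule from_fun_carrier[OF k])
  moreover have "from_fun i k (- to_fun i k x) \<oplus>\<^bsub>KK i k\<^esub> x = \<zero>\<^bsub>KK i k\<^esub>"
   by (rule inj) (use x calculation in \<open>simp_all add: th to_from_fun[OF k m]\<close>)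
  ultimately show ?thesis by blast
 qed
qed (use KK_th(1)[OF k] KK_zero[OF k] in auto)

lemma KK_part:
 assumes k: "k > 0"
 shows "\<phi> \<in> mod_part (KK i k) u \<longleftrightarrow> \<phi> \<in> carrier (KK i k) \<and> (\<forall>t w s. to_fun i k \<phi> (t, w, s) ~= 0 --> wdeg d w = int (k * d i) - u)"
 using KK_ops(4)[OF k, of \<phi> i u] KK_part_carrier[of i k u] by blast

lemma act_II:
 assumes l: "l \<in> ker_fun i k" and x: "x \<in> II"
 shows "act x l = 0"
proof -
 note xP = II_PA[OF x]
 have "act x l p = 0" for p
 proof (cases "is_path C p")
  case True
  have "act x l p = pair (act x l) (basis_path p)" by (simp add: pair_basis)
  also have "... = pair l (flip_fun x \<cdot> basis_path p)"
   by (rule act_mult[OF xP xP basis_PA[OF True], symmetric])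
  also have "... = 0"
   by (rule D_annihilates_II[OF ker_funD(1)[OF l]]) (intro II_mult flip_II x basis_PA True)
  finally show ?thesis .
 next
  case False
  thus ?thesis using rel_dual_path[OF ker_funD(1)[OF act_ker_fun[OF l xP]], of p] by blast
 qed
 thus ?thesis by (simp add: fun_eq_iff fun_app)
qed

lemma act_one:
 assumes l: "l \<in> ker_fun i k"
 shows "act (sc c \<one>\<^bsub>PA\<^esub>) l = sc c l"
proof -
 have "act \<one>\<^bsub>PA\<^esub> l p = l p" for p
 proof (cases "is_path C p")
  case True
  have f: "flip_fun \<one>\<^bsub>PA\<^esub> = \<one>\<^bsub>PA\<^esub>"
   by (auto simp: fun_eq_iff flip_fun_apply path_algebra_def)
  have "act \<one>\<^bsub>PA\<^esub> l p = pair (act \<one>\<^bsub>PA\<^esub> l) (basis_path p)" by (simp add: pair_basis)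
  also have "... = pair l (flip_fun \<one>\<^bsub>PA\<^esub> \<cdot> basis_path p)"
   by (rule act_mult[OF PA.one_closed PA.one_closed basis_PA[OF True], symmetric])
  also have "... = l p" using basis_PA[OF True] by (simp add: f pair_basis)
  finally show ?thesis .
 next
  case False
  thus ?thesis
   using rel_dual_path[OF ker_funD(1)[OF act_ker_fun[OF l PA.one_closed]], of p] rel_dual_path[OF ker_funD(1)[OF l], of p]
   by metis
 qed
 hence "act \<one>\<^bsub>PA\<^esub> l = l" by (rule ext)
 thus ?thesis by (simp add: act_scale)
qed

end

text \<open>On \<open>U + V\<close> the value at \<open>x + y\<close> has to be \<open>g x\<close>;
  it is well defined because \<open>g\<close> vanishes on the intersection.\<close>

lemma functional_extend_zero:
 fixes g :: "('z => 'k::field) => 'k"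
 assumes U: "fv.subspace U" and V: "fv.subspace V"
  and add: "\<And>x y. x \<in> U ==> y \<in> U ==> g (x + y) = g x + g y"
  and scale: "\<And>c x. x \<in> U ==> g (sc c x) = c * g x"
  and zero: "\<And>x. x \<in> U ==> x \<in> V ==> g x = 0"
 obtains L where "functional L" "\<And>x. x \<in> U ==> L x = g x" "\<And>x. x \<in> V ==> L x = 0"
proof -
 define W where "W = {x + y |x y. x \<in> U \<and> y \<in> V}"
 define G where "G z = g (SOME x. x \<in> U \<and> z - x \<in> V)" for z
 have G: "G (x + y) = g x" if "x \<in> U" "y \<in> V" for x y
 proof -
  define x' where "x' = (SOME x'. x' \<in> U \<and> (x + y) - x' \<in> V)"
  have "x \<in> U \<and> (x + y) - x \<in> V" using that by simp
  hence x': "x' \<in> U \<and> (x + y) - x' \<in> V" unfolding x'_def by (rule someI[of "\<lambda>x'. x' \<in> U \<and> (x + y) - x' \<in> V" x])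
  have d: "x + sc (-1) x' \<in> U" by (intro fv.subspace_add[OF U] fv.subspace_scale[OF U] that(1)) (use x' in blast)
  have "((x + y) - x') - y \<in> V" using x' that(2) fv.subspace_diff[OF V] by blast
  moreover have "((x + y) - x') - y = x + sc (-1) x'" by (auto simp: fun_eq_iff fun_app)
  ultimately have "g (x + sc (-1) x') = 0" using zero[OF d] by simp
  moreover have "g (x + sc (-1) x') = g x + (-1) * g x'"
   using add[OF that(1) fv.subspace_scale[OF U]] scale x' by metis
  ultimately show ?thesis unfolding G_def x'_def by simp
 qed
 have W: "fv.subspace W" unfolding W_def by (rule fv.subspace_sums[OF U V])
 obtain L where L: "functional L" "\<And>x. x \<in> W ==> L x = G x"
 proof (rule functional_extend[OF W, of G])
  fix z z' assume "z \<in> W" "z' \<in> W"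
  then obtain x y x' y' where e: "z = x + y" "z' = x' + y'" "x \<in> U" "y \<in> V" "x' \<in> U" "y' \<in> V" unfolding W_def by blast
  have "z + z' = (x + x') + (y + y')" using e by (simp add: algebra_simps)
  hence "G (z + z') = g (x + x')" using G[OF fv.subspace_add[OF U e(3,5)] fv.subspace_add[OF V e(4,6)]] by simp
  thus "G (z + z') = G z + G z'" using e G add by simp
 next
  fix c z assume "z \<in> W"
  then obtain x y where e: "z = x + y" "x \<in> U" "y \<in> V" unfolding W_def by blast
  hence "sc c z = sc c x + sc c y" by (simp add: fv.scale_right_distrib)
  thus "G (sc c z) = c * G z" using e G fv.subspace_scale[OF U] fv.subspace_scale[OF V] scale by simp
 qed (rule that)
 show thesis
 proof (rule that[OF L(1)])
  show "L x = g x" if "x \<in> U" for x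
  proof -
   have "x + 0 \<in> W" unfolding W_def using that fv.subspace_0[OF V] by blast
   thus ?thesis using L(2)[of "x + 0"] G[OF that fv.subspace_0[OF V]] by simp
  qed
  show "L y = 0" if "y \<in> V" for y
  proof -
   have "0 + y \<in> W" unfolding W_def using that fv.subspace_0[OF U] by blast
   moreover have "g 0 = 0" using zero[OF fv.subspace_0[OF U] fv.subspace_0[OF V]] .
   ultimately show ?thesis using L(2)[of "0 + y"] G[OF fv.subspace_0[OF U] that] by simp
  qed
 qed
qed

text \<open>\<open>\<psi>\<close> identifies the quotient with the space of sequences that vanish
  from \<open>n\<close> on. The cosets are the fibres of \<open>\<psi>\<close>, and the fibres over
  the unit vectors are the basis that \<open>has_dim\<close> asks for.\<close>

lemma has_dim_quot:
 fixes H :: "('k::field, 'f) module" and \<psi> :: "'f => nat => 'k"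
 assumes ag: "abelian_group H"
  and smc: "\<And>a x. x \<in> carrier H ==> a \<odot>\<^bsub>H\<^esub> x \<in> carrier H"
  and add: "\<And>x y. x \<in> carrier H ==> y \<in> carrier H ==> \<psi> (x \<oplus>\<^bsub>H\<^esub> y) = \<psi> x + \<psi> y"
  and sm: "\<And>a x. x \<in> carrier H ==> \<psi> (a \<odot>\<^bsub>H\<^esub> x) = sc a (\<psi> x)"
  and supp: "\<And>x s. x \<in> carrier H ==> s >= n ==> \<psi> x s = 0"
  and B: "B = {x \<in> carrier H. \<psi> x = 0}"
  and surj: "\<And>v. (\<And>s. s >= n ==> v s = 0) ==> \<exists>x\<in>carrier H. \<psi> x = v"
 shows "has_dim (quot_module H B) n"
proof -
 interpret H: abelian_group H by (rule ag)
 define VV where "VV = {v :: nat => 'k. \<forall>s\<ge>n. v s = 0}"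
 define K where "K v = {x \<in> carrier H. \<psi> x = v}" for v
 let ?V = "quot_module H B"
 have VV: "v + w \<in> VV" "sc a v \<in> VV" "0 \<in> VV" if "v \<in> VV" "w \<in> VV" for v w a
  using that by (auto simp: VV_def fun_app)
 have ex: "\<exists>x\<in>carrier H. \<psi> x = v" if "v \<in> VV" for v
  using surj[of v] that by (simp add: VV_def)
 have \<psi>VV: "\<psi> x \<in> VV" if "x \<in> carrier H" for x using supp[OF that] by (simp add: VV_def)
 have neg: "\<psi> (\<ominus>\<^bsub>H\<^esub> x) = - \<psi> x" if x: "x \<in> carrier H" for x
 proof -
  have "\<psi> \<zero>\<^bsub>H\<^esub> = \<psi> \<zero>\<^bsub>H\<^esub> + \<psi> \<zero>\<^bsub>H\<^esub>" using add[of "\<zero>\<^bsub>H\<^esub>" "\<zero>\<^bsub>H\<^esub>"] by simp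
  hence "\<psi> \<zero>\<^bsub>H\<^esub> = 0" by simp
  moreover have "\<psi> (\<ominus>\<^bsub>H\<^esub> x \<oplus>\<^bsub>H\<^esub> x) = \<psi> (\<ominus>\<^bsub>H\<^esub> x) + \<psi> x" by (intro add H.a_inv_closed x)
  ultimately show ?thesis using x by (simp add: H.l_neg eq_neg_iff_add_eq_0)
 qed
 have split: "\<exists>y\<in>K v. y \<oplus>\<^bsub>H\<^esub> x = z" if "x \<in> carrier H" "z \<in> K (v + \<psi> x)" for x z v
 proof
  have z: "z \<in> carrier H" "\<psi> z = v + \<psi> x" using that(2) by (auto simp: K_def)
  show "(z \<oplus>\<^bsub>H\<^esub> \<ominus>\<^bsub>H\<^esub> x) \<oplus>\<^bsub>H\<^esub> x = z" using that(1) z(1) by (simp add: H.a_assoc H.l_neg)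
  show "z \<oplus>\<^bsub>H\<^esub> \<ominus>\<^bsub>H\<^esub> x \<in> K v" using that(1) z by (simp add: K_def add neg)
 qed
 have BK: "B = K 0" by (simp add: B K_def)
 have coset: "B +>\<^bsub>H\<^esub> x = K (\<psi> x)" if x: "x \<in> carrier H" for x
 proof
  show "B +>\<^bsub>H\<^esub> x \<subseteq> K (\<psi> x)" using x by (auto simp: a_r_coset_def' B K_def add)
  show "K (\<psi> x) \<subseteq> B +>\<^bsub>H\<^esub> x" using split[OF x, of _ 0] by (auto simp: a_r_coset_def' BK)
 qed
 have car: "carrier ?V = K ` VV"
 proof -
  have "carrier ?V = (\<lambda>x. K (\<psi> x)) ` carrier H" by (auto simp: quot_module_def A_RCOSETS_def' coset)
  also have "... = K ` VV" using ex \<psi>VV by (force simp: image_iff)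
  finally show ?thesis .
 qed
 have inj: "K v = K w \<longleftrightarrow> v = w" if "v \<in> VV" for v w
  using ex[OF that] by (auto simp: K_def)
 have addV: "K v \<oplus>\<^bsub>?V\<^esub> K w = K (v + w)" if "v \<in> VV" "w \<in> VV" for v w
 proof -
  obtain x where x: "x \<in> carrier H" "\<psi> x = w" using ex[OF \<open>w \<in> VV\<close>] by blast
  have "K v <+>\<^bsub>H\<^esub> K w = K (v + w)"
  proof
   show "K v <+>\<^bsub>H\<^esub> K w \<subseteq> K (v + w)" by (auto simp: set_add_def' K_def add)
   show "K (v + w) \<subseteq> K v <+>\<^bsub>H\<^esub> K w" using split[OF x(1), of _ v] x by (auto simp: set_add_def' K_def) blast
  qed
  thus ?thesis by (simp add: quot_module_def)
 qed
 have smV: "a \<odot>\<^bsub>?V\<^esub> K v = K (sc a v)" if "v \<in> VV" for a v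
 proof -
  have "B +>\<^bsub>H\<^esub> (a \<odot>\<^bsub>H\<^esub> x) = K (sc a v)" if "x \<in> K v" for x
   using that by (simp add: K_def coset smc sm)
  moreover obtain x where "x \<in> K v" using ex[OF \<open>v \<in> VV\<close>] by (auto simp: K_def)
  ultimately show ?thesis by (auto simp: quot_module_def)
 qed
 have zeroV: "\<zero>\<^bsub>?V\<^esub> = K 0" by (simp add: quot_module_def BK)
 have 0: "0 \<in> VV" by (simp add: VV_def fun_app)
 interpret V: abelian_monoid ?V
 proof (rule abelian_monoidI)
  show "X \<oplus>\<^bsub>?V\<^esub> Y = Y \<oplus>\<^bsub>?V\<^esub> X" if "X \<in> carrier ?V" "Y \<in> carrier ?V" for X Y
   using that by (auto simp only: car addV add.commute)
 qed (auto simp: car zeroV addV VV add.assoc 0)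
 have fin: "(\<Oplus>\<^bsub>?V\<^esub>b\<in>S. K (h b)) = K (\<Sum>b\<in>S. h b) \<and> (\<Sum>b\<in>S. h b) \<in> VV"
  if "finite S" "\<And>b. b \<in> S ==> h b \<in> VV" for S and h :: "'f set => nat => 'k"
  using that
 proof (induction S rule: finite_induct)
  case empty
  thus ?case using zeroV 0 V.finsum_empty by (simp only: sum.empty V.finsum_empty)
 next
  case (insert b S)
  thus ?case by (subst V.finsum_insert) (auto simp: car addV VV)
 qed
 define e where "e s = (\<lambda>t. if t = s then 1 else (0 :: 'k))" for s :: nat
 have e: "e s \<in> VV" if "s < n" for s using that by (auto simp: e_def VV_def)
 define Bs where "Bs = (\<lambda>s. K (e s)) ` {..<n}"
 have injB: "inj_on (\<lambda>s. K (e s)) {..<n}"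
 proof (rule inj_onI)
  fix s t assume "s \<in> {..<n}" "t \<in> {..<n}" "K (e s) = K (e t)"
  hence "e s s = e t s" using inj[OF e[of s]] by simp
  thus "s = t" by (simp add: e_def split: if_splits)
 qed
 have comb: "(\<Oplus>\<^bsub>?V\<^esub>b\<in>Bs. c b \<odot>\<^bsub>?V\<^esub> b) = K (\<lambda>t. if t < n then c (K (e t)) else 0)" for c
 proof -
  define ix where "ix = the_inv_into {..<n} (\<lambda>s. K (e s))"
  have ix: "ix (K (e s)) = s" if "s < n" for s
   unfolding ix_def using the_inv_into_f_f[OF injB] that by simp
  have h: "c b \<odot>\<^bsub>?V\<^esub> b = K (sc (c b) (e (ix b)))" "sc (c b) (e (ix b)) \<in> VV" if b: "b \<in> Bs" for b
   using b ix smV[OF e] VV(2)[OF e e] by (auto simp: Bs_def)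
  have "(\<Oplus>\<^bsub>?V\<^esub>b\<in>Bs. c b \<odot>\<^bsub>?V\<^esub> b) = (\<Oplus>\<^bsub>?V\<^esub>b\<in>Bs. K (sc (c b) (e (ix b))))"
   by (rule V.finsum_cong') (use h car in auto)
  also have "... = K (\<Sum>b\<in>Bs. sc (c b) (e (ix b)))"
   using fin[of Bs "\<lambda>b. sc (c b) (e (ix b))"] h(2) by (simp add: Bs_def)
  also have "(\<Sum>b\<in>Bs. sc (c b) (e (ix b))) = (\<Sum>s<n. sc (c (K (e s))) (e s))"
   unfolding Bs_def by (subst sum.reindex[OF injB]) (auto simp: ix)
  also have "... = (\<lambda>t. if t < n then c (K (e t)) else 0)"
  proof
   fix t
   have "(\<Sum>s<n. sc (c (K (e s))) (e s)) t = (\<Sum>s<n. if s = t then c (K (e t)) else 0)"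
   proof -
    have "(\<Sum>s\<in>S. f s) t = (\<Sum>s\<in>S. f s t)" for S and f :: "nat => nat => 'k"
     by (induction S rule: infinite_finite_induct) (auto simp: fun_app)
    hence "(\<Sum>s<n. sc (c (K (e s))) (e s)) t = (\<Sum>s<n. c (K (e s)) * e s t)" by (simp add: sc_apply)
    also have "... = (\<Sum>s<n. if s = t then c (K (e t)) else 0)" by (intro sum.cong refl) (auto simp: e_def)
    finally show ?thesis .
   qed
   thus "(\<Sum>s<n. sc (c (K (e s))) (e s)) t = (if t < n then c (K (e t)) else 0)" by simp
  qed
  finally show ?thesis .
 qed
 show ?thesis
  unfolding has_dim_def
 proof (intro exI[of _ Bs] conjI ballI)
  show "finite Bs" "card Bs = n" by (auto simp: Bs_def card_image[OF injB])
  show "Bs \<subseteq> carrier ?V" using e by (auto simp: Bs_def car)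
  fix X assume "X \<in> carrier ?V"
  then obtain v where v: "v \<in> VV" "X = K v" by (auto simp: car)
  have eq: "X = (\<Oplus>\<^bsub>?V\<^esub>b\<in>Bs. c b \<odot>\<^bsub>?V\<^esub> b) \<longleftrightarrow> (\<forall>t<n. c (K (e t)) = v t)" for c
   unfolding comb v(2) inj[OF v(1)] using v(1) by (fastforce simp: fun_eq_iff VV_def)
  show "\<exists>!c. c \<in> Bs \<rightarrow>\<^sub>E UNIV \<and> X = (\<Oplus>\<^bsub>?V\<^esub>b\<in>Bs. c b \<odot>\<^bsub>?V\<^esub> b)"
   unfolding eq
  proof (rule ex1I)
   show "(\<lambda>b\<in>Bs. v (the_inv_into {..<n} (\<lambda>s. K (e s)) b)) \<in> Bs \<rightarrow>\<^sub>E UNIV \<and>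
    (\<forall>t<n. (\<lambda>b\<in>Bs. v (the_inv_into {..<n} (\<lambda>s. K (e s)) b)) (K (e t)) = v t)"
    using the_inv_into_f_f[OF injB] by (auto simp: Bs_def)
   fix c assume c: "c \<in> Bs \<rightarrow>\<^sub>E UNIV \<and> (\<forall>t<n. c (K (e t)) = v t)"
   show "c = (\<lambda>b\<in>Bs. v (the_inv_into {..<n} (\<lambda>s. K (e s)) b))"
   proof (rule extensionalityI[of _ Bs])
    show "c \<in> extensional Bs" using c by (simp add: PiE_def)
    fix b assume "b \<in> Bs"
    thus "c b = (\<lambda>b\<in>Bs. v (the_inv_into {..<n} (\<lambda>s. K (e s)) b)) b"
     using c the_inv_into_f_f[OF injB] by (auto simp: Bs_def)
   qed simp
  qed
 qed
qed

text \<open>Entries of elements of the free module are classes of the preprojective algebra. A lift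
  chooses representatives and is stored as a single function on pairs of a generator and a path,
  which makes the linear algebra of function spaces available.\<close>

type_synonym ('i, 'k) lift = "(int \<times> (('i, 'k) preproj_elt set => 'k)) \<times> 'i path => 'k"

text \<open>\<open>u0\<close> is the degree in which the graded extension space is evaluated; it
  enters as a shift of the first argument.\<close>

locale ext_setting = gpa_over C \<omega> d r K for C :: "'i::finite => 'i => int" and \<omega> d r and K :: "'k::field itself" +
 fixes i j :: 'i and k l :: nat and u0 :: int
 assumes k: "k > 0" and l: "l > 0"
begin

interpretation PA: ring PA by (rule path_algebra_ring)

abbreviation "MM \<equiv> shift u0 (KK i k)"
abbreviation "NN \<equiv> KK j l"
abbreviation "thM \<equiv> to_fun i k"
abbreviation "thN \<equiv> to_fun j l"

lemma MM_simps: "carrier MM = carrier (KK i k)" "add MM = add (KK i k)" "smult MM = smult (KK i k)"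
 "zero MM = zero (KK i k)" "mod_part MM v = mod_part (KK i k) (v - u0)"
 by (simp_all add: shift_def)

lemma MM_abelian: "abelian_group MM"
proof -
 interpret abelian_group "KK i k" by (rule KK_abelian_group[OF k])
 show ?thesis
 proof (rule abelian_groupI, unfold MM_simps)
  show "\<exists>y\<in>carrier (KK i k). y \<oplus>\<^bsub>KK i k\<^esub> x = \<zero>\<^bsub>KK i k\<^esub>" if "x \<in> carrier (KK i k)" for x
   using that a_inv_closed l_neg by blast
 qed (auto intro: a_assoc a_comm)
qed

definition lifts :: "('i, 'k) lift set" where
 "lifts = {y \<in> fin_supp. \<forall>u m p. y ((u, m), p) ~= 0 --> is_path C p \<and> m \<in> mod_part MM u}"

definition proj :: "('i, 'k) lift => (int \<times> (('i, 'k) preproj_elt set => 'k)) => ('i, 'k) preproj_elt" where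
 "proj y z = cls (slice y z)"

definition aug :: "('i, 'k) lift => 'i path => 'k" where
 "aug = lin_ext (\<lambda>((u, m), p). path_act p (thM m))"

definition amul :: "('i path => 'k) => ('i, 'k) lift => ('i, 'k) lift" where
 "amul x y = (\<lambda>(z, p). (x \<cdot> slice y z) p)"

definition part :: "'i => int => ('i, 'k) lift => ('i, 'k) lift" where
 "part t v y = (\<lambda>((u, m), (t', w, s)). if t' = t \<and> u + wdeg d w = v then y ((u, m), (t', w, s)) else 0)"

lemma lifts_fin_supp: "y \<in> lifts ==> y \<in> fin_supp" by (simp add: lifts_def)

lemma lifts_nz: "y \<in> lifts ==> y ((u, m), p) ~= 0 ==> is_path C p \<and> m \<in> mod_part MM u"
 unfolding lifts_def by blast

lemma lifts_subspace: "fv.subspace lifts"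
proof (rule fv.subspaceI)
 show "0 \<in> lifts" by (simp add: lifts_def fin_supp_zero fun_app)
 show "x + y \<in> lifts" if x: "x \<in> lifts" and y: "y \<in> lifts" for x y
  unfolding lifts_def
 proof (intro CollectI conjI allI impI)
  show "x + y \<in> fin_supp" using x y by (simp add: lifts_fin_supp fin_supp_add)
  fix u m p assume "(x + y) ((u, m), p) ~= 0"
  hence "x ((u, m), p) ~= 0 \<or> y ((u, m), p) ~= 0" by (auto simp: fun_app)
  thus "is_path C p" "m \<in> mod_part MM u" using lifts_nz[OF x] lifts_nz[OF y] by blast+
 qed
 show "sc c x \<in> lifts" if "x \<in> lifts" for c x
  using that by (auto simp: lifts_def fin_supp_scale fun_app)
qed

lemma slice_PA: "y \<in> lifts ==> slice y z \<in> carrier PA"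
proof -
 assume y: "y \<in> lifts"
 have "{p. slice y z p ~= 0} \<subseteq> snd ` {q. y q ~= 0}" by (force simp: slice_def)
 hence "slice y z \<in> fin_supp" using lifts_fin_supp[OF y] by (auto simp: fin_supp_def intro: finite_subset)
 moreover have "is_path C p" if "slice y z p ~= 0" for p
  using lifts_nz[OF y, of "fst z" "snd z" p] that by (simp add: slice_def)
 ultimately show ?thesis unfolding PA_carrier by blast
qed

lemma slice_finite: "y \<in> lifts ==> finite {z. slice y z ~= 0}"
proof -
 assume y: "y \<in> lifts"
 have "{z. slice y z ~= 0} \<subseteq> fst ` {q. y q ~= 0}" by (force simp: slice_def fun_eq_iff fun_app image_iff)
 thus ?thesis using lifts_fin_supp[OF y] by (auto simp: fin_supp_def intro: finite_subset)
qed

lemma slice_part: "slice y (u, m) ~= 0 ==> y \<in> lifts ==> m \<in> mod_part MM u"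
 using lifts_nz[of y u m] by (auto simp: slice_def fun_eq_iff fun_app)

lemma liftsI:
 assumes "finite {z. slice y z ~= 0}" and "\<And>z. slice y z \<in> carrier PA"
  and "\<And>u m. slice y (u, m) ~= 0 ==> m \<in> mod_part MM u"
 shows "y \<in> lifts"
proof -
 have "{q. y q ~= 0} \<subseteq> (SIGMA z:{z. slice y z ~= 0}. {p. slice y z p ~= 0})"
  by (auto simp: slice_def fun_eq_iff fun_app)
 moreover have "finite (SIGMA z:{z. slice y z ~= 0}. {p. slice y z p ~= 0})"
  using assms(1) PA_fin_supp[OF assms(2)] by (intro finite_SigmaI) (auto simp: fin_supp_def)
 ultimately have "finite {q. y q ~= 0}" by (rule finite_subset)
 moreover have "is_path C p \<and> m \<in> mod_part MM u" if nz: "y ((u, m), p) ~= 0" for u m p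
 proof -
  have "slice y (u, m) p ~= 0" using nz by (simp add: slice_def)
  moreover from this have "slice y (u, m) ~= 0" by (auto simp: fun_app)
  ultimately show ?thesis using assms(2)[of "(u, m)"] assms(3)[of u m] unfolding PA_carrier by blast
 qed
 ultimately show ?thesis unfolding lifts_def fin_supp_def by blast
qed

lemma slice_amul: "slice (amul x y) z = x \<cdot> slice y z"
 by (simp add: slice_def amul_def)

lemma amul_lifts: "x \<in> carrier PA ==> y \<in> lifts ==> amul x y \<in> lifts"
proof (rule liftsI)
 assume x: "x \<in> carrier PA" and y: "y \<in> lifts"
 have nz: "slice y z ~= 0" if "slice (amul x y) z ~= 0" for z
  using that by (auto simp: slice_amul PA_mult_zero)
 thus "finite {z. slice (amul x y) z ~= 0}" using slice_finite[OF y] by (auto intro: finite_subset[rotated])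
 show "slice (amul x y) z \<in> carrier PA" for z unfolding slice_amul by (intro PA.m_closed x slice_PA y)
 show "m \<in> mod_part MM u" if "slice (amul x y) (u, m) ~= 0" for u m using slice_part[OF nz[OF that] y] .
qed

lemma amul_add: "amul x (y + y') = amul x y + amul x y'" "amul (x + x') y = amul x y + amul x' y"
 and amul_scale: "amul x (sc c y) = sc c (amul x y)" "amul (sc c x) y = sc c (amul x y)"
 and amul_zero: "amul x 0 = 0" "amul 0 y = 0"
 and amul_diff: "amul x (y - y') = amul x y - amul x y'"
 unfolding slice_eq_iff
 by (simp_all add: slice_amul slice_add slice_scale slice_zero slice_diff PA_mult_add PA_mult_scale PA_mult_zero PA_mult_diff)

lemma amul_amul: "x \<in> carrier PA ==> x' \<in> carrier PA ==> y \<in> lifts ==> amul x (amul x' y) = amul (x \<cdot> x') y"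
 unfolding slice_eq_iff by (simp add: slice_amul PA.m_assoc slice_PA)

lemma part_linear: "fun_linear (part t v)"
 by (rule fun_linearI) (auto simp: part_def fun_eq_iff fun_app)

lemma part_apply: "part t v y ((u, m), (t', w, s)) = (if t' = t \<and> u + wdeg d w = v then y ((u, m), (t', w, s)) else 0)"
 by (simp add: part_def)

lemma part_lifts: "y \<in> lifts ==> part t v y \<in> lifts"
proof -
 assume y: "y \<in> lifts"
 have nz: "y q ~= 0" if "part t v y q ~= 0" for q
  using that by (cases q rule: prod.exhaust, cases "fst q", cases "snd q") (auto simp: part_def split: if_splits)
 have "{q. part t v y q ~= 0} \<subseteq> {q. y q ~= 0}" using nz by blast
 hence "part t v y \<in> fin_supp" using lifts_fin_supp[OF y] by (auto simp: fin_supp_def intro: finite_subset)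
 thus ?thesis using nz lifts_nz[OF y] unfolding lifts_def by blast
qed

lemma part_part: "part t v (part t' v' y) = (if t = t' \<and> v = v' then part t v y else 0)"
 by (auto simp: part_def fun_eq_iff fun_app)

lemma thM_ker: "m \<in> mod_part MM u ==> thM m \<in> ker_fun i k"
 using to_fun_ker_fun[OF k] KK_part_carrier unfolding MM_simps by blast

lemma thM_deg: "m \<in> mod_part MM u ==> thM m (t, w, s) ~= 0 ==> wdeg d w = int (k * d i) + u0 - u"
 unfolding MM_simps KK_part[OF k] by (elim conjE allE[of _ t] allE[of _ w] allE[of _ s]) simp

lemma lifts_induct [consumes 1, case_names zero add]:
 assumes y: "y \<in> lifts" and 0: "P 0"
  and add: "\<And>c u m p x. is_path C p ==> m \<in> mod_part MM u ==> x \<in> lifts ==> P x ==> P (sc c (\<lambda>q. if q = ((u, m), p) then 1 else 0) + x)"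
 shows "P y"
proof (rule fin_supp_induct[of y P, OF lifts_fin_supp[OF y] 0])
 fix c and q :: "(int \<times> (('i, 'k) preproj_elt set => 'k)) \<times> 'i path" and x
 assume q: "y q ~= 0" and x: "x \<in> fin_supp" "{q. x q ~= 0} \<subseteq> {q. y q ~= 0}" "P x"
 obtain u m p where q': "q = ((u, m), p)" by (metis prod.exhaust)
 have "x \<in> lifts" using x lifts_nz[OF y] unfolding lifts_def by blast
 thus "P (sc c (\<lambda>q'. if q' = q then 1 else 0) + x)"
  unfolding q' using lifts_nz[OF y, of u m p] q q' x by (intro add) auto
qed

lemma single_lifts: "is_path C p ==> m \<in> mod_part MM u ==> (\<lambda>q. if q = ((u, m), p) then 1 else 0) \<in> lifts"
 by (auto simp: lifts_def single_fin_supp split: if_splits)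

lemma aug_add: "x \<in> lifts ==> y \<in> lifts ==> aug (x + y) = aug x + aug y"
 and aug_diff: "x \<in> lifts ==> y \<in> lifts ==> aug (x - y) = aug x - aug y"
 and aug_scale: "aug (sc c x) = sc c (aug x)"
 and aug_zero: "aug 0 = 0"
 and aug_single: "aug (\<lambda>q. if q = ((u, m), p) then 1 else 0) = path_act p (thM m)"
 by (simp_all add: aug_def lin_ext_add lin_ext_diff lin_ext_scale lin_ext_zero lin_ext_single lifts_fin_supp)

lemma aug_part:
 assumes y: "y \<in> lifts"
 shows "aug (part t v y) (t', w, s) = (if t' = t \<and> wdeg d w = int (k * d i) + u0 - v then aug y (t', w, s) else 0)"
 using y
proof (induction arbitrary: t' w s rule: lifts_induct)
 case zero
 have "part t v 0 = 0" by (rule fvv.linear_0[OF part_linear])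
 thus "aug (part t v 0) (t', w, s) = (if t' = t \<and> wdeg d w = int (k * d i) + u0 - v then aug 0 (t', w, s) else 0)"
  by (simp add: aug_zero fun_app)
next
 case (add c u m p x)
 let ?e = "\<lambda>q. if q = ((u, m), p) then 1 else (0 :: 'k)"
 obtain a x' b where p: "p = (a, x', b)" by (cases p)
 have e: "part t v ?e = (if a = t \<and> u + wdeg d x' = v then ?e else 0)"
  by (auto simp: part_def p fun_eq_iff fun_app)
 have 1: "aug (part t v ?e) (t', w, s) = (if t' = t \<and> wdeg d w = int (k * d i) + u0 - v then aug ?e (t', w, s) else 0)"
 proof -
  have "wdeg d w = int (k * d i) + u0 - (u + wdeg d x')" if "thM m (b, rev (map flip_arrow x') @ w, s) ~= 0"
   using thM_deg[OF add(2) that] by simp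
  thus ?thesis
   by (auto simp: e aug_single aug_zero fun_app) (auto simp: p path_act_apply split: if_splits)
 qed
 have s: "?e \<in> lifts" "sc c ?e \<in> lifts" "part t v ?e \<in> lifts" "sc c (part t v ?e) \<in> lifts" "part t v x \<in> lifts"
  using single_lifts[OF add(1,2)] add(3) fv.subspace_scale[OF lifts_subspace] part_lifts by auto
 have "aug (part t v (sc c ?e + x)) = sc c (aug (part t v ?e)) + aug (part t v x)"
  using s by (simp add: fvv.linear_add[OF part_linear] fvv.linear_scale[OF part_linear] aug_add aug_scale)
 moreover have "aug (sc c ?e + x) = sc c (aug ?e) + aug x" using s add(3) by (simp add: aug_add aug_scale)
 ultimately show "aug (part t v (sc c ?e + x)) (t', w, s)
   = (if t' = t \<and> wdeg d w = int (k * d i) + u0 - v then aug (sc c ?e + x) (t', w, s) else 0)"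
  using add(4)[of t' w s] by (simp add: fun_app 1)
qed

lemma aug_ker_fun: "y \<in> lifts ==> aug y \<in> ker_fun i k"
proof (induction rule: lifts_induct)
 case zero
 show "aug 0 \<in> ker_fun i k" by (simp add: aug_zero fv.subspace_0[OF ker_fun_subspace])
next
 case (add c u m p x)
 let ?e = "\<lambda>q. if q = ((u, m), p) then 1 else (0 :: 'k)"
 have "aug ?e \<in> ker_fun i k" unfolding aug_single by (rule path_act_ker_fun[OF thM_ker[OF add(2)] add(1)])
 thus "aug (sc c ?e + x) \<in> ker_fun i k"
  using add single_lifts[OF add(1,2)] fv.subspace_scale[OF lifts_subspace]
  by (simp add: aug_add aug_scale fv.subspace_add[OF ker_fun_subspace] fv.subspace_scale[OF ker_fun_subspace])
qed

lemma act_path_mult: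
 "path_act (a, u, b) (path_act (t, w, s) m) = (if b = t then path_act (a, u @ w, s) m else 0)"
 by (auto simp: fun_eq_iff path_act_apply fun_app)

lemma aug_amul_basis:
 assumes p: "is_path C p" and y: "y \<in> lifts"
 shows "aug (amul (basis_path p) y) = path_act p (aug y)"
 using y
proof (induction rule: lifts_induct)
 case zero
 show "aug (amul (basis_path p) 0) = path_act p (aug 0)"
  by (simp add: amul_zero aug_zero path_act_def fvv.linear_0[OF left_path_linear])
next
 case (add c u m q x)
 let ?e = "\<lambda>q'. if q' = ((u, m), q) then 1 else (0 :: 'k)"
 obtain a x1 b t x2 s where p': "p = (a, x1, b)" and q': "q = (t, x2, s)" by (cases p, cases q)
 have "slice ?e z = (if z = (u, m) then basis_path q else 0)" for z
  by (auto simp: slice_def basis_path_def fun_eq_iff fun_app)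
 hence "slice (amul (basis_path p) ?e) z = slice (if b = t then (\<lambda>q'. if q' = ((u, m), (a, x1 @ x2, s)) then 1 else (0 :: 'k)) else 0) z" for z
  by (auto simp: slice_amul p' q' basis_mult_basis PA_mult_zero) (auto simp: slice_def basis_path_def fun_eq_iff fun_app)
 hence e: "amul (basis_path p) ?e = (if b = t then (\<lambda>q'. if q' = ((u, m), (a, x1 @ x2, s)) then 1 else (0 :: 'k)) else 0)"
  unfolding slice_eq_iff by blast
 have 1: "aug (amul (basis_path p) ?e) = path_act p (aug ?e)"
  by (auto simp: e aug_single aug_zero) (auto simp: p' q' act_path_mult)
 have s: "?e \<in> lifts" "sc c ?e \<in> lifts" "amul (basis_path p) ?e \<in> lifts" "sc c (amul (basis_path p) ?e) \<in> lifts" "amul (basis_path p) x \<in> lifts"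
  using single_lifts[OF add(1,2)] add(3) fv.subspace_scale[OF lifts_subspace] amul_lifts basis_PA[OF p] by auto
 show "aug (amul (basis_path p) (sc c ?e + x)) = path_act p (aug (sc c ?e + x))"
  using s add by (simp add: amul_add amul_scale aug_add aug_scale 1)
   (simp add: path_act_def fvv.linear_add[OF left_path_linear] fvv.linear_scale[OF left_path_linear])
qed

lemma aug_amul:
 assumes x: "x \<in> carrier PA" and y: "y \<in> lifts"
 shows "aug (amul x y) = act x (aug y)"
 using x
proof (induction rule: PA_induct)
 case zero
 show "aug (amul 0 y) = act 0 (aug y)" by (simp add: amul_zero aug_zero act_zero)
next
 case (scale_basis c p z)
 have "sc c (amul (basis_path p) y) \<in> lifts" "amul z y \<in> lifts"
  using scale_basis y amul_lifts basis_PA fv.subspace_scale[OF lifts_subspace] by auto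
 thus "aug (amul (sc c (basis_path p) + z) y) = act (sc c (basis_path p) + z) (aug y)"
  using scale_basis y
  by (simp add: amul_add amul_scale aug_add aug_scale aug_amul_basis act_add act_scale act_basis fin_supp_scale basis_fin_supp PA_fin_supp)
qed

text \<open>The kernel of \<open>proj\<close>, by \<open>NK_diff\<close>: the ambiguity in the
  choice of a lift.\<close>

definition NK :: "('i, 'k) lift set" where
 "NK = {y \<in> lifts. \<forall>z. slice y z \<in> II}"

definition homogeneous :: "int => ('i, 'k) lift => bool" where
 "homogeneous v y \<longleftrightarrow> (\<forall>u m t w s. y ((u, m), (t, w, s)) ~= 0 --> u + wdeg d w = v)"

abbreviation FF where "FF \<equiv> free_on AA MM"

lemma NK_lifts: "y \<in> NK ==> y \<in> lifts" by (simp add: NK_def)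

lemma NK_amul: "x \<in> carrier PA ==> y \<in> NK ==> amul x y \<in> NK"
 by (simp add: NK_def amul_lifts slice_amul II_mult)

lemma II_amul: "x \<in> II ==> y \<in> lifts ==> amul x y \<in> NK"
 by (simp add: NK_def amul_lifts slice_amul II_mult slice_PA II_PA)

lemma NK_subspace: "fv.subspace NK"
 by (rule fv.subspaceI)
   (auto simp: NK_def slice_zero slice_add slice_scale fv.subspace_0[OF II_subspace] fv.subspace_add[OF II_subspace]
    fv.subspace_scale[OF II_subspace] fv.subspace_0[OF lifts_subspace] fv.subspace_add[OF lifts_subspace] fv.subspace_scale[OF lifts_subspace])

lemma NK_diff: "x \<in> lifts ==> y \<in> lifts ==> proj x = proj y \<longleftrightarrow> x - y \<in> NK"
 using cls_eq[OF slice_PA slice_PA] fv.subspace_diff[OF lifts_subspace, of x y]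
 by (auto simp: proj_def fun_eq_iff NK_def slice_diff)

lemma proj_carrier:
 assumes y: "y \<in> lifts"
 shows "proj y \<in> carrier FF"
proof -
 have "slice y z ~= 0" if "proj y z ~= \<zero>\<^bsub>AA\<^esub>" for z
  using that by (auto simp: proj_def AA_zero)
 hence "{z. proj y z ~= \<zero>\<^bsub>AA\<^esub>} \<subseteq> {z. slice y z ~= 0}"
  and part: "\<forall>u m. proj y (u, m) ~= \<zero>\<^bsub>AA\<^esub> --> m \<in> mod_part MM u"
  using slice_part[OF _ y] by blast+
 moreover have "\<forall>z. proj y z \<in> carrier AA" by (simp add: proj_def AA_carrier slice_PA y)
 ultimately show ?thesis using finite_subset[OF _ slice_finite[OF y]] by (simp add: free_on_def Let_def)
qed

lemma proj_choice:
 assumes f: "f \<in> carrier FF" and x: "\<And>z. x z \<in> carrier PA" "\<And>z. cls (x z) = f z" "\<And>z. f z = \<zero>\<^bsub>AA\<^esub> ==> x z = 0"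
 shows "(\<lambda>(z, p). x z p) \<in> lifts" "proj (\<lambda>(z, p). x z p) = f" "slice (\<lambda>(z, p). x z p) z = x z"
proof -
 show s: "slice (\<lambda>(z, p). x z p) z = x z" for z by (simp add: slice_def)
 show "proj (\<lambda>(z, p). x z p) = f" by (rule ext) (simp only: proj_def s x(2))
 show "(\<lambda>(z, p). x z p) \<in> lifts"
 proof (rule liftsI)
  have "{z. slice (\<lambda>(z, p). x z p) z ~= 0} \<subseteq> {z. f z ~= \<zero>\<^bsub>AA\<^esub>}" using x(3) by (auto simp: s)
  moreover have "finite {z. f z ~= \<zero>\<^bsub>AA\<^esub>}" using f by (simp add: free_on_def Let_def)
  ultimately show "finite {z. slice (\<lambda>(z, p). x z p) z ~= 0}" by (rule finite_subset)
  show "slice (\<lambda>(z, p). x z p) z \<in> carrier PA" for z by (simp add: s x(1))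
  show "m \<in> mod_part MM u" if "slice (\<lambda>(z, p). x z p) (u, m) ~= 0" for u m
   using that x(3)[of "(u, m)"] f unfolding s free_on_def Let_def by fastforce
 qed
qed

lemma carrier_FF: "carrier FF = proj ` lifts"
proof
 show "carrier FF \<subseteq> proj ` lifts"
 proof
  fix f assume f: "f \<in> carrier FF"
  have "\<exists>x. x \<in> carrier PA \<and> cls x = f z \<and> (f z = \<zero>\<^bsub>AA\<^esub> --> x = 0)" for z
  proof (cases "f z = \<zero>\<^bsub>AA\<^esub>")
   case True
   thus ?thesis using PA_zero by (auto simp: AA_zero)
  next
   case False
   moreover have "f z \<in> carrier AA" using f by (cases z) (simp add: free_on_def Let_def)
   ultimately show ?thesis unfolding AA_carrier by auto
  qed
  then obtain x where x: "\<And>z. x z \<in> carrier PA" "\<And>z. cls (x z) = f z" "\<And>z. f z = \<zero>\<^bsub>AA\<^esub> ==> x z = 0" by metis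
  show "f \<in> proj ` lifts" using proj_choice(1,2)[OF f, of x] x by (metis imageI)
 qed
qed (use proj_carrier in blast)

lemma part_FF: "mod_part FF v = proj ` {y \<in> lifts. homogeneous v y}"
proof
 show "mod_part FF v \<subseteq> proj ` {y \<in> lifts. homogeneous v y}"
 proof
  fix f assume "f \<in> mod_part FF v"
  hence f: "f \<in> carrier FF" and p: "\<And>u m. f (u, m) \<in> alg_part AA (v - u)" by (auto simp: free_on_def Let_def)
  have "\<exists>x. x \<in> carrier PA \<and> cls x = f z \<and> (f z = \<zero>\<^bsub>AA\<^esub> --> x = 0) \<and> of_deg (v - fst z) x" for z
  proof (cases "f z = \<zero>\<^bsub>AA\<^esub>")
   case True
   thus ?thesis using PA_zero by (intro exI[of _ 0]) (auto simp: AA_zero fun_app)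
  next
   case False
   moreover have "f z \<in> alg_part AA (v - fst z)" using p[of "fst z" "snd z"] by simp
   ultimately show ?thesis unfolding AA_part by blast
  qed
  then obtain x where x: "\<And>z. x z \<in> carrier PA" "\<And>z. cls (x z) = f z" "\<And>z. f z = \<zero>\<^bsub>AA\<^esub> ==> x z = 0"
    "\<And>z p. x z p ~= 0 ==> path_deg d p = v - fst z" by metis
  have "homogeneous v (\<lambda>(z, p). x z p)"
   unfolding homogeneous_def
  proof (intro allI impI)
   fix u m t w s assume "(case ((u, m), t, w, s) of (z, p) => x z p) ~= 0"
   thus "u + wdeg d w = v" using x(4)[of "(u, m)" "(t, w, s)"] unfolding path_deg_eq_wdeg by simp
  qed
  thus "f \<in> proj ` {y \<in> lifts. homogeneous v y}" using proj_choice(1,2)[OF f, of x] x(1-3) by blast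
 qed
 show "proj ` {y \<in> lifts. homogeneous v y} \<subseteq> mod_part FF v"
 proof clarify
  fix y assume y: "y \<in> lifts" "homogeneous v y"
  have "\<forall>u m. proj y (u, m) \<in> alg_part AA (v - u)"
  proof (intro allI)
   fix u m
   have "path_deg d p = v - u" if "slice y (u, m) p ~= 0" for p
   proof -
    obtain t w s where p: "p = (t, w, s)" by (cases p)
    have "u + wdeg d w = v" using that y(2) unfolding p slice_def homogeneous_def by blast
    thus ?thesis unfolding p path_deg_eq_wdeg by simp
   qed
   thus "proj y (u, m) \<in> alg_part AA (v - u)"
    unfolding AA_part proj_def using slice_PA[OF y(1)] by blast
  qed
  thus "proj y \<in> mod_part FF v" using proj_carrier[OF y(1)] by (simp add: free_on_def Let_def)
 qed
qed

lemma FF_ops: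
 "x \<in> lifts ==> y \<in> lifts ==> proj x \<oplus>\<^bsub>FF\<^esub> proj y = proj (x + y)"
 "a \<in> carrier PA ==> y \<in> lifts ==> cls a \<odot>\<^bsub>FF\<^esub> proj y = proj (amul a y)"
 by (simp_all add: free_on_def Let_def proj_def fun_eq_iff AA_add AA_mult slice_PA slice_add slice_amul)

lemma aug_slices:
 assumes y: "y \<in> lifts"
 shows "aug y = (\<Sum>z | slice y z ~= 0. act (slice y z) (thM (snd z)))"
proof -
 have e: "{q. y q ~= 0} = (SIGMA z:{z. slice y z ~= 0}. {p. slice y z p ~= 0})"
  by (auto simp: slice_def fun_eq_iff fun_app)
 have "aug y = (\<Sum>q | y q ~= 0. sc (y q) (path_act (snd q) (thM (snd (fst q)))))"
  unfolding aug_def lin_ext_def by (intro sum.cong) auto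
 also have "... = (\<Sum>z | slice y z ~= 0. \<Sum>p | slice y z p ~= 0. sc (slice y z p) (path_act p (thM (snd z))))"
 proof -
  have "finite {p. slice y z p ~= 0}" for z
   using PA_fin_supp[OF slice_PA[OF y]] unfolding fin_supp_def by blast
  thus ?thesis
   unfolding e by (subst sum.Sigma[OF slice_finite[OF y]]) (auto simp: slice_def intro!: sum.cong)
 qed
 finally show ?thesis by (simp add: act_def)
qed

text \<open>\<open>augmentation\<close> sums over the non-zero classes, \<open>aug\<close> over the
  non-zero representatives. The difference consists of representatives in the ideal, which act by
  0.\<close>

lemma augmentation_proj:
 assumes y: "y \<in> lifts"
 shows "augmentation AA MM (proj y) \<in> carrier MM" "thM (augmentation AA MM (proj y)) = aug y"
proof -
 interpret M: abelian_group MM by (rule MM_abelian)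
 let ?Z = "{z. proj y z ~= \<zero>\<^bsub>AA\<^esub>}"
 let ?h = "\<lambda>z. proj y z \<odot>\<^bsub>MM\<^esub> snd z"
 have sub: "?Z \<subseteq> {z. slice y z ~= 0}" by (auto simp: proj_def AA_zero)
 hence fin: "finite ?Z" by (rule finite_subset[OF _ slice_finite[OF y]])
 have mem: "snd z \<in> mod_part MM (fst z)" if "slice y z ~= 0" for z
  using slice_part[of y "fst z" "snd z"] that y by simp
 have h: "?h z \<in> carrier MM \<and> thM (?h z) = act (slice y z) (thM (snd z))" if "slice y z ~= 0" for z
  using KK_th(3,4)[OF k, of "snd z" i "slice y z"] KK_part_carrier[of i k "fst z - u0"] mem[OF that] slice_PA[OF y]
  by (auto simp: proj_def MM_simps)
 have gen: "(\<Oplus>\<^bsub>MM\<^esub>z\<in>S. ?h z) \<in> carrier MM \<and> thM (\<Oplus>\<^bsub>MM\<^esub>z\<in>S. ?h z) = (\<Sum>z\<in>S. act (slice y z) (thM (snd z)))"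
  if "finite S" "S \<subseteq> ?Z" for S
  using that
 proof (induction S rule: finite_induct)
  case empty
  thus ?case using KK_zero[OF k, of i] by (simp add: MM_simps)
 next
  case (insert z S)
  have z: "?h z \<in> carrier MM" "thM (?h z) = act (slice y z) (thM (snd z))" using h insert.prems sub by blast+
  have "?h \<in> S \<rightarrow> carrier MM" using h insert.prems sub by blast
  hence "(\<Oplus>\<^bsub>MM\<^esub>z\<in>insert z S. ?h z) = ?h z \<oplus>\<^bsub>MM\<^esub> (\<Oplus>\<^bsub>MM\<^esub>z\<in>S. ?h z)"
   using insert z by (intro M.finsum_insert) auto
  thus ?case using insert z KK_th(1,2)[OF k, of "?h z" i "\<Oplus>\<^bsub>MM\<^esub>z\<in>S. ?h z"] by (simp add: MM_simps)
 qed
 have "(\<Sum>z\<in>?Z. act (slice y z) (thM (snd z))) = (\<Sum>z | slice y z ~= 0. act (slice y z) (thM (snd z)))"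
 proof (rule sum.mono_neutral_left[OF slice_finite[OF y] sub], rule ballI)
  fix z assume "z \<in> {z. slice y z ~= 0} - ?Z"
  hence nz: "slice y z ~= 0" and z: "proj y z = \<zero>\<^bsub>AA\<^esub>" by blast+
  hence "slice y z - 0 \<in> II" using cls_eq[OF slice_PA[OF y] PA_zero] unfolding AA_zero proj_def by blast
  thus "act (slice y z) (thM (snd z)) = 0"
   using act_II[OF thM_ker[OF mem[OF nz]]] by simp
 qed
 thus "augmentation AA MM (proj y) \<in> carrier MM" "thM (augmentation AA MM (proj y)) = aug y"
  using gen[OF fin order_refl] by (simp_all add: augmentation_def aug_slices[OF y])
qed

lemma aug_NK: "y \<in> NK ==> aug y = 0"
 unfolding aug_slices[OF NK_lifts]
proof (rule sum.neutral, clarify)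
 fix u m assume y: "y \<in> NK" and nz: "slice y (u, m) ~= 0"
 show "act (slice y (u, m)) (thM (snd (u, m))) = 0"
  using act_II[OF thM_ker[of m u]] slice_part[OF nz NK_lifts[OF y]] y by (simp add: NK_def)
qed

definition OY :: "('i, 'k) lift set" where
 "OY = {y \<in> lifts. aug y = 0}"

lemma syzygy_eq: "syzygy AA MM = sub_graded FF (proj ` OY)"
proof -
 have "augmentation AA MM (proj y) = \<zero>\<^bsub>MM\<^esub> \<longleftrightarrow> aug y = 0" if y: "y \<in> lifts" for y
 proof -
  have "augmentation AA MM (proj y) = \<zero>\<^bsub>MM\<^esub> \<longleftrightarrow> thM (augmentation AA MM (proj y)) = thM \<zero>\<^bsub>MM\<^esub>"
   using to_fun_inj[OF k, of "augmentation AA MM (proj y)" i "\<zero>\<^bsub>MM\<^esub>"] augmentation_proj(1)[OF y] KK_zero[OF k, of i]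
   unfolding MM_simps by metis
  thus ?thesis using augmentation_proj(2)[OF y] KK_zero[OF k, of i] by (simp add: MM_simps)
 qed
 hence "{f \<in> carrier FF. augmentation AA MM f = \<zero>\<^bsub>MM\<^esub>} = proj ` OY"
  unfolding carrier_FF OY_def by blast
 thus ?thesis by (simp add: syzygy_def)
qed

lemma part_amul:
 assumes x: "x \<in> carrier PA" and y: "y \<in> lifts" and hx: "\<And>t w s. x (t, w, s) ~= 0 ==> t = a \<and> s = b \<and> wdeg d w = e"
 shows "part a v (amul x y) = amul x (part b (v - e) y)" "t ~= a ==> part t v (amul x y) = 0"
proof -
 have "part t v (amul x y) ((u, m), (t', w, s)) = (if t = a then amul x (part b (v - e) y) ((u, m), (t', w, s)) else 0)" for t u m t' w s
 proof -
  have 1: "x (t', take n w, p) = 0" if "t' ~= a" for n p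
   using that hx[of t'] by auto
  have 2: "x (a, take n w, p) * (if p = b \<and> u + wdeg d (drop n w) = v - e then y ((u, m), (p, drop n w, s)) else 0)
    = (if u + wdeg d w = v then x (a, take n w, p) * y ((u, m), (p, drop n w, s)) else 0)" for n p
  proof (cases "x (a, take n w, p) = 0")
   case False
   have "wdeg d (take n w @ drop n w) = wdeg d (take n w) + wdeg d (drop n w)" by (rule wdeg_simps(3))
   hence "wdeg d w = wdeg d (take n w) + wdeg d (drop n w)" by simp
   with hx[OF False] show ?thesis by auto
  qed simp
  have ap: "amul x z ((u, m), (t', w, s)) = (\<Sum>n\<le>length w. \<Sum>p\<in>UNIV. x (t', take n w, p) * z ((u, m), (p, drop n w, s)))" for z t'
   by (simp add: amul_def slice_def path_algebra_def)
  show ?thesis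
  proof (cases "t' = a")
   case True
   thus ?thesis by (auto simp: part_apply ap 2)
  next
   case False
   thus ?thesis using 1[OF False] by (auto simp: part_apply ap sum.neutral hx)
  qed
 qed
 thus "part a v (amul x y) = amul x (part b (v - e) y)" "t ~= a ==> part t v (amul x y) = 0"
  by (auto simp: fun_eq_iff fun_app)
qed

text \<open>The ideal is homogeneous: by \<open>II_iff\<close> it suffices to pair with
  \<open>D\<close>, and taking a part of a lift is transposed to \<open>restr\<close>, under which
  \<open>D\<close> is stable.\<close>

lemma part_NK: "y \<in> NK ==> part t v y \<in> NK"
proof -
 assume y: "y \<in> NK"
 have "slice (part t v y) z \<in> II" for z
 proof -
  have PA: "slice (part t v y) z \<in> carrier PA" by (rule slice_PA[OF part_lifts[OF NK_lifts[OF y]]])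
  have "pair l (slice (part t v y) z) = 0" if l: "l \<in> D" for l
  proof -
   obtain u m where z: "z = (u, m)" by (cases z)
   let ?l = "restr d (\<lambda>t' c e s. t' = t \<and> e = v - u) l"
   have "pair l (slice (part t v y) z) = pair ?l (slice y z)"
   proof -
    have "slice (part t v y) z p * l p = slice y z p * ?l p" for p
     by (cases p) (auto simp: slice_def part_def z restr_def algebra_simps)
    moreover have "finite {p. slice y z p ~= 0}" using PA_fin_supp[OF slice_PA[OF NK_lifts[OF y]]] by (simp add: fin_supp_def)
    moreover have "{p. slice (part t v y) z p ~= 0} \<subseteq> {p. slice y z p ~= 0}" by (auto simp: slice_def part_def z split: if_splits)
    ultimately show ?thesis by (simp add: pair_superset[of "{p. slice y z p ~= 0}"])
   qed
   also have "... = 0" by (rule D_annihilates_II[OF restr_D[OF l]]) (use y NK_def in blast)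
   finally show ?thesis .
  qed
  thus ?thesis using II_iff[OF PA] by blast
 qed
 thus ?thesis unfolding NK_def using part_lifts[OF NK_lifts[OF y]] by blast
qed

lemma part_homogeneous: "homogeneous v (part t v y)"
 by (auto simp: homogeneous_def part_def)

lemma part_sum:
 assumes y: "y \<in> lifts"
 obtains T where "finite T" "y = (\<Sum>(t, v)\<in>T. part t v y)"
proof -
 define G where "G = (\<lambda>q :: (int \<times> (('i, 'k) preproj_elt set => 'k)) \<times> 'i path. (fst (snd q), fst (fst q) + wdeg d (fst (snd (snd q)))))"
 let ?T = "G ` {q. y q ~= 0}"
 have fin: "finite ?T" using lifts_fin_supp[OF y] by (simp add: fin_supp_def)
 have "y ((u, m), (t, w, s)) = (\<Sum>(t', v)\<in>?T. part t' v y) ((u, m), (t, w, s))" for u m t w s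
 proof -
  have "(\<Sum>(t', v)\<in>?T. part t' v y) ((u, m), (t, w, s)) = (\<Sum>x\<in>?T. if x = (t, u + wdeg d w) then y ((u, m), (t, w, s)) else 0)"
   unfolding sum_fun_apply by (intro sum.cong) (auto simp: part_def split: if_splits)
  also have "... = y ((u, m), (t, w, s))"
  proof (cases "y ((u, m), (t, w, s)) = 0")
   case False
   hence "(t, u + wdeg d w) \<in> ?T" by (intro image_eqI[of _ _ "((u, m), (t, w, s))"]) (auto simp: G_def)
   thus ?thesis using fin by (simp add: sum.delta)
  qed (auto intro!: sum.neutral)
  finally show ?thesis by simp
 qed
 hence "y = (\<Sum>(t, v)\<in>?T. part t v y)" by (auto simp: fun_eq_iff)
 thus thesis using that fin by blast
qed

lemma aug_part_zero: "y \<in> lifts ==> aug y = 0 ==> aug (part t v y) = 0"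
 by (auto simp: fun_eq_iff aug_part fun_app)

text \<open>These are the full preimages of graded submodules of the free module. The instances are
  \<open>lifts\<close>, for the free module itself, and \<open>OY\<close>, for the syzygy, so that
  homomorphisms from both are treated together.\<close>

definition lift_closed :: "('i, 'k) lift set => bool" where
 "lift_closed S \<longleftrightarrow> S \<subseteq> lifts \<and> NK \<subseteq> S \<and> fv.subspace S \<and> (\<forall>x\<in>carrier PA. \<forall>y\<in>S. amul x y \<in> S) \<and> (\<forall>y\<in>S. \<forall>t v. part t v y \<in> S)"

lemma lift_closedD:
 assumes "lift_closed S"
 shows "y \<in> S ==> y \<in> lifts" "y \<in> NK ==> y \<in> S" "fv.subspace S" "x \<in> carrier PA ==> y \<in> S ==> amul x y \<in> S"
  "y \<in> S ==> part t v y \<in> S"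
 using assms by (auto simp: lift_closed_def)

lemma lift_closed_lifts: "lift_closed lifts"
 unfolding lift_closed_def using NK_lifts lifts_subspace amul_lifts part_lifts by blast

lemma OY_subspace: "fv.subspace OY"
 by (rule fv.subspaceI)
   (auto simp: OY_def aug_zero aug_add aug_scale fv.subspace_0[OF lifts_subspace] fv.subspace_add[OF lifts_subspace] fv.subspace_scale[OF lifts_subspace])

lemma lift_closed_OY: "lift_closed OY"
proof -
 have "amul x y \<in> OY" if "x \<in> carrier PA" "y \<in> OY" for x y
  using that by (simp add: OY_def aug_amul amul_lifts fvv.linear_0[OF act_right_linear])
 moreover have "part t v y \<in> OY" if "y \<in> OY" for t v y
  using that by (simp add: OY_def part_lifts aug_part_zero)
 moreover have "NK \<subseteq> OY" "OY \<subseteq> lifts" using NK_lifts aug_NK by (auto simp: OY_def)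
 ultimately show ?thesis unfolding lift_closed_def using OY_subspace by blast
qed

text \<open>A graded homomorphism into the generic kernel at \<open>j\<close>, composed with
  \<open>proj\<close> on one side and \<open>to_fun\<close> on the other. Vanishing on
  \<open>NK\<close>, which makes it descend from lifts to classes, is stated separately.\<close>

definition hom_lift :: "('i, 'k) lift set => (('i, 'k) lift => 'i path => 'k) => bool" where
 "hom_lift S g \<longleftrightarrow> (\<forall>y\<in>S. g y \<in> ker_fun j l) \<and> (\<forall>y\<in>S. \<forall>y'\<in>S. g (y + y') = g y + g y')
   \<and> (\<forall>x\<in>carrier PA. \<forall>y\<in>S. g (amul x y) = act x (g y))
   \<and> (\<forall>y\<in>S. \<forall>v. homogeneous v y --> (\<forall>t w s. g y (t, w, s) ~= 0 --> wdeg d w = int (l * d j) - v))"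

lemma hom_liftD:
 assumes "hom_lift S g"
 shows "y \<in> S ==> g y \<in> ker_fun j l" "y \<in> S ==> y' \<in> S ==> g (y + y') = g y + g y'"
  "x \<in> carrier PA ==> y \<in> S ==> g (amul x y) = act x (g y)"
  "y \<in> S ==> homogeneous v y ==> g y (t, w, s) ~= 0 ==> wdeg d w = int (l * d j) - v"
 using assms unfolding hom_lift_def by blast+

lemma amul_one: "y \<in> lifts ==> amul (sc c \<one>\<^bsub>PA\<^esub>) y = sc c y"
 unfolding slice_eq_iff by (simp add: slice_amul slice_scale PA_one_mult slice_PA)

lemma hom_lift_scale:
 assumes S: "lift_closed S" and g: "hom_lift S g" and y: "y \<in> S"
 shows "g (sc c y) = sc c (g y)"
proof -
 have "g (sc c y) = act (sc c \<one>\<^bsub>PA\<^esub>) (g y)"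
  using hom_liftD(3)[OF g PA_scale[OF PA.one_closed] y] amul_one[OF lift_closedD(1)[OF S y]] by simp
 thus ?thesis using act_one[OF hom_liftD(1)[OF g y]] by simp
qed

abbreviation sub_FF where "sub_FF S \<equiv> sub_graded FF (proj ` S)"

lemma sub_FF_simps: "carrier (sub_FF S) = proj ` S" "add (sub_FF S) = add FF" "smult (sub_FF S) = smult FF"
 "mod_part (sub_FF S) v = mod_part FF v \<inter> proj ` S"
 by (simp_all add: sub_graded_def)

lemma part_sub_FF:
 assumes S: "lift_closed S"
 shows "mod_part (sub_FF S) v = proj ` {y \<in> S. homogeneous v y}"
proof -
 have "y \<in> S" if "y \<in> lifts" "y' \<in> S" "proj y = proj y'" for y y'
 proof -
  have "y - y' \<in> NK" using NK_diff[OF that(1) lift_closedD(1)[OF S that(2)]] that(3) by simp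
  hence "(y - y') + y' \<in> S" using that(2) lift_closedD(2,3)[OF S] fv.subspace_add by blast
  thus ?thesis by simp
 qed
 thus ?thesis unfolding sub_FF_simps part_FF using lift_closedD(1)[OF S] by blast
qed

lemma graded_homs_iff:
 assumes S: "lift_closed S"
 shows "f \<in> graded_homs AA (sub_FF S) NN \<longleftrightarrow> f \<in> proj ` S \<rightarrow>\<^sub>E carrier NN \<and> hom_lift S (\<lambda>y. thN (f (proj y)))"
proof (cases "f \<in> proj ` S \<rightarrow>\<^sub>E carrier NN")
 case True
 hence fN: "f (proj y) \<in> carrier NN" if "y \<in> S" for y using that by (auto simp: PiE_iff)
 note SL = lift_closedD[OF S]
 have add: "(\<forall>X\<in>proj ` S. \<forall>Y\<in>proj ` S. f (X \<oplus>\<^bsub>FF\<^esub> Y) = f X \<oplus>\<^bsub>NN\<^esub> f Y) \<longleftrightarrow>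
   (\<forall>y\<in>S. \<forall>y'\<in>S. thN (f (proj (y + y'))) = thN (f (proj y)) + thN (f (proj y')))"
 proof -
  have "f (proj y \<oplus>\<^bsub>FF\<^esub> proj y') = f (proj y) \<oplus>\<^bsub>NN\<^esub> f (proj y') \<longleftrightarrow> thN (f (proj (y + y'))) = thN (f (proj y)) + thN (f (proj y'))"
   if "y \<in> S" "y' \<in> S" for y y'
   using to_fun_inj[OF l, of "f (proj (y + y'))" j "f (proj y) \<oplus>\<^bsub>NN\<^esub> f (proj y')"] KK_th(1,2)[OF l fN[OF that(1)] fN[OF that(2)]]
    fN[OF fv.subspace_add[OF SL(3) that]] FF_ops(1)[OF SL(1)[OF that(1)] SL(1)[OF that(2)]] by metis
  thus ?thesis by simp
 qed
 have smult: "(\<forall>a\<in>carrier AA. \<forall>X\<in>proj ` S. f (a \<odot>\<^bsub>FF\<^esub> X) = a \<odot>\<^bsub>NN\<^esub> f X) \<longleftrightarrow>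
   (\<forall>x\<in>carrier PA. \<forall>y\<in>S. thN (f (proj (amul x y))) = act x (thN (f (proj y))))"
 proof -
  have "f (cls x \<odot>\<^bsub>FF\<^esub> proj y) = cls x \<odot>\<^bsub>NN\<^esub> f (proj y) \<longleftrightarrow> thN (f (proj (amul x y))) = act x (thN (f (proj y)))"
   if "x \<in> carrier PA" "y \<in> S" for x y
   using to_fun_inj[OF l, of "f (proj (amul x y))" j "cls x \<odot>\<^bsub>NN\<^esub> f (proj y)"] KK_th(3,4)[OF l fN[OF that(2)] that(1)]
    fN[OF SL(4)[OF that]] FF_ops(2)[OF that(1) SL(1)[OF that(2)]] by metis
  thus ?thesis unfolding AA_carrier by simp
 qed
 have part: "(\<forall>u. f ` mod_part (sub_FF S) u \<subseteq> mod_part NN u) \<longleftrightarrow>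
   (\<forall>y\<in>S. \<forall>v. homogeneous v y --> (\<forall>t w s. thN (f (proj y)) (t, w, s) ~= 0 --> wdeg d w = int (l * d j) - v))"
 proof -
  have "f (proj y) \<in> mod_part NN v \<longleftrightarrow> (\<forall>t w s. thN (f (proj y)) (t, w, s) ~= 0 --> wdeg d w = int (l * d j) - v)"
   if "y \<in> S" for y v
   using KK_part[OF l] fN[OF that] by blast
  thus ?thesis unfolding part_sub_FF[OF S] by blast
 qed
 have ker: "(\<forall>y\<in>S. thN (f (proj y)) \<in> ker_fun j l) = True" using fN to_fun_ker_fun[OF l] by blast
 have T: "(f \<in> proj ` S \<rightarrow>\<^sub>E carrier NN) = True" using True by simp
 show ?thesis
  unfolding graded_homs_def hom_lift_def mem_Collect_eq sub_FF_simps(1-3) ker T add smult part simp_thms ..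
qed (simp add: graded_homs_def sub_FF_simps)

lemma graded_homs_FF: "graded_homs AA FF NN = graded_homs AA (sub_FF lifts) NN"
proof -
 have "mod_part FF u \<inter> proj ` lifts = mod_part FF u" for u unfolding part_FF by blast
 thus ?thesis unfolding graded_homs_def sub_FF_simps carrier_FF by simp
qed

lemma hom_of_lift:
 assumes S: "lift_closed S" and g: "hom_lift S g" and z: "\<And>y. y \<in> NK ==> g y = 0"
 obtains f where "f \<in> graded_homs AA (sub_FF S) NN" "\<And>y. y \<in> S ==> thN (f (proj y)) = g y"
proof -
 define f where "f = (\<lambda>X\<in>proj ` S. from_fun j l (g (SOME y. y \<in> S \<and> proj y = X)))"
 note SL = lift_closedD[OF S]
 have th: "thN (f (proj y)) = g y \<and> f (proj y) \<in> carrier NN" if y: "y \<in> S" for y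
 proof -
  define y' where "y' = (SOME y'. y' \<in> S \<and> proj y' = proj y)"
  have y': "y' \<in> S" "proj y' = proj y" using someI[of "\<lambda>y'. y' \<in> S \<and> proj y' = proj y" y] y unfolding y'_def by blast+
  have n: "y' - y \<in> NK" using NK_diff[OF SL(1)[OF y'(1)] SL(1)[OF y]] y'(2) by simp
  have "g ((y' - y) + y) = g (y' - y) + g y" by (rule hom_liftD(2)[OF g SL(2)[OF n] y])
  hence "g y' = g y" using z[OF n] by simp
  hence "f (proj y) = from_fun j l (g y)" using y by (simp add: f_def y'_def)
  thus ?thesis using to_from_fun[OF l] from_fun_carrier[OF l] hom_liftD(1)[OF g y] by simp
 qed
 have "hom_lift S (\<lambda>y. thN (f (proj y)))"
  using g th SL(4) fv.subspace_add[OF SL(3)] unfolding hom_lift_def by simp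
 moreover have "f \<in> proj ` S \<rightarrow>\<^sub>E carrier NN" using th by (auto simp: f_def)
 ultimately show thesis using that th graded_homs_iff[OF S] by blast
qed

text \<open>In the generic kernel at \<open>j\<close> the trivial path, of path degree 0, belongs to
  degree \<open>cN\<close>. Multiplication by \<open>epsN\<close> raises degrees by
  \<open>2 * l * d j\<close>, that is, from \<open>cM\<close> to \<open>cN\<close>.\<close>

abbreviation "cN \<equiv> int (l * d j)"
abbreviation "cM \<equiv> - int (l * d j)"
abbreviation "epsN \<equiv> basis_path (eps_path j l) :: 'i path => 'k"

text \<open>A homomorphism \<open>f\<close> into the generic kernel at \<open>j\<close> is determined by the functional
 \<open>x \<mapsto> f x (e\<^sub>j)\<close>, which may be any functional vanishing on the components outside a single one,
 and on the image of \<open>\<epsilon>\<^sub>j\<^sup>l\<close>.\<close>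

definition admissible :: "('i, 'k) lift set => (('i, 'k) lift => 'k) => bool" where
 "admissible S L \<longleftrightarrow> functional L \<and> (\<forall>y\<in>NK. L y = 0) \<and> (\<forall>y\<in>S. L (amul epsN y) = 0) \<and> (\<forall>y\<in>S. L (part j cN y) = L y)"

lemma act_apply_left: "path_act (j, rev (map flip_arrow w), t) m (j, [], s) = m (t, w, s)"
 by (simp add: path_act_apply rev_map)

lemma epsN_PA: "epsN \<in> carrier PA"
 by (rule basis_PA[OF eps_path_path])

lemma act_eps:
 "act epsN m = leps j l m"
proof (rule ext, clarify)
 fix t w s
 have "rev (map flip_arrow (eps l j)) = eps l j" by (simp add: rev_replicate)
 thus "act epsN m (t, w, s) = leps j l m (t, w, s)"
  using l left_op_pow_off[of t j l m w s]
  by (cases "t = j") (simp_all add: act_basis eps_path_def path_act_apply left_op_pow_at)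
qed

lemma ker_fun_eps: "m \<in> ker_fun j l ==> act epsN m (j, [], j) = 0"
proof -
 assume m: "m \<in> ker_fun j l"
 have "act epsN m (j, [], j) = reps j l m (j, [], j)"
  by (simp add: act_eps left_op_pow_at right_op_pow_at)
 thus ?thesis by (simp add: ker_funD(3)[OF m] fun_app)
qed

lemma hom_lift_sum:
 assumes S: "lift_closed S" and g: "hom_lift S g" and "finite T" "\<And>x. x \<in> T ==> h x \<in> S"
 shows "g (\<Sum>x\<in>T. h x) = (\<Sum>x\<in>T. g (h x))"
 using assms(3,4)
proof (induction T rule: finite_induct)
 case empty
 show "g (\<Sum>x\<in>{}. h x) = (\<Sum>x\<in>{}. g (h x))"
  using hom_lift_scale[OF S g fv.subspace_0[OF lift_closedD(3)[OF S]], of 0] by (simp add: fv.scale_zero_left)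
next
 case (insert x T)
 have "(\<Sum>x\<in>T. h x) \<in> S" using insert by (intro fv.subspace_sum lift_closedD(3)[OF S]) auto
 thus "g (\<Sum>x\<in>insert x T. h x) = (\<Sum>x\<in>insert x T. g (h x))" using insert by (simp add: hom_liftD(2)[OF g])
qed

lemma idem_PA: "basis_path (t, [], t) \<in> carrier PA"
 by (rule basis_PA) simp

lemma part_amul_basis:
 assumes p: "is_path C (a, x, b)" and y: "y \<in> lifts"
 shows "part a v (amul (basis_path (a, x, b)) y) = amul (basis_path (a, x, b)) (part b (v - wdeg d x) y)"
  "t ~= a ==> part t v (amul (basis_path (a, x, b)) y) = 0"
 by (rule part_amul[OF basis_PA[OF p] y]; simp add: basis_path_def split: if_splits)+

lemma idem_part: "y \<in> lifts ==> amul (basis_path (t, [], t)) (part t v y) = part t v y"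
proof -
 assume y: "y \<in> lifts"
 have "amul (basis_path (t, [], t)) (part t v y) ((u, m), (t', w, s)) = part t v y ((u, m), (t', w, s))" for u m t' w s
 proof -
  define x where "x = slice (part t v y) (u, m)"
  have 1: "basis_path (t, [], t) (t', take n w, p) * x (p, drop n w, s)
    = (if p = t then if n = 0 then if t' = t then x (t', w, s) else 0 else 0 else 0)" if "n <= length w" for n p
   using that by (auto simp: basis_path_def)
  have "amul (basis_path (t, [], t)) (part t v y) ((u, m), (t', w, s))
   = (\<Sum>n\<le>length w. \<Sum>p\<in>UNIV. basis_path (t, [], t) (t', take n w, p) * x (p, drop n w, s))"
   by (simp add: amul_def path_algebra_def x_def)
  also have "... = (\<Sum>n\<le>length w. \<Sum>p\<in>UNIV. if p = t then if n = 0 then if t' = t then x (t', w, s) else 0 else 0 else 0)"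
   by (intro sum.cong refl 1) simp
  also have "... = part t v y ((u, m), (t', w, s))" by (simp add: x_def slice_def part_apply)
  finally show ?thesis .
 qed
 thus ?thesis by (auto simp: fun_eq_iff)
qed

text \<open>By degree and target, evaluation at the trivial path sees only the component at
  \<open>j\<close> of degree \<open>cN\<close>.\<close>

lemma hom_lift_part:
 assumes S: "lift_closed S" and g: "hom_lift S g" and y: "y \<in> S"
 shows "g (part j cN y) (j, [], s) = g y (j, [], s)"
proof -
 obtain T where T: "finite T" "y = (\<Sum>(t, v)\<in>T. part t v y)" using part_sum[OF lift_closedD(1)[OF S y]] .
 have P: "part t v y \<in> S" for t v by (rule lift_closedD(5)[OF S y])
 have off: "g (part t v y) (j, [], s) = 0" if "(t, v) ~= (j, cN)" for t v
 proof (cases "t = j")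
  case True
  have "wdeg d [] = int (l * d j) - v" if "g (part t v y) (j, [], s) ~= 0"
   by (rule hom_liftD(4)[OF g P part_homogeneous that])
  thus ?thesis using that True by auto
 next
  case False
  have "g (part t v y) = act (basis_path (t, [], t)) (g (part t v y))"
   using hom_liftD(3)[OF g idem_PA P, of t t v] idem_part[OF lift_closedD(1)[OF S y], of t v] by simp
  hence "g (part t v y) (j, [], s) = path_act (t, [], t) (g (part t v y)) (j, [], s)" by (metis act_basis)
  thus ?thesis using False by (simp add: path_act_apply)
 qed
 have zero: "part j cN y = 0" if "(j, cN) \<notin> T"
 proof -
  have "part j cN y = (\<Sum>(t, v)\<in>T. part j cN (part t v y))"
   by (subst T(2), simp add: fvv.linear_sum[OF part_linear] case_prod_unfold)
  also have "... = 0" by (rule sum.neutral) (use that in \<open>auto simp: part_part\<close>)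
  finally show ?thesis .
 qed
 have "g y = (\<Sum>x\<in>T. g ((\<lambda>(t, v). part t v y) x))"
  by (subst T(2), rule hom_lift_sum[OF S g T(1)]) (auto intro: P)
 hence "g y (j, [], s) = (\<Sum>x\<in>T. g (part (fst x) (snd x) y) (j, [], s))"
  by (simp add: sum_fun_apply case_prod_unfold)
 also have "... = (\<Sum>x\<in>T. if x = (j, cN) then g (part j cN y) (j, [], s) else 0)"
 proof (intro sum.cong refl)
  fix x
  show "g (part (fst x) (snd x) y) (j, [], s) = (if x = (j, cN) then g (part j cN y) (j, [], s) else 0)"
   using off[of "fst x" "snd x"] by (cases "x = (j, cN)") simp_all
 qed
 also have "... = g (part j cN y) (j, [], s)"
 proof (cases "(j, cN) \<in> T")
  case False
  have "g (part j cN y) = sc 0 (g (part j cN y))"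
   using hom_lift_scale[OF S g P, of 0 j cN] zero[OF False] by (simp add: fv.scale_zero_left fv.scale_zero_right)
  hence "g (part j cN y) (j, [], s) = 0" by (metis fv.scale_zero_left fun_app(2))
  thus ?thesis by (simp add: sum.neutral)
 qed (use T(1) in simp)
 finally show ?thesis by simp
qed

lemma hom_lift_functional:
 assumes S: "lift_closed S" and g: "hom_lift S g" and z: "\<And>y. y \<in> NK ==> g y = 0"
 obtains L where "admissible S L" "\<And>y. y \<in> S ==> L y = g y (j, [], j)"
proof -
 obtain L where L: "functional L" "\<And>y. y \<in> S ==> L y = g y (j, [], j)"
 proof (rule functional_extend[OF lift_closedD(3)[OF S], of "\<lambda>y. g y (j, [], j)"])
  show "g (x + y) (j, [], j) = g x (j, [], j) + g y (j, [], j)" if "x \<in> S" "y \<in> S" for x y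
   using hom_liftD(2)[OF g that] by (simp add: fun_app)
  show "g (sc c x) (j, [], j) = c * g x (j, [], j)" if "x \<in> S" for c x
   using hom_lift_scale[OF S g that] by (simp add: fun_app)
 qed (rule that)
 have "admissible S L"
  unfolding admissible_def
 proof (intro conjI ballI L(1))
  show "L y = 0" if "y \<in> NK" for y using L(2)[OF lift_closedD(2)[OF S that]] z[OF that] by (simp add: fun_app)
  show "L (amul epsN y) = 0" if "y \<in> S" for y
   using L(2)[OF lift_closedD(4)[OF S epsN_PA that]] hom_liftD(3)[OF g epsN_PA that] ker_fun_eps[OF hom_liftD(1)[OF g that]] by simp
  show "L (part j cN y) = L y" if "y \<in> S" for y
   using L(2)[OF lift_closedD(5)[OF S that]] L(2)[OF that] hom_lift_part[OF S g that] by simp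
 qed
 thus thesis using that L(2) by blast
qed

text \<open>The value of \<open>g y\<close> at a path is the value at the trivial path of
  \<open>g\<close> applied to the flipped path times \<open>y\<close>.\<close>

lemma hom_lift_determined:
 assumes S: "lift_closed S" and g: "hom_lift S g" and g': "hom_lift S g'"
  and eq: "\<And>y. y \<in> S ==> g y (j, [], j) = g' y (j, [], j)" and y: "y \<in> S"
 shows "g y = g' y"
proof (rule ext, clarify)
 fix t w s
 show "g y (t, w, s) = g' y (t, w, s)"
 proof (cases "s = j \<and> is_path C (t, w, s)")
  case True
  hence "is_path C (flip_path (t, w, j))" using is_path_flip[of t w j] by blast
  hence p: "is_path C (j, rev (map flip_arrow w), t)" by simp
  have h: "h y (t, w, j) = h (amul (basis_path (j, rev (map flip_arrow w), t)) y) (j, [], j)" if "hom_lift S h" for h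
   using hom_liftD(3)[OF that basis_PA[OF p] y] by (simp add: act_basis act_apply_left)
  show ?thesis using True h[OF g] h[OF g'] eq[OF lift_closedD(4)[OF S basis_PA[OF p] y]] by simp
 next
  case False
  hence h: "h y (t, w, s) = 0" if "hom_lift S h" for h
   using ker_funD(2)[OF hom_liftD(1)[OF that y]] rel_dual_path[OF ker_funD(1)[OF hom_liftD(1)[OF that y]]] by blast
  show ?thesis using h[OF g] h[OF g'] by simp
 qed
qed

lemma admissibleD:
 assumes "admissible S L"
 shows "functional L" "y \<in> NK ==> L y = 0" "y \<in> S ==> L (amul epsN y) = 0" "y \<in> S ==> L (part j cN y) = L y"
 using assms by (auto simp: admissible_def)

text \<open>The formula for \<open>g\<close> is forced by the argument of
  \<open>hom_lift_determined\<close>. Each condition in \<open>admissible\<close> becomes a property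
  of the values: vanishing on \<open>NK\<close> puts them into \<open>D\<close>, vanishing on
  multiples of \<open>epsN\<close> gives \<open>reps j l (g y) = 0\<close>, and dependence on a
  single component gives the degrees.\<close>

lemma lift_of_functional:
 assumes S: "lift_closed S" and L: "admissible S L"
 obtains g where "hom_lift S g" "\<And>y. y \<in> NK ==> g y = 0" "\<And>y. y \<in> S ==> g y (j, [], j) = L y"
proof -
 note SL = lift_closedD[OF S] and LL = admissibleD[OF L]
 note lin = fvk.linear_add[OF LL(1)] fvk.linear_scale[OF LL(1)] fvk.linear_0[OF LL(1)]
 define fl :: "'i arrow list => 'i arrow list" where "fl w = rev (map flip_arrow w)" for w
 have fl_app: "fl (u @ w) = fl w @ fl u" and fl_fl: "fl (fl w) = w" for u w
  by (simp_all add: fl_def rev_map)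
 have fl_deg: "wdeg d (fl w) = wdeg d w" for w by (simp add: fl_def)
 have fl_path: "is_path C (t, w, s) \<longleftrightarrow> is_path C (s, fl w, t)" for t w s
  using is_path_flip_iff[of "(t, w, s)"] by (simp add: fl_def)
 define g where "g y = (\<lambda>(t, w, s). if s = j \<and> is_path C (t, w, s) then L (amul (basis_path (j, fl w, t)) y) else 0)" for y
 have g: "g y (t, w, s) = (if s = j \<and> is_path C (t, w, s) then L (amul (basis_path (j, fl w, t)) y) else 0)" for y t w s
  by (simp add: g_def)
 have add: "g (y + y') = g y + g y'" for y y'
  by (auto simp: fun_eq_iff fun_app g amul_add lin)
 have scale: "g (sc c y) = sc c (g y)" for c y
  by (auto simp: fun_eq_iff fun_app g amul_scale lin)
 have g0: "g 0 = 0" by (auto simp: fun_eq_iff fun_app g amul_zero lin)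
 have NKz: "g y = 0" if "y \<in> NK" for y
  using that by (auto simp: fun_eq_iff fun_app g LL(2) NK_amul basis_PA fl_path[symmetric])
 have pr: "pair (g y) x = L (amul (flip_fun (x \<cdot> basis_path (j, [], j))) y)" if x: "x \<in> carrier PA" for x y
  using x
 proof (induction rule: PA_induct)
  case zero
  show "pair (g y) 0 = L (amul (flip_fun (0 \<cdot> basis_path (j, [], j))) y)"
   by (simp add: pair_zero PA_mult_zero fvv.linear_0[OF flip_fun_linear] amul_zero lin)
 next
  case (scale_basis c p z)
  obtain t w s where p: "p = (t, w, s)" by (cases p)
  have b: "g y p = L (amul (flip_fun (basis_path p \<cdot> basis_path (j, [], j))) y)"
   using scale_basis(1) by (auto simp: p g basis_mult_basis flip_basis fl_def fvv.linear_0[OF flip_fun_linear] amul_zero lin)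
  show "pair (g y) (sc c (basis_path p) + z) = L (amul (flip_fun ((sc c (basis_path p) + z) \<cdot> basis_path (j, [], j))) y)"
   using scale_basis
   by (simp add: pair_add fin_supp_scale basis_fin_supp PA_fin_supp pair_scale pair_basis b PA_mult_add PA_mult_scale
    fvv.linear_add[OF flip_fun_linear] fvv.linear_scale[OF flip_fun_linear] amul_add amul_scale lin)
 qed
 have D: "g y \<in> D" if y: "y \<in> S" for y
 proof (rule annihilator_in_D)
  show "g y p = 0" if "\<not> is_path C p" for p using that by (cases p) (simp add: g)
  show "pair (g y) x = 0" if x: "x \<in> II" for x
   unfolding pr[OF II_PA[OF x]] by (intro LL(2) II_amul SL(1) y flip_II II_mult x idem_PA)
 qed
 have right: "reps j l (g y) = 0" if y: "y \<in> S" for y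
 proof (rule ext, clarify)
  fix t w s
  show "reps j l (g y) (t, w, s) = 0 (t, w, s)"
  proof (cases "s = j \<and> is_path C (t, w, j)")
   case True
   hence p: "is_path C (j, fl w, t)" using fl_path by blast
   have e: "epsN \<cdot> basis_path (j, fl w, t) = basis_path (j, fl (w @ eps l j), t)"
    by (simp add: eps_path_def basis_mult_basis fl_def rev_replicate)
   have "reps j l (g y) (t, w, s) = L (amul epsN (amul (basis_path (j, fl w, t)) y))"
   proof -
    have "is_path C (j, eps l j, j)" by (simp add: is_path_replicate)
    hence "is_path C (t, w @ eps l j, j)" unfolding is_path_append using True by blast
    thus ?thesis
     using True unfolding amul_amul[OF epsN_PA basis_PA[OF p] SL(1)[OF y]] e by (simp add: right_op_pow_at g)
   qed
   also have "... = 0" by (rule LL(3)[OF SL(4)[OF basis_PA[OF p] y]])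
   finally show ?thesis by (simp add: fun_app)
  next
   case False
   show ?thesis
   proof (cases "s = j")
    case True
    thus ?thesis using False by (auto simp: right_op_pow_at g is_path_append is_path_replicate fun_app split: if_splits)
   next
    case False
    thus ?thesis using l by (cases l) (simp_all add: right_op_def fun_app)
   qed
  qed
 qed
 have part: "part t (cN - wdeg d w) y ~= 0" if y: "y \<in> S" and nz: "g y (t, w, s) ~= 0" for y t w s
 proof
  assume z: "part t (cN - wdeg d w) y = 0"
  have p: "is_path C (j, fl w, t)" and nz': "L (amul (basis_path (j, fl w, t)) y) ~= 0"
   using nz fl_path by (auto simp: g split: if_splits)
  have "L (amul (basis_path (j, fl w, t)) y) = L (part j cN (amul (basis_path (j, fl w, t)) y))"
   by (rule LL(4)[OF SL(4)[OF basis_PA[OF p] y], symmetric])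
  thus False using nz' by (simp add: part_amul_basis(1)[OF p SL(1)[OF y]] fl_deg z[simplified] amul_zero lin)
 qed
 have deg: "wdeg d w = cN - v" if y: "y \<in> S" and h: "homogeneous v y" and nz: "g y (t, w, s) ~= 0" for y v t w s
 proof (rule ccontr)
  assume "wdeg d w ~= cN - v"
  hence "part t (cN - wdeg d w) y = 0"
  proof (intro ext, clarify)
   fix u m t' x s' assume "wdeg d w ~= cN - v"
   hence "y ((u, m), (t', x, s')) = 0" if "u + wdeg d x = cN - wdeg d w"
    using h that unfolding homogeneous_def by fastforce
   thus "part t (cN - wdeg d w) y ((u, m), (t', x, s')) = 0 ((u, m), (t', x, s'))"
    by (auto simp: part_apply fun_app)
  qed
  thus False using part[OF y nz] by blast
 qed
 have fin: "finite {e. \<exists>t w s. g y (t, w, s) ~= 0 \<and> wdeg d w = e}" if y: "y \<in> S" for y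
 proof -
  let ?G = "\<lambda>q :: (int \<times> (('i, 'k) preproj_elt set => 'k)) \<times> 'i path. cN - (fst (fst q) + wdeg d (fst (snd (snd q))))"
  have "{e. \<exists>t w s. g y (t, w, s) ~= 0 \<and> wdeg d w = e} \<subseteq> ?G ` {q. y q ~= 0}"
  proof clarify
   fix t w s assume "g y (t, w, s) ~= 0"
   from part[OF y this] obtain u m t' x s' where "part t (cN - wdeg d w) y ((u, m), (t', x, s')) ~= 0"
    by (auto simp: fun_eq_iff fun_app)
   hence "y ((u, m), (t', x, s')) ~= 0" "u + wdeg d x = cN - wdeg d w" by (auto simp: part_apply split: if_splits)
   thus "wdeg d w \<in> ?G ` {q. y q ~= 0}" by (intro image_eqI[of _ _ "((u, m), (t', x, s'))"]) auto
  qed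
  moreover have "finite {q. y q ~= 0}" using lifts_fin_supp[OF SL(1)[OF y]] by (simp add: fin_supp_def)
  ultimately show ?thesis using finite_subset by blast
 qed
 have basis: "g (amul (basis_path p) y) = path_act p (g y)" if y: "y \<in> S" and p: "is_path C p" for p y
 proof (rule ext, clarify)
  fix t w s
  obtain a u b where p': "p = (a, u, b)" by (cases p)
  show "g (amul (basis_path p) y) (t, w, s) = path_act p (g y) (t, w, s)"
  proof (cases "s = j \<and> is_path C (t, w, s)")
   case True
   hence q: "is_path C (j, fl w, t)" using fl_path by blast
   have "is_path C (b, fl u, a)" using p fl_path[of a u b] by (simp add: p')
   hence "is_path C (b, fl u @ w, j)" if "t = a" unfolding is_path_append using True that by blast
   thus ?thesis
    using True q p unfolding g amul_amul[OF basis_PA[OF q] basis_PA[OF p] SL(1)[OF y]]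
    by (auto simp: p' path_act_apply g basis_mult_basis fl_def[symmetric] fl_app fl_fl amul_zero lin)
  next
   case False
   have "\<not> (t = a \<and> s = j \<and> is_path C (b, fl u @ w, j))"
   proof
    assume A: "t = a \<and> s = j \<and> is_path C (b, fl u @ w, j)"
    then obtain x where x: "is_path C (b, fl u, x)" "is_path C (x, w, j)" using is_path_append by metis
    moreover have "is_path C (b, fl u, a)" using p fl_path[of a u b] by (simp add: p')
    ultimately have "x = a" using is_path_src_unique by metis
    thus False using A x False by blast
   qed
   thus ?thesis using False by (auto simp: g path_act_apply p' fl_def[symmetric])
  qed
 qed
 have mul: "g (amul x y) = act x (g y)" if y: "y \<in> S" and x: "x \<in> carrier PA" for x y
  using x
 proof (induction rule: PA_induct)
  case zero
  show "g (amul 0 y) = act 0 (g y)" by (simp add: amul_zero g0 act_zero)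
 next
  case (scale_basis c p z)
  show "g (amul (sc c (basis_path p) + z) y) = act (sc c (basis_path p) + z) (g y)"
   using scale_basis y
   by (simp add: amul_add amul_scale add scale basis act_add act_scale act_basis fin_supp_scale basis_fin_supp PA_fin_supp)
 qed
 have val: "g y (j, [], j) = L y" if y: "y \<in> S" for y
 proof -
  have p: "is_path C (j, [], j)" by simp
  have e: "amul (basis_path (j, [], j)) y \<in> S" by (rule SL(4)[OF idem_PA y])
  have "L (amul (basis_path (j, [], j)) y) = L (part j cN (amul (basis_path (j, [], j)) y))" by (rule LL(4)[OF e, symmetric])
  also have "... = L (part j cN y)"
   using part_amul_basis(1)[OF p SL(1)[OF y], of cN] idem_part[OF SL(1)[OF y], of j cN] by simp
  also have "... = L y" by (rule LL(4)[OF y])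
  finally show ?thesis by (simp add: g fl_def)
 qed
 have "hom_lift S g"
  unfolding hom_lift_def
 proof (intro conjI ballI allI impI)
  show "g y \<in> ker_fun j l" if "y \<in> S" for y
  proof -
   have "s = j" if "g y (t, w, s) ~= 0" for t w s using that by (auto simp: g split: if_splits)
   thus ?thesis unfolding ker_fun_def using D right fin that by blast
  qed
 qed (use add mul deg in blast)+
 thus thesis using that NKz val by blast
qed

section \<open>Extensions as functions on paths\<close>

definition ext_ker :: "('i path => 'k) set" where
 "ext_ker = right_ker i j (u0 + int (k * d i) + int (l * d j)) k \<inter> left_ker i j (u0 + int (k * d i) + int (l * d j)) l"

lemma ext_ker_subspace: "fv.subspace ext_ker"
 unfolding ext_ker_def by (intro fv.subspace_inter right_ker_subspace left_ker_subspace)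

text \<open>The generator of the free module that belongs to the module element \<open>b\<close>,
  times the idempotent at \<open>j\<close>. Its augmentation is \<open>b\<close>, so its product
  with \<open>epsN\<close> is a syzygy, because \<open>b\<close> is killed by
  \<open>epsN\<close>.\<close>

definition gen_lift :: "('i path => 'k) => ('i, 'k) lift" where
 "gen_lift b = (\<lambda>q. if q = ((cM, from_fun i k b), (j, [], j)) then 1 else 0)"

text \<open>Degree \<open>cM\<close> of the shifted module is path degree
  \<open>k * d i + u0 - cM\<close>, the one prescribed in \<open>ext_ker\<close>.\<close>

lemma ext_ker_fun:
 assumes b: "b \<in> ext_ker"
 shows "b \<in> ker_fun i k" "from_fun i k b \<in> mod_part MM cM" "thM (from_fun i k b) = b"
proof -
 have h: "b \<in> Hom i j (u0 + int (k * d i) + int (l * d j))" and z: "reps i k b = 0"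
  using b by (auto simp: ext_ker_def right_ker_def)
 have nz: "t = j \<and> s = i \<and> wdeg d w = u0 + int (k * d i) + int (l * d j)" if "b (t, w, s) ~= 0" for t w s
  using homog_supp[OF h] that by blast
 have "{e. \<exists>t w s. b (t, w, s) ~= 0 \<and> wdeg d w = e} \<subseteq> {u0 + int (k * d i) + int (l * d j)}" using nz by blast
 hence "finite {e. \<exists>t w s. b (t, w, s) ~= 0 \<and> wdeg d w = e}" by (rule finite_subset) simp
 thus bk: "b \<in> ker_fun i k" unfolding ker_fun_def using homog_D[OF h] z nz by blast
 show t: "thM (from_fun i k b) = b" by (rule to_from_fun[OF k bk])
 show "from_fun i k b \<in> mod_part MM cM"
  unfolding MM_simps KK_part[OF k] t using nz from_fun_carrier[OF k bk] by auto
qed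

lemma gen_lift:
 assumes b: "b \<in> ext_ker"
 shows "gen_lift b \<in> lifts" "aug (gen_lift b) = b" "part j cM (gen_lift b) = gen_lift b"
  "amul epsN (gen_lift b) \<in> OY"
proof -
 have "is_path C (j, [], j)" by simp
 from single_lifts[OF this ext_ker_fun(2)[OF b]] show li: "gen_lift b \<in> lifts" unfolding gen_lift_def .
 have h: "b \<in> Hom i j (u0 + int (k * d i) + int (l * d j))" and z: "leps j l b = 0"
  using b by (auto simp: ext_ker_def left_ker_def)
 have "path_act (j, [], j) b = b"
  by (auto simp: fun_eq_iff path_act_apply homog_supp[OF h])
 thus a: "aug (gen_lift b) = b" unfolding gen_lift_def aug_single ext_ker_fun(3)[OF b] .
 show "part j cM (gen_lift b) = gen_lift b" by (auto simp: fun_eq_iff part_def gen_lift_def)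
 show "amul epsN (gen_lift b) \<in> OY"
  using aug_amul[OF epsN_PA li] amul_lifts[OF epsN_PA li] by (simp add: OY_def a act_eps z)
qed

lemma part_eps: "y \<in> lifts ==> part j cN (amul epsN y) = amul epsN (part j cM y)"
 using part_amul_basis(1)[of j "eps l j" j y cN] by (simp add: is_path_replicate eps_path_def algebra_simps)

text \<open>Any augmentation is killed by \<open>reps i k\<close>, being in the generic kernel at
  \<open>i\<close>; the syzygy \<open>amul epsN y\<close> supplies the kernel condition on the
  left.\<close>

lemma aug_good:
 assumes y: "y \<in> lifts" and g: "part j cM y = y" and z: "aug (amul epsN y) = 0"
 shows "aug y \<in> ext_ker"
proof -
 have ak: "aug y \<in> ker_fun i k" by (rule aug_ker_fun[OF y])
 have nz: "t = j \<and> wdeg d w = int (k * d i) + u0 - cM" if "aug y (t, w, s) ~= 0" for t w s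
  using that aug_part[OF y, of j cM t w s] unfolding g by (auto split: if_splits)
 have h: "aug y \<in> Hom i j (u0 + int (k * d i) + int (l * d j))"
 proof (rule homogI[OF ker_funD(1)[OF ak]])
  fix t w s assume A: "t ~= j \<or> s ~= i \<or> wdeg d w ~= u0 + int (k * d i) + int (l * d j)"
  show "aug y (t, w, s) = 0"
  proof (rule ccontr)
   assume "aug y (t, w, s) ~= 0"
   from nz[OF this] ker_funD(2)[OF ak this] A show False by auto
  qed
 qed
 have "leps j l (aug y) = 0" using z by (simp add: aug_amul[OF epsN_PA y] act_eps)
 thus ?thesis using h ker_funD(3)[OF ak] by (simp add: ext_ker_def left_ker_def right_ker_def)
qed

text \<open>On the finite support of \<open>x\<close>, a function in \<open>D\<close> is a sum of
  homogeneous ones with target \<open>j\<close>. By \<open>left_pow_onto\<close> these are images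
  under \<open>leps j l\<close>, so their pairing with \<open>x\<close> is a pairing of elements of
  \<open>D\<close> with \<open>epsN \<cdot> x\<close>, which vanishes.\<close>

lemma left_torsion_free:
 assumes P: "mesh_table j N P" and x: "x \<in> carrier PA" and tgt: "\<And>p. x p ~= 0 ==> fst p = j"
  and e: "epsN \<cdot> x \<in> II"
 shows "x \<in> II"
proof -
 have "pair lam x = 0" if lam: "lam \<in> D" for lam
 proof -
  define h where "h = (\<lambda>(s, v). restr d (\<lambda>t c e s'. t = j \<and> s' = s \<and> e = v) lam)"
  define T where "T = (\<lambda>p. (snd (snd p), wdeg d (fst (snd p)))) ` {p. x p ~= 0}"
  have fin: "finite {p. x p ~= 0}" using PA_fin_supp[OF x] by (simp add: fin_supp_def)
  hence finT: "finite T" by (simp add: T_def)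
  have "x p * lam p = x p * (\<Sum>q\<in>T. h q) p" if nz: "x p ~= 0" for p
  proof -
   obtain t w s where p: "p = (t, w, s)" by (cases p)
   have "t = j" using tgt[OF nz] p by simp
   have "(\<Sum>q\<in>T. h q) p = (\<Sum>q\<in>T. if q = (s, wdeg d w) then lam p else 0)"
    unfolding sum_fun_apply by (intro sum.cong refl) (auto simp: h_def restr_def p \<open>t = j\<close> split: prod.splits)
   also have "... = lam p"
   proof -
    have "(s, wdeg d w) \<in> T" unfolding T_def by (rule image_eqI[of _ _ p]) (use nz in \<open>auto simp: p\<close>)
    thus ?thesis using finT by simp
   qed
   finally show ?thesis by simp
  qed
  hence "pair lam x = pair (\<Sum>q\<in>T. h q) x" unfolding pair_def by (intro sum.cong) auto
  also have "... = (\<Sum>q\<in>T. pair (h q) x)" by (rule pair_sum_left)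
  also have "... = 0"
  proof (rule sum.neutral, clarify)
   fix s v
   have "h (s, v) \<in> Hom s j v"
    unfolding h_def prod.case by (rule homogI[OF restr_D[OF lam]]) (auto simp: restr_def)
   from left_pow_onto[OF P this, of l] obtain m where m: "m \<in> Hom s j (v + 2 * int l * int (d j))" "leps j l m = h (s, v)"
    by blast
   have "left_path (eps_path j l) m = leps j l m"
   proof (rule ext, clarify)
    fix t w s
    show "left_path (eps_path j l) m (t, w, s) = leps j l m (t, w, s)"
     using l left_op_pow_off[of t j l m w s] by (cases "t = j") (auto simp: left_path_def eps_path_def left_op_pow_at)
   qed
   hence "pair (h (s, v)) x = pair m (epsN \<cdot> x)"
    using pair_left_mult[OF x eps_path_path, of m j l] m(2) by simp
   also have "... = 0" by (rule D_annihilates_II[OF homog_D[OF m(1)] e])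
   finally show "pair (h (s, v)) x = 0" .
  qed
  finally show ?thesis .
 qed
 thus ?thesis using II_iff[OF x] by blast
qed

lemma left_torsion_free_lift:
 assumes P: "mesh_table j N P" and y: "y \<in> lifts" and g: "part j cM y = y" and e: "amul epsN y \<in> NK"
 shows "y \<in> NK"
 unfolding NK_def
proof (intro CollectI conjI allI y)
 fix z
 show "slice y z \<in> II"
 proof (rule left_torsion_free[OF P slice_PA[OF y]])
  show "epsN \<cdot> slice y z \<in> II" using e unfolding slice_amul[symmetric] NK_def by blast
  show "fst p = j" if "slice y z p ~= 0" for p
  proof -
   have "y (z, p) ~= 0" using that by (simp add: slice_def)
   hence "part j cM y (z, p) ~= 0" by (simp only: g not_False_eq_True)
   thus ?thesis by (cases z, cases p) (auto simp: part_def split: if_splits)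
  qed
 qed
qed

abbreviation HH where "HH S \<equiv> hom_space AA (sub_FF S) NN"

lemma HH_simps: "carrier (HH S) = graded_homs AA (sub_FF S) NN"
 "f \<oplus>\<^bsub>HH S\<^esub> f' = (\<lambda>X\<in>proj ` S. f X \<oplus>\<^bsub>NN\<^esub> f' X)"
 "c \<odot>\<^bsub>HH S\<^esub> f = (\<lambda>X\<in>proj ` S. cls (sc c \<one>\<^bsub>PA\<^esub>) \<odot>\<^bsub>NN\<^esub> f X)"
 "\<zero>\<^bsub>HH S\<^esub> = (\<lambda>X\<in>proj ` S. \<zero>\<^bsub>NN\<^esub>)"
 by (simp_all add: hom_space_def AA_base sub_FF_simps)

lemma HH_mem:
 assumes S: "lift_closed S" and f: "f \<in> carrier (HH S)"
 shows "f \<in> proj ` S \<rightarrow>\<^sub>E carrier NN" "hom_lift S (\<lambda>y. thN (f (proj y)))" "y \<in> S ==> f (proj y) \<in> carrier NN"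
 using f graded_homs_iff[OF S, of f] by (auto simp: HH_simps PiE_iff)

lemma HH_memI:
 assumes S: "lift_closed S" and f: "f \<in> extensional (proj ` S)" and c: "\<And>y. y \<in> S ==> f (proj y) \<in> carrier NN"
  and g: "\<And>y. y \<in> S ==> thN (f (proj y)) = g y" and h: "hom_lift S g"
 shows "f \<in> carrier (HH S)"
proof -
 note SL = lift_closedD[OF S]
 have "hom_lift S (\<lambda>y. thN (f (proj y)))"
  using h unfolding hom_lift_def using g SL(4) fv.subspace_add[OF SL(3)] by simp
 moreover have "f \<in> proj ` S \<rightarrow>\<^sub>E carrier NN" using f c by (auto simp: PiE_iff)
 ultimately show ?thesis using graded_homs_iff[OF S, of f] by (simp add: HH_simps)
qed

lemma HH_ops:
 assumes S: "lift_closed S" and f: "f \<in> carrier (HH S)"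
 shows "f' \<in> carrier (HH S) ==> f \<oplus>\<^bsub>HH S\<^esub> f' \<in> carrier (HH S)"
  and "f' \<in> carrier (HH S) ==> y \<in> S ==> thN ((f \<oplus>\<^bsub>HH S\<^esub> f') (proj y)) = thN (f (proj y)) + thN (f' (proj y))"
  and "c \<odot>\<^bsub>HH S\<^esub> f \<in> carrier (HH S)"
  and "y \<in> S ==> thN ((c \<odot>\<^bsub>HH S\<^esub> f) (proj y)) = sc c (thN (f (proj y)))"
proof -
 note SL = lift_closedD[OF S] and F = HH_mem[OF S f]
 show a: "thN ((f \<oplus>\<^bsub>HH S\<^esub> f') (proj y)) = thN (f (proj y)) + thN (f' (proj y))"
  if "f' \<in> carrier (HH S)" "y \<in> S" for f' y
  using that KK_th(2)[OF l F(3) HH_mem(3)[OF S]] by (simp add: HH_simps(2))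
 show m: "thN ((c \<odot>\<^bsub>HH S\<^esub> f) (proj y)) = sc c (thN (f (proj y)))" if "y \<in> S" for c y
  using that KK_th(4)[OF l F(3) PA_scale[OF PA.one_closed]] act_one[OF to_fun_ker_fun[OF l F(3)]] by (simp add: HH_simps(3))
 show "f \<oplus>\<^bsub>HH S\<^esub> f' \<in> carrier (HH S)" if f': "f' \<in> carrier (HH S)"
 proof (rule HH_memI[OF S, where g = "\<lambda>y. thN (f (proj y)) + thN (f' (proj y))"])
  show "f \<oplus>\<^bsub>HH S\<^esub> f' \<in> extensional (proj ` S)" by (simp add: HH_simps(2))
  show "(f \<oplus>\<^bsub>HH S\<^esub> f') (proj y) \<in> carrier NN" if "y \<in> S" for y
   using that KK_th(1)[OF l F(3) HH_mem(3)[OF S f']] by (simp add: HH_simps(2))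
  show "thN ((f \<oplus>\<^bsub>HH S\<^esub> f') (proj y)) = thN (f (proj y)) + thN (f' (proj y))" if "y \<in> S" for y by (rule a[OF f' that])
  note G = hom_liftD[OF F(2)] and G' = hom_liftD[OF HH_mem(2)[OF S f']]
  show "hom_lift S (\<lambda>y. thN (f (proj y)) + thN (f' (proj y)))"
   unfolding hom_lift_def
  proof (intro conjI ballI allI impI)
   show "thN (f (proj y)) + thN (f' (proj y)) \<in> ker_fun j l" if "y \<in> S" for y
    by (intro fv.subspace_add[OF ker_fun_subspace] G(1) G'(1) that)
   show "thN (f (proj (y + y'))) + thN (f' (proj (y + y'))) = thN (f (proj y)) + thN (f' (proj y)) + (thN (f (proj y')) + thN (f' (proj y')))"
    if "y \<in> S" "y' \<in> S" for y y' using G(2)[OF that] G'(2)[OF that] by (simp add: algebra_simps)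
   show "thN (f (proj (amul x y))) + thN (f' (proj (amul x y))) = act x (thN (f (proj y)) + thN (f' (proj y)))"
    if "x \<in> carrier PA" "y \<in> S" for x y
    using G(3)[OF that] G'(3)[OF that] by (simp add: fvv.linear_add[OF act_right_linear])
   fix y v t w s assume "y \<in> S" "homogeneous v y" "(thN (f (proj y)) + thN (f' (proj y))) (t, w, s) ~= 0"
   moreover from this(3) have "thN (f (proj y)) (t, w, s) ~= 0 \<or> thN (f' (proj y)) (t, w, s) ~= 0" by (auto simp: fun_app)
   ultimately show "wdeg d w = int (l * d j) - v" using G(4) G'(4) by blast
  qed
 qed
 show "c \<odot>\<^bsub>HH S\<^esub> f \<in> carrier (HH S)"
 proof (rule HH_memI[OF S, where g = "\<lambda>y. sc c (thN (f (proj y)))"])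
  show "c \<odot>\<^bsub>HH S\<^esub> f \<in> extensional (proj ` S)" by (simp add: HH_simps(3))
  show "(c \<odot>\<^bsub>HH S\<^esub> f) (proj y) \<in> carrier NN" if "y \<in> S" for y
   using that KK_th(3)[OF l F(3) PA_scale[OF PA.one_closed]] by (simp add: HH_simps(3))
  show "thN ((c \<odot>\<^bsub>HH S\<^esub> f) (proj y)) = sc c (thN (f (proj y)))" if "y \<in> S" for y by (rule m[OF that])
  note G = hom_liftD[OF F(2)]
  show "hom_lift S (\<lambda>y. sc c (thN (f (proj y))))"
   unfolding hom_lift_def
  proof (intro conjI ballI allI impI)
   show "sc c (thN (f (proj y))) \<in> ker_fun j l" if "y \<in> S" for y
    by (intro fv.subspace_scale[OF ker_fun_subspace] G(1) that)
   show "sc c (thN (f (proj (y + y')))) = sc c (thN (f (proj y))) + sc c (thN (f (proj y')))"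
    if "y \<in> S" "y' \<in> S" for y y' using G(2)[OF that] by (simp add: fv.scale_right_distrib)
   show "sc c (thN (f (proj (amul x y)))) = act x (sc c (thN (f (proj y))))" if "x \<in> carrier PA" "y \<in> S" for x y
    using G(3)[OF that] by (simp add: fvv.linear_scale[OF act_right_linear])
   fix y v t w s assume "y \<in> S" "homogeneous v y" "sc c (thN (f (proj y))) (t, w, s) ~= 0"
   moreover from this(3) have "thN (f (proj y)) (t, w, s) ~= 0" by (auto simp: fun_app)
   ultimately show "wdeg d w = int (l * d j) - v" using G(4) by blast
  qed
 qed
qed

lemma HH_eqI:
 assumes S: "lift_closed S" and "f \<in> carrier (HH S)" "f' \<in> carrier (HH S)"
  and eq: "\<And>y. y \<in> S ==> thN (f (proj y)) = thN (f' (proj y))"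
 shows "f = f'"
proof (rule extensionalityI[of _ "proj ` S"])
 show "f \<in> extensional (proj ` S)" "f' \<in> extensional (proj ` S)" using HH_mem(1)[OF S] assms(2,3) by (auto simp: PiE_def)
 show "f X = f' X" if "X \<in> proj ` S" for X
  using that to_fun_inj[OF l HH_mem(3)[OF S assms(2)] HH_mem(3)[OF S assms(3)] eq] by blast
qed

lemma HH_zero:
 assumes S: "lift_closed S"
 shows "\<zero>\<^bsub>HH S\<^esub> \<in> carrier (HH S)" "y \<in> S ==> thN (\<zero>\<^bsub>HH S\<^esub> (proj y)) = 0"
proof -
 show t: "thN (\<zero>\<^bsub>HH S\<^esub> (proj y)) = 0" if "y \<in> S" for y using that KK_zero(2)[OF l] by (simp add: HH_simps(4))
 show "\<zero>\<^bsub>HH S\<^esub> \<in> carrier (HH S)"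
  by (rule HH_memI[OF S, where g = "\<lambda>y. 0"])
    (auto simp: t, auto simp: HH_simps(4) KK_zero[OF l] hom_lift_def fv.subspace_0[OF ker_fun_subspace] fvv.linear_0[OF act_right_linear] fun_app)
qed

lemma HH_abelian:
 assumes S: "lift_closed S"
 shows "abelian_group (HH S)"
proof (rule abelian_groupI)
 note O = HH_ops[OF S] and Z = HH_zero[OF S]
 note eqI = HH_eqI[OF S]
 show "f \<oplus>\<^bsub>HH S\<^esub> f' \<oplus>\<^bsub>HH S\<^esub> f'' = f \<oplus>\<^bsub>HH S\<^esub> (f' \<oplus>\<^bsub>HH S\<^esub> f'')"
  if "f \<in> carrier (HH S)" "f' \<in> carrier (HH S)" "f'' \<in> carrier (HH S)" for f f' f''
  by (rule eqI) (use that in \<open>simp_all add: O add.assoc del: HH_simps\<close>)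
 show "f \<oplus>\<^bsub>HH S\<^esub> f' = f' \<oplus>\<^bsub>HH S\<^esub> f" if "f \<in> carrier (HH S)" "f' \<in> carrier (HH S)" for f f'
  by (rule eqI) (use that in \<open>simp_all add: O add.commute\<close>)
 show "\<zero>\<^bsub>HH S\<^esub> \<oplus>\<^bsub>HH S\<^esub> f = f" if "f \<in> carrier (HH S)" for f
  by (rule eqI) (use that in \<open>simp_all add: O Z\<close>)
 show "\<exists>f'\<in>carrier (HH S). f' \<oplus>\<^bsub>HH S\<^esub> f = \<zero>\<^bsub>HH S\<^esub>" if "f \<in> carrier (HH S)" for f
 proof
  show m: "(-1) \<odot>\<^bsub>HH S\<^esub> f \<in> carrier (HH S)" by (rule O(3)[OF that])
  show "(-1) \<odot>\<^bsub>HH S\<^esub> f \<oplus>\<^bsub>HH S\<^esub> f = \<zero>\<^bsub>HH S\<^esub>"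
   by (rule eqI) (use that m in \<open>simp_all add: O Z fun_eq_iff fun_app\<close>)
 qed
qed (use HH_ops[OF S] HH_zero[OF S] in auto)

lemma NK_thN:
 assumes S: "lift_closed S" and f: "f \<in> carrier (HH S)" and y: "y \<in> NK"
 shows "thN (f (proj y)) = 0"
proof -
 have p: "proj y = proj 0" using NK_diff[OF NK_lifts[OF y] fv.subspace_0[OF lifts_subspace]] y by simp
 have "0 \<in> S" by (rule fv.subspace_0[OF lift_closedD(3)[OF S]])
 from hom_lift_scale[OF S HH_mem(2)[OF S f] this, of 0] have "thN (f (proj 0)) = 0"
  by (simp add: fv.scale_zero_left)
 thus ?thesis by (simp add: p)
qed

text \<open>A homomorphism from the syzygy is a functional that kills \<open>epsN\<close> times
  syzygies. It extends to the free module iff it also kills \<open>epsN\<close> times those lifts in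
  component \<open>cM\<close> at \<open>j\<close> for which this product happens to be a syzygy.
  Modulo \<open>epsN\<close> times syzygies these products are spanned by the \<open>E s\<close>,
  one for each basis element of \<open>ext_ker\<close>. So the values \<open>\<psi> f s\<close> are
  coordinates of the class of \<open>f\<close>.\<close>

lemma ext1_dim:
 assumes P: "mesh_table j N P" and fd: "fin_dim ext_ker"
 shows "has_dim (ext1 AA (KK i k) NN u0) (fv.dim ext_ker)"
proof -
 let ?n = "fv.dim ext_ker"
 obtain b :: "nat => 'i path => 'k" and h where b: "\<And>s. s < ?n ==> b s \<in> ext_ker" and h: "\<And>s. functional (h s)"
  "\<And>s t. s < ?n ==> t < ?n ==> h s (b t) = (if s = t then 1 else 0)" and sp: "ext_ker = fv.span (b ` {..<?n})"
  using fin_dim_coordinates[OF fd ext_ker_subspace] by metis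
 let ?R = "(\<lambda>f. restrict f (carrier (sub_FF OY))) ` graded_homs AA FF NN"
 define E where "E s = amul epsN (gen_lift (b s))" for s
 have E: "E s \<in> OY" if "s < ?n" for s unfolding E_def by (rule gen_lift(4)[OF b[OF that]])
 define \<psi> where "\<psi> f s = (if s < ?n then thN (f (proj (E s))) (j, [], j) else 0)" for f s
 note O = HH_ops[OF lift_closed_OY]
 have partN: "part j cN y = y" if "y \<in> lifts" "y = amul epsN y'" "y' \<in> lifts" "part j cM y' = y'" for y y'
  using part_eps[OF that(3)] that by simp
 \<comment> \<open>\<open>y\<close> and the combination of the \<open>gen_lift (b s)\<close> have
   the same augmentation, so they differ by a syzygy, and \<open>L\<close> kills \<open>epsN\<close>
   times it.\<close>
 have Lsum: "L (amul epsN y) = (\<Sum>s<?n. a s * L (E s))"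
  if L: "admissible OY L" and y: "y \<in> lifts" and a: "aug y = (\<Sum>s<?n. sc (a s) (b s))" for L y a
 proof -
  note lin = admissibleD(1)[OF L]
  let ?s = "\<Sum>s<?n. sc (a s) (gen_lift (b s))"
  have gl: "sc (a s) (gen_lift (b s)) \<in> lifts" if "s < ?n" for s
   using gen_lift(1)[OF b[OF that]] fv.subspace_scale[OF lifts_subspace] by blast
  have "?s \<in> lifts \<and> aug ?s = (\<Sum>s<?n. sc (a s) (b s))"
  proof -
   have "(\<Sum>s<m. sc (a s) (gen_lift (b s))) \<in> lifts \<and> aug (\<Sum>s<m. sc (a s) (gen_lift (b s))) = (\<Sum>s<m. sc (a s) (b s))"
    if "m <= ?n" for m
    using that
   proof (induction m)
    case 0
    thus ?case by (simp add: aug_zero fv.subspace_0[OF lifts_subspace])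
   next
    case (Suc m)
    thus ?case using gl[of m] gen_lift(2)[OF b[of m]]
     by (simp add: aug_add aug_scale fv.subspace_add[OF lifts_subspace])
   qed
   thus ?thesis by blast
  qed
  hence "y - ?s \<in> OY" using y a fv.subspace_diff[OF lifts_subspace] by (simp add: OY_def aug_diff)
  from admissibleD(3)[OF L this] have "L (amul epsN y) = L (amul epsN ?s)"
   by (simp add: amul_diff fvk.linear_diff[OF lin])
  also have "amul epsN ?s = (\<Sum>s<?n. sc (a s) (E s))"
  proof -
   have "amul epsN (\<Sum>s\<in>T. sc (a s) (gen_lift (b s))) = (\<Sum>s\<in>T. sc (a s) (E s))" if "finite T" for T
    using that by (induction T rule: finite_induct) (auto simp: amul_zero amul_add amul_scale E_def)
   thus ?thesis by simp
  qed
  finally show ?thesis by (simp add: fvk.linear_sum[OF lin] fvk.linear_scale[OF lin])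
 qed
 have coef: "\<exists>a. x = (\<Sum>s<?n. sc (a s) (b s))" if "x \<in> ext_ker" for x
 proof -
  have "x \<in> fv.span (b ` {..<?n})" using that sp by simp
  thus ?thesis
  proof (induction rule: fv.span_induct_alt)
   case base
   show ?case by (rule exI[of _ "\<lambda>_. 0"]) (simp add: fv.scale_zero_left)
  next
   case (step c x y)
   then obtain a m where am: "y = (\<Sum>s<?n. sc (a s) (b s))" "m < ?n" "x = b m" by blast
   have "sc c x + y = (\<Sum>s<?n. sc ((if s = m then c else 0) + a s) (b s))"
   proof -
    have "(\<Sum>s<?n. sc (if s = m then c else 0) (b s)) = (\<Sum>s<?n. if s = m then sc c (b s) else 0)"
     by (intro sum.cong) (auto simp: fv.scale_zero_left)
    thus ?thesis using am by (simp add: fv.scale_left_distrib sum.distrib)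
   qed
   thus ?case by (rule exI[of _ "\<lambda>s. (if s = m then c else 0) + a s"])
  qed
 qed
 \<comment> \<open>A functional that comes from the free module vanishes on \<open>V\<close>, since
   at the trivial path \<open>epsN\<close> acts by 0 on the generic kernel.\<close>
 define V where "V = {amul epsN y |y. y \<in> lifts \<and> part j cM y = y}"
 have V: "fv.subspace V"
 proof -
  have "fun_linear (amul epsN)" by (rule fun_linearI) (simp_all add: amul_add amul_scale)
  moreover have "fv.subspace (lifts \<inter> {y. part j cM y = y})"
   by (intro fv.subspace_inter lifts_subspace fv.subspaceI)
     (simp_all add: fvv.linear_0[OF part_linear] fvv.linear_add[OF part_linear] fvv.linear_scale[OF part_linear])
  moreover have "V = amul epsN ` (lifts \<inter> {y. part j cM y = y})" by (auto simp: V_def)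
  ultimately show ?thesis by (simp only: fvv.linear_subspace_image)
 qed
 have ker: "?R = {f \<in> carrier (HH OY). \<psi> f = 0}"
 proof (intro equalityI subsetI)
  fix f assume "f \<in> ?R"
  then obtain F where F: "F \<in> carrier (HH lifts)" "f = restrict F (proj ` OY)"
   unfolding graded_homs_FF HH_simps sub_FF_simps by blast
  have fF: "f (proj y) = F (proj y)" if "y \<in> OY" for y using F(2) that by simp
  have l2: "y \<in> lifts" if "y \<in> OY" for y using that by (simp add: OY_def)
  have f: "f \<in> carrier (HH OY)"
  proof (rule HH_memI[OF lift_closed_OY, where g = "\<lambda>y. thN (F (proj y))"])
   show "hom_lift OY (\<lambda>y. thN (F (proj y)))"
    using HH_mem(2)[OF lift_closed_lifts F(1)] l2 unfolding hom_lift_def by blast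
   show "f \<in> extensional (proj ` OY)" by (simp add: F(2))
  qed (use fF HH_mem(3)[OF lift_closed_lifts F(1)] l2 in auto)
  have "\<psi> f s = 0" for s
  proof (cases "s < ?n")
   case True
   have "thN (F (proj (E s))) = act epsN (thN (F (proj (gen_lift (b s)))))"
    unfolding E_def by (rule hom_liftD(3)[OF HH_mem(2)[OF lift_closed_lifts F(1)] epsN_PA gen_lift(1)[OF b[OF True]]])
   thus ?thesis
    using True ker_fun_eps[OF hom_liftD(1)[OF HH_mem(2)[OF lift_closed_lifts F(1)] gen_lift(1)[OF b[OF True]]]] fF[OF E[OF True]]
    by (simp add: \<psi>_def)
  qed (simp add: \<psi>_def)
  hence "\<psi> f = 0" by (auto simp: fun_eq_iff fun_app)
  with f show "f \<in> {f \<in> carrier (HH OY). \<psi> f = 0}" by blast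
 next
  fix f assume "f \<in> {f \<in> carrier (HH OY). \<psi> f = 0}"
  hence f: "f \<in> carrier (HH OY)" and z: "\<And>s. s < ?n ==> thN (f (proj (E s))) (j, [], j) = 0"
   by (auto simp: \<psi>_def fun_eq_iff fun_app split: if_splits)
  obtain L where L: "admissible OY L" "\<And>y. y \<in> OY ==> L y = thN (f (proj y)) (j, [], j)"
   using hom_lift_functional[OF lift_closed_OY HH_mem(2)[OF lift_closed_OY f] NK_thN[OF lift_closed_OY f]] by metis
  note lin = admissibleD(1)[OF L(1)]
  define U where "U = {y \<in> OY. part j cN y = y}"
  have U: "fv.subspace U"
   by (rule fv.subspaceI)
     (auto simp: U_def fvv.linear_0[OF part_linear] fvv.linear_add[OF part_linear] fvv.linear_scale[OF part_linear]
      intro: fv.subspace_0[OF OY_subspace] fv.subspace_add[OF OY_subspace] fv.subspace_scale[OF OY_subspace])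
  \<comment> \<open>The extension is to be \<open>L\<close> on the syzygy and 0 on \<open>V\<close>.
    On the intersection the two agree because the coordinates of \<open>f\<close> are 0.\<close>
  obtain L' where L': "functional L'" "\<And>y. y \<in> U ==> L' y = L y" "\<And>y. y \<in> V ==> L' y = 0"
  proof (rule functional_extend_zero[OF U V, of L])
   show "L x = 0" if xU: "x \<in> U" and xV: "x \<in> V" for x
   proof -
    obtain y where y: "x = amul epsN y" "y \<in> lifts" "part j cM y = y" using xV unfolding V_def by blast
    have "aug (amul epsN y) = 0" using xU by (simp add: U_def OY_def y(1))
    hence "aug y \<in> ext_ker" by (rule aug_good[OF y(2,3)])
    then obtain a where "aug y = (\<Sum>s<?n. sc (a s) (b s))" using coef by blast
    hence "L x = (\<Sum>s<?n. a s * L (E s))" using Lsum[OF L(1) y(2)] y(1) by simp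
    also have "... = 0" using L(2)[OF E] z by simp
    finally show ?thesis .
   qed
  qed (auto simp: fvk.linear_add[OF lin] fvk.linear_scale[OF lin] intro: that)
  define M where "M y = L' (part j cN y)" for y
  have M: "functional M"
   unfolding M_def using Vector_Spaces.linear_compose[OF part_linear L'(1)] by (simp add: comp_def)
  have UU: "part j cN y \<in> U" if "y \<in> OY" for y
   unfolding U_def using lift_closedD(5)[OF lift_closed_OY that] by (simp add: part_part)
  have "admissible lifts M"
   unfolding admissible_def
  proof (intro conjI ballI M)
   show "M y = 0" if "y \<in> NK" for y
    unfolding M_def using L'(2)[OF UU[OF lift_closedD(2)[OF lift_closed_OY that]]] admissibleD(2)[OF L(1) part_NK[OF that]] by simp
   show "M (amul epsN y) = 0" if "y \<in> lifts" for y
    unfolding M_def part_eps[OF that]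
   proof (rule L'(3))
    show "amul epsN (part j cM y) \<in> V" unfolding V_def using part_lifts[OF that] part_part[of j cM j cM y] by auto
   qed
   show "M (part j cN y) = M y" for y by (simp add: M_def part_part)
  qed
  from lift_of_functional[OF lift_closed_lifts this] obtain g where g: "hom_lift lifts g" "\<And>y. y \<in> NK ==> g y = 0"
   "\<And>y. y \<in> lifts ==> g y (j, [], j) = M y" by metis
  obtain F where F: "F \<in> graded_homs AA (sub_FF lifts) NN" "\<And>y. y \<in> lifts ==> thN (F (proj y)) = g y"
   using hom_of_lift[OF lift_closed_lifts g(1,2)] by metis
  have gO: "hom_lift OY g" using g(1) unfolding hom_lift_def OY_def by blast
  have "f = restrict F (proj ` OY)"
  proof (rule extensionalityI[of _ "proj ` OY"])
   show "f \<in> extensional (proj ` OY)" using HH_mem(1)[OF lift_closed_OY f] by (simp add: PiE_def)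
   show "f X = restrict F (proj ` OY) X" if "X \<in> proj ` OY" for X
   proof -
    obtain y where y: "y \<in> OY" "X = proj y" using \<open>X \<in> proj ` OY\<close> by blast
    have "thN (f (proj y)) = g y"
    proof (rule hom_lift_determined[OF lift_closed_OY HH_mem(2)[OF lift_closed_OY f] gO _ y(1)])
     fix y assume y: "y \<in> OY"
     have "g y (j, [], j) = L' (part j cN y)" using g(3)[of y] y by (simp add: OY_def M_def)
     also have "... = L y" using L'(2)[OF UU[OF y]] admissibleD(4)[OF L(1) y] by simp
     finally show "thN (f (proj y)) (j, [], j) = g y (j, [], j)" using L(2)[OF y] by simp
    qed
    hence "thN (f (proj y)) = thN (F (proj y))" using F(2)[of y] y(1) by (simp add: OY_def)
    moreover have "F (proj y) \<in> carrier NN"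
     using HH_mem(3)[OF lift_closed_lifts, of F y] F(1) y(1) by (simp add: HH_simps OY_def)
    ultimately show ?thesis
     using to_fun_inj[OF l HH_mem(3)[OF lift_closed_OY f y(1)]] y by simp
   qed
  qed simp
  thus "f \<in> ?R" using F(1) unfolding graded_homs_FF sub_FF_simps by blast
 qed
 have surj: "\<exists>f\<in>carrier (HH OY). \<psi> f = v" if v: "\<And>s. s >= ?n ==> v s = 0" for v
 proof -
  \<comment> \<open>A functional on all functions with prescribed values \<open>v s\<close> on the
    basis of \<open>ext_ker\<close>; it is also applied to augmentations outside
    \<open>ext_ker\<close>.\<close>
  define hv where "hv x = (\<Sum>s<?n. v s * h s x)" for x
  have hv: "hv (x + y) = hv x + hv y" "hv (sc c x) = c * hv x" for x y c
   by (simp_all add: hv_def fvk.linear_add[OF h(1)] fvk.linear_scale[OF h(1)] algebra_simps sum.distrib sum_distrib_left)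
  have hvb: "hv (b s) = v s" if "s < ?n" for s
  proof -
   have "hv (b s) = (\<Sum>t<?n. if t = s then v s else 0)" unfolding hv_def by (intro sum.cong) (use h(2) that in auto)
   thus ?thesis using that by simp
  qed
  \<comment> \<open>Removes \<open>l\<close> loops at the left end of a word: a left inverse of
    multiplication by \<open>epsN\<close> on lifts.\<close>
  define strip where "strip y = (\<lambda>(z, (t, w, s)). if t = j then y (z, (j, eps l j @ w, s)) else 0)" for y :: "('i, 'k) lift"
  have strip_lin: "fun_linear strip" by (rule fun_linearI) (auto simp: strip_def fun_eq_iff fun_app)
  have strip: "strip (amul epsN y) = y" if y: "part j cM y = y" for y
  proof -
   have "strip (amul epsN y) (z, (t, w, s)) = y (z, (t, w, s))" for z t w s
   proof (cases "t = j")
    case True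
    have 1: "epsN (j, take n (eps l j @ w), p) * y (z, (p, drop n (eps l j @ w), s))
     = (if p = j then if n = l then y (z, (j, w, s)) else 0 else 0)" if "n <= length (eps l j @ w)" for n p
    proof (cases "n = l")
     case False
     hence "length (take n (eps l j @ w)) ~= length (eps l j)" using that by simp
     hence "take n (eps l j @ w) ~= eps l j" by metis
     thus ?thesis using False by (simp add: basis_path_def eps_path_def)
    qed (simp add: basis_path_def eps_path_def)
    have "strip (amul epsN y) (z, (t, w, s)) = (\<Sum>n\<le>length (eps l j @ w). \<Sum>p\<in>UNIV.
      epsN (j, take n (eps l j @ w), p) * y (z, (p, drop n (eps l j @ w), s)))"
     using True by (simp add: strip_def amul_def path_algebra_def slice_def)
    also have "... = (\<Sum>n\<le>length (eps l j @ w). \<Sum>p\<in>UNIV. if p = j then if n = l then y (z, (j, w, s)) else 0 else 0)"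
     by (intro sum.cong refl 1) simp
    finally show ?thesis using True by simp
   next
    case False
    hence "part j cM y (z, (t, w, s)) = 0" by (cases z) (simp add: part_apply)
    thus ?thesis using False unfolding y by (simp add: strip_def)
   qed
   thus ?thesis by (auto simp: fun_eq_iff)
  qed
  have stripV: "strip x \<in> lifts" if "x \<in> V" for x using that strip unfolding V_def by fastforce
  obtain L where L: "functional L" "\<And>x. x \<in> V ==> L x = hv (aug (strip x))" "\<And>y. y \<in> NK ==> L y = 0"
  proof (rule functional_extend_zero[OF V NK_subspace, of "\<lambda>x. hv (aug (strip x))"])
   show "hv (aug (strip (x + y))) = hv (aug (strip x)) + hv (aug (strip y))" if "x \<in> V" "y \<in> V" for x y
    using stripV[OF that(1)] stripV[OF that(2)] by (simp add: fvv.linear_add[OF strip_lin] aug_add hv)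
   show "hv (aug (strip (sc c x))) = c * hv (aug (strip x))" for c x
    by (simp add: fvv.linear_scale[OF strip_lin] aug_scale hv)
   \<comment> \<open>Torsion freeness: if \<open>epsN\<close> times \<open>y\<close> represents 0,
     then so does \<open>y\<close>, whose augmentation is therefore 0.\<close>
   show "hv (aug (strip x)) = 0" if xV: "x \<in> V" and xN: "x \<in> NK" for x
   proof -
    obtain y where y: "x = amul epsN y" "y \<in> lifts" "part j cM y = y" using xV unfolding V_def by blast
    have "y \<in> NK" using left_torsion_free_lift[OF P y(2,3)] xN y(1) by simp
    hence "aug (strip x) = 0" using strip[OF y(3)] y(1) aug_NK by simp
    thus ?thesis using hv(2)[of 0 0] by (simp add: fv.scale_zero_left)
   qed
  qed (rule that)
  define M where "M y = L (part j cN y)" for y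
  have M: "functional M"
   unfolding M_def using Vector_Spaces.linear_compose[OF part_linear L(1)] by (simp add: comp_def)
  have Meps: "M (amul epsN y) = hv (aug (part j cM y))" if y: "y \<in> lifts" for y
  proof -
   have p: "part j cM (part j cM y) = part j cM y" by (simp add: part_part)
   hence "amul epsN (part j cM y) \<in> V" unfolding V_def using part_lifts[OF y] by blast
   thus ?thesis unfolding M_def part_eps[OF y] using L(2) strip[OF p] by simp
  qed
  have "admissible OY M"
   unfolding admissible_def
  proof (intro conjI ballI M)
   show "M y = 0" if "y \<in> NK" for y unfolding M_def by (rule L(3)[OF part_NK[OF that]])
   show "M (amul epsN y) = 0" if "y \<in> OY" for y
    using Meps[of y] aug_part_zero[of y j cM] hv(2)[of 0 0] that by (simp add: OY_def fv.scale_zero_left)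
   show "M (part j cN y) = M y" for y by (simp add: M_def part_part)
  qed
  from lift_of_functional[OF lift_closed_OY this] obtain g where g: "hom_lift OY g" "\<And>y. y \<in> NK ==> g y = 0"
   "\<And>y. y \<in> OY ==> g y (j, [], j) = M y" by metis
  obtain f where f: "f \<in> graded_homs AA (sub_FF OY) NN" "\<And>y. y \<in> OY ==> thN (f (proj y)) = g y"
   using hom_of_lift[OF lift_closed_OY g(1,2)] by metis
  have "\<psi> f s = v s" for s
  proof (cases "s < ?n")
   case True
   have "M (E s) = v s"
    unfolding E_def Meps[OF gen_lift(1)[OF b[OF True]]] gen_lift(3)[OF b[OF True]] gen_lift(2)[OF b[OF True]] by (rule hvb[OF True])
   thus ?thesis using True f(2)[OF E[OF True]] g(3)[OF E[OF True]] by (simp add: \<psi>_def)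
  qed (simp add: \<psi>_def v)
  hence "\<psi> f = v" by (rule ext)
  thus ?thesis using f(1) by (auto simp: HH_simps)
 qed
 have "has_dim (quot_module (HH OY) ?R) ?n"
 proof (rule has_dim_quot[OF HH_abelian[OF lift_closed_OY] O(3), where \<psi> = \<psi>])
  show "\<psi> (x \<oplus>\<^bsub>HH OY\<^esub> y) = \<psi> x + \<psi> y" if "x \<in> carrier (HH OY)" "y \<in> carrier (HH OY)" for x y
   using O(2)[OF that E] by (auto simp: fun_eq_iff fun_app \<psi>_def)
  show "\<psi> (a \<odot>\<^bsub>HH OY\<^esub> x) = sc a (\<psi> x)" if "x \<in> carrier (HH OY)" for a x
   using O(4)[OF that E] by (auto simp: fun_eq_iff fun_app \<psi>_def)
  show "\<psi> x s = 0" if "?n <= s" for x s using that by (simp add: \<psi>_def)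
 qed (use ker surj in auto)
 thus ?thesis by (simp add: ext1_def Ext1_def syzygy_eq)
qed

end

section \<open>Inverting the quantum Cartan matrix\<close>

lemma shift_mult: "fls_shift a (1 :: rat fls) * fls_shift b 1 = fls_shift (a + b) 1"
 using fls_X_intpow_times_fls_X_intpow[of "- a" "- b", where 'a = rat] by (simp add: add.commute)

lemma q_pow_add: "q_pow a * q_pow b = q_pow (a + b)"
 by (rule fls_X_intpow_times_fls_X_intpow)

lemma q_pow_nth: "fls_nth (q_pow a) e = (if e = a then 1 else 0)"
 by (auto simp: fls_nonzeroI)

lemma q_int_numerator: "(q_pow x - q_pow (- x)) * (\<Sum>m<n. q_pow (x * (int n - 1 - 2 * int m))) = q_pow (int n * x) - q_pow (- (int n * x))"
proof (induction n)
 case (Suc n)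
 have e: "(\<Sum>m<Suc n. q_pow (x * (int (Suc n) - 1 - 2 * int m)))
  = q_pow x * (\<Sum>m<n. q_pow (x * (int n - 1 - 2 * int m))) + q_pow (- (int n * x))"
 proof -
  have "q_pow (x * (int (Suc n) - 1 - 2 * int m)) = q_pow x * q_pow (x * (int n - 1 - 2 * int m))" for m
   unfolding q_pow_add by (rule arg_cong[of _ _ q_pow]) (simp add: algebra_simps)
  moreover have "q_pow (x * (int (Suc n) - 1 - 2 * int n)) = q_pow (- (int n * x))"
   by (rule arg_cong[of _ _ q_pow]) (simp add: algebra_simps)
  ultimately show ?thesis by (simp only: sum.lessThan_Suc sum_distrib_left)
 qed
 have "(q_pow x - q_pow (- x)) * (\<Sum>m<Suc n. q_pow (x * (int (Suc n) - 1 - 2 * int m)))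
  = q_pow x * (q_pow (int n * x) - q_pow (- (int n * x))) + (q_pow x - q_pow (- x)) * q_pow (- (int n * x))"
  unfolding e distrib_left mult.left_commute[of "q_pow x - q_pow (- x)" "q_pow x"] Suc.IH ..
 also have "... = q_pow (int (Suc n) * x) - q_pow (- (int (Suc n) * x))"
 proof -
  have "q_pow x * q_pow (int n * x) = q_pow (int (Suc n) * x)" "q_pow (- x) * q_pow (- (int n * x)) = q_pow (- (int (Suc n) * x))"
   unfolding q_pow_add by (rule arg_cong[of _ _ q_pow], simp add: algebra_simps)+
  thus ?thesis by (simp only: right_diff_distrib left_diff_distrib) simp
 qed
 finally show ?case .
qed simp

lemma q_pow_diff_nonzero: "x > 0 ==> q_pow x - q_pow (- x) ~= 0"
proof
 assume "x > 0" "q_pow x - q_pow (- x) = 0"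
 hence "fls_nth (q_pow x - q_pow (- x)) x = 0" by (simp only: fls_zero_nth)
 thus False using \<open>x > 0\<close> by (simp only: fls_minus_nth q_pow_nth) simp
qed

lemma q_int_of_nat: "q_int (int n) = (\<Sum>m<n. q_pow (int n - 1 - 2 * int m))"
 using q_int_numerator[of 1 n] q_pow_diff_nonzero[of 1] by (simp add: q_int_def field_simps)

lemma q_int_uminus: "q_int (- k) = - q_int k"
 unfolding q_int_def minus_divide_left by simp

lemma q_int_ratio:
 assumes "x > 0"
 shows "q_int (int n * x) / q_int x = (\<Sum>m<n. q_pow (x * (int n - 1 - 2 * int m)))"
proof -
 have nz: "q_pow 1 - q_pow (- 1) ~= 0" "q_pow x - q_pow (- x) ~= 0" using q_pow_diff_nonzero assms by auto
 hence "q_int (int n * x) / q_int x = (q_pow (int n * x) - q_pow (- (int n * x))) / (q_pow x - q_pow (- x))"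
  by (simp add: q_int_def)
 also have "... = (\<Sum>m<n. q_pow (x * (int n - 1 - 2 * int m)))"
  unfolding q_int_numerator[symmetric] using nz(2) by simp
 finally show ?thesis .
qed

lemma matrix_inv_right_inverse:
 fixes A B :: "'a::field ^'n^'n"
 assumes "A ** B = mat 1"
 shows "matrix_inv A ** A = mat 1"
proof -
 have "\<exists>A'. A ** A' = mat 1 \<and> A' ** A = mat 1" using assms matrix_left_right_inverse by blast
 from someI_ex[OF this] show ?thesis unfolding matrix_inv_def by blast
qed

text \<open>If \<open>Q N = 1 + q\<^sup>T S\<close> with \<open>S\<close> a substitution matrix, then \<open>Q\<^sup>-\<^sup>1\<close> agrees with \<open>N\<close> up to order \<open>T\<close>.\<close>

lemma inverse_truncation:
 fixes Q N :: "rat fls ^'i::finite^'i" and star :: "'i => 'i" and T :: int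
 assumes QN: "\<And>b s. (Q ** N) $ b $ s = (if b = s then 1 else 0) + (if b = star s then q_pow T else 0)"
  and T: "T > 0" and pos: "\<And>b s u. u <= 0 ==> fls_nth (N $ b $ s) u = 0"
  and u: "u <= T"
 shows "fls_nth (matrix_inv Q $ b $ s) u = fls_nth (N $ b $ s) u"
proof -
 have min: "\<exists>s. f s ~= 0 \<and> (\<forall>s'. f s' ~= 0 --> fls_subdegree (f s) <= fls_subdegree (f s'))" if "\<exists>s. f s ~= 0"
  for f :: "'i => rat fls"
 proof -
  let ?S = "{s. f s ~= 0}" and ?m = "Min ((\<lambda>s. fls_subdegree (f s)) ` {s. f s ~= 0})"
  have "?m \<in> (\<lambda>s. fls_subdegree (f s)) ` ?S" using that by (intro Min_in) auto
  then obtain s where "s \<in> ?S" "fls_subdegree (f s) = ?m" by auto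
  moreover have "?m <= fls_subdegree (f s')" if "f s' ~= 0" for s' using that by (intro Min_le) auto
  ultimately show ?thesis by auto
 qed
 have low: "fls_nth (f s') e = 0" if "\<And>s'. f s' ~= 0 ==> \<delta> <= fls_subdegree (f s')" "e < \<delta>" for f :: "'i => rat fls" and s' e \<delta>
  using that by (cases "f s' = 0") (auto simp: order.strict_trans2)
 \<comment> \<open>In \<open>Q ** N\<close> the second summand raises orders by
   \<open>T > 0\<close>, so an entry of lowest order of a kernel vector cannot be cancelled. This
   gives invertibility of \<open>Q\<close>.\<close>
 have "x = 0" if x: "(Q ** N) *v x = 0" for x
 proof (rule ccontr)
  assume "x ~= 0"
  hence "\<exists>s. x $ s ~= 0" by (simp add: vec_eq_iff)
  then obtain s0 where s0: "x $ s0 ~= 0" "\<And>s. x $ s ~= 0 ==> fls_subdegree (x $ s0) <= fls_subdegree (x $ s)"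
   using min[of "\<lambda>s. x $ s"] by blast
  let ?\<delta> = "fls_subdegree (x $ s0)"
  have "0 = fls_nth (((Q ** N) *v x) $ s0) ?\<delta>" using x by simp
  also have "... = (\<Sum>s\<in>UNIV. fls_nth ((if s0 = s then x $ s else 0) + (if s0 = star s then q_pow T * x $ s else 0)) ?\<delta>)"
   unfolding matrix_vector_mult_def QN by (simp add: fls_nth_sum distrib_right if_distrib[of "\<lambda>y. y * _"] cong: if_cong)
  also have "... = (\<Sum>s\<in>UNIV. if s0 = s then fls_nth (x $ s0) ?\<delta> else 0)"
  proof (intro sum.cong refl)
   fix s
   have "fls_nth (x $ s) (?\<delta> - T) = 0" by (rule low[of "\<lambda>s. x $ s", OF s0(2)]) (use T in auto)
   thus "fls_nth ((if s0 = s then x $ s else 0) + (if s0 = star s then q_pow T * x $ s else 0)) ?\<delta>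
    = (if s0 = s then fls_nth (x $ s0) ?\<delta> else 0)"
    by (auto simp: fls_X_intpow_times_conv_shift)
  qed
  finally show False using s0(1) by simp
 qed
 then obtain B where "B ** (Q ** N) = mat 1" using matrix_left_invertible_ker by blast
 hence "Q ** (N ** B) = mat 1" using matrix_left_right_inverse by (metis matrix_mul_assoc)
 hence inv: "matrix_inv Q ** Q = mat 1" by (rule matrix_inv_right_inverse)
 let ?I = "matrix_inv Q"
 have N: "N $ b $ s = ?I $ b $ s + ?I $ b $ star s * q_pow T" for b s
 proof -
  have "N = ?I ** (Q ** N)" by (simp add: matrix_mul_assoc inv)
  hence "N $ b $ s = (?I ** (Q ** N)) $ b $ s" by (rule arg_cong)
  also have "... = (\<Sum>t\<in>UNIV. ?I $ b $ t * (Q ** N) $ t $ s)"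
   unfolding matrix_matrix_mult_def[of ?I "Q ** N"] by simp
  also have "... = (\<Sum>t\<in>UNIV. (if t = s then ?I $ b $ t else 0) + (if t = star s then ?I $ b $ t * q_pow T else 0))"
   unfolding QN by (intro sum.cong refl) (auto simp: distrib_left)
  finally show ?thesis by (simp add: sum.distrib)
 qed
 \<comment> \<open>The same argument in a row of the inverse: an entry of lowest order that is not
   positive would be visible in \<open>N\<close>.\<close>
 have Ipos: "fls_nth (?I $ b $ s) e = 0" if "e <= 0" for s e
 proof (cases "\<exists>s. ?I $ b $ s ~= 0")
  case True
  then obtain s0 where s0: "?I $ b $ s0 ~= 0" "\<And>s. ?I $ b $ s ~= 0 ==> fls_subdegree (?I $ b $ s0) <= fls_subdegree (?I $ b $ s)"
   using min[of "\<lambda>s. ?I $ b $ s"] by blast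
  let ?\<delta> = "fls_subdegree (?I $ b $ s0)"
  have "\<not> ?\<delta> <= 0"
  proof
   assume "?\<delta> <= 0"
   hence "0 = fls_nth (N $ b $ s0) ?\<delta>" using pos by simp
   also have "... = fls_nth (?I $ b $ s0) ?\<delta> + fls_nth (?I $ b $ star s0) (?\<delta> - T)"
    unfolding N by (simp add: fls_X_intpow_times_conv_shift)
   also have "fls_nth (?I $ b $ star s0) (?\<delta> - T) = 0" by (rule low[of "\<lambda>s. ?I $ b $ s", OF s0(2)]) (use T in auto)
   finally show False using s0(1) by simp
  qed
  thus ?thesis using low[of "\<lambda>s. ?I $ b $ s", OF s0(2), of e s] that by simp
 qed simp
 have "fls_nth (N $ b $ s) u = fls_nth (?I $ b $ s) u + fls_nth (?I $ b $ star s) (u - T)"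
  unfolding N by (simp add: fls_X_intpow_times_conv_shift)
 thus ?thesis using Ipos[of "u - T" "star s"] u by simp
qed

context gpa_over
begin

text \<open>The two additions to \<open>mesh_table\<close> place the table correctly: the last
  non-zero row is one monomial, which accounts for the term of order \<open>T\<close>, and
  multiplication by \<open>q_pow (d s)\<close> moves all exponents into the range from 1 to
  \<open>T\<close>.\<close>

definition full_table :: "int => 'i => nat => ('i => nat => rat fls) => bool" where
 "full_table T s N P \<longleftrightarrow> mesh_table s N P \<and>
   (\<exists>s'. \<forall>b. P b (N - 1) = (if b = s' then q_pow (T - int (d b) - int (d s)) else 0)) \<and>
   (\<forall>b. \<forall>n<N. \<forall>e. fls_nth (P b n) e ~= 0 --> - int (d s) < e \<and> e <= T - int (d s))"

text \<open>Summed over the rows, the recursion telescopes: the quantum Cartan matrix applied to the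
  sums of the columns leaves the first row and the last, that is, the unit matrix and a single
  \<open>q_pow T\<close> per column.\<close>

lemma full_table_inverse:
 assumes full: "\<And>s. full_table T s N (P s)"
  and T: "T > 0"
  and C0: "\<And>i j. i ~= j ==> C i j <= 0"
  and d1: "\<And>i j. adj C i j ==> E i j = 1 \<or> d i = 1"
 shows "int u <= T ==> inv_coeff C d b s u = (\<Sum>n<N. fls_nth (P s b n) (int u - int (d s)))"
proof -
 assume u: "int u <= T"
 define Nm :: "rat fls ^'i^'i" where "Nm = (\<chi> b s. q_pow (int (d s)) * (\<Sum>n<N. P s b n))"
 have table: "mesh_table s N (P s)" for s using full by (simp add: full_table_def)
 have N: "N > 0" using table by (simp add: mesh_table_def)
 obtain star where star: "\<And>s b. P s b (N - 1) = (if b = star s then q_pow (T - int (d b) - int (d s)) else 0)"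
  using full unfolding full_table_def by metis
 have rec: "q_pow (- int (d j)) * P s j (Suc n) + (if n = 0 then 0 else q_pow (int (d j)) * P s j (n - 1))
    = (\<Sum>k | adj C j k. (\<Sum>m<E j k. q_pow (int (d j) * (int (E j k) - 1 - 2 * int m))) * P s k n)" if "n < N" for s n j
  using table[of s] that unfolding mesh_table_def by blast
 have P0: "P s j 0 = (if j = s then 1 else 0)" "P s j N = 0" for s j using table[of s] by (auto simp: mesh_table_def)
 \<comment> \<open>The recursion has quantum integers in the variable \<open>q_pow (d j)\<close>,
   the matrix has them in \<open>q\<close>. By \<open>d1\<close> they coincide, as
   \<open>E j k = 1\<close> or \<open>d j = 1\<close>.\<close>
 have q: "q_int (C j k) = - (\<Sum>m<E j k. q_pow (int (d j) * (int (E j k) - 1 - 2 * int m)))" if "adj C j k" for j k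
 proof -
  have "C j k = - int (E j k)" using C0[of j k] that by (simp add: eps_mult_def adj_def)
  hence "q_int (C j k) = - (\<Sum>m<E j k. q_pow (int (E j k) - 1 - 2 * int m))" by (simp add: q_int_uminus q_int_of_nat)
  thus ?thesis using d1[OF that] by auto
 qed
 have QN: "(quantum_cartan C d ** Nm) $ b $ s = (if b = s then 1 else 0) + (if b = star s then q_pow T else 0)" for b s
 proof -
  let ?S = "\<lambda>k. \<Sum>n<N. P s k n"
  let ?c = "\<lambda>k. if k = b then q_pow (int (d b)) + q_pow (- int (d b)) else q_int (C b k)"
  have c0: "?c k = 0" if "\<not> adj C b k" "k ~= b" for k
  proof -
   have "C b k = 0" using C0[of b k] that by (auto simp: adj_def)
   thus ?thesis using that by (simp add: q_int_def)
  qed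
  have "(\<Sum>k\<in>UNIV. ?c k * ?S k) = (\<Sum>k\<in>insert b {k. adj C b k}. ?c k * ?S k)"
   by (rule sum.mono_neutral_right) (use c0 in auto)
  also have "... = (q_pow (int (d b)) + q_pow (- int (d b))) * ?S b + (\<Sum>k | adj C b k. ?c k * ?S k)"
   by (subst sum.insert) (auto simp: adj_def)
  also have "(\<Sum>k | adj C b k. ?c k * ?S k) = - (\<Sum>k | adj C b k. (\<Sum>m<E b k. q_pow (int (d b) * (int (E b k) - 1 - 2 * int m))) * ?S k)"
   unfolding sum_negf[symmetric] by (intro sum.cong refl) (auto simp: q adj_def)
  also have "(\<Sum>k | adj C b k. (\<Sum>m<E b k. q_pow (int (d b) * (int (E b k) - 1 - 2 * int m))) * ?S k)
   = (\<Sum>n<N. \<Sum>k | adj C b k. (\<Sum>m<E b k. q_pow (int (d b) * (int (E b k) - 1 - 2 * int m))) * P s k n)"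
   unfolding sum_distrib_left by (rule sum.swap)
  also have "... = (\<Sum>n<N. q_pow (- int (d b)) * P s b (Suc n) + (if n = 0 then 0 else q_pow (int (d b)) * P s b (n - 1)))"
   by (intro sum.cong refl) (use rec in simp)
  also have "... = q_pow (- int (d b)) * (?S b - P s b 0) + q_pow (int (d b)) * (?S b - P s b (N - 1))"
  proof -
   have 1: "(\<Sum>n<N. P s b (Suc n)) = ?S b - P s b 0"
    using sum.lessThan_Suc_shift[of "P s b" N] by (simp add: P0(2))
   obtain N' where N': "N = Suc N'" using N by (cases N) auto
   have "(\<Sum>n<N. if n = 0 then 0 else q_pow (int (d b)) * P s b (n - 1)) = q_pow (int (d b)) * (\<Sum>n<N'. P s b n)"
    unfolding N' sum.lessThan_Suc_shift by (simp add: sum_distrib_left)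
   moreover have "(\<Sum>n<N'. P s b n) = ?S b - P s b (N - 1)" by (simp add: N')
   ultimately show ?thesis by (simp only: sum.distrib sum_distrib_left[symmetric] 1)
  qed
  finally have "(\<Sum>k\<in>UNIV. ?c k * ?S k) = q_pow (- int (d b)) * P s b 0 + q_pow (int (d b)) * P s b (N - 1)"
   by (simp only: ring_distribs) (simp add: algebra_simps)
  moreover have "(quantum_cartan C d ** Nm) $ b $ s = q_pow (int (d s)) * (\<Sum>k\<in>UNIV. ?c k * ?S k)"
   unfolding matrix_matrix_mult_def quantum_cartan_def Nm_def sum_distrib_left[of "q_pow (int (d s))"]
   by (simp add: eq_commute[of b] mult.left_commute cong: if_cong)
  ultimately have "(quantum_cartan C d ** Nm) $ b $ s
    = q_pow (int (d s)) * (q_pow (- int (d b)) * P s b 0 + q_pow (int (d b)) * P s b (N - 1))" by simp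
  also have "... = q_pow (int (d s)) * (q_pow (- int (d b)) * P s b 0) + q_pow (int (d s)) * (q_pow (int (d b)) * P s b (N - 1))"
   by (rule distrib_left)
  also have "q_pow (int (d s)) * (q_pow (- int (d b)) * P s b 0) = (if b = s then 1 else 0)"
   by (simp add: P0 shift_mult)
  also have "q_pow (int (d s)) * (q_pow (int (d b)) * P s b (N - 1)) = (if b = star s then q_pow T else 0)"
  proof (cases "b = star s")
   case True
   have "q_pow (int (d s)) * (q_pow (int (d b)) * q_pow (T - int (d b) - int (d s))) = q_pow T"
    unfolding q_pow_add by (rule arg_cong[of _ _ q_pow]) simp
   thus ?thesis unfolding star using True by simp
  qed (simp only: star if_False mult_zero_right)
  finally show ?thesis .
 qed
 have nth: "fls_nth (Nm $ b $ s) e = (\<Sum>n<N. fls_nth (P s b n) (e - int (d s)))" for b s e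
  by (simp add: Nm_def fls_X_intpow_times_conv_shift fls_nth_sum)
 have pos: "fls_nth (Nm $ b $ s) e = 0" if "e <= 0" for b s e
  unfolding nth
 proof (rule sum.neutral, intro ballI)
  fix n assume "n \<in> {..<N}"
  hence "fls_nth (P s b n) (e - int (d s)) ~= 0 ==> - int (d s) < e - int (d s)"
   using full[of s] unfolding full_table_def by blast
  thus "fls_nth (P s b n) (e - int (d s)) = 0" using that by linarith
 qed
 show ?thesis
  unfolding inv_coeff_def using inverse_truncation[OF QN T pos u, of b s] nth by simp
qed

end

section \<open>Tables over the standard Dynkin diagrams\<close>

abbreviation verts :: "dynkin_type => nat set" where "verts X \<equiv> {1..type_rank X}"

definition std_nbrs :: "dynkin_type => nat => nat set" where
 "std_nbrs X b = {c \<in> verts X. (b, c) \<in> dynkin_edges X \<or> (c, b) \<in> dynkin_edges X}"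

definition std_mult :: "dynkin_type => nat => nat => nat" where
 "std_mult X b c = (if std_symmetrizer X b < std_symmetrizer X c then std_symmetrizer X c else 1)"

abbreviation qmult :: "dynkin_type => nat => nat => rat fls" where
 "qmult X b c \<equiv> (\<Sum>x<std_mult X b c. q_pow (int (std_mult X b c) - 1 - 2 * int x))"

definition std_period :: "dynkin_type => int" where
 "std_period X = int (lacing_number X * dual_coxeter_number X)"

abbreviation sdeg :: "dynkin_type => nat => int" where
 "sdeg X b \<equiv> int (std_symmetrizer X b)"

text \<open>\<open>full_table\<close> on the standard diagram. In all types the number
  \<open>N\<close> of rows will be the Coxeter number minus 1.\<close>

definition std_table :: "dynkin_type => nat => nat => (nat => nat => rat fls) => bool" where
 "std_table X s N P \<longleftrightarrow> N > 0 \<and>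
   (\<forall>b\<in>(verts X). P b 0 = (if b = s then 1 else 0)) \<and>
   (\<forall>n<N. \<forall>b\<in>(verts X). q_pow (- sdeg X b) * P b (Suc n)
     + (if n = 0 then 0 else q_pow (sdeg X b) * P b (n - 1))
    = (\<Sum>c\<in>std_nbrs X b. qmult X b c * P c n)) \<and>
   (\<forall>n<N. \<exists>b\<in>(verts X). P b n ~= 0) \<and> (\<forall>b\<in>(verts X). P b N = 0) \<and>
   (\<exists>s'\<in>(verts X). \<forall>b\<in>(verts X). P b (N - 1) =
    (if b = s' then q_pow (std_period X - sdeg X b - sdeg X s) else 0)) \<and>
   (\<forall>b\<in>(verts X). \<forall>n<N. \<forall>e. fls_nth (P b n) e ~= 0 -->
    - sdeg X s < e \<and> e <= std_period X - sdeg X s)"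

lemma std_symmetrizer_cases: "std_symmetrizer X a = 1 \<or> std_symmetrizer X a = lacing_number X"
 by (cases X) auto

lemma lacing_cases: "lacing_number X \<in> {1, 2, 3}"
 by (cases X) auto

lemma std_symmetrizer_pos: "std_symmetrizer X a > 0"
 using std_symmetrizer_cases[of X a] lacing_cases[of X] by auto

lemma std_edge_irrefl: "valid_type X ==> (a, a) \<notin> dynkin_edges X"
 by (cases X) auto

lemma standard_cartan_edge:
 assumes "a ~= b"
 shows "standard_cartan X a b = (if (a, b) \<in> dynkin_edges X \<or> (b, a) \<in> dynkin_edges X then - int (std_mult X a b) else 0)"
proof -
 have "\<lceil>rat_of_nat (std_symmetrizer X b) / rat_of_nat (std_symmetrizer X a)\<rceil> = int (std_mult X a b)"
  using std_symmetrizer_cases[of X a] std_symmetrizer_cases[of X b] lacing_cases[of X]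
  by (auto simp: std_mult_def ceiling_eq_iff)
 thus ?thesis using assms by (simp add: standard_cartan_def)
qed

lemma std_mult_pos: "std_mult X a b > 0"
 using std_symmetrizer_pos[of X b] by (simp add: std_mult_def)

lemma std_mult_symmetrizer: "std_mult X a b * std_symmetrizer X a = max (std_symmetrizer X a) (std_symmetrizer X b)"
 "std_mult X a b = 1 \<or> std_symmetrizer X a = 1"
 using std_symmetrizer_cases[of X a] std_symmetrizer_cases[of X b] lacing_cases[of X]
 by (auto simp: std_mult_def max_def)

lemma dynkin_connected:
 assumes X: "valid_type X"
  and f: "\<And>a b. (a, b) \<in> dynkin_edges X ==> f a = f b"
  and a: "a \<in> verts X" and b: "b \<in> verts X"
 shows "f a = f b"
proof -
 have up: "f a = f n" if "\<And>a. m <= a ==> a < n ==> f a = f (Suc a)" "m <= a" "a <= n" for a m n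
  using that(3,2) by (induction rule: inc_induct) (use that(1) in auto)
 have chain: "\<exists>z. \<forall>a\<in>(verts X). f a = z" if "dynkin_edges X = {(a, a + 1) |a. 1 <= a \<and> a < type_rank X}"
 proof (intro exI ballI)
  have "f a = f (Suc a)" if "1 <= a" "a < type_rank X" for a
   by (rule f) (use \<open>dynkin_edges X = _\<close> that in simp)
  note step = this
  show "f a = f (type_rank X)" if "a \<in> verts X" for a
   by (rule up[OF step]) (use that in auto)
 qed
 have "\<exists>z. \<forall>a\<in>(verts X). f a = z"
 proof (cases X)
  case (TypeA n)
  thus ?thesis by (intro chain) simp_all
 next
  case (TypeB n)
  thus ?thesis by (intro chain) simp_all
 next
  case (TypeC n)
  thus ?thesis by (intro chain) simp_all
 next
  case (TypeD n)
  have e: "f a = f (n - 1)" if "1 <= a" "a <= n - 1" for a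
  proof (rule up[OF _ that])
   show "f a = f (Suc a)" if "1 <= a" "a < n - 1" for a using that by (intro f) (simp add: TypeD)
  qed
  have e2: "f (n - 2) = f n" using f TypeD by auto
  have e3: "f (n - 2) = f (n - 1)" by (rule e) (use TypeD X in auto)
  have "f a = f (n - 1)" if "1 <= a" "a <= n" for a
  proof (cases "a = n")
   case False
   thus ?thesis using e[of a] that by linarith
  qed (use e2 e3 in simp)
  thus ?thesis unfolding TypeD type_rank.simps by (meson atLeastAtMost_iff)
 next
  case (TypeE n)
  have n: "n >= 6" using X TypeE by auto
  have e: "f a = f n" if "3 <= a" "a <= n" for a
  proof (rule up[OF _ that])
   show "f a = f (Suc a)" if "3 <= a" "a < n" for a using that by (intro f) (simp add: TypeE)
  qed
  moreover have "f 1 = f 3" "f 2 = f 4" using f TypeE by auto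
  ultimately have "f a = f n" if "1 <= a" "a <= n" for a
  proof -
   have "a = 1 \<or> a = 2 \<or> 3 <= a" using that by auto
   moreover have "f 3 = f n" "f 4 = f n" by (rule e; use n in simp)+
   ultimately show ?thesis using e[of a] \<open>f 1 = f 3\<close> \<open>f 2 = f 4\<close> that by metis
  qed
  thus ?thesis unfolding TypeE type_rank.simps by (meson atLeastAtMost_iff)
 next
  case TypeF4
  have e: "f 1 = f 2" "f 2 = f 3" "f 3 = f 4" using f TypeF4 by auto
  have "f a = f 4" if "1 <= a" "a <= 4" for a
  proof -
   consider "a = 1" | "a = 2" | "a = 3" | "a = 4" using \<open>1 <= a\<close> \<open>a <= 4\<close> by linarith
   thus ?thesis using e by cases simp_all
  qed
  thus ?thesis unfolding TypeF4 type_rank.simps by (meson atLeastAtMost_iff)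
 next
  case TypeG2
  have e: "f 1 = f 2" using f TypeG2 by auto
  have "f a = f 2" if "1 <= a" "a <= 2" for a
  proof -
   consider "a = 1" | "a = 2" using \<open>1 <= a\<close> \<open>a <= 2\<close> by linarith
   thus ?thesis using e by cases simp_all
  qed
  thus ?thesis unfolding TypeG2 type_rank.simps by (meson atLeastAtMost_iff)
 qed
 thus ?thesis using a b by metis
qed

lemma dynkin_edges_range: "valid_type X ==> (a, b) \<in> dynkin_edges X ==> a \<in> verts X \<and> b \<in> verts X"
 by (cases X) auto

lemma dynkin_short: "valid_type X ==> \<exists>a\<in>(verts X). std_symmetrizer X a = 1"
proof (cases X)
 case TypeF4
 thus ?thesis by (intro bexI[of _ 3]) auto
next
 case TypeG2
 thus ?thesis by (intro bexI[of _ 1]) auto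
next
 case (TypeB n)
 thus "valid_type X ==> ?thesis" by (intro bexI[of _ n]) auto
qed (auto intro!: bexI[of _ 1])

text \<open>The quotient of \<open>d\<close> by the standard symmetrizer is constant along edges,
  hence constant. At a short vertex it is seen to be an integer, this integer divides all
  \<open>d i\<close>, and coprimeness makes it 1.\<close>

lemma dynkin_labelling:
 assumes C: "cartan_matrix_of_type X C" and d: "symmetrizer C d"
 obtains \<sigma> where "bij_betw \<sigma> UNIV (verts X)" "\<And>i j. C i j = standard_cartan X (\<sigma> i) (\<sigma> j)"
  "\<And>i. d i = std_symmetrizer X (\<sigma> i)"
proof -
 have X: "valid_type X" using C by (simp add: cartan_matrix_of_type_def)
 obtain \<sigma> where \<sigma>: "bij_betw \<sigma> UNIV (verts X)" "\<And>i j. C i j = standard_cartan X (\<sigma> i) (\<sigma> j)"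
  using C by (auto simp: cartan_matrix_of_type_def)
 define \<tau> where "\<tau> = inv_into UNIV \<sigma>"
 have \<tau>\<sigma>: "\<tau> (\<sigma> i) = i" for i using \<sigma>(1) by (simp add: \<tau>_def bij_betw_def)
 have \<sigma>\<tau>: "\<sigma> (\<tau> a) = a" if "a \<in> verts X" for a
  using \<sigma>(1) that by (simp add: \<tau>_def bij_betw_def f_inv_into_f)
 have r: "\<sigma> i \<in> verts X" for i using \<sigma>(1) by (auto simp: bij_betw_def)
 define f where "f a = rat_of_nat (d (\<tau> a)) / rat_of_nat (std_symmetrizer X a)" for a
 have e: "f a = f b" if "(a, b) \<in> dynkin_edges X" for a b
 proof -
  have ab: "a \<in> verts X" "b \<in> verts X" "a ~= b"
   using dynkin_edges_range[OF X that] std_edge_irrefl[OF X] that by auto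
  have "int (d (\<tau> a)) * C (\<tau> a) (\<tau> b) = int (d (\<tau> b)) * C (\<tau> b) (\<tau> a)"
   using d unfolding symmetrizer_def by blast
  hence "int (d (\<tau> a)) * int (std_mult X a b) = int (d (\<tau> b)) * int (std_mult X b a)"
   using that ab by (simp add: \<sigma>(2) \<sigma>\<tau> standard_cartan_edge)
  hence 1: "d (\<tau> a) * std_mult X a b = d (\<tau> b) * std_mult X b a" by (metis of_nat_eq_iff of_nat_mult)
  have 2: "std_mult X a b * std_symmetrizer X a = std_mult X b a * std_symmetrizer X b"
   by (simp add: std_mult_symmetrizer(1) max.commute)
  have "d (\<tau> a) * std_symmetrizer X b * (std_mult X a b * std_mult X b a) = d (\<tau> b) * std_symmetrizer X a * (std_mult X a b * std_mult X b a)"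
  proof -
   have "(d (\<tau> a) * std_mult X a b) * (std_mult X b a * std_symmetrizer X b) = (d (\<tau> b) * std_mult X b a) * (std_mult X a b * std_symmetrizer X a)"
    unfolding 1 2 ..
   thus ?thesis by (simp only: ac_simps)
  qed
  hence "d (\<tau> a) * std_symmetrizer X b = d (\<tau> b) * std_symmetrizer X a"
   using std_mult_pos[of X a b] std_mult_pos[of X b a] by simp
  hence "rat_of_nat (d (\<tau> a)) * rat_of_nat (std_symmetrizer X b) = rat_of_nat (d (\<tau> b)) * rat_of_nat (std_symmetrizer X a)"
   by (metis of_nat_mult)
  thus ?thesis using std_symmetrizer_pos[of X a] std_symmetrizer_pos[of X b] by (simp add: f_def frac_eq_eq)
 qed
 obtain a0 where a0: "a0 \<in> verts X" "std_symmetrizer X a0 = 1" using dynkin_short[OF X] by blast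
 have dk: "d i = d (\<tau> a0) * std_symmetrizer X (\<sigma> i)" for i
 proof -
  have "f (\<sigma> i) = f a0" by (rule dynkin_connected[OF X e r a0(1)])
  hence "rat_of_nat (d i) = rat_of_nat (d (\<tau> a0)) * rat_of_nat (std_symmetrizer X (\<sigma> i))"
   using std_symmetrizer_pos[of X "\<sigma> i"] a0(2) by (simp add: f_def \<tau>\<sigma> divide_eq_eq)
  hence "rat_of_nat (d i) = rat_of_nat (d (\<tau> a0) * std_symmetrizer X (\<sigma> i))" by simp
  thus ?thesis by (simp only: of_nat_eq_iff)
 qed
 hence "d (\<tau> a0) dvd Gcd (range d)" by (intro Gcd_greatest) (metis dvd_triv_left imageE)
 moreover have "Gcd (range d) = 1" using d unfolding symmetrizer_def by blast
 ultimately have "d (\<tau> a0) = 1" by simp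
 hence "d i = std_symmetrizer X (\<sigma> i)" for i using dk[of i] by simp
 thus thesis by (rule that[OF \<sigma>])
qed

lemma dynkin_gpa:
 assumes X: "valid_type X" and om: "sign_choice C \<omega>"
  and \<sigma>: "bij_betw \<sigma> UNIV (verts X)" "\<And>i j. C i j = standard_cartan X (\<sigma> i) (\<sigma> j)"
  "\<And>i. d i = std_symmetrizer X (\<sigma> i)"
 shows "gpa C \<omega> d (lacing_number X)"
  and "adj C i j \<longleftrightarrow> (\<sigma> i, \<sigma> j) \<in> dynkin_edges X \<or> (\<sigma> j, \<sigma> i) \<in> dynkin_edges X"
  and "adj C i j ==> eps_mult C i j = std_mult X (\<sigma> i) (\<sigma> j)"
  and "i ~= j ==> C i j <= 0"
proof -
 have ne: "\<sigma> i ~= \<sigma> j" if "i ~= j" for i j using \<sigma>(1) that by (auto simp: bij_betw_def inj_on_def)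
 show adj: "adj C i j \<longleftrightarrow> (\<sigma> i, \<sigma> j) \<in> dynkin_edges X \<or> (\<sigma> j, \<sigma> i) \<in> dynkin_edges X" for i j
  using std_edge_irrefl[OF X, of "\<sigma> i"] std_mult_pos[of X "\<sigma> i" "\<sigma> j"] ne[of i j]
  by (cases "i = j") (auto simp: adj_def \<sigma>(2) standard_cartan_edge)
 show em: "eps_mult C i j = std_mult X (\<sigma> i) (\<sigma> j)" if "adj C i j" for i j
  using that adj[of i j] ne[of i j] by (auto simp: eps_mult_def \<sigma>(2) standard_cartan_edge adj_def)
 show "i ~= j ==> C i j <= 0" using ne[of i j] by (simp add: \<sigma>(2) standard_cartan_edge)
 show "gpa C \<omega> d (lacing_number X)"
 proof
  show "adj C j i" if "adj C i j" for i j using that adj by blast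
  show "eps_mult C i j * d i = max (d i) (d j)" if "adj C i j" for i j
   using em[OF that] std_mult_symmetrizer(1) by (simp add: \<sigma>(3))
  show "\<omega> i j \<in> {1, -1}" if "adj C i j" for i j using om that unfolding sign_choice_def by blast
  show "d i dvd lacing_number X" for i using std_symmetrizer_cases[of X "\<sigma> i"] by (auto simp: \<sigma>(3))
 qed (use std_symmetrizer_pos lacing_cases[of X] in \<open>auto simp: \<sigma>(3)\<close>)
qed

lemma (in gpa_over) full_table_of_std:
 assumes X: "valid_type X" and om: "sign_choice C \<omega>"
  and \<sigma>: "bij_betw \<sigma> UNIV (verts X)" "\<And>i j. C i j = standard_cartan X (\<sigma> i) (\<sigma> j)"
  "\<And>i. d i = std_symmetrizer X (\<sigma> i)"
  and P: "std_table X (\<sigma> s) N P"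
 shows "full_table (std_period X) s N (\<lambda>b. P (\<sigma> b))"
proof -
 have r: "\<sigma> i \<in> verts X" for i using \<sigma>(1) by (auto simp: bij_betw_def)
 have inj: "\<sigma> i = \<sigma> j \<longleftrightarrow> i = j" for i j using \<sigma>(1) by (auto simp: bij_betw_def inj_on_def)
 have sur: "\<exists>i. \<sigma> i = a" if "a \<in> verts X" for a using \<sigma>(1) that unfolding bij_betw_def by (metis imageE)
 note G = dynkin_gpa[OF X om \<sigma>]
 have nb: "std_nbrs X (\<sigma> b) = \<sigma> ` {c. adj C b c}" for b
  unfolding std_nbrs_def using G(2)[of b] r sur by fast
 have p: "N > 0" "\<And>b. P (\<sigma> b) 0 = (if b = s then 1 else 0)" "\<And>n. n < N ==> \<exists>b. P (\<sigma> b) n ~= 0" "\<And>b. P (\<sigma> b) N = 0"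
  using P r unfolding std_table_def by (auto simp: inj) (metis sur atLeastAtMost_iff One_nat_def)
 have rec: "q_pow (- int (d b)) * P (\<sigma> b) (Suc n) + (if n = 0 then 0 else q_pow (int (d b)) * P (\<sigma> b) (n - 1))
    = (\<Sum>c | adj C b c. (\<Sum>m<E b c. q_pow (int (d b) * (int (E b c) - 1 - 2 * int m))) * P (\<sigma> c) n)" if "n < N" for n b
 proof -
  have "(\<Sum>m<E b c. q_pow (int (d b) * (int (E b c) - 1 - 2 * int m)))
    = qmult X (\<sigma> b) (\<sigma> c)" if "adj C b c" for c
   using G(3)[OF that] std_mult_symmetrizer(2)[of X "\<sigma> b" "\<sigma> c"] by (auto simp: \<sigma>(3))
  hence "(\<Sum>c | adj C b c. (\<Sum>m<E b c. q_pow (int (d b) * (int (E b c) - 1 - 2 * int m))) * P (\<sigma> c) n)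
   = (\<Sum>c\<in>std_nbrs X (\<sigma> b). qmult X (\<sigma> b) c * P c n)"
   unfolding nb by (subst sum.reindex) (auto simp: inj_on_def inj)
  also have "... = q_pow (- int (d b)) * P (\<sigma> b) (Suc n) + (if n = 0 then 0 else q_pow (int (d b)) * P (\<sigma> b) (n - 1))"
   using P that r[of b] unfolding std_table_def \<sigma>(3) by presburger
  finally show ?thesis by simp
 qed
 have "\<exists>s'. \<forall>b. P (\<sigma> b) (N - 1) = (if b = s' then q_pow (std_period X - int (d b) - int (d s)) else 0)"
 proof -
  obtain s' where "s' \<in> verts X" "\<forall>b\<in>(verts X). P b (N - 1) =
    (if b = s' then q_pow (std_period X - sdeg X b - sdeg X (\<sigma> s)) else 0)"
   using P unfolding std_table_def by blast
  moreover then obtain t where "\<sigma> t = s'" using sur by blast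
  ultimately show ?thesis using r by (intro exI[of _ t]) (auto simp: inj \<sigma>(3))
 qed
 moreover have "\<forall>b. \<forall>n<N. \<forall>e. fls_nth (P (\<sigma> b) n) e ~= 0 --> - int (d s) < e \<and> e <= std_period X - int (d s)"
  using P r unfolding std_table_def \<sigma>(3) by blast
 moreover have "mesh_table s N (\<lambda>b. P (\<sigma> b))"
  unfolding mesh_table_def using p rec by simp
 ultimately show ?thesis unfolding full_table_def by blast
qed

section \<open>Classical types\<close>

definition q_term :: "int => int => rat fls" where
 "q_term e c = q_pow e * of_int c"

lemma q_term_mult: "q_pow x * q_term e c = q_term (x + e) c"
 by (simp only: q_term_def mult.assoc[symmetric] q_pow_add)

lemma q_term_zero [simp]: "q_term e 0 = 0"
 by (simp add: q_term_def)

lemma q_term_nth: "fls_nth (q_term e c) u = (if u = e then of_int c else 0)"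
 by (auto simp: q_term_def fls_X_intpow_times_conv_shift fls_of_int_nth)

text \<open>The rows of a nonnegative table cannot vanish before the end: by the recursion, a zero row would
 force the previous one to vanish.\<close>

lemma std_tableI:
 fixes P :: "nat => nat => rat fls"
 assumes "N > 0" and s: "s \<in> verts X"
  and P0: "\<And>b. b \<in> verts X ==> P b 0 = (if b = s then 1 else 0)"
  and rec: "\<And>n b. n < N ==> b \<in> verts X ==>
   q_pow (- sdeg X b) * P b (Suc n) + (if n = 0 then 0 else q_pow (sdeg X b) * P b (n - 1))
    = (\<Sum>c\<in>std_nbrs X b. qmult X b c * P c n)"
  and "\<And>b. b \<in> verts X ==> P b N = 0"
  and s': "s' \<in> verts X" "\<And>b. b \<in> verts X ==> P b (N - 1) =
    (if b = s' then q_pow (std_period X - sdeg X b - sdeg X s) else 0)"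
  and nonneg: "\<And>n b e. b \<in> verts X ==> 0 <= fls_nth (P b n) e"
  and deg: "\<And>n b e. n < N ==> b \<in> verts X ==> fls_nth (P b n) e ~= 0 ==>
    - sdeg X s < e \<and> e <= std_period X - sdeg X s"
 shows "std_table X s N P"
 unfolding std_table_def
proof (intro conjI ballI allI impI)
 show "\<exists>s'\<in>(verts X). \<forall>b\<in>(verts X). P b (N - 1) =
    (if b = s' then q_pow (std_period X - sdeg X b - sdeg X s) else 0)"
  using s' by blast
 fix n assume "n < N"
 thus "\<exists>b\<in>(verts X). P b n ~= 0"
 proof (induction n)
  case 0
  thus ?case using P0[OF s] s by (intro bexI[of _ s]) simp_all
 next
  case (Suc n)
  show ?case
  proof (rule ccontr)
   assume "\<not> ?case"
   hence z: "P b (Suc n) = 0" if "b \<in> verts X" for b using that by blast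
   obtain b where b: "b \<in> verts X" "P b n ~= 0" using Suc by auto
   let ?d = "sdeg X b"
   have "q_pow (- ?d) * P b (Suc (Suc n)) + q_pow ?d * P b n = 0"
    using rec[OF Suc.prems b(1)] by (simp add: z std_nbrs_def)
   hence "fls_nth (q_pow (- ?d) * P b (Suc (Suc n)) + q_pow ?d * P b n) (e + ?d) = 0" for e
    by (simp only: fls_zero_nth)
   hence "fls_nth (P b (Suc (Suc n))) (e + ?d - - ?d) + fls_nth (P b n) (e + ?d - ?d) = 0" for e
    unfolding fls_plus_nth fls_nth_q_pow_mult .
   hence "fls_nth (P b n) e = 0" for e
    using nonneg[OF b(1)] by (metis add_nonneg_eq_0_iff add_diff_cancel_right')
   thus False using b(2) by (simp add: fls_eq_iff)
  qed
 qed
qed (fact assms | use deg in blast)+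

text \<open>With integer arguments, row \<open>- 1\<close> and the vertices just outside the diagram
  are available for boundary values, and the recursion has the same form at \<open>m = 0\<close> as
  elsewhere.\<close>

lemma std_table_intI:
 fixes P :: "int => int => rat fls"
 assumes "N > 0" and "s \<in> verts X"
  and "\<And>b. b \<in> verts X ==> P (int b) 0 = (if b = s then 1 else 0)"
  and neg: "\<And>b. P b (- 1) = 0"
  and rec: "\<And>b m. b \<in> verts X ==> 0 <= m ==> m < int N ==>
   q_pow (- sdeg X b) * P (int b) (m + 1) + q_pow (sdeg X b) * P (int b) (m - 1)
    = (\<Sum>c\<in>std_nbrs X b. qmult X b c * P (int c) m)"
  and "\<And>b. b \<in> verts X ==> P (int b) (int N) = 0"
  and "s' \<in> verts X" and last: "\<And>b. b \<in> verts X ==> P (int b) (int N - 1) =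
    (if b = s' then q_pow (std_period X - sdeg X b - sdeg X s) else 0)"
  and "\<And>m b e. b \<in> verts X ==> 0 <= fls_nth (P (int b) m) e"
  and deg: "\<And>m b e. 0 <= m ==> m < int N ==> b \<in> verts X ==> fls_nth (P (int b) m) e ~= 0 ==>
    - sdeg X s < e \<and> e <= std_period X - sdeg X s"
 shows "std_table X s N (\<lambda>b m. P (int b) (int m))"
proof (rule std_tableI[where s' = s'])
 show "q_pow (- sdeg X b) * P (int b) (int (Suc n))
    + (if n = 0 then 0 else q_pow (sdeg X b) * P (int b) (int (n - 1)))
   = (\<Sum>c\<in>std_nbrs X b. qmult X b c * P (int c) (int n))"
  if "n < N" "b \<in> verts X" for n b
  using rec[OF that(2), of "int n"] that(1) neg by (cases n) (simp_all add: add.commute)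
 show "- sdeg X s < e \<and> e <= std_period X - sdeg X s"
  if "n < N" "b \<in> verts X" "fls_nth (P (int b) (int n)) e ~= 0" for n b e
  using deg[of "int n"] that by simp
qed (use assms(1-3,6-9) in \<open>simp_all add: of_nat_diff\<close>)

text \<open>The indicator function of a rectangle in the coordinates \<open>m - b\<close>, \<open>m + b\<close>: the solution of the
 discrete wave equation on \<open>{1..M}\<close> with Dirichlet boundary values that starts at \<open>s\<close>.\<close>

definition wave :: "int => int => int => int => int" where
 "wave M s b m = of_bool (even (s + b + m) \<and> s - b <= m \<and> b - s <= m \<and> m <= s + b - 2 \<and> m <= 2 * M - s - b)"

text \<open>Where parity allows non-zero terms, the indicator is a product of one in
  \<open>m - b\<close> and one in \<open>m + b\<close>. So the recursion can fail only at the four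
  points just outside the corners of the rectangle, and these have \<open>m = - 1\<close>,
  \<open>m = M\<close>, \<open>b = 0\<close> or \<open>b = M + 1\<close>.\<close>

lemma wave_rec:
 assumes "1 <= s" "s <= M" "1 <= b" "b <= M" "0 <= m" "m < M"
 shows "wave M s b (m + 1) + wave M s b (m - 1) = wave M s (b - 1) m + wave M s (b + 1) m"
proof (cases "even (s + b + m)")
 case True
 hence o: "odd (s + b + (m + 1))" "odd (s + b + (m - 1))" "odd (s + (b - 1) + m)" "odd (s + (b + 1) + m)" by presburger+
 show ?thesis unfolding wave_def using o by simp
next
 case False
 hence o: "even (s + b + (m + 1))" "even (s + b + (m - 1))" "even (s + (b - 1) + m)" "even (s + (b + 1) + m)" by presburger+
 have "s - b ~= m" "b - s ~= m" "m ~= s + b - 2" "m ~= 2 * M - s - b" using False by presburger+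
 thus ?thesis unfolding wave_def using o assms by (auto simp: of_bool_def)
qed

lemma wave_boundary: "1 <= s ==> s <= M ==> wave M s 0 m = 0" "1 <= s ==> s <= M ==> wave M s (M + 1) m = 0"
 by (auto simp: wave_def)

lemma wave_zero: "1 <= s ==> s <= M ==> 1 <= b ==> b <= M ==> wave M s b 0 = of_bool (b = s)"
 "m < 0 ==> wave M s b m = 0"
 by (auto simp: wave_def)

lemma wave_end: "1 <= b ==> b <= M ==> wave M s b M = 0"
 "1 <= s ==> s <= M ==> 1 <= b ==> b <= M ==> wave M s b (M - 1) = of_bool (b = M + 1 - s)"
 by (auto simp: wave_def)

lemma wave_nonneg: "0 <= wave M s b m"
 by (simp add: wave_def)

text \<open>At the centre \<open>b\<close> of \<open>{1..2 b - 1}\<close> the wave travels in one direction only.\<close>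

lemma wave_centre:
 assumes "1 <= s" "s <= b" "0 <= m" "m < 2 * b - 1"
 shows "wave (2 * b - 1) s b (m + 1) = wave (2 * b - 1) s (b - 1) m"
  "wave (2 * b - 1) s b (m - 1) = wave (2 * b - 1) s (b + 1) m"
 using assms by (auto simp: wave_def algebra_simps) presburger+

lemma wave_symmetric: "wave (2 * n - 1) n (2 * n - b) m = wave (2 * n - 1) n b m"
proof -
 have "even (n + (2 * n - b) + m) = even (n + b + m)" by presburger
 thus ?thesis unfolding wave_def by (auto simp: of_bool_def)
qed

lemma two_term: "(\<Sum>x<2. q_pow (int 2 - 1 - 2 * int x)) = q_pow 1 + q_pow (- 1)"
 by (simp add: numeral_2_eq_2)

lemma chain_nbrs:
 assumes "dynkin_edges X = {(a, a + 1) |a. 1 <= a \<and> a < n}" "type_rank X = n" "b \<in> {1..n}" "F 0 = 0"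
 shows "(\<Sum>c\<in>std_nbrs X b. F (int c)) = F (int b - 1) + (if b = n then 0 else F (int b + 1))"
proof -
 have "std_nbrs X b = (if b = 1 then {} else {b - 1}) \<union> (if b = n then {} else {b + 1})"
  using assms(3) unfolding std_nbrs_def assms(1,2) by auto
 thus ?thesis using assms(3,4) by (auto simp: add.commute of_nat_diff)
qed

lemma std_neighbours:
 assumes "b \<in> {1..n}"
 shows "F 0 = 0 ==> (\<Sum>c\<in>std_nbrs (TypeA n) b. F (int c)) = F (int b - 1) + (if b = n then 0 else F (int b + 1))"
  "F 0 = 0 ==> (\<Sum>c\<in>std_nbrs (TypeB n) b. F (int c)) = F (int b - 1) + (if b = n then 0 else F (int b + 1))"
  "F 0 = 0 ==> (\<Sum>c\<in>std_nbrs (TypeC n) b. F (int c)) = F (int b - 1) + (if b = n then 0 else F (int b + 1))"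
 by (rule chain_nbrs; use assms in simp)+

text \<open>Multiplying row \<open>m\<close> of an integer solution by \<open>q_pow m\<close>
  absorbs the factors \<open>q_pow (- 1)\<close> and \<open>q_pow 1\<close> of the
  recursion.\<close>

lemma simply_laced_table:
 fixes V :: "int => int => int"
 assumes sym: "\<And>a. std_symmetrizer X a = 1" and N: "N > 0" and T: "std_period X = int N + 1"
  and s: "s \<in> verts X"
  and V0: "\<And>b. b \<in> verts X ==> V (int b) 0 = of_bool (b = s)"
  and neg: "\<And>b. V b (- 1) = 0"
  and rec: "\<And>b m. b \<in> verts X ==> 0 <= m ==> m < int N ==>
   V (int b) (m + 1) + V (int b) (m - 1) = (\<Sum>c\<in>std_nbrs X b. V (int c) m)"
  and VN: "\<And>b. b \<in> verts X ==> V (int b) (int N) = 0"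
  and last: "s' \<in> verts X" "\<And>b. b \<in> verts X ==> V (int b) (int N - 1) = of_bool (b = s')"
  and nonneg: "\<And>m b. b \<in> verts X ==> 0 <= V (int b) m"
 shows "\<exists>P. std_table X s N P"
proof
 let ?P = "\<lambda>b m. q_term m (V b m)"
 have m: "std_mult X b c = 1" for b c by (simp add: std_mult_def sym)
 show "std_table X s N (\<lambda>b m. ?P (int b) (int m))"
 proof (rule std_table_intI[OF N s _ _ _ _ last(1)])
  show "q_pow (- sdeg X b) * ?P (int b) (m + 1) + q_pow (sdeg X b) * ?P (int b) (m - 1)
    = (\<Sum>c\<in>std_nbrs X b. qmult X b c * ?P (int c) m)"
   if "b \<in> verts X" "0 <= m" "m < int N" for m b
  proof -
   have "qmult X b c = 1" for c by (simp add: m)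
   moreover have "q_pow (- 1) * ?P (int b) (m + 1) + q_pow 1 * ?P (int b) (m - 1) = q_term m (V (int b) (m + 1) + V (int b) (m - 1))"
    unfolding q_term_mult by (simp add: q_term_def distrib_left)
   moreover have "q_term m (V (int b) (m + 1) + V (int b) (m - 1)) = (\<Sum>c\<in>std_nbrs X b. ?P (int c) m)"
    unfolding rec[OF that] by (simp only: q_term_def of_int_sum sum_distrib_left)
   ultimately show ?thesis by (simp only: sym of_nat_1 mult_1_left)
  qed
  show "?P (int b) (int N - 1) = (if b = s' then q_pow (std_period X - sdeg X b - sdeg X s) else 0)"
   if "b \<in> verts X" for b
   unfolding last(2)[OF that] sym by (simp add: T q_term_def)
 qed (use neg V0 VN nonneg in \<open>auto simp: T sym q_term_nth q_term_def split: if_splits\<close>)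
qed

text \<open>After reflection at the ends, the wave from \<open>s\<close> is concentrated at the
  mirror image \<open>n + 1 - s\<close> in the last row.\<close>

lemma table_A:
 assumes n: "1 <= n" and s: "s \<in> {1..n}"
 shows "\<exists>P. std_table (TypeA n) s n P"
proof (rule simply_laced_table[where V = "wave (int n) (int s)" and s' = "n + 1 - s"])
 have R: "1 <= int s" "int s <= int n" using s by auto
 show "wave (int n) (int s) (int b) (m + 1) + wave (int n) (int s) (int b) (m - 1) = (\<Sum>c\<in>std_nbrs (TypeA n) b. wave (int n) (int s) (int c) m)"
  if "b \<in> {1..type_rank (TypeA n)}" "0 <= m" "m < int n" for b m
  using that wave_boundary[OF R, of m] wave_rec[OF R, of "int b" m]
  by (subst std_neighbours) (auto simp: add.commute)
 show "wave (int n) (int s) (int b) (int n - 1) = of_bool (b = n + 1 - s)" if "b \<in> {1..type_rank (TypeA n)}" for b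
  using that s wave_end(2)[OF R, of "int b"] by auto
qed (use n s in \<open>auto simp: std_period_def wave_zero wave_end(1) wave_nonneg\<close>)

text \<open>Type \<open>B\<^sub>n\<close> arises from \<open>A\<^sub>2\<^sub>n\<^sub>-\<^sub>1\<close> by folding; the reflected half of the
 wave is multiplied by \<open>q\<^sup>-\<^sup>2\<close>.\<close>

lemma table_B:
 assumes n: "2 <= n" and s: "s \<in> {1..n}"
 shows "\<exists>P. std_table (TypeB n) s (2 * n - 1) P \<and>
  (s = n --> (\<forall>m e e'. fls_nth (P n m) e ~= 0 --> fls_nth (P n m) e' ~= 0 --> e = e'))"
proof (intro exI conjI)
 define M where "M = 2 * int n - 1"
 have N: "int (2 * n - 1) = M" using n by (simp add: M_def of_nat_diff)
 have R: "1 <= int s" "int s <= M" using s n by (auto simp: M_def)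
 let ?w = "\<lambda>b m. wave M (int s) b m"
 \<comment> \<open>The reflected half. For \<open>s = n\<close> the source is its own mirror image
   and the wave is symmetric already, so it is not to be counted twice; this leaves one exponent per
   row at \<open>n\<close>.\<close>
 define y where "y b m = (if s < n then ?w (2 * int n - b) m else 0)" for b m
 let ?P = "\<lambda>b m. q_term (2 * m) (?w b m) + q_term (2 * m - 2) (y b m)"
 have z: "?w 0 m = 0" "y 0 m = 0" "?w b (- 1) = 0" "y b (- 1) = 0" for b m
  using wave_boundary[OF R, of m] by (simp_all add: M_def y_def wave_zero(2))
 have T: "std_period (TypeB n) = 4 * int n - 2" using n by (simp add: std_period_def of_nat_diff)
 show "std_table (TypeB n) s (2 * n - 1) (\<lambda>b m. ?P (int b) (int m))"
 proof (rule std_table_intI[where s' = s])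
  fix b m assume b: "b \<in> {1..type_rank (TypeB n)}" and m: "0 <= m" "m < int (2 * n - 1)"
  hence b': "b \<in> {1..n}" "1 <= int b" "int b <= M" "1 <= 2 * int n - int b" "2 * int n - int b <= M" and mM: "m < M"
   using n by (auto simp: M_def)
  show "q_pow (- sdeg (TypeB n) b) * ?P (int b) (m + 1) + q_pow (sdeg (TypeB n) b) * ?P (int b) (m - 1)
    = (\<Sum>c\<in>std_nbrs (TypeB n) b. qmult (TypeB n) b c * ?P (int c) m)"
  proof (cases "b < n")
   case True
   have "?w (int b) (m + 1) + ?w (int b) (m - 1) = ?w (int b - 1) m + ?w (int b + 1) m"
    "y (int b) (m + 1) + y (int b) (m - 1) = y (int b - 1) m + y (int b + 1) m"
    using wave_rec[OF R b'(2,3) m(1) mM] wave_rec[OF R b'(4,5) m(1) mM] by (simp_all add: y_def algebra_simps)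
   note r = this[THEN arg_cong[where f = rat_of_int], unfolded of_int_add]
   have mult: "qmult (TypeB n) b c = 1" for c
    using True by (simp add: std_mult_def)
   have sy: "sdeg (TypeB n) b = 2" using True by simp
   have "(\<Sum>c\<in>std_nbrs (TypeB n) b. ?P (int c) m) = ?P (int b - 1) m + ?P (int b + 1) m"
    by (subst std_neighbours[OF b'(1), where F = "\<lambda>c. ?P c m"]) (use True in \<open>simp_all add: z\<close>)
   thus ?thesis unfolding mult mult_1_left sy
    by (simp only: distrib_left distrib_right q_term_mult) (intro fls_eqI, use r in \<open>auto simp: q_term_nth\<close>)
  next
   case False
   hence bn: "b = n" using b by auto
   have "?w (int n) (m + 1) = ?w (int n - 1) m" "?w (int n) (m - 1) = ?w (int n + 1) m"
    "s = n ==> ?w (int n + 1) m = ?w (int n - 1) m"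
    using wave_centre[of "int s" "int n" m] wave_symmetric[of "int n" "int n - 1" m] s m(1) mM by (simp_all add: M_def)
   note r = this(1,2) this(3)[OF le_antisym]
   have "std_mult (TypeB n) n c = 2" if "c \<in> std_nbrs (TypeB n) n" for c
    using that by (auto simp: std_mult_def std_nbrs_def)
   hence "(\<Sum>c\<in>std_nbrs (TypeB n) n. qmult (TypeB n) n c * ?P (int c) m)
     = (\<Sum>c\<in>std_nbrs (TypeB n) n. (q_pow 1 + q_pow (- 1)) * ?P (int c) m)"
    by (intro sum.cong refl) (simp only: two_term)
   also have "... = (q_pow 1 + q_pow (- 1)) * ?P (int n - 1) m"
    by (subst std_neighbours(2)[where F = "\<lambda>c. (q_pow 1 + q_pow (- 1)) * ?P c m"]) (use n in \<open>simp_all add: z\<close>)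
   finally show ?thesis
    unfolding bn by (simp only: distrib_left distrib_right q_term_mult) (intro fls_eqI, use r s in
     \<open>auto simp: q_term_nth y_def algebra_simps\<close>)
  qed
 next
  fix b assume "b \<in> {1..type_rank (TypeB n)}"
  hence b: "1 <= int b" "int b <= M" "1 <= 2 * int n - int b" "2 * int n - int b <= M" "b <= n" using n by (auto simp: M_def)
  have y0: "y (int b) 0 = 0" using wave_zero(1)[OF R b(3,4)] b(5) by (auto simp: y_def M_def)
  show "?P (int b) 0 = (if b = s then 1 else 0)"
   unfolding y0 wave_zero(1)[OF R b(1,2)] by (simp add: q_term_def)
  show "?P (int b) (int (2 * n - 1)) = 0"
   unfolding N y_def wave_end(1)[OF b(1,2)] wave_end(1)[OF b(3,4)] by simp
  show "?P (int b) (int (2 * n - 1) - 1)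
    = (if b = s then q_pow (std_period (TypeB n) - sdeg (TypeB n) b - sdeg (TypeB n) s) else 0)"
   unfolding N y_def wave_end(2)[OF R b(1,2)] wave_end(2)[OF R b(3,4)] using b s
   by (auto simp: T M_def q_term_def)
  show "0 <= fls_nth (?P (int b) m) e" for m e by (simp add: y_def q_term_nth wave_nonneg)
  fix m e assume m: "0 <= m" "m < int (2 * n - 1)" and e: "fls_nth (?P (int b) m) e ~= 0"
  have "e = 2 * m \<or> s < n \<and> e = 2 * m - 2 \<and> m ~= 0"
   using e y0 by (auto simp: q_term_nth y_def split: if_splits)
  thus "- sdeg (TypeB n) s < e \<and> e <= std_period (TypeB n) - sdeg (TypeB n) s"
   using m n s by (auto simp: T N M_def)
 qed (use n s z in auto)
 show "s = n --> (\<forall>m e e'. fls_nth (?P (int n) (int m)) e ~= 0 --> fls_nth (?P (int n) (int m)) e' ~= 0 --> e = e')"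
  by (auto simp: y_def q_term_nth split: if_splits)
qed

text \<open>Here the reflected half of the wave is multiplied by \<open>q\<^sup>2\<close>, and at the fixed vertex the sum of both
 halves is divided by \<open>q + q\<^sup>-\<^sup>1\<close>.\<close>

lemma table_C:
 assumes n: "3 <= n" and s: "s \<in> {1..n}"
 shows "\<exists>P. std_table (TypeC n) s (2 * n - 1) P"
proof
 define M where "M = 2 * int n - 1"
 have N: "int (2 * n - 1) = M" using n by (simp add: M_def of_nat_diff)
 have R: "1 <= int s" "int s <= M" using s n by (auto simp: M_def)
 let ?w = "\<lambda>b m. wave M (int s) b m"
 define v where "v b m = ?w (2 * int n - b) m" for b m
 \<comment> \<open>Normalises row 0 to exponent 0: a source below \<open>n\<close> has exponent
   \<open>m + k\<close>, the source \<open>n\<close> has \<open>m + k + 1\<close>.\<close>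
 define k where "k = (if s < n then 0 else - 1 :: int)"
 let ?Q = "\<lambda>b m. q_term (m + k) (?w b m) + q_term (m + k + 2) (v b m)"
 let ?P = "\<lambda>b m. if b < int n then ?Q b m else q_term (m + k + 1) (?w (int n) m)"
 have z: "?w 0 m = 0" "v 0 m = 0" "?w b (- 1) = 0" "v b (- 1) = 0" for b m
  using wave_boundary[OF R, of m] by (simp_all add: M_def v_def wave_zero(2))
 have T: "std_period (TypeC n) = 2 * int n + 2" by (simp add: std_period_def)
 show "std_table (TypeC n) s (2 * n - 1) (\<lambda>b m. ?P (int b) (int m))"
 proof (rule std_table_intI[where s' = s])
  fix b m assume b: "b \<in> {1..type_rank (TypeC n)}" and m: "0 <= m" "m < int (2 * n - 1)"
  hence b': "b \<in> {1..n}" "1 <= int b" "int b <= M" "1 <= 2 * int n - int b" "2 * int n - int b <= M" and mM: "m < M"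
   using n by (auto simp: M_def)
  \<comment> \<open>On an edge to the long vertex, the factor \<open>q_pow 1 + q_pow (- 1)\<close>
    undoes the division there, and the recursion becomes that of the unfolded chain.\<close>
  have mult: "qmult (TypeC n) b c * ?P (int c) m
    = (if b < n then ?Q (int c) m else ?P (int c) m)" if "c \<in> std_nbrs (TypeC n) b" for c
  proof (cases "c = n \<and> b < n")
   case True
   hence "std_mult (TypeC n) b c = 2" by (simp add: std_mult_def)
   thus ?thesis using True
    by (simp only: two_term distrib_right q_term_mult less_irrefl if_False if_True refl simp_thms) (intro fls_eqI, auto simp: v_def q_term_nth)
  next
   case False
   hence "std_mult (TypeC n) b c = 1" using b by (auto simp: std_mult_def)
   thus ?thesis using False that by (auto simp: std_nbrs_def)
  qed
  have sum: "(\<Sum>c\<in>std_nbrs (TypeC n) b. qmult (TypeC n) b c * ?P (int c) m)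
    = (\<Sum>c\<in>std_nbrs (TypeC n) b. if b < n then ?Q (int c) m else ?P (int c) m)"
   by (rule sum.cong[OF refl mult])
  show "q_pow (- sdeg (TypeC n) b) * ?P (int b) (m + 1) + q_pow (sdeg (TypeC n) b) * ?P (int b) (m - 1)
    = (\<Sum>c\<in>std_nbrs (TypeC n) b. qmult (TypeC n) b c * ?P (int c) m)"
  proof (cases "b < n")
   case True
   have "?w (int b) (m + 1) + ?w (int b) (m - 1) = ?w (int b - 1) m + ?w (int b + 1) m"
    "v (int b) (m + 1) + v (int b) (m - 1) = v (int b - 1) m + v (int b + 1) m"
    using wave_rec[OF R b'(2,3) m(1) mM] wave_rec[OF R b'(4,5) m(1) mM] by (simp_all add: v_def algebra_simps)
   note r = this[THEN arg_cong[where f = rat_of_int], unfolded of_int_add]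
   have sy: "sdeg (TypeC n) b = 1" using True by simp
   have "(\<Sum>c\<in>std_nbrs (TypeC n) b. ?Q (int c) m) = ?Q (int b - 1) m + ?Q (int b + 1) m"
    by (subst std_neighbours(3)[OF b'(1), where F = "\<lambda>c. ?Q c m"]) (use True in \<open>simp_all add: z\<close>)
   thus ?thesis unfolding sum sy using True
    by (simp only: if_True of_nat_less_iff distrib_left q_term_mult) (intro fls_eqI, use r in \<open>auto simp: q_term_nth\<close>)
  next
   case False
   hence bn: "b = n" using b by auto
   have r: "?w (int n) (m + 1) = ?w (int n - 1) m" "?w (int n) (m - 1) = v (int n - 1) m"
    using wave_centre[of "int s" "int n" m] s m(1) mM by (simp_all add: M_def v_def algebra_simps)
   have "(\<Sum>c\<in>std_nbrs (TypeC n) n. ?P (int c) m) = ?P (int n - 1) m"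
    by (subst std_neighbours(3)[where F = "\<lambda>c. ?P c m"]) (use n in \<open>simp_all add: z\<close>)
   thus ?thesis unfolding sum unfolding bn using r
    by (simp only: less_irrefl if_False q_term_mult) (intro fls_eqI, auto simp: q_term_nth)
  qed
 next
  fix b assume "b \<in> {1..type_rank (TypeC n)}"
  hence b: "1 <= int b" "int b <= M" "1 <= 2 * int n - int b" "2 * int n - int b <= M" "b <= n" using n by (auto simp: M_def)
  have b': "\<not> b < n ==> b = n" using b by simp
  show "?P (int b) 0 = (if b = s then 1 else 0)"
   using wave_zero(1)[OF R b(1,2)] wave_zero(1)[OF R b(3,4)] b s b' by (auto simp: v_def k_def q_term_def)
  show "?P (int b) (int (2 * n - 1)) = 0"
   unfolding N v_def using wave_end(1)[OF b(1,2)] wave_end(1)[OF b(3,4)] b' by auto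
  show "?P (int b) (int (2 * n - 1) - 1)
    = (if b = s then q_pow (std_period (TypeC n) - sdeg (TypeC n) b - sdeg (TypeC n) s) else 0)"
   unfolding N v_def using wave_end(2)[OF R b(1,2)] wave_end(2)[OF R b(3,4)] b s b'
   by (auto simp: T M_def k_def q_term_def)
  show "0 <= fls_nth (?P (int b) m) e" for m e by (simp add: v_def q_term_nth wave_nonneg)
  show "- sdeg (TypeC n) s < e \<and> e <= std_period (TypeC n) - sdeg (TypeC n) s"
   if "0 <= m" "m < int (2 * n - 1)" "fls_nth (?P (int b) m) e ~= 0" for m e
   using that n s by (auto simp: T k_def q_term_nth split: if_splits)
 qed (use n s z in auto)
qed

lemma D_nbrs:
 assumes n: "4 <= n" and b: "b \<in> {1..n}" and F: "F 0 = 0"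
 shows "(\<Sum>c\<in>std_nbrs (TypeD n) b. F (int c)) = (if b = n then F (int n - 2) else F (int b - 1))
   + (if b < n - 1 then F (int b + 1) else 0) + (if b = n - 2 then F (int n) else 0)"
proof -
 obtain k where k: "n = k + 4" using n by (metis add.commute le_Suc_ex)
 consider "b = 1" | "b = n" | "b ~= 1" "b < n" using b by force
 hence "std_nbrs (TypeD n) b = (if b = 1 then {} else if b = n then {n - 2} else {b - 1})
   \<union> (if b < n - 1 then {b + 1} else {}) \<union> (if b = n - 2 then {n} else {})"
  using b unfolding std_nbrs_def by cases (auto simp: k)
 thus ?thesis using b F by (auto simp: k of_nat_diff add_ac)
qed

text \<open>The solution of the wave equation on the chain \<open>1, ..., n - 2\<close> is continued by \<open>Q\<close>, which is split
 into \<open>S (n - 1)\<close> and \<open>S n\<close> on the two spin vertices.\<close>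

lemma table_D_of_chain:
 fixes Q S :: "int => int => int" and n :: nat
 defines "V \<equiv> \<lambda>b m. if b <= int n - 2 then Q b m else S b m"
 assumes n: "4 <= n" and s: "s \<in> {1..n}" "s' \<in> {1..n}"
  and z: "\<And>m. Q 0 m = 0" and neg: "\<And>b. V b (- 1) = 0"
  and rec: "\<And>b m. 1 <= b ==> b <= int n - 2 ==> 0 <= m ==> m < 2 * int n - 3 ==> Q b (m + 1) + Q b (m - 1) = Q (b - 1) m + Q (b + 1) m"
  and sum: "\<And>m. 0 <= m ==> m < 2 * int n - 3 ==> S (int n - 1) m + S (int n) m = Q (int n - 1) m"
  and spin: "\<And>b m. b = int n - 1 \<or> b = int n ==> 0 <= m ==> m < 2 * int n - 3 ==> S b (m + 1) + S b (m - 1) = Q (int n - 2) m"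
  and "\<And>b. b \<in> {1..n} ==> V (int b) 0 = of_bool (b = s)" "\<And>b. b \<in> {1..n} ==> V (int b) (2 * int n - 3) = 0"
   "\<And>b. b \<in> {1..n} ==> V (int b) (2 * int n - 3 - 1) = of_bool (b = s')" "\<And>b m. 0 <= V b m"
 shows "\<exists>P. std_table (TypeD n) s (2 * n - 3) P"
proof (rule simply_laced_table[where V = V and s' = s'])
 have N: "int (2 * n - 3) = 2 * int n - 3" using n by (simp add: of_nat_diff)
 show "V (int b) (m + 1) + V (int b) (m - 1) = (\<Sum>c\<in>std_nbrs (TypeD n) b. V (int c) m)"
  if b: "b \<in> {1..type_rank (TypeD n)}" and m: "0 <= m" "m < int (2 * n - 3)" for b m
 proof -
  have b': "b \<in> {1..n}" and m': "m < 2 * int n - 3" using b m N by simp_all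
  have V: "V x k = Q x k" if "x <= int n - 2" for x k using that by (simp add: V_def)
  have V': "V x k = S x k" if "\<not> x <= int n - 2" for x k using that by (simp add: V_def)
  have nb: "(\<Sum>c\<in>std_nbrs (TypeD n) b. V (int c) m) = (if b = n then V (int n - 2) m else V (int b - 1) m)
   + (if b < n - 1 then V (int b + 1) m else 0) + (if b = n - 2 then V (int n) m else 0)"
   by (rule D_nbrs[OF n b', where F = "\<lambda>c. V c m"]) (use n z in \<open>simp add: V\<close>)
  consider "b < n - 2" | "b = n - 2" | "b = n - 1" | "b = n" using b' by force
  thus ?thesis
  proof cases
   case 1
   thus ?thesis unfolding nb using rec[of "int b" m] b' m' m(1) by (auto simp: V)
  next
   case 2
   hence e: "int b = int n - 2" using n by simp
   show ?thesis unfolding nb e using rec[of "int n - 2" m] sum[OF m(1) m'] 2 n m' m(1) by (auto simp: V V')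
  next
   case 3
   hence e: "int b = int n - 1" using n by simp
   show ?thesis unfolding nb e using spin[of "int n - 1" m] 3 n m' m(1) by (auto simp: V V')
  next
   case 4
   thus ?thesis unfolding nb using spin[of "int n" m] n m' m(1) by (auto simp: V V')
  qed
 qed
qed (use assms in \<open>auto simp: std_period_def of_nat_diff\<close>)

lemma table_D:
 assumes n: "4 <= n" and s: "s \<in> {1..n}"
 shows "\<exists>P. std_table (TypeD n) s (2 * n - 3) P"
proof -
 define c where "c = int n - 1"
 have M: "2 * int n - 3 = 2 * c - 1" "int n - 2 = c - 1" "int n - 1 = c" "1 <= c" using n by (simp_all add: c_def)
 show ?thesis
 proof (cases "s <= n - 2")
  case True
  \<comment> \<open>The wave on the chain of \<open>2 * c - 1\<close> vertices is made symmetric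
    about the centre \<open>c\<close>; each spin vertex receives half of the resulting value
    there.\<close>
  let ?w = "wave (2 * c - 1) (int s)"
  have R: "1 <= int s" "int s <= 2 * c - 1" "int s < c" using s True n by (auto simp: c_def)
  show ?thesis
  proof (rule table_D_of_chain[OF n s s, where Q = "\<lambda>b m. ?w b m + ?w (2 * c - b) m" and S = "\<lambda>b. ?w c"], unfold M)
   show "?w b (m + 1) + ?w (2 * c - b) (m + 1) + (?w b (m - 1) + ?w (2 * c - b) (m - 1))
     = ?w (b - 1) m + ?w (2 * c - (b - 1)) m + (?w (b + 1) m + ?w (2 * c - (b + 1)) m)"
    if "1 <= b" "b <= c - 1" "0 <= m" "m < 2 * c - 1" for b m
    using wave_rec[OF R(1,2), of b m] wave_rec[OF R(1,2), of "2 * c - b" m] that by (simp add: algebra_simps)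
   show "?w c (m + 1) + ?w c (m - 1) = ?w (c - 1) m + ?w (2 * c - (c - 1)) m" if "0 <= m" "m < 2 * c - 1" for m
    using wave_rec[OF R(1,2), of c m] M(4) that by (simp add: algebra_simps)
   fix b assume "b \<in> {1..n}"
   hence b: "int b <= c - 1 ==> 1 <= 2 * c - int b \<and> 2 * c - int b <= 2 * c - 1" "1 <= int b" "\<not> int b <= c - 1 ==> b ~= s"
    using R(3) by auto
   show "(if int b <= c - 1 then ?w (int b) 0 + ?w (2 * c - int b) 0 else ?w c 0) = of_bool (b = s)"
    using wave_zero(1)[OF R(1,2), of "int b"] wave_zero(1)[OF R(1,2), of "2 * c - int b"] wave_zero(1)[OF R(1,2), of c] b R M(4) by auto
   show "(if int b <= c - 1 then ?w (int b) (2 * c - 1) + ?w (2 * c - int b) (2 * c - 1) else ?w c (2 * c - 1)) = 0"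
    using b M(4) by (auto simp: wave_end(1))
   show "(if int b <= c - 1 then ?w (int b) (2 * c - 1 - 1) + ?w (2 * c - int b) (2 * c - 1 - 1) else ?w c (2 * c - 1 - 1)) = of_bool (b = s)"
    using wave_end(2)[OF R(1,2), of "int b"] wave_end(2)[OF R(1,2), of "2 * c - int b"] wave_end(2)[OF R(1,2), of c] b R M(4) by auto
  qed (use wave_boundary[OF R(1,2)] wave_nonneg in \<open>auto simp: wave_zero(2)\<close>)
 next
  case False
  let ?w = "wave (2 * c - 1) c"
  \<comment> \<open>The wave from the centre has the value 1 at the centre in every even row up to
    \<open>2 * c - 2\<close>. The two spin vertices share these rows alternately, the source taking
    those divisible by 4.\<close>
  let ?S = "\<lambda>b m. of_bool (0 <= m \<and> m <= 2 * c - 2 \<and> even m \<and> ((b = int s) = (4 dvd m))) :: int"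
  have R: "1 <= c" "c <= 2 * c - 1" using n by (auto simp: c_def)
  have ss: "int s = c \<or> int s = c + 1" using False s n by (auto simp: c_def)
  \<comment> \<open>The last row is \<open>2 * c - 2\<close>, divisible by 4 iff \<open>n\<close> is
    even; for odd \<open>n\<close> the two spin vertices are exchanged.\<close>
  define s' where "s' = (if even n then s else 2 * n - 1 - s)"
  have s': "s' \<in> {1..n}" using False s n by (auto simp: s'_def)
  show ?thesis
  proof (rule table_D_of_chain[OF n s s', where Q = ?w and S = ?S], unfold M)
   show "?w b (m + 1) + ?w b (m - 1) = ?w (b - 1) m + ?w (b + 1) m"
    if "1 <= b" "b <= c - 1" "0 <= m" "m < 2 * c - 1" for b m
    using wave_rec[OF R, of b m] that by simp
   show "?S c m + ?S (int n) m = ?w c m" if "0 <= m" "m < 2 * c - 1" for m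
    using that ss by (auto simp: wave_def c_def of_bool_def)
   show "?S b (m + 1) + ?S b (m - 1) = ?w (c - 1) m" if "b = c \<or> b = int n" "0 <= m" "m < 2 * c - 1" for b m
   proof (cases "even m")
    case True
    thus ?thesis by (auto simp: wave_def)
   next
    case False
    hence "(4 dvd (m + 1)) ~= (4 dvd (m - 1))" "m + 1 <= 2 * c - 2" "1 <= m" using that by presburger+
    thus ?thesis using False by (auto simp: wave_def of_bool_def)
   qed
   fix b assume b: "b \<in> {1..n}"
   show "(if int b <= c - 1 then ?w (int b) 0 else ?S (int b) 0) = of_bool (b = s)"
    using wave_zero(1)[OF R, of "int b"] b ss R by auto
   show "(if int b <= c - 1 then ?w (int b) (2 * c - 1) else ?S (int b) (2 * c - 1)) = 0"
    using b R by (auto simp: wave_end(1))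
   have "4 dvd 2 * c - 2 \<longleftrightarrow> even n" unfolding c_def by presburger
   thus "(if int b <= c - 1 then ?w (int b) (2 * c - 1 - 1) else ?S (int b) (2 * c - 1 - 1)) = of_bool (b = s')"
    using wave_end(2)[OF R, of "int b"] b ss R by (auto simp: s'_def c_def)
  qed (use wave_boundary[OF R] wave_nonneg in \<open>auto simp: wave_zero(2)\<close>)
 qed
qed

section \<open>Exceptional types\<close>

definition q_sum :: "int list => rat fls" where
 "q_sum L = (\<Sum>e\<leftarrow>L. q_pow e)"

lemma q_sum_append: "q_sum (L @ L') = q_sum L + q_sum L'"
 by (simp add: q_sum_def)

lemma q_sum_concat: "q_sum (concat Ls) = (\<Sum>L\<leftarrow>Ls. q_sum L)"
 by (induction Ls) (simp_all add: q_sum_append, simp add: q_sum_def)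

lemma q_sum_shift: "q_sum (map (\<lambda>e. e + x) L) = q_pow x * q_sum L"
proof (induction L)
 case (Cons e L)
 thus ?case unfolding q_sum_def list.map sum_list.Cons distrib_left q_pow_add by (simp only: add.commute)
qed (simp add: q_sum_def)

lemma q_sum_nth: "fls_nth (q_sum L) u = of_nat (count (mset L) u)"
 by (induction L) (auto simp: q_sum_def q_pow_nth simp del: fls_shift_nth)

lemma q_sum_mset: "mset L = mset L' ==> q_sum L = q_sum L'"
 unfolding q_sum_def by (metis mset_map sum_mset_sum_list)

text \<open>The entries of a table are represented by the lists of their exponents. The lists \<open>nb\<close> and \<open>d\<close>
 contain the neighbours and the symmetrizers of the vertices \<open>1, 2, ...\<close>, which are numbered from \<open>0\<close>
 here.\<close>

definition exps_rhs :: "nat list list => nat list => int list list => nat => int list" where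
 "exps_rhs nb d v b = concat (map (\<lambda>c. let k = (if d ! b < d ! c then d ! c else 1) in
   concat (map (\<lambda>x. map (\<lambda>e. e + (int k - 1 - 2 * int x)) (v ! c)) [0..<k])) (nb ! b))"

text \<open>Subtraction of Laurent polynomials as a difference of multisets; the comparison of
  lengths in \<open>exps_run\<close> guarantees that every exponent to be removed is
  present.\<close>

definition exps_diff :: "nat list list => nat list => int list list => int list list => nat => int list" where
 "exps_diff nb d u v b = fold remove1 (map (\<lambda>e. e + int (d ! b)) (u ! b)) (exps_rhs nb d v b)"

definition exps_next :: "nat list list => nat list => int list list => int list list => int list list" where
 "exps_next nb d u v = map (\<lambda>b. map (\<lambda>e. e + int (d ! b)) (exps_diff nb d u v b)) [0..<length d]"

fun exps_run :: "nat list list => nat list => int => nat => nat => int list list => int list list => bool" where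
 "exps_run nb d T s 0 u v \<longleftrightarrow> (\<forall>b\<in>set [0..<length d]. v ! b = [])"
| "exps_run nb d T s (Suc N) u v \<longleftrightarrow>
   (\<forall>b\<in>set [0..<length d]. length (exps_diff nb d u v b) + length (u ! b) = length (exps_rhs nb d v b) \<and>
    (\<forall>e\<in>set (v ! b). - int (d ! s) < e \<and> e <= T - int (d ! s))) \<and>
   (N = 0 --> (\<exists>s'\<in>set [0..<length d]. \<forall>b\<in>set [0..<length d].
    v ! b = (if b = s' then [T - int (d ! b) - int (d ! s)] else []))) \<and>
   exps_run nb d T s N v (exps_next nb d u v)"

definition exps_check :: "nat list list => nat list => int => nat => bool" where
 "exps_check nb d T N \<longleftrightarrow> (\<forall>s\<in>set [0..<length d].
   exps_run nb d T s N (map (\<lambda>b. []) d) (map (\<lambda>b. if b = s then [0] else []) [0..<length d]))"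

text \<open>The lengths add up only if each \<open>remove1\<close> has found its element.\<close>

lemma q_sum_fold_remove1:
 assumes "length (fold remove1 ys xs) + length ys = length xs"
 shows "q_sum (fold remove1 ys xs) + q_sum ys = q_sum xs"
proof -
 have m: "mset (fold remove1 ys xs) = mset xs - mset ys" by (induction ys arbitrary: xs) auto
 hence "size (mset xs) = size ((mset xs - mset ys) + mset ys)" using assms by (metis size_mset size_union)
 hence "mset xs = (mset xs - mset ys) + mset ys"
  by (metis mset_subset_size nless_le subset_mset.le_less subset_eq_diff_conv subset_mset.order_refl)
 hence "mset (fold remove1 ys xs @ ys) = mset xs" using m by simp
 thus ?thesis unfolding q_sum_append[symmetric] by (rule q_sum_mset)
qed

text \<open>\<open>exps_run\<close> carries along just two consecutive rows; here \<open>V m\<close>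
  is row \<open>m\<close> and \<open>U m\<close> the row before it.\<close>

lemma exps_run_rows:
 assumes U: "\<And>m. U (Suc m) = V m" and V: "\<And>m. V (Suc m) = exps_next nb d (U m) (V m)"
  and run: "exps_run nb d T s N (U 0) (V 0)"
 shows "m < N ==> \<forall>b<length d. length (exps_diff nb d (U m) (V m) b) + length (U m ! b) = length (exps_rhs nb d (V m) b) \<and>
    (\<forall>e\<in>set (V m ! b). - int (d ! s) < e \<and> e <= T - int (d ! s))" (is "_ ==> ?G m")
  and "\<forall>b<length d. V N ! b = []" (is "?Z N")
  and "N > 0 ==> \<exists>s'<length d. \<forall>b<length d. V (N - 1) ! b = (if b = s' then [T - int (d ! b) - int (d ! s)] else [])"
   (is "_ ==> ?F (N - 1)")
proof -
 have Suc_D: "?G k" "N = 0 ==> ?F k" "exps_run nb d T s N (U (Suc k)) (V (Suc k))"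
  if "exps_run nb d T s (Suc N) (U k) (V k)" for N k
  using that by (auto simp: U V)
 have "(m < N --> ?G (k + m)) \<and> ?Z (k + N) \<and> (N > 0 --> ?F (k + N - 1))"
  if "exps_run nb d T s N (U k) (V k)" for N m k
  using that
 proof (induction N arbitrary: k m)
  case (Suc N)
  note S = Suc_D[OF Suc.prems]
  note I = Suc.IH[OF S(3)]
  have "?G (k + m)" if "m < Suc N" using I[of "m - 1"] S(1) that by (cases m) simp_all
  moreover have "?F (k + N)" using I S(2) by (cases "N = 0") simp_all
  ultimately show ?case using I by simp
 qed simp
 from this[OF run] show "m < N ==> ?G m" "?Z N" "N > 0 ==> ?F (N - 1)" by simp_all
qed

primrec exps_iter :: "nat list list => nat list => nat => nat => int list list \<times> int list list" where
 "exps_iter nb d s 0 = (map (\<lambda>b. []) d, map (\<lambda>b. if b = s then [0] else []) [0..<length d])"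
| "exps_iter nb d s (Suc m) = (snd (exps_iter nb d s m), exps_next nb d (fst (exps_iter nb d s m)) (snd (exps_iter nb d s m)))"

definition nbr_lists :: "dynkin_type => nat list list" where
 "nbr_lists X = map (\<lambda>b. filter (\<lambda>c. (Suc b, Suc c) \<in> dynkin_edges X \<or> (Suc c, Suc b) \<in> dynkin_edges X)
   [0..<type_rank X]) [0..<type_rank X]"

definition sym_list :: "dynkin_type => nat list" where
 "sym_list X = map (\<lambda>b. std_symmetrizer X (Suc b)) [0..<type_rank X]"

lemma exps_table:
 assumes nb: "nbr_lists X = nb" and d: "sym_list X = d"
  and T: "std_period X = T" and chk: "exps_check nb d T N" and N: "N > 0" and s: "s \<in> verts X"
 shows "std_table X s N (\<lambda>b m. q_sum (snd (exps_iter nb d (s - 1) m) ! (b - 1)))"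
proof -
 have rank: "length d = type_rank X" and d: "\<And>b. b < type_rank X ==> d ! b = std_symmetrizer X (Suc b)"
  using d by (auto simp: sym_list_def)
 have nb: "std_nbrs X (Suc b) = Suc ` set (nb ! b) \<and> distinct (nb ! b)" if "b < type_rank X" for b
 proof -
  have "(verts X) = Suc ` {..<type_rank X}" by (simp add: image_Suc_lessThan)
  thus ?thesis using that unfolding nb[symmetric] nbr_lists_def std_nbrs_def by auto
 qed
 note chk = chk[folded T]
 define U V where "U m = fst (exps_iter nb d (s - 1) m)" and "V m = snd (exps_iter nb d (s - 1) m)" for m
 have U: "U (Suc m) = V m" and V: "V (Suc m) = exps_next nb d (U m) (V m)" for m by (simp_all add: U_def V_def)
 have s1: "s - 1 < type_rank X" "Suc (s - 1) = s" using s by auto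
 have ds: "d ! (s - 1) = std_symmetrizer X s" using d[OF s1(1)] s1(2) by simp
 have "exps_run nb d (std_period X) (s - 1) N (U 0) (V 0)"
  using chk s1(1) rank by (simp add: exps_check_def U_def V_def)
 note R = exps_run_rows[of U V, OF U V this, unfolded rank ds]
 obtain s' where s': "s' < type_rank X" "\<And>b. b < type_rank X ==> V (N - 1) ! b
   = (if b = s' then [std_period X - int (d ! b) - sdeg X s] else [])"
  using R(3)[OF N] by blast
 have q: "q_sum [] = 0" "q_sum [e] = q_pow e" for e by (simp_all add: q_sum_def)
 show ?thesis
  unfolding V_def[symmetric]
 proof (rule std_tableI[where s' = "Suc s'"])
  fix b assume "b \<in> verts X"
  hence b: "b - 1 < type_rank X" "Suc (b - 1) = b" by auto
  have db: "d ! (b - 1) = std_symmetrizer X b" using d[OF b(1)] b(2) by simp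
  have nbb: "std_nbrs X b = Suc ` set (nb ! (b - 1))" "distinct (nb ! (b - 1))" using nb[OF b(1)] b(2) by simp_all
  show "q_sum (V 0 ! (b - 1)) = (if b = s then 1 else 0)" using b s1 rank by (auto simp: V_def q)
  show "q_sum (V N ! (b - 1)) = 0" using R(2) b(1) by (simp add: q)
  show "q_sum (V (N - 1) ! (b - 1)) = (if b = Suc s' then q_pow (std_period X - sdeg X b - sdeg X s) else 0)"
   unfolding s'(2)[OF b(1)] db using b(2) by (auto simp only: q split: if_splits)
  show "0 <= fls_nth (q_sum (V m ! (b - 1))) e" for m e by (simp add: q_sum_nth)
  fix m assume m: "m < N"
  note R = R(1)[OF m, rule_format, OF b(1)]
  show "- sdeg X s < e \<and> e <= std_period X - sdeg X s"
   if "fls_nth (q_sum (V m ! (b - 1))) e ~= 0" for e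
   using R that by (auto simp: q_sum_nth)
  have n: "V (Suc m) ! (b - 1) = map (\<lambda>e. e + int (d ! (b - 1))) (exps_diff nb d (U m) (V m) (b - 1))"
   unfolding V exps_next_def using b rank by simp
  have "(if m = 0 then 0 else q_pow (sdeg X b) * q_sum (V (m - 1) ! (b - 1)))
    = q_sum (map (\<lambda>e. e + int (d ! (b - 1))) (U m ! (b - 1)))"
   unfolding q_sum_shift db using b rank by (cases m) (simp_all add: U, simp add: U_def q)
  moreover have "q_pow (- sdeg X b) * q_sum (V (Suc m) ! (b - 1)) = q_sum (exps_diff nb d (U m) (V m) (b - 1))"
   unfolding n q_sum_shift db mult.assoc[symmetric] q_pow_add by simp
  ultimately have "q_pow (- sdeg X b) * q_sum (V (Suc m) ! (b - 1)) + (if m = 0 then 0 else q_pow (sdeg X b) * q_sum (V (m - 1) ! (b - 1)))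
   = q_sum (exps_rhs nb d (V m) (b - 1))"
   using q_sum_fold_remove1[of "map (\<lambda>e. e + int (d ! (b - 1))) (U m ! (b - 1))"] R unfolding exps_diff_def by simp
  also have "... = (\<Sum>c\<leftarrow>nb ! (b - 1). let k = (if d ! (b - 1) < d ! c then d ! c else 1) in
    (\<Sum>x\<leftarrow>[0..<k]. q_pow (int k - 1 - 2 * int x)) * q_sum (V m ! c))"
   unfolding exps_rhs_def q_sum_concat map_map comp_def Let_def q_sum_shift sum_list_mult_const ..
  also have "... = (\<Sum>c\<in>set (nb ! (b - 1)). let k = (if d ! (b - 1) < d ! c then d ! c else 1) in
    (\<Sum>x\<leftarrow>[0..<k]. q_pow (int k - 1 - 2 * int x)) * q_sum (V m ! c))"
   using nbb(2) by (rule sum_list_distinct_conv_sum_set)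
  also have "... = (\<Sum>c\<in>set (nb ! (b - 1)). qmult X b (Suc c) * q_sum (V m ! (Suc c - 1)))"
  proof (intro sum.cong refl)
   fix c assume "c \<in> set (nb ! (b - 1))"
   hence "Suc c \<in> std_nbrs X b" using nbb(1) by blast
   hence c: "c < type_rank X" by (auto simp: std_nbrs_def)
   have "(if d ! (b - 1) < d ! c then d ! c else 1) = std_mult X b (Suc c)" unfolding std_mult_def db d[OF c] by simp
   thus "(let k = (if d ! (b - 1) < d ! c then d ! c else 1) in (\<Sum>x\<leftarrow>[0..<k]. q_pow (int k - 1 - 2 * int x)) * q_sum (V m ! c))
     = qmult X b (Suc c) * q_sum (V m ! (Suc c - 1))"
    by (simp add: Let_def sum_list_distinct_conv_sum_set atLeast0LessThan)
  qed
  also have "... = (\<Sum>c\<in>std_nbrs X b. qmult X b c * q_sum (V m ! (c - 1)))"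
   unfolding nbb(1) by (subst sum.reindex) auto
  finally show "q_pow (- sdeg X b) * q_sum (V (Suc m) ! (b - 1)) + (if m = 0 then 0 else q_pow (sdeg X b) * q_sum (V (m - 1) ! (b - 1)))
   = (\<Sum>c\<in>std_nbrs X b. qmult X b c * q_sum (V m ! (c - 1)))" .
 qed (use N s s' in auto)
qed

lemmas lists_simps = nbr_lists_def sym_list_def std_period_def upt_rec

lemma tables_E:
 "s \<in> {1..6} ==> \<exists>P. std_table (TypeE 6) s 11 P"
 "s \<in> {1..7} ==> \<exists>P. std_table (TypeE 7) s 17 P"
 "s \<in> {1..8} ==> \<exists>P. std_table (TypeE 8) s 29 P"
proof -
 have "exps_check [[2], [3], [0, 3], [1, 2, 4], [3, 5], [4]] [1, 1, 1, 1, 1, 1] 12 11"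
  "exps_check [[2], [3], [0, 3], [1, 2, 4], [3, 5], [4, 6], [5]] [1, 1, 1, 1, 1, 1, 1] 18 17"
  "exps_check [[2], [3], [0, 3], [1, 2, 4], [3, 5], [4, 6], [5, 7], [6]] [1, 1, 1, 1, 1, 1, 1, 1] 30 29"
  by code_simp+
 note chk = this[THEN exps_table[rotated 3]]
 show "s \<in> {1..6} ==> \<exists>P. std_table (TypeE 6) s 11 P" by (rule exI, rule chk(1)) (simp_all add: lists_simps)
 show "s \<in> {1..7} ==> \<exists>P. std_table (TypeE 7) s 17 P" by (rule exI, rule chk(2)) (simp_all add: lists_simps)
 show "s \<in> {1..8} ==> \<exists>P. std_table (TypeE 8) s 29 P" by (rule exI, rule chk(3)) (simp_all add: lists_simps)
qed

lemma table_F4: "s \<in> {1..4} ==> \<exists>P. std_table TypeF4 s 11 P"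
proof -
 have "exps_check [[1], [0, 2], [1, 3], [2]] [2, 2, 1, 1] 18 11" by code_simp
 note chk = this[THEN exps_table[rotated 3]]
 show "s \<in> {1..4} ==> ?thesis" by (rule exI, rule chk) (simp_all add: lists_simps)
qed

text \<open>A spread below 4 at the short vertex is what \<open>left_ker_spread\<close> demands as
  soon as \<open>l < k\<close>; for \<open>k = l\<close> it demands a spread below 2.\<close>

lemma table_G2:
 assumes "s \<in> {1..2}"
 shows "\<exists>P. std_table TypeG2 s 5 P \<and>
  (s = 1 --> (\<forall>m e e'. m < 5 --> fls_nth (P 1 m) e ~= 0 --> fls_nth (P 1 m) e' ~= 0 --> e' - e < 4))"
proof (intro exI conjI impI)
 have "exps_check [[1], [0]] [1, 3] 12 5" by code_simp
 note chk = this[THEN exps_table[rotated 3]]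
 let ?V = "\<lambda>s m. snd (exps_iter [[1], [0]] [1, 3] s m)"
 show "std_table TypeG2 s 5 (\<lambda>b m. q_sum (?V (s - 1) m ! (b - 1)))"
  by (rule chk) (use assms in \<open>simp_all add: lists_simps\<close>)
 have "\<forall>m\<in>set [0..<5]. \<forall>e\<in>set (?V 0 m ! 0). \<forall>e'\<in>set (?V 0 m ! 0). e' - e < 4" by code_simp
 thus "\<forall>m e e'. m < 5 --> fls_nth (q_sum (?V (s - 1) m ! (1 - 1))) e ~= 0
   --> fls_nth (q_sum (?V (s - 1) m ! (1 - 1))) e' ~= 0 --> e' - e < 4" if "s = 1"
  using that by (simp add: q_sum_nth)
qed

section \<open>The dimension formula\<close>

text \<open>The two extra clauses bound the spread of exponents at the unique short vertex of types
  B and G2, for the cases that centrality does not reach.\<close>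

lemma std_tables:
 assumes X: "valid_type X"
 obtains N P where "\<And>s. s \<in> verts X ==> std_table X s N (P s)"
  and "\<And>n m e e'. X = TypeB n ==> fls_nth (P n n m) e ~= 0 ==> fls_nth (P n n m) e' ~= 0 ==> e = e'"
  and "\<And>m e e'. X = TypeG2 ==> m < N ==> fls_nth (P 1 1 m) e ~= 0 ==> fls_nth (P 1 1 m) e' ~= 0 ==> e' - e < 4"
proof -
 let ?B = "\<lambda>s P. \<forall>n m e e'. X = TypeB n --> s = n --> fls_nth (P n m) e ~= 0 --> fls_nth (P n m) e' ~= 0 --> e = e'"
 let ?G = "\<lambda>N s P. \<forall>m e e'. X = TypeG2 --> s = 1 --> m < N --> fls_nth (P 1 m) e ~= 0 --> fls_nth (P 1 m) e' ~= 0 --> e' - e < 4"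
 have "\<exists>N. \<forall>s\<in>(verts X). \<exists>P. std_table X s N P \<and> ?B s P \<and> ?G N s P"
 proof (cases X)
  case (TypeA n)
  show ?thesis by (intro exI[of _ n] ballI) (use TypeA table_A X in auto)
 next
  case (TypeB n)
  show ?thesis
  proof (intro exI[of _ "2 * n - 1"] ballI)
   fix s assume "s \<in> verts X"
   thus "\<exists>P. std_table X s (2 * n - 1) P \<and> ?B s P \<and> ?G (2 * n - 1) s P"
    using table_B[of n s] X unfolding TypeB by auto
  qed
 next
  case (TypeC n)
  show ?thesis by (intro exI[of _ "2 * n - 1"] ballI) (use TypeC table_C X in auto)
 next
  case (TypeD n)
  show ?thesis by (intro exI[of _ "2 * n - 3"] ballI) (use TypeD table_D X in auto)
 next
  case (TypeE n)
  hence "n = 6 \<or> n = 7 \<or> n = 8" using X by auto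
  thus ?thesis
   by (elim disjE) (rule exI[of _ 11] exI[of _ 17] exI[of _ 29], use TypeE tables_E in auto)+
 next
  case TypeF4
  show ?thesis by (rule exI[of _ 11], rule ballI) (use TypeF4 table_F4 in auto)
 next
  case TypeG2
  show ?thesis
  proof (rule exI[of _ 5], rule ballI)
   fix s assume "s \<in> verts X"
   thus "\<exists>P. std_table X s 5 P \<and> ?B s P \<and> ?G (5 :: nat) s P" using table_G2[of s] unfolding TypeG2 by auto
  qed
 qed
 then obtain N where "\<forall>s\<in>(verts X). \<exists>P. std_table X s N P \<and> ?B s P \<and> ?G N s P" by blast
 then obtain P where P: "\<And>s. s \<in> verts X ==> std_table X s N (P s) \<and> ?B s (P s) \<and> ?G N s (P s)" by metis
 have "n \<in> verts X" if "X = TypeB n" for n using X that by simp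
 moreover have "1 \<in> verts X" if "X = TypeG2" using that by simp
 ultimately show thesis using P by (intro that[of N P]) blast+
qed

lemma fls_nth_truncated_sum:
 assumes "T >= 0" and S: "\<And>u. int u <= T ==> c u = S (int u)" and out: "\<And>y. y < 0 \<or> y > T ==> S y = 0"
 shows "fls_nth (\<Sum>u = 0..nat T. fls_const (c u) * q_pow (- int u)) y = (S (- y) :: rat)"
proof -
 have "fls_nth (\<Sum>u = 0..nat T. fls_const (c u) * q_pow (- int u)) y = (\<Sum>u = 0..nat T. if u = nat (- y) \<and> y <= 0 then S (- y) else 0)"
  unfolding fls_nth_sum
 proof (intro sum.cong refl)
  fix u assume "u \<in> {0..nat T}"
  hence "c u = S (int u)" using S[of u] assms(1) by auto
  thus "fls_nth (fls_const (c u) * q_pow (- int u)) y = (if u = nat (- y) \<and> y <= 0 then S (- y) else 0)"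
   by (auto simp: q_pow_nth fls_X_intpow_times_conv_shift)
 qed
 also have "... = S (- y)"
 proof (cases "y <= 0")
  case True
  thus ?thesis using out[of "- y"] assms(1) by (auto simp: nat_le_eq_zle)
 qed (use out[of "- y"] in simp)
 finally show ?thesis .
qed

lemma fls_nth_const_q_pow_sum:
 "fls_nth (q_pow a * (\<Sum>m<n. q_pow (b m)) * F) y = (\<Sum>m<n. fls_nth F (y - a - b m))"
proof -
 have "q_pow a * (\<Sum>m<n. q_pow (b m)) * F = (\<Sum>m<n. q_pow (a + b m) * F)"
  unfolding sum_distrib_left sum_distrib_right q_pow_add ..
 thus ?thesis by (simp only: fls_nth_sum fls_X_intpow_times_conv_shift) (simp add: algebra_simps)
qed

theorem proposition5p6:
  fixes X :: dynkin_type
    and C :: "'i::finite \<Rightarrow> 'i \<Rightarrow> int"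
    and d :: "'i \<Rightarrow> nat"
    and \<omega> :: "'i \<Rightarrow> 'i \<Rightarrow> int"
    and A :: "('k::field, ('i, 'k) preproj_elt) graded_algebra"
    and i j :: 'i
    and k l :: nat
  assumes "cartan_matrix_of_type X C"
    and "symmetrizer C d"
    and "sign_choice C \<omega>"
    and "A = preproj_algebra C d \<omega>"
    and "0 < k" and "0 < l"
    and "k * d i \<ge> l * d j"
  shows "(\<not> clubsuit X d i j k l \<longrightarrow>
            has_qdim (ext1 A (generic_kernel C d \<omega> i k) (generic_kernel C d \<omega> j l))
              (ext_formula X C d i j k l)) \<and>
         (\<exists>D. has_qdim (ext1 A (generic_kernel C d \<omega> i k) (generic_kernel C d \<omega> j l)) D \<and>
            ext_formula X C d i j k l - D \<in> nonneg_laurent_polys)"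
proof -
 have X: "valid_type X" using assms(1) by (simp add: cartan_matrix_of_type_def)
 obtain \<sigma> where \<sigma>: "bij_betw \<sigma> UNIV (verts X)" "\<And>i j. C i j = standard_cartan X (\<sigma> i) (\<sigma> j)"
  "\<And>i. d i = std_symmetrizer X (\<sigma> i)" using dynkin_labelling[OF assms(1,2)] by metis
 have inj: "\<sigma> a = \<sigma> b \<longleftrightarrow> a = b" for a b using \<sigma>(1) by (auto simp: bij_betw_def inj_on_def)
 have rg: "\<sigma> a \<in> verts X" for a using \<sigma>(1) by (auto simp: bij_betw_def)
 let ?r = "lacing_number X"
 note gp = dynkin_gpa[OF X assms(3) \<sigma>]
 interpret gpa_over C \<omega> d ?r "TYPE('k)" using gp(1) by (simp add: gpa_over_def)
 obtain N P where P: "\<And>s. s \<in> verts X ==> std_table X s N (P s)"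
  and PB: "\<And>n m e e'. X = TypeB n ==> fls_nth (P n n m) e ~= 0 ==> fls_nth (P n n m) e' ~= 0 ==> e = e'"
  and PG: "\<And>m e e'. X = TypeG2 ==> m < N ==> fls_nth (P 1 1 m) e ~= 0 ==> fls_nth (P 1 1 m) e' ~= 0 ==> e' - e < 4"
  using std_tables[OF X] by metis
 let ?P = "\<lambda>s b. P (\<sigma> s) (\<sigma> b)"
 have full: "full_table (std_period X) s N (?P s)" for s
  by (rule full_table_of_std[OF X assms(3) \<sigma> P[OF rg]])
 hence mesh: "mesh_table s N (?P s)" for s by (simp add: full_table_def)
 have T: "std_period X > 0" using lacing_cases[of X] X by (cases X) (auto simp: std_period_def)
 have S: "inv_coeff C d i j u = (\<Sum>n<N. fls_nth (?P j i n) (int u - int (d j)))" if "int u <= std_period X" for u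
 proof (rule full_table_inverse[OF full T gp(4) _ that])
  show "E a b = 1 \<or> d a = 1" if "adj C a b" for a b
   using gp(3)[OF that] std_mult_symmetrizer(2)[of X "\<sigma> a" "\<sigma> b"] by (simp add: \<sigma>(3))
 qed
 \<comment> \<open>The path degree of the functions that represent extensions in degree
   \<open>u\<close>, as in \<open>ext_ker\<close>.\<close>
 define v where "v u = u + int (k * d i) + int (l * d j)" for u
 define L where "L u = fv.dim (left_ker i j (v u) l)" for u
 have L: "of_nat (L u) = (\<Sum>s<l. \<Sum>n<N. fls_nth (?P j i n) (2 * int s * int (d j) - v u))" for u
  unfolding L_def by (rule left_ker_dim(2)[OF mesh])
 have exps: "- int (d j) < e \<and> e <= std_period X - int (d j)" if "n < N" "fls_nth (?P j i n) e ~= 0" for n e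
  using full[of j] that unfolding full_table_def by blast
 have formula: "fls_nth (ext_formula X C d i j k l) u = of_nat (L u)" for u
 proof -
  let ?S = "\<lambda>y. \<Sum>n<N. fls_nth (?P j i n) (y - int (d j))"
  have nT: "lacing_number X * dual_coxeter_number X = nat (std_period X)" unfolding std_period_def nat_int ..
  have out: "?S y = 0" if "y < 0 \<or> y > std_period X" for y
  proof (rule sum.neutral, rule ballI)
   fix n assume "n \<in> {..<N}"
   thus "fls_nth (?P j i n) (y - int (d j)) = 0" using exps[of n "y - int (d j)"] that by fastforce
  qed
  have tr: "fls_nth (\<Sum>u = 0..nat (std_period X). fls_const (inv_coeff C d i j u) * q_pow (- int u)) y = ?S (- y)" for y
   by (rule fls_nth_truncated_sum) (use T S out in auto)
  have ratio: "q_int (int (l * d j)) / q_int (int (d j)) = (\<Sum>m<l. q_pow (int (d j) * (int l - 1 - 2 * int m)))"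
   using q_int_ratio[of "int (d j)" l] d_pos[of j] by simp
  have "fls_nth (ext_formula X C d i j k l) u = (\<Sum>m<l. ?S (- (u - (- int (k * d i)) - int (d j) * (int l - 1 - 2 * int m))))"
   unfolding ext_formula_def nT ratio fls_nth_const_q_pow_sum tr ..
  \<comment> \<open>The exponents of the quantum integer run in the opposite order to the powers of
    the loop in \<open>left_ker_dim\<close>.\<close>
  also have "... = (\<Sum>m<l. ?S (- (u - (- int (k * d i)) - int (d j) * (int l - 1 - 2 * int (l - Suc m)))))"
   by (rule sum.nat_diff_reindex[symmetric])
  also have "... = of_nat (L u)"
   unfolding L
  proof (intro sum.cong refl)
   fix m n assume "m \<in> {..<l}"
   hence "- (u - (- int (k * d i)) - int (d j) * (int l - 1 - 2 * int (l - Suc m))) - int (d j) = 2 * int m * int (d j) - v u"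
    by (simp add: v_def of_nat_diff algebra_simps)
   thus "fls_nth (?P j i n) (- (u - (- int (k * d i)) - int (d j) * (int l - 1 - 2 * int (l - Suc m))) - int (d j))
    = fls_nth (?P j i n) (2 * int m * int (d j) - v u)" by (simp only:)
  qed
  finally show ?thesis .
 qed
 \<comment> \<open>The space whose dimension is that of the extensions. The formula counts the
   second factor alone, which explains the inequality in general and the equality where the second
   factor is contained in the first.\<close>
 define W where "W u = right_ker i j (v u) k \<inter> left_ker i j (v u) l" for u
 have W: "fin_dim (W u)" "fv.dim (W u) <= L u" for u
 proof -
  have sub: "W u \<subseteq> left_ker i j (v u) l" by (simp add: W_def)
  show fd: "fin_dim (W u)" by (rule fin_dim_subset[OF left_ker_dim(1)[OF mesh] sub])
  obtain B where B: "finite B" "fv.span B = left_ker i j (v u) l" "card B = L u"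
   unfolding L_def using fin_dim_basis[OF left_ker_dim(1)[OF mesh] left_ker_subspace] by metis
  have "fv.subspace (W u)" unfolding W_def by (intro fv.subspace_inter right_ker_subspace left_ker_subspace)
  then obtain B' where B': "B' \<subseteq> W u" "fv.independent B'" "card B' = fv.dim (W u)"
   using fin_dim_basis[OF fd] by metis
  thus "fv.dim (W u) <= L u" using fv.independent_span_bound[OF B(1), of B'] B sub by auto
 qed
 have ext: "has_dim (ext1 A (generic_kernel C d \<omega> i k) (generic_kernel C d \<omega> j l) u) (fv.dim (W u))" for u
 proof -
  interpret E: ext_setting C \<omega> d ?r "TYPE('k)" i j k l u by unfold_locales (use assms in auto)
  have "E.ext_ker = W u" by (simp add: E.ext_ker_def W_def v_def)
  thus ?thesis using E.ext1_dim[OF mesh] W(1) assms(4) by simp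
 qed
 have main: "left_ker i j y l \<subseteq> right_ker i j y k" if "\<not> clubsuit X d i j k l" for y
 proof -
  have di: "d i = 1 \<or> d i = ?r" "d j = 1 \<or> d j = ?r" unfolding \<sigma>(3) by (rule std_symmetrizer_cases)+
  have r: "?r > 0" by (rule r_pos)
  \<comment> \<open>\<open>left_ker_central\<close> is applied with \<open>a = k\<close> in the
    first case, with \<open>a = l\<close> in the second, and in the third with any \<open>a\<close>
    such that \<open>a * ?r\<close> lies between \<open>l\<close> and \<open>k\<close>.\<close>
  consider "d i = ?r" | "d i = 1" "d j = ?r" | "d i = 1" "d j = 1" using di by blast
  thus ?thesis
  proof cases
   case 1
   have "l <= k * (?r div d j)" using di(2) assms(7) 1 r by auto
   thus ?thesis using 1 r by (intro left_ker_central[of k]) auto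
  next
   case 2
   thus ?thesis using assms(7) r by (intro left_ker_central[of l]) auto
  next
   case 3
   show ?thesis
   proof (cases "\<exists>a. l <= a * ?r \<and> a * ?r <= k")
    case True
    then obtain a where "l <= a * ?r" "a * ?r <= k" by blast
    thus ?thesis using 3 by (intro left_ker_central[of a]) auto
   next
    case False
    have lk: "l <= k" using assms(7) 3 by simp
    have nr: "\<not> ?r dvd k" using False lk by (metis dvd_def mult.commute order_refl)
    have even: "?r = 2 ==> k = l"
    proof (rule ccontr)
     assume r2: "?r = 2" and "k ~= l"
     hence "l <= (k div 2) * 2" "(k div 2) * 2 <= k" using lk by linarith+
     thus False using False r2 by metis
    qed
    have s1: "std_symmetrizer X (\<sigma> i) = 1" "std_symmetrizer X (\<sigma> j) = 1" using 3 \<sigma>(3) by metis+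
    \<comment> \<open>No multiple of the lacing number lies between \<open>l\<close> and
      \<open>k\<close>, so the lacing number is not 1, and if it is 2 then \<open>k = l\<close>.
      Types C and F4 thus fall under the exceptional condition. In types B and G2 there is a single
      short vertex, so \<open>i = j\<close>; in G2 moreover \<open>l < k\<close>, for otherwise the
      condition would hold.\<close>
    have one: "i = j \<and> (\<forall>n<N. \<forall>e e'. fls_nth (?P i i n) e ~= 0 --> fls_nth (?P i i n) e' ~= 0
     --> e' - e < 2 * int (d i) * (int k - int l + 1))"
    proof (cases X)
     case (TypeB n)
     have n: "x = n" if "(if x = n then 1 else 2) = (1 :: nat)" for x using that by (cases "x = n") auto
     have \<sigma>n: "\<sigma> i = n" "\<sigma> j = n" by (rule n, rule s1[unfolded TypeB std_symmetrizer.simps])+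
     hence "i = j" using inj[of i j] by simp
     moreover have "e' - e < 2 * int (d i) * (int k - int l + 1)"
      if "fls_nth (?P i i m) e ~= 0" "fls_nth (?P i i m) e' ~= 0" for m e e'
      using PB[OF TypeB that[unfolded \<sigma>n]] 3 lk by simp
     ultimately show ?thesis by blast
    next
     case TypeG2
     have n: "x = 1" if "(if x = 1 then 1 else 3) = (1 :: nat)" for x :: nat using that by (cases "x = 1") auto
     have \<sigma>1: "\<sigma> i = 1" "\<sigma> j = 1" by (rule n, rule s1[unfolded TypeG2 std_symmetrizer.simps])+
     hence "i = j" using inj[of i j] by simp
     moreover have "k ~= l" using that nr 3 TypeG2 unfolding clubsuit_def by blast
     hence "l < k" using lk by simp
     hence "e' - e < 2 * int (d i) * (int k - int l + 1)"
      if "m < N" "fls_nth (?P i i m) e ~= 0" "fls_nth (?P i i m) e' ~= 0" for m e e'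
      using PG[OF TypeG2 that[unfolded \<sigma>1]] 3 by simp
     ultimately show ?thesis by blast
    qed (use that nr 3 even in \<open>auto simp: clubsuit_def\<close>)
    thus ?thesis using left_ker_spread[OF mesh[of i] lk, of y] by auto
   qed
  qed
 qed
 define D where "D = Abs_fls (\<lambda>u. of_nat (fv.dim (W u)) :: rat)"
 \<comment> \<open>Non-zero dimensions are confined to finitely many degrees: this makes
   \<open>D\<close> a Laurent series and the difference a Laurent polynomial.\<close>
 have Lfin: "v u \<in> {- std_period X..2 * int l * int (d j) + int (d j)}" if Lu: "L u ~= 0" for u
 proof -
  have "(\<Sum>s<l. \<Sum>n<N. fls_nth (?P j i n) (2 * int s * int (d j) - v u)) ~= 0" using Lu L[of u] by simp
  then obtain s n where sn: "s < l" "n < N" "fls_nth (?P j i n) (2 * int s * int (d j) - v u) ~= 0"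
   by (meson sum.neutral lessThan_iff)
  have "int s * int (d j) <= int l * int (d j)" using sn(1) by (intro mult_right_mono) auto
  moreover have "0 <= int s * int (d j)" by simp
  ultimately show ?thesis using exps[OF sn(2,3)] by (simp only: atLeastAtMost_iff) linarith
 qed
 have D: "fls_nth D u = of_nat (fv.dim (W u))" for u
  unfolding D_def
 proof (rule nth_Abs_fls_lower_bound[of "- std_period X - int (k * d i) - int (l * d j)"], intro allI impI)
  fix u assume "u < - std_period X - int (k * d i) - int (l * d j)"
  hence "L u = 0" using Lfin[of u] by (auto simp: v_def)
  thus "of_nat (fv.dim (W u)) = (0 :: rat)" using W(2)[of u] by simp
 qed
 have "has_qdim (ext1 A (generic_kernel C d \<omega> i k) (generic_kernel C d \<omega> j l)) D"
  unfolding has_qdim_def using ext D by blast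
 moreover have "ext_formula X C d i j k l - D \<in> nonneg_laurent_polys"
 proof -
  have nth: "fls_nth (ext_formula X C d i j k l - D) u = of_nat (L u - fv.dim (W u))" for u
   using W(2)[of u] by (simp add: formula D of_nat_diff)
  have "{u. fls_nth (ext_formula X C d i j k l - D) u ~= 0} \<subseteq> (\<lambda>y. y - int (k * d i) - int (l * d j)) ` {- std_period X..2 * int l * int (d j) + int (d j)}"
  proof
   fix u assume "u \<in> {u. fls_nth (ext_formula X C d i j k l - D) u ~= 0}"
   hence "L u ~= 0" unfolding nth by auto
   from Lfin[OF this] show "u \<in> (\<lambda>y. y - int (k * d i) - int (l * d j)) ` {- std_period X..2 * int l * int (d j) + int (d j)}"
    by (rule image_eqI[rotated]) (simp add: v_def)
  qed
  hence "finite {u. fls_nth (ext_formula X C d i j k l - D) u ~= 0}" by (rule finite_subset) simp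
  moreover have "\<forall>u. fls_nth (ext_formula X C d i j k l - D) u \<in> \<nat>" unfolding nth by simp
  ultimately show ?thesis unfolding nonneg_laurent_polys_def by blast
 qed
 moreover have "has_qdim (ext1 A (generic_kernel C d \<omega> i k) (generic_kernel C d \<omega> j l)) (ext_formula X C d i j k l)"
  if "\<not> clubsuit X d i j k l"
 proof -
  have "W u = left_ker i j (v u) l" for u using main[OF that] by (auto simp: W_def)
  hence "fls_nth (ext_formula X C d i j k l) u = of_nat (fv.dim (W u))" for u by (simp add: formula L_def)
  thus ?thesis unfolding has_qdim_def using ext by blast
 qed
 ultimately show ?thesis by blast
qed

end
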